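(* Let $\omega\in\mathbb R\setminus\mathbb Q$ be such that $$\Big|\omega-\frac pq\Big|\le q^{-70}e^{-2\pi q}$$ for infinitely many coprime pairs of integers $(p,q)$ with $q>0$. Then there exists a nontrivial real-analytic family of potentials $(V_\tau:\mathbb T\to\mathbb R)_\tau$ (with $\tau$ in an open interval) such that, for a sequence of rationals $p_j/q_j\to\omega$, the value $\beta_{V_\tau}(p_j/q_j)$ is constant in $\tau$ for each $j$.
   Context: Let $\mathbb T=\mathbb R/\mathbb Z$. For $V:\mathbb T\to\mathbb R$, the standard map with potential $V$ is $\mathscr F(x,y)=(x+y+\dot V(x),y+\dot V(x))$ on $\mathbb T\times\mathbb R$; it is an exact symplectic twist map with generating function $S(x,x')=\frac12(x-x')^2+V(x)$. For coprime integers $p,q$ with $q>0$, a $(p,q)$-periodic orbit is an orbit whose lift to $\mathbb R^2$ (under the lift of $\mathscr F$ given by the same formula) satisfies $x_q=x_0+p$, $y_q=y_0$; its symplectic action is $\sum_{k=0}^{q-1}S(x_k,x_{k+1})$. Mather's beta function $\beta_V:\mathbb R\to\mathbb R$ is the continuous function whose values at rationals are $$\beta_V\Big(\frac pq\Big)=\frac1q\min\{\text{symplectic actions of }(p,q)\text{-periodic orbits}\},$$ for coprime $(p,q)$, $q>0$. A real-analytic family of potentials means $V_\tau(x)$ is jointly real-analytic in $(\tau,x)$. The family is nontrivial if it is a genuine deformation: the standard maps of the $V_\tau$ are not all conjugate to one another by translations $(x,y)\mapsto(x+c,y)$, i.e. the $V_\tau$ do not all agree up to translations in $x$ and additive constants.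 *)

theory Defs
  imports "HOL-Analysis.Analysis"
begin

text \<open>Functions on the circle \<open>\<real>/\<int>\<close> are represented by their 1-periodic lifts to \<open>\<real>\<close>.\<close>

definition potential :: "(real \<Rightarrow> real) \<Rightarrow> bool" where
  "potential V \<longleftrightarrow> (\<forall>x. V (x + 1) = V x)"

text \<open>The lift of the standard map to the plane.\<close>

definition standard_map :: "(real \<Rightarrow> real) \<Rightarrow> real \<times> real \<Rightarrow> real \<times> real" where
  "standard_map V = (\<lambda>(x, y). (x + y + deriv V x, y + deriv V x))"

definition generating_function :: "(real \<Rightarrow> real) \<Rightarrow> real \<Rightarrow> real \<Rightarrow> real" where
  "generating_function V x x' = (x - x')\<^sup>2 / 2 + V x"

definition periodic_point :: "(real \<Rightarrow> real) \<Rightarrow> int \<Rightarrow> nat \<Rightarrow> real \<times> real \<Rightarrow> bool" where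
  "periodic_point V p q z \<longleftrightarrow> (standard_map V ^^ q) z = (fst z + real_of_int p, snd z)"

definition orbit_action :: "(real \<Rightarrow> real) \<Rightarrow> nat \<Rightarrow> real \<times> real \<Rightarrow> real" where
  "orbit_action V q z =
     (\<Sum>k<q. generating_function V (fst ((standard_map V ^^ k) z))
                                   (fst ((standard_map V ^^ Suc k) z)))"

definition periodic_actions :: "(real \<Rightarrow> real) \<Rightarrow> int \<Rightarrow> nat \<Rightarrow> real set" where
  "periodic_actions V p q = {orbit_action V q z | z. periodic_point V p q z}"

text \<open>The minimal average action at a rational rotation number (the reduced
  representation is unique).\<close>

definition min_average_action :: "(real \<Rightarrow> real) \<Rightarrow> real \<Rightarrow> real" where
  "min_average_action V w =
     (THE v. \<exists>p q. q > 0 \<and> coprime p (int q) \<and> w = real_of_int p / real q \<and>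
        v = (1 / real q) * (LEAST a. a \<in> periodic_actions V p q))"

text \<open>Mather's beta function is the continuous function with these values at the rationals.
  As the rationals are dense, its value at an irrational number is the limit along rationals.\<close>

definition mather_beta :: "(real \<Rightarrow> real) \<Rightarrow> real \<Rightarrow> real" where
  "mather_beta V w =
     (if w \<in> \<rat> then min_average_action V w
      else Lim (at w within \<rat>) (min_average_action V))"

lemma mather_beta_rational:
  assumes "q > 0" "coprime p (int q)"
  shows "mather_beta V (real_of_int p / real q) =
           (1 / real q) * (LEAST a. a \<in> periodic_actions V p q)"
proof -
  have uniq: "p' = p \<and> q' = q"
    if h: "q' > 0" "coprime p' (int q')"
      "real_of_int p / real q = real_of_int p' / real q'" for p' q'
  proof -
    from h assms have "real_of_int p * real q' = real_of_int p' * real q"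
      by (simp add: field_simps)
    then have eq: "p * int q' = p' * int q"
      by (metis of_int_eq_iff of_int_mult of_int_of_nat_eq)
    then have "\<bar>p\<bar> * \<bar>int q'\<bar> = \<bar>p'\<bar> * \<bar>int q\<bar>"
      by (metis abs_mult)
    then have "\<bar>p\<bar> = \<bar>p'\<bar> \<and> \<bar>int q'\<bar> = \<bar>int q\<bar>"
      using coprime_crossproduct_int[of p "int q" p' "int q'"] assms(2) h(2)
      by (simp add: coprime_commute)
    with eq assms h show ?thesis by auto
  qed
  have "real_of_int p / real q \<in> \<rat>" by simp
  moreover have "min_average_action V (real_of_int p / real q) =
      (1 / real q) * (LEAST a. a \<in> periodic_actions V p q)"
    unfolding min_average_action_def
    by (rule the_equality) (use assms uniq in blast)+
  ultimately show ?thesis unfolding mather_beta_def by presburger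
qed

text \<open>Joint real-analyticity on an open set \<open>S\<close> of pairs: local expansion in a
  (double, hence absolutely convergent) power series.\<close>

definition real_analytic2_on :: "(real \<Rightarrow> real \<Rightarrow> real) \<Rightarrow> (real \<times> real) set \<Rightarrow> bool" where
  "real_analytic2_on f S \<longleftrightarrow>
     (\<forall>(t0, x0) \<in> S. \<exists>(a :: nat \<Rightarrow> nat \<Rightarrow> real) r. r > 0 \<and>
        (\<forall>t x. \<bar>t - t0\<bar> < r \<longrightarrow> \<bar>x - x0\<bar> < r \<longrightarrow>
           ((\<lambda>(m, n). a m n * (t - t0) ^ m * (x - x0) ^ n) has_sum f t x) UNIV))"

definition analytic_family :: "real set \<Rightarrow> (real \<Rightarrow> real \<Rightarrow> real) \<Rightarrow> bool" where
  "analytic_family I V \<longleftrightarrow>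
     (\<forall>\<tau>\<in>I. potential (V \<tau>)) \<and> real_analytic2_on V (I \<times> UNIV)"

definition equivalent_potentials :: "(real \<Rightarrow> real) \<Rightarrow> (real \<Rightarrow> real) \<Rightarrow> bool" where
  "equivalent_potentials U W \<longleftrightarrow> (\<exists>c d. \<forall>x. W x = U (x + c) + d)"

definition nontrivial_family :: "real set \<Rightarrow> (real \<Rightarrow> real \<Rightarrow> real) \<Rightarrow> bool" where
  "nontrivial_family I V \<longleftrightarrow>
     \<not> (\<forall>\<sigma>\<in>I. \<forall>\<tau>\<in>I. equivalent_potentials (V \<sigma>) (V \<tau>))"

text \<open>Equivalence of potentials is conjugacy of the standard maps by a horizontal translation.\<close>

lemma equivalent_potentials_iff_conjugate:
  assumes U: "\<And>x. U field_differentiable at x" and W: "\<And>x. W field_differentiable at x"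
  shows "equivalent_potentials U W \<longleftrightarrow>
    (\<exists>c. standard_map U \<circ> (\<lambda>(x, y). (x + c, y)) = (\<lambda>(x, y). (x + c, y)) \<circ> standard_map W)"
proof -
  have dU: "((\<lambda>x. U (x + c)) has_field_derivative deriv U (x + c)) (at x)" for c x
    using U[of "x + c"] DERIV_shift[of U "deriv U (x + c)" x c]
    by (simp only: DERIV_deriv_iff_field_differentiable)
  have dW: "(W has_field_derivative deriv W x) (at x)" for x
    using W[of x] by (simp add: DERIV_deriv_iff_field_differentiable)
  have "(\<exists>d. \<forall>x. W x = U (x + c) + d) \<longleftrightarrow> (\<forall>x. deriv U (x + c) = deriv W x)" for c
  proof
    assume "\<exists>d. \<forall>x. W x = U (x + c) + d"
    then obtain d where "W = (\<lambda>x. U (x + c) + d)" by auto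
    moreover have "((\<lambda>x. U (x + c) + d) has_field_derivative deriv U (x + c)) (at x)" for x
      using DERIV_add[OF dU DERIV_const] by simp
    ultimately show "\<forall>x. deriv U (x + c) = deriv W x"
      using DERIV_imp_deriv by metis
  next
    assume h: "\<forall>x. deriv U (x + c) = deriv W x"
    have "((\<lambda>x. W x - U (x + c)) has_field_derivative 0) (at x)" for x
      using DERIV_diff[OF dW[of x] dU[of c x]] h by simp
    then have "W x - U (x + c) = W 0 - U (0 + c)" for x
      using DERIV_isconst_all[of "\<lambda>x. W x - U (x + c)" x 0] by simp
    then show "\<exists>d. \<forall>x. W x = U (x + c) + d"
      by (intro exI[of _ "W 0 - U (0 + c)"]) (simp add: algebra_simps)
  qed
  moreover have "(standard_map U \<circ> (\<lambda>(x, y). (x + c, y)) = (\<lambda>(x, y). (x + c, y)) \<circ> standard_map W)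
      \<longleftrightarrow> (\<forall>x. deriv U (x + c) = deriv W x)" for c
    by (auto simp: fun_eq_iff standard_map_def)
  ultimately show ?thesis unfolding equivalent_potentials_def by simp
qed

end

theory Submission
  imports Defs "HOL-Complex_Analysis.Complex_Analysis"
begin

text \<open>
  Prescribe an invariant circle of rotation number \<open>\<omega>\<close> through the cosine series \<open>t = 1 / h'\<close> of its
  parametrisation \<open>h\<close>; the potential is then determined by
  \<open>V' (h \<theta>) = h (\<theta> + \<omega>) + h (\<theta> - \<omega>) - 2 * h \<theta>\<close>. For \<open>p / q\<close> very close to \<open>\<omega>\<close>, the orbits satisfying the
  Euler--Lagrange equations except at one site form a circle, and their action is \<open>p\<close> times the action of the
  invariant circle per rotation, plus an excess of size \<open>(\<omega> - p / q)\<^sup>2\<close> whose reciprocal is an analytic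
  function of \<open>t\<close>. If \<open>t\<close> contains a harmonic of frequency \<open>q\<close> of size \<open>exp (- q)\<close>, the excess has a strict
  minimum at the symmetric orbit, so \<open>\<beta> (p / q)\<close> is an explicit analytic function of the coefficients of
  \<open>t\<close>. Each of the countably many conditions ``\<open>\<beta> (p\<^sub>j / q\<^sub>j)\<close> is constant'' can therefore be solved
  for the coefficient of frequency \<open>q\<^sub>j\<close>, while the normalisation and the two remaining scalar conditions are
  solved for the coefficients of frequencies 0, 1 and 2. The coefficient of frequency 3 stays free and is the
  parameter of the family. All equations are solved simultaneously by a fixed point of a holomorphic map of an
  infinite polydisc, so the solution is holomorphic in the parameter.
\<close>

section \<open>Fixed points of holomorphic maps of a polydisc\<close>

text \<open>Why the reciprocal of the excess: to leading order the excess is, up to a factor, the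
  minimum of the sum of (y k)^2 / (2 * tau k) under the constraint that the y k sum to q. The
  reciprocal of such a minimum is proportional to the mean of the tau k, which are products of two
  values of t. Averaging products of harmonics of frequency below q / 2 over the rotation by p / q
  leaves only diagonal squares, and these make up \<open>Iw\<close>, common to all q. The harmonic q
  is constant along that rotation and enters linearly. Once \<open>Iw\<close> is pinned, the
  condition at q involves essentially one coefficient, so the infinite system is nearly diagonal.
  The two remaining scalar conditions are thus the action of the circle and \<open>Iw\<close>. The
  size exp (- q) is a compromise: it must dominate the error of order q * |\<omega> - p / q| of the
  leading-order formula, yet leave the series convergent on a strip where the harmonic grows like
  exp (q / 2). No derivative of the equations is computed: on a polydisc Cauchy's inequality turns
  sup bounds into a contraction.\<close>

lemma holomorphic_on_uniform_seq:
  fixes f :: "nat \<Rightarrow> complex \<Rightarrow> complex"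
  assumes S: "open S" and hol: "\<And>n. f n holomorphic_on S"
    and ul: "uniform_limit S f g sequentially"
  shows "g holomorphic_on S"
proof (rule holomorphic_uniform_sequence[OF S hol])
  fix x assume "x \<in> S"
  then obtain d where d: "d > 0" "cball x d \<subseteq> S" using S open_contains_cball by blast
  show "\<exists>d>0. cball x d \<subseteq> S \<and> uniform_limit (cball x d) f g sequentially"
    using d uniform_limit_on_subset[OF ul] by blast
qed

text \<open>Cauchy's inequality on discs of radius R / 2 bounds the derivative on the closed unit
  disc; these discs stay inside the domain because R > 2 gives R / 2 < R - 1.\<close>

lemma holomorphic_increment_bound:
  assumes hol: "f holomorphic_on ball 0 R" and R: "R > 2"
    and bd: "\<And>z. z \<in> ball 0 R \<Longrightarrow> norm (f z) \<le> M"
  shows "norm (f 1 - f 0) \<le> 4 * M / R"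
proof -
  have "0 \<le> norm (f 0)" by simp
  also have "norm (f 0) \<le> M" using R by (intro bd) simp
  finally have M: "M \<ge> 0" .
  have der: "norm (deriv f z) \<le> M / r" if z: "norm z \<le> 1" and r: "0 < r" "r < R - 1" for z r
  proof -
    have sub: "cball z r \<subseteq> ball 0 R"
    proof
      fix w assume "w \<in> cball z r"
      then have "norm (w - z) \<le> r" by (simp add: dist_norm norm_minus_commute)
      then have "norm w \<le> r + norm z" using norm_triangle_sub[of w z] by linarith
      then show "w \<in> ball 0 R" using z r by simp
    qed
    have "norm ((deriv ^^ 1) f z) \<le> fact 1 * M / r ^ 1"
    proof (rule Cauchy_inequality)
      show "f holomorphic_on ball z r"
        using hol sub by (meson ball_subset_cball holomorphic_on_subset order_trans)
      show "continuous_on (cball z r) f"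
        using hol sub by (meson holomorphic_on_imp_continuous_on holomorphic_on_subset)
      show "0 < r" by (rule r)
      show "norm (f x) \<le> M" if "norm (z - x) = r" for x
        using that sub by (intro bd) (auto simp: dist_norm)
    qed
    then show ?thesis by simp
  qed
  have "norm (f 1 - f 0) \<le> (M / (R/2)) * norm (1 - 0 :: complex)"
  proof (rule field_differentiable_bound[where S="cball 0 1"])
    show "convex (cball (0::complex) 1)" by simp
    show "(f has_field_derivative deriv f z) (at z within cball 0 1)" if "z \<in> cball 0 1" for z
    proof -
      have "z \<in> ball 0 R" using that R by simp
      then show ?thesis using hol
        by (meson open_ball holomorphic_derivI has_field_derivative_at_within)
    qed
    show "norm (deriv f z) \<le> M / (R/2)" if "z \<in> cball 0 1" for z
    proof -
      have *: "(R/2) \<le> R - 1" using R by simp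
      show ?thesis
      proof (rule field_le_epsilon)
        fix e :: real assume e: "e > 0"
        define r where "r = R/2"
        show "norm (deriv f z) \<le> M / (R/2) + e"
          using der[of z r] that R e by (auto simp: r_def)
      qed
    qed
  qed auto
  also have "\<dots> \<le> 4 * M / R" using M R by (auto simp: divide_simps)
  finally show ?thesis .
qed

text \<open>Holomorphy on an infinite product is encoded by composition with holomorphic curves.
  Combined with the shrinking of the unit polydisc to radius 1/16 it already yields a sup norm
  contraction, so no Lipschitz condition has to be imposed.\<close>

definition ball_contraction :: "(('i \<Rightarrow> complex) \<Rightarrow> 'i \<Rightarrow> complex) \<Rightarrow> bool" where
  "ball_contraction \<Psi> \<longleftrightarrow>
     (\<forall>u i. (\<forall>i. norm (u i) \<le> 1) \<longrightarrow> norm (\<Psi> u i) \<le> 1/16) \<and>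
     (\<forall>D u i. open D \<longrightarrow> (\<forall>i. (\<lambda>z. u z i) holomorphic_on D) \<longrightarrow> (\<forall>z\<in>D. \<forall>i. norm (u z i) \<le> 1)
        \<longrightarrow> (\<lambda>z. \<Psi> (u z) i) holomorphic_on D)"

lemma ball_contraction_bound:
  "ball_contraction \<Psi> \<Longrightarrow> (\<And>i. norm (u i) \<le> 1) \<Longrightarrow> norm (\<Psi> u i) \<le> 1/16"
  by (simp add: ball_contraction_def)

text \<open>The complex line through \<open>v\<close> and \<open>u\<close> stays in the unit
  polydisc for parameters up to R = 1 / (2 * d), and there the map is bounded by 1/16. The increment
  from 0 to 1 is therefore at most 4 * (1/16) / R = d / 2.\<close>

lemma ball_contraction_lipschitz:
  assumes c: "ball_contraction \<Psi>"
    and u: "\<And>i. norm (u i) \<le> 1/2" and v: "\<And>i. norm (v i) \<le> 1/2"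
    and d: "\<And>i. norm (u i - v i) \<le> d" and d0: "d > 0" "d \<le> 1/8"
  shows "norm (\<Psi> u i - \<Psi> v i) \<le> d / 2"
proof -
  define w where "w = (\<lambda>z i. v i + z * (u i - v i))"
  define R where "R = 1 / (2*d)"
  have R: "R > 2" using d0 by (simp add: R_def field_simps)
  have w: "norm (w z i) \<le> 1" if "z \<in> ball 0 R" for z i
  proof -
    have "norm (w z i) \<le> norm (v i) + norm z * norm (u i - v i)"
      unfolding w_def by (metis norm_mult norm_triangle_ineq)
    also have "norm z * norm (u i - v i) \<le> R * d"
      using that d d0 R by (intro mult_mono) auto
    also have "R * d = 1/2" using d0 by (simp add: R_def)
    finally show ?thesis using v[of i] by simp
  qed
  have "norm (\<Psi> (w 1) i - \<Psi> (w 0) i) \<le> 4 * (1/16) / R"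
  proof (rule holomorphic_increment_bound[OF _ R])
    have "(\<lambda>z. w z i) holomorphic_on ball 0 R" for i
      unfolding w_def by (intro holomorphic_intros)
    then show "(\<lambda>z. \<Psi> (w z) i) holomorphic_on ball 0 R"
      using c w unfolding ball_contraction_def by blast
    show "norm (\<Psi> (w z) i) \<le> 1/16" if "z \<in> ball 0 R" for z
      using ball_contraction_bound[OF c] w[OF that] by blast
  qed
  moreover have "w 1 = u" "w 0 = v" by (auto simp: w_def)
  ultimately show ?thesis using d0 by (simp add: R_def)
qed

lemma ball_contraction_iterate:
  assumes c: "ball_contraction \<Psi>"
  shows "norm ((\<Psi> ^^ n) (\<lambda>_. 0) i) \<le> 1/16"
    and "norm ((\<Psi> ^^ Suc n) (\<lambda>_. 0) i - (\<Psi> ^^ n) (\<lambda>_. 0) i) \<le> (1/8) * (1/2)^n"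
proof -
  have b: "norm ((\<Psi> ^^ n) (\<lambda>_. 0) i) \<le> 1/16" for n i
  proof (induction n arbitrary: i)
    case 0 then show ?case by simp
  next
    case (Suc n)
    have "norm ((\<Psi> ^^ n) (\<lambda>_. 0) i) \<le> 1" for i using Suc[of i] by simp
    then show ?case using ball_contraction_bound[OF c, of "(\<Psi> ^^ n) (\<lambda>_. 0)"] by simp
  qed
  show "norm ((\<Psi> ^^ n) (\<lambda>_. 0) i) \<le> 1/16" by (rule b)
  show "norm ((\<Psi> ^^ Suc n) (\<lambda>_. 0) i - (\<Psi> ^^ n) (\<lambda>_. 0) i) \<le> (1/8) * (1/2)^n"
  proof (induction n arbitrary: i)
    case 0 then show ?case using b[of "Suc 0" i] by simp
  next
    case (Suc n)
    have "norm (\<Psi> ((\<Psi> ^^ Suc n) (\<lambda>_. 0)) i - \<Psi> ((\<Psi> ^^ n) (\<lambda>_. 0)) i) \<le> ((1/8) * (1/2)^n) / 2"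
    proof (rule ball_contraction_lipschitz[OF c])
      show "norm ((\<Psi> ^^ Suc n) (\<lambda>_. 0) i) \<le> 1/2" for i using b[of "Suc n" i] by simp
      show "norm ((\<Psi> ^^ n) (\<lambda>_. 0) i) \<le> 1/2" for i using b[of "n" i] by simp
    qed (use Suc in \<open>auto simp: power_le_one\<close>)
    then show ?case by simp
  qed
qed

text \<open>The limit of explicit iterates from 0, so that holomorphy in a parameter and invariance
  under conjugation pass from the iterates to the fixed point.\<close>

definition fixpoint :: "(('i \<Rightarrow> complex) \<Rightarrow> 'i \<Rightarrow> complex) \<Rightarrow> 'i \<Rightarrow> complex" where
  "fixpoint \<Psi> i = lim (\<lambda>n. (\<Psi> ^^ n) (\<lambda>_. 0) i)"

lemma fixpoint_iterates:
  assumes c: "ball_contraction \<Psi>"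
  shows "norm ((\<Psi> ^^ n) (\<lambda>_. 0) i - fixpoint \<Psi> i) \<le> (1/4) * (1/2)^n"
    and "(\<lambda>n. (\<Psi> ^^ n) (\<lambda>_. 0) i) \<longlonglongrightarrow> fixpoint \<Psi> i"
proof -
  define f where "f = (\<lambda>n. (\<Psi> ^^ n) (\<lambda>_. 0) i)"
  have step: "norm (f (Suc n) - f n) \<le> (1/8) * (1/2)^n" for n
    unfolding f_def by (rule ball_contraction_iterate[OF c])
  have dist: "norm (f (n + m) - f n) \<le> (1/4) * (1/2)^n * (1 - (1/2)^m)" for n m
  proof (induction m)
    case 0 then show ?case by simp
  next
    case (Suc m)
    have "norm (f (n + Suc m) - f n) \<le> norm (f (Suc (n+m)) - f (n+m)) + norm (f (n+m) - f n)"
      using norm_triangle_ineq[of "f (Suc (n+m)) - f (n+m)" "f (n+m) - f n"] by simp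
    also have "\<dots> \<le> (1/8) * (1/2)^(n+m) + (1/4) * (1/2)^n * (1 - (1/2)^m)"
      using step[of "n+m"] Suc by linarith
    also have "\<dots> = (1/4) * (1/2)^n * (1 - (1/2)^Suc m)"
      by (simp add: power_add field_simps)
    finally show ?case .
  qed
  have dist': "norm (f (n + m) - f n) \<le> (1/4) * (1/2)^n" for n m
  proof -
    have "(1/4) * (1/2)^n * (1 - (1/2)^m) \<le> (1/4) * (1/2::real)^n * 1"
      by (intro mult_left_mono) auto
    then show ?thesis using dist[of n m] by linarith
  qed
  have "Cauchy f"
  proof (rule metric_CauchyI)
    fix e :: real assume e: "e > 0"
    have "(\<lambda>n. (1/2::real)^n) \<longlonglongrightarrow> 0" by (intro LIMSEQ_realpow_zero) auto
    then obtain N where N: "(1/2::real)^N < e"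
      using e real_arch_pow_inv[of e "1/2"] by auto
    show "\<exists>M. \<forall>m\<ge>M. \<forall>n\<ge>M. dist (f m) (f n) < e"
    proof (intro exI allI impI)
      fix m n assume "m \<ge> N" "n \<ge> N"
      then obtain a b where ab: "m = N + a" "n = N + b" by (metis le_iff_add)
      have "dist (f m) (f n) \<le> dist (f m) (f N) + dist (f n) (f N)" by (rule dist_triangle2)
      also have "\<dots> \<le> (1/4)*(1/2)^N + (1/4)*(1/2)^N"
        using dist'[of N a] dist'[of N b] by (intro add_mono) (auto simp: ab dist_norm)
      also have "\<dots> < e" using N e zero_less_power[of "1/2::real" N] by linarith
      finally show "dist (f m) (f n) < e" .
    qed
  qed
  then have lim: "f \<longlonglongrightarrow> fixpoint \<Psi> i"
    unfolding fixpoint_def f_def[symmetric] using Cauchy_convergent_iff convergent_LIMSEQ_iff by blast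
  then show "(\<lambda>n. (\<Psi> ^^ n) (\<lambda>_. 0) i) \<longlonglongrightarrow> fixpoint \<Psi> i" by (simp add: f_def)
  have "(\<lambda>m. norm (f (n + m) - f n)) \<longlonglongrightarrow> norm (fixpoint \<Psi> i - f n)"
    using LIMSEQ_ignore_initial_segment[OF lim, of n] by (intro tendsto_intros) (simp add: add.commute)
  then have "norm (fixpoint \<Psi> i - f n) \<le> (1/4) * (1/2)^n"
    by (rule LIMSEQ_le_const2) (use dist' in auto)
  then show "norm ((\<Psi> ^^ n) (\<lambda>_. 0) i - fixpoint \<Psi> i) \<le> (1/4) * (1/2)^n"
    by (simp add: f_def norm_minus_commute)
qed

lemma fixpoint_bound:
  assumes c: "ball_contraction \<Psi>"
  shows "norm (fixpoint \<Psi> i) \<le> 1/16"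
proof -
  have "(\<lambda>n. norm ((\<Psi> ^^ n) (\<lambda>_. 0) i)) \<longlonglongrightarrow> norm (fixpoint \<Psi> i)"
    using fixpoint_iterates(2)[OF c] by (intro tendsto_intros)
  then show ?thesis by (rule LIMSEQ_le_const2) (use ball_contraction_iterate(1)[OF c] in auto)
qed

lemma fixpoint_eq:
  assumes c: "ball_contraction \<Psi>"
  shows "\<Psi> (fixpoint \<Psi>) = fixpoint \<Psi>"
proof
  fix i
  have *: "norm ((\<Psi> ^^ Suc (n+1)) (\<lambda>_. 0) i - \<Psi> (fixpoint \<Psi>) i) \<le> (1/2)^n" for n
  proof -
    have "norm (\<Psi> ((\<Psi> ^^ (n+1)) (\<lambda>_. 0)) i - \<Psi> (fixpoint \<Psi>) i) \<le> ((1/8) * (1/2)^n) / 2"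
    proof (rule ball_contraction_lipschitz[OF c])
      show "norm ((\<Psi> ^^ (n+1)) (\<lambda>_. 0) i) \<le> 1/2" for i
        using ball_contraction_iterate(1)[OF c, of "n+1" i] by simp
      show "norm (fixpoint \<Psi> i) \<le> 1/2" for i using fixpoint_bound[OF c, of i] by simp
      show "norm ((\<Psi> ^^ (n+1)) (\<lambda>_. 0) i - fixpoint \<Psi> i) \<le> (1/8) * (1/2)^n" for i
        using fixpoint_iterates(1)[OF c, of "n+1" i] by simp
    qed (auto simp: power_le_one)
    also have "\<dots> \<le> (1/2)^n" by simp
    finally show ?thesis by simp
  qed
  have "(\<lambda>n. (\<Psi> ^^ Suc (n+1)) (\<lambda>_. 0) i - \<Psi> (fixpoint \<Psi>) i) \<longlonglongrightarrow> 0"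
  proof (rule Lim_null_comparison)
    show "\<forall>\<^sub>F n in sequentially. norm ((\<Psi> ^^ Suc (n+1)) (\<lambda>_. 0) i - \<Psi> (fixpoint \<Psi>) i) \<le> (1/2)^n"
      by (rule always_eventually, rule allI, rule *)
    show "(\<lambda>n. (1/2::real)^n) \<longlonglongrightarrow> 0" by (rule LIMSEQ_realpow_zero) auto
  qed
  then have "(\<lambda>n. (\<Psi> ^^ Suc (n+1)) (\<lambda>_. 0) i) \<longlonglongrightarrow> \<Psi> (fixpoint \<Psi>) i"
    by (rule LIM_zero_cancel)
  moreover have "(\<lambda>n. (\<Psi> ^^ (n+2)) (\<lambda>_. 0) i) \<longlonglongrightarrow> fixpoint \<Psi> i"
    by (rule LIMSEQ_ignore_initial_segment[OF fixpoint_iterates(2)[OF c]])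
  ultimately show "\<Psi> (fixpoint \<Psi>) i = fixpoint \<Psi> i"
    by (simp add: LIMSEQ_unique)
qed

text \<open>One application of the map already places \<open>u\<close> in the polydisc of radius
  1/16, so the two fixed points are within 1/8 of each other and the Lipschitz bound can be
  iterated.\<close>

lemma fixpoint_unique:
  assumes c: "ball_contraction \<Psi>" and u: "\<And>i. norm (u i) \<le> 1" and fx: "\<Psi> u = u"
  shows "u = fixpoint \<Psi>"
proof -
  have ub: "norm (u i) \<le> 1/16" for i using ball_contraction_bound[OF c, of u i] u fx by simp
  have "norm (u i - fixpoint \<Psi> i) \<le> (1/8) * (1/2)^n" for n i
  proof (induction n arbitrary: i)
    case 0
    show ?case using norm_triangle_ineq4[of "u i" "fixpoint \<Psi> i"] ub[of i] fixpoint_bound[OF c, of i] by simp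
  next
    case (Suc n)
    have "norm (\<Psi> u i - \<Psi> (fixpoint \<Psi>) i) \<le> ((1/8) * (1/2)^n) / 2"
    proof (rule ball_contraction_lipschitz[OF c])
      show "norm (u i) \<le> 1/2" for i using ub[of i] by simp
      show "norm (fixpoint \<Psi> i) \<le> 1/2" for i using fixpoint_bound[OF c, of i] by simp
    qed (use Suc in \<open>auto simp: power_le_one\<close>)
    then show ?case using fixpoint_eq[OF c] fx by simp
  qed
  moreover have "(\<lambda>n. (1/8) * (1/2::real)^n) \<longlonglongrightarrow> (1/8) * 0"
    by (intro tendsto_intros LIMSEQ_realpow_zero) auto
  ultimately have "norm (u i - fixpoint \<Psi> i) \<le> 0" for i
    by (intro LIMSEQ_le_const[of "\<lambda>n. (1/8) * (1/2::real)^n"]) auto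
  then show ?thesis by auto
qed

text \<open>The rate (1/4) * (1/2)^n of the iteration does not depend on the parameter, so the
  holomorphic iterates converge uniformly.\<close>

lemma fixpoint_holomorphic:
  assumes D: "open D" and c: "\<And>z. z \<in> D \<Longrightarrow> ball_contraction (\<Psi> z)"
    and hol: "\<And>u i. (\<And>i. (\<lambda>z. u z i) holomorphic_on D) \<Longrightarrow> (\<And>z i. z \<in> D \<Longrightarrow> norm (u z i) \<le> 1) \<Longrightarrow>
                (\<lambda>z. \<Psi> z (u z) i) holomorphic_on D"
  shows "(\<lambda>z. fixpoint (\<Psi> z) i) holomorphic_on D"
proof (rule holomorphic_on_uniform_seq[OF D])
  show "(\<lambda>z. (\<Psi> z ^^ n) (\<lambda>_. 0) i) holomorphic_on D" for n
  proof (induction n arbitrary: i)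
    case 0 then show ?case by simp
  next
    case (Suc n)
    have "(\<lambda>z. \<Psi> z ((\<Psi> z ^^ n) (\<lambda>_. 0)) i) holomorphic_on D"
    proof (rule hol[OF Suc])
      fix z i assume "z \<in> D"
      then show "norm ((\<Psi> z ^^ n) (\<lambda>_. 0) i) \<le> 1"
        using ball_contraction_iterate(1)[OF c, of z n i] by simp
    qed
    then show ?case by simp
  qed
  show "uniform_limit D (\<lambda>n z. (\<Psi> z ^^ n) (\<lambda>_. 0) i) (\<lambda>z. fixpoint (\<Psi> z) i) sequentially"
  proof (rule uniform_limitI)
    fix e :: real assume e: "e > 0"
    then obtain N where N: "(1/2::real)^N < e"
      using real_arch_pow_inv[of e "1/2"] by auto
    show "\<forall>\<^sub>F n in sequentially. \<forall>z\<in>D. dist ((\<Psi> z ^^ n) (\<lambda>_. 0) i) (fixpoint (\<Psi> z) i) < e"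
    proof (rule eventually_sequentiallyI[of N], intro ballI)
      fix n z assume n: "n \<ge> N" and z: "z \<in> D"
      have "dist ((\<Psi> z ^^ n) (\<lambda>_. 0) i) (fixpoint (\<Psi> z) i) \<le> (1/4) * (1/2)^n"
        using fixpoint_iterates(1)[OF c[OF z], of n i] by (simp add: dist_norm)
      also have "\<dots> \<le> (1/2)^n" by simp
      also have "(1/2::real)^n \<le> (1/2)^N" using n by (intro power_decreasing) auto
      finally show "dist ((\<Psi> z ^^ n) (\<lambda>_. 0) i) (fixpoint (\<Psi> z) i) < e" using N by simp
    qed
  qed
qed

section \<open>Holomorphic dependence of integrals on a parameter\<close>

lemma integral_Riemann_sum_bound:
  fixes f :: "real \<Rightarrow> complex"
  assumes lip: "\<And>s s'. s \<in> {0..1} \<Longrightarrow> s' \<in> {0..1} \<Longrightarrow> norm (f s - f s') \<le> B * \<bar>s - s'\<bar>" and n: "n > 0"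
  shows "norm (integral {0..1} f - (\<Sum>k<n. f (of_nat k / of_nat n)) / of_nat n) \<le> B / of_nat n"
proof -
  have B: "B \<ge> 0" using order_trans[OF norm_ge_zero lip[of 0 1]] by simp
  have cont: "continuous_on {0..1} f"
  proof (rule continuous_onI)
    fix x e :: real assume x: "x \<in> {0..1}" and e: "e > 0"
    show "\<exists>d>0. \<forall>x'\<in>{0..1}. dist x' x < d \<longrightarrow> dist (f x') (f x) \<le> e"
    proof (intro exI[of _ "e / (B+1)"] conjI ballI impI)
      show "e / (B+1) > 0" using e B by simp
      fix x' assume x': "x' \<in> {0..1}" "dist x' x < e / (B+1)"
      have "dist (f x') (f x) \<le> B * \<bar>x' - x\<bar>" using lip x x' by (simp add: dist_norm)
      also have "\<dots> \<le> (B+1) * (e / (B+1))" using B x' by (intro mult_mono) (auto simp: dist_real_def)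
      also have "\<dots> = e" using B by simp
      finally show "dist (f x') (f x) \<le> e" .
    qed
  qed
  have *: "norm (integral {0..of_nat m / of_nat n} f - (\<Sum>k<m. f (of_nat k / of_nat n)) / of_nat n)
          \<le> of_nat m * (B / (of_nat n)^2)" if "m \<le> n" for m
    using that
  proof (induction m)
    case 0 then show ?case by simp
  next
    case (Suc m)
    define a b where "a = (of_nat m / of_nat n :: real)" and "b = (of_nat (Suc m) / of_nat n :: real)"
    have ab: "0 \<le> a" "a \<le> b" "b \<le> 1" "b - a = 1 / of_nat n"
      using Suc n by (auto simp: a_def b_def field_simps)
    have int: "f integrable_on {c..d}" if "0 \<le> c" "d \<le> 1" for c d
      by (rule integrable_continuous_real) (use cont that in \<open>auto intro: continuous_on_subset\<close>)
    have split: "integral {0..b} f = integral {0..a} f + integral {a..b} f"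
      using ab int by (intro Henstock_Kurzweil_Integration.integral_combine[symmetric]) auto
    have "norm (integral {a..b} f - f a * of_real (b - a)) \<le> (B * (b - a)) * (b - a)"
    proof -
      have c: "integral {a..b} (\<lambda>s. f a) = f a * of_real (b - a)" using ab by (simp add: scaleR_conv_of_real)
      have "integral {a..b} f - integral {a..b} (\<lambda>s. f a) = integral {a..b} (\<lambda>s. f s - f a)"
        using int ab by (intro integral_diff[symmetric]) auto
      also have "norm \<dots> \<le> (B * (b - a)) * (b - a)"
      proof (rule integral_bound)
        show "continuous_on {a..b} (\<lambda>s. f s - f a)"
          using ab cont by (intro continuous_intros) (auto intro: continuous_on_subset)
        show "norm (f s - f a) \<le> B * (b - a)" if "s \<in> {a..b}" for s
        proof -
          have "norm (f s - f a) \<le> B * \<bar>s - a\<bar>" using that ab by (intro lip) auto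
          also have "\<dots> \<le> B * (b - a)" using that B by (intro mult_left_mono) auto
          finally show ?thesis .
        qed
      qed (use ab in auto)
      finally show ?thesis using c by simp
    qed
    also have "(B * (b - a)) * (b - a) = B / (of_nat n)^2"
      using ab by (simp add: power2_eq_square)
    finally have 1: "norm (integral {a..b} f - f a / of_nat n) \<le> B / (of_nat n)^2"
      using ab by simp
    have eq: "integral {0..b} f - (\<Sum>k<Suc m. f (of_nat k / of_nat n)) / of_nat n
        = (integral {0..a} f - (\<Sum>k<m. f (of_nat k / of_nat n)) / of_nat n) + (integral {a..b} f - f a / of_nat n)"
      unfolding split by (simp add: a_def add_divide_distrib)
    have "norm (integral {0..b} f - (\<Sum>k<Suc m. f (of_nat k / of_nat n)) / of_nat n)
       \<le> of_nat m * (B / (of_nat n)^2) + B / (of_nat n)^2"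
      unfolding eq using 1 Suc by (intro norm_triangle_le add_mono) (auto simp: a_def)
    then show ?case by (simp add: b_def algebra_simps add_divide_distrib)
  qed
  have "norm (integral {0..of_nat n / of_nat n} f - (\<Sum>k<n. f (of_nat k / of_nat n)) / of_nat n)
          \<le> of_nat n * (B / (of_nat n)^2)" by (rule *) simp
  then show ?thesis using n by (simp add: power2_eq_square)
qed

text \<open>Riemann sums are finite sums of holomorphic functions, and a Lipschitz constant common
  to the whole domain makes them converge uniformly.\<close>

lemma holomorphic_on_integral:
  assumes D: "open D" and hol: "\<And>s. s \<in> {0..1} \<Longrightarrow> (\<lambda>z. f z s) holomorphic_on D"
    and lip: "\<And>z s s'. z \<in> D \<Longrightarrow> s \<in> {0..1} \<Longrightarrow> s' \<in> {0..1} \<Longrightarrow> norm (f z s - f z s') \<le> B * \<bar>s - s'\<bar>"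
  shows "(\<lambda>z. integral {0..1::real} (f z)) holomorphic_on D"
proof (rule holomorphic_on_uniform_seq[OF D])
  show "(\<lambda>z. (\<Sum>k<Suc n. f z (of_nat k / of_nat (Suc n))) / of_nat (Suc n)) holomorphic_on D" for n
    by (intro holomorphic_intros hol) (auto simp: field_simps)
  show "uniform_limit D (\<lambda>n z. (\<Sum>k<Suc n. f z (of_nat k / of_nat (Suc n))) / of_nat (Suc n))
       (\<lambda>z. integral {0..1} (f z)) sequentially"
  proof (rule uniform_limitI)
    fix e :: real assume e: "e > 0"
    have "(\<lambda>n. \<bar>B\<bar> / of_nat (Suc n)) \<longlonglongrightarrow> 0" by (rule LIMSEQ_Suc[OF lim_const_over_n])
    then have "\<forall>\<^sub>F n in sequentially. \<bar>B\<bar> / of_nat (Suc n) < e" using e by (rule order_tendstoD)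
    then show "\<forall>\<^sub>F n in sequentially. \<forall>z\<in>D. dist ((\<Sum>k<Suc n. f z (of_nat k / of_nat (Suc n))) / of_nat (Suc n)) (integral {0..1} (f z)) < e"
    proof eventually_elim
      case (elim n)
      show ?case
      proof
        fix z assume z: "z \<in> D"
        have "norm (integral {0..1} (f z) - (\<Sum>k<Suc n. f z (of_nat k / of_nat (Suc n))) / of_nat (Suc n)) \<le> B / of_nat (Suc n)"
          by (rule integral_Riemann_sum_bound) (use lip[OF z] in auto)
        also have "\<dots> \<le> \<bar>B\<bar> / of_nat (Suc n)" by (intro divide_right_mono) auto
        finally show "dist ((\<Sum>k<Suc n. f z (of_nat k / of_nat (Suc n))) / of_nat (Suc n)) (integral {0..1} (f z)) < e"
          using elim by (simp add: dist_norm norm_minus_commute)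
      qed
    qed
  qed
qed

section \<open>Segment integrals\<close>

lemma norm_mult_le: "norm a \<le> x \<Longrightarrow> norm b \<le> y \<Longrightarrow> norm (a * b :: complex) \<le> x * y"
  unfolding norm_mult by (intro mult_mono) (auto intro: order_trans[OF norm_ge_zero])

text \<open>The half-width satisfies 2 * pi / 16 < 1/2, so a harmonic of frequency q is at most exp
  (q / 2) here, which a coefficient of size exp (- q) compensates.\<close>

definition strip :: "complex set" where "strip = {z. \<bar>Im z\<bar> < 1/16}"

text \<open>Here \<open>t\<close> plays the role of \<open>1 / h'\<close>, where \<open>h\<close> parametrises an invariant circle.\<close>

definition adm :: "(complex \<Rightarrow> complex) \<Rightarrow> bool" where
  "adm t \<longleftrightarrow> t holomorphic_on strip \<and> (\<forall>z\<in>strip. norm (t z - 1) \<le> 1/1000) \<and>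
     (\<forall>z\<in>strip. \<forall>w\<in>strip. norm (t z - t w) \<le> norm (z - w))"

text \<open>Joint holomorphy in parameter and argument, tested on arguments that move
  holomorphically with the parameter. This keeps all arguments in one complex variable, and it is
  what orbits need, since their points move with the parameter.\<close>

definition holfam :: "complex set \<Rightarrow> (complex \<Rightarrow> complex \<Rightarrow> complex) \<Rightarrow> bool" where
  "holfam D tt \<longleftrightarrow> open D \<and> (\<forall>z\<in>D. adm (tt z)) \<and>
     (\<forall>\<theta>. \<theta> holomorphic_on D \<longrightarrow> \<theta> ` D \<subseteq> strip \<longrightarrow> (\<lambda>z. tt z (\<theta> z)) holomorphic_on D)"

lemma strip_segment:
  assumes "x \<in> strip" "x + v \<in> strip" "s \<in> {0..1}"
  shows "x + of_real s * v \<in> strip"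
proof -
  have "Im (x + of_real s * v) = (1 - s) * Im x + s * Im (x + v)" by (simp add: algebra_simps)
  also have "\<bar>\<dots>\<bar> \<le> (1 - s) * \<bar>Im x\<bar> + s * \<bar>Im (x + v)\<bar>"
    using assms(3) by (intro order_trans[OF abs_triangle_ineq]) (simp add: abs_mult)
  also have "\<dots> < 1/16"
    using assms convex_bound_lt[of "\<bar>Im x\<bar>" "1/16" "\<bar>Im (x + v)\<bar>" "1 - s" s] by (simp add: strip_def)
  finally show ?thesis by (simp add: strip_def)
qed

lemma strip_of_real [simp]: "of_real x \<in> strip" by (simp add: strip_def)
lemma strip_add_real [simp]: "x + of_real r \<in> strip \<longleftrightarrow> x \<in> strip" by (simp add: strip_def)

lemma open_strip: "open strip"
proof -
  have "strip = {z. Im z < 1/16} \<inter> {z. Im z > -1/16}" by (auto simp: strip_def)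
  also have "open \<dots>" by (intro open_Int open_halfspace_Im_lt open_halfspace_Im_gt)
  finally show ?thesis .
qed

lemma adm_bounds:
  assumes "adm t" "z \<in> strip"
  shows "norm (t z - 1) \<le> 1/1000" "norm (t z) \<le> 1001/1000" "norm (t z) \<ge> 999/1000" "t z \<noteq> 0"
    "norm (inverse (t z)) \<le> 1002/1000"
proof -
  show 1: "norm (t z - 1) \<le> 1/1000" using assms by (simp add: adm_def)
  show "norm (t z) \<le> 1001/1000" using 1 norm_triangle_sub[of "t z" 1] by simp
  show 2: "norm (t z) \<ge> 999/1000" using 1 norm_triangle_sub[of 1 "t z"] by (simp add: norm_minus_commute)
  then show "t z \<noteq> 0" by auto
  have "inverse (norm (t z)) \<le> inverse (999/1000)" using 2 by (intro le_imp_inverse_le) auto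
  then show "norm (inverse (t z)) \<le> 1002/1000" by (simp add: norm_inverse)
qed

lemma adm_lipschitz: "adm t \<Longrightarrow> z \<in> strip \<Longrightarrow> w \<in> strip \<Longrightarrow> norm (t z - t w) \<le> norm (z - w)"
  by (simp add: adm_def)

lemma adm_inverse_lipschitz:
  assumes t: "adm t" and z: "z \<in> strip" and w: "w \<in> strip"
  shows "norm (inverse (t z) - inverse (t w)) \<le> 101/100 * norm (z - w)"
proof -
  have "inverse (t z) - inverse (t w) = - (inverse (t z) * (t z - t w) * inverse (t w))"
    using adm_bounds(4)[OF t] z w by (intro inverse_diff_inverse) auto
  then have "norm (inverse (t z) - inverse (t w)) = norm (inverse (t z)) * norm (t z - t w) * norm (inverse (t w))"
    by (simp add: norm_mult)
  also have "\<dots> \<le> (1002/1000) * norm (z - w) * (1002/1000)"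
    using adm_bounds(5)[OF t] adm_lipschitz[OF t z w] z w by (intro mult_mono) auto
  also have "\<dots> \<le> 101/100 * norm (z - w)" by simp
  finally show ?thesis .
qed

text \<open>The divided difference \<open>(h (\<theta> + v) - h \<theta>) / v\<close> for \<open>h' = 1 / t\<close>, regular also at \<open>v = 0\<close>.\<close>

definition R1 :: "(complex \<Rightarrow> complex) \<Rightarrow> complex \<Rightarrow> complex \<Rightarrow> complex" where
  "R1 t \<theta> v = integral {0..1::real} (\<lambda>s. inverse (t (\<theta> + of_real s * v)))"

lemma adm_continuous: "adm t \<Longrightarrow> continuous_on strip t"
  by (simp add: adm_def holomorphic_on_imp_continuous_on)

lemma adm_inverse_segment_continuous:
  assumes t: "adm t" and x: "x \<in> strip" "x + v \<in> strip"
  shows "continuous_on {0..1} (\<lambda>s::real. inverse (t (x + of_real s * v)))"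
proof -
  have "continuous_on {0..1} (\<lambda>s::real. t (x + of_real s * v))"
    by (rule continuous_on_compose2[OF adm_continuous[OF t]])
       (use strip_segment[OF x] in \<open>auto intro!: continuous_intros\<close>)
  then show ?thesis
    by (rule continuous_on_inverse) (use strip_segment[OF x] adm_bounds(4)[OF t] in blast)
qed

lemma integral_close_const:
  fixes f :: "real \<Rightarrow> complex"
  assumes c: "continuous_on {0..1} f" and b: "\<And>s. s \<in> {0..1} \<Longrightarrow> norm (f s - g s) \<le> B"
    and g: "(g has_integral I) {0..1}" and cg: "continuous_on {0..1} g"
  shows "norm (integral {0..1} f - I) \<le> B"
proof -
  have i: "f integrable_on {0..1}" using c by (rule integrable_continuous_real)
  have "integral {0..1} f - I = integral {0..1} (\<lambda>s. f s - g s)"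
    using i g by (simp add: integral_diff has_integral_integrable integral_unique)
  also have "norm \<dots> \<le> B * (1 - 0)"
    by (rule integral_bound) (use c cg b in \<open>auto intro!: continuous_intros\<close>)
  finally show ?thesis by simp
qed

lemma R1_close:
  assumes t: "adm t" and x: "x \<in> strip" "x + v \<in> strip" and w: "w \<in> strip"
    and d: "\<And>s. s \<in> {0..1} \<Longrightarrow> norm (x + of_real s * v - w) \<le> d"
  shows "norm (R1 t x v - inverse (t w)) \<le> 101/100 * d"
  unfolding R1_def
proof (rule integral_close_const[OF adm_inverse_segment_continuous[OF t x]])
  show "((\<lambda>s. inverse (t w)) has_integral inverse (t w)) {0..1::real}"
    using has_integral_const_real[of "inverse (t w)" 0 1] by simp
  fix s :: real assume s: "s \<in> {0..1}"
  have "norm (inverse (t (x + of_real s * v)) - inverse (t w)) \<le> 101/100 * norm (x + of_real s * v - w)"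
    by (rule adm_inverse_lipschitz[OF t strip_segment[OF x s] w])
  then show "norm (inverse (t (x + of_real s * v)) - inverse (t w)) \<le> 101/100 * d" using d[OF s] by simp
qed auto

lemma R1_lipschitz:
  assumes t: "adm t" and x: "x \<in> strip" "x + v \<in> strip" and x': "x' \<in> strip" "x' + v' \<in> strip"
    and d: "\<And>s. s \<in> {0..1} \<Longrightarrow> norm (x + of_real s * v - (x' + of_real s * v')) \<le> d"
  shows "norm (R1 t x v - R1 t x' v') \<le> 101/100 * d"
  unfolding R1_def
proof (rule integral_close_const[OF adm_inverse_segment_continuous[OF t x]])
  show "((\<lambda>s. inverse (t (x' + of_real s * v'))) has_integral integral {0..1} (\<lambda>s. inverse (t (x' + of_real s * v')))) {0..1::real}"
    using adm_inverse_segment_continuous[OF t x'] integrable_continuous_real by blast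
  fix s :: real assume s: "s \<in> {0..1}"
  have "norm (inverse (t (x + of_real s * v)) - inverse (t (x' + of_real s * v'))) \<le> 101/100 * norm (x + of_real s * v - (x' + of_real s * v'))"
    by (rule adm_inverse_lipschitz[OF t strip_segment[OF x s] strip_segment[OF x' s]])
  then show "norm (inverse (t (x + of_real s * v)) - inverse (t (x' + of_real s * v'))) \<le> 101/100 * d" using d[OF s] by simp
qed (rule adm_inverse_segment_continuous[OF t x'])

lemma R1_bounds:
  assumes t: "adm t" and x: "x \<in> strip" "x + v \<in> strip"
  shows "norm (R1 t x v - 1) \<le> 2/1000" "norm (R1 t x v) \<le> 1002/1000" "R1 t x v \<noteq> 0"
proof -
  show 1: "norm (R1 t x v - 1) \<le> 2/1000"
    unfolding R1_def
  proof (rule integral_close_const[OF adm_inverse_segment_continuous[OF t x]])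
    show "((\<lambda>s. 1::complex) has_integral 1) {0..1::real}"
      using has_integral_const_real[of "1::complex" 0 1] by simp
    fix s :: real assume s: "s \<in> {0..1}"
    let ?w = "x + of_real s * v"
    have w: "?w \<in> strip" by (rule strip_segment[OF x s])
    have "inverse (t ?w) - 1 = inverse (t ?w) * (1 - t ?w)" using adm_bounds(4)[OF t w] by (simp add: algebra_simps)
    also have "norm \<dots> \<le> (1002/1000) * (1/1000)"
      unfolding norm_mult using adm_bounds[OF t w] by (intro mult_mono) (auto simp: norm_minus_commute)
    finally show "norm (inverse (t ?w) - 1) \<le> 2/1000" by simp
  qed auto
  then show "norm (R1 t x v) \<le> 1002/1000" using norm_triangle_sub[of "R1 t x v" 1] by simp
  show "R1 t x v \<noteq> 0" using 1 by auto
qed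

lemma holfam_compose: "holfam D tt \<Longrightarrow> \<theta> holomorphic_on D \<Longrightarrow> (\<And>z. z \<in> D \<Longrightarrow> \<theta> z \<in> strip) \<Longrightarrow> (\<lambda>z. tt z (\<theta> z)) holomorphic_on D"
  unfolding holfam_def by blast

lemma holfam_const:
  assumes "adm t" "open D" shows "holfam D (\<lambda>_. t)"
  unfolding holfam_def
proof (intro conjI allI impI ballI)
  fix \<theta> assume "\<theta> holomorphic_on D" "\<theta> ` D \<subseteq> strip"
  then show "(\<lambda>z. t (\<theta> z)) holomorphic_on D"
    using assms holomorphic_on_compose_gen[of \<theta> D t strip] by (simp add: adm_def o_def)
qed (use assms in auto)

lemma holfam_adm: "holfam D tt \<Longrightarrow> z \<in> D \<Longrightarrow> adm (tt z)" by (simp add: holfam_def)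
lemma holfam_open: "holfam D tt \<Longrightarrow> open D" by (simp add: holfam_def)

lemma holomorphic_inverse_segment:
  assumes H: "holfam D tt" and \<theta>: "\<theta> holomorphic_on D" and v: "v holomorphic_on D"
    and s: "\<And>z. z \<in> D \<Longrightarrow> \<theta> z \<in> strip" "\<And>z. z \<in> D \<Longrightarrow> \<theta> z + v z \<in> strip" and r: "r \<in> {0..1}"
  shows "(\<lambda>z. inverse (tt z (\<theta> z + of_real r * v z))) holomorphic_on D"
proof (rule holomorphic_on_inverse)
  have *: "\<theta> z + of_real r * v z \<in> strip" if "z \<in> D" for z using strip_segment s r that by blast
  show "(\<lambda>z. tt z (\<theta> z + of_real r * v z)) holomorphic_on D"
    by (rule holfam_compose[OF H]) (use * in \<open>auto intro!: holomorphic_intros \<theta> v\<close>)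
  show "tt z (\<theta> z + of_real r * v z) \<noteq> 0" if "z \<in> D" for z
    using adm_bounds(4)[OF holfam_adm[OF H that] *[OF that]] .
qed

lemma R1_holomorphic:
  assumes H: "holfam D tt" and \<theta>: "\<theta> holomorphic_on D" and v: "v holomorphic_on D"
    and s: "\<And>z. z \<in> D \<Longrightarrow> \<theta> z \<in> strip" "\<And>z. z \<in> D \<Longrightarrow> \<theta> z + v z \<in> strip"
    and B: "\<And>z. z \<in> D \<Longrightarrow> norm (v z) \<le> B"
  shows "(\<lambda>z. R1 (tt z) (\<theta> z) (v z)) holomorphic_on D"
  unfolding R1_def
proof (rule holomorphic_on_integral[OF holfam_open[OF H], where B="101/100*B"])
  show "(\<lambda>z. inverse (tt z (\<theta> z + of_real r * v z))) holomorphic_on D" if "r \<in> {0..1}" for r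
    by (rule holomorphic_inverse_segment[OF H \<theta> v s that])
  fix z and r r' :: real assume z: "z \<in> D" and r: "r \<in> {0..1}" "r' \<in> {0..1}"
  have "norm (inverse (tt z (\<theta> z + of_real r * v z)) - inverse (tt z (\<theta> z + of_real r' * v z)))
     \<le> 101/100 * norm ((\<theta> z + of_real r * v z) - (\<theta> z + of_real r' * v z))"
    by (rule adm_inverse_lipschitz[OF holfam_adm[OF H z] strip_segment strip_segment]) (use s[OF z] r in auto)
  also have "(\<theta> z + of_real r * v z) - (\<theta> z + of_real r' * v z) = of_real (r - r') * v z" by (simp add: algebra_simps)
  also have "101/100 * norm (of_real (r - r') * v z) \<le> 101/100 * (\<bar>r - r'\<bar> * B)"
    unfolding norm_mult norm_of_real using B[OF z] by (intro mult_left_mono) auto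
  finally show "norm (inverse (tt z (\<theta> z + of_real r * v z)) - inverse (tt z (\<theta> z + of_real r' * v z))) \<le> 101/100 * B * \<bar>r - r'\<bar>"
    by (simp add: mult_ac)
qed

text \<open>\<open>v\<^sup>2 * LL t w \<theta> v\<close> is the action, relative to the invariant circle, of the step from \<open>\<theta>\<close> to \<open>\<theta> + w + v\<close>.\<close>

definition LL :: "(complex \<Rightarrow> complex) \<Rightarrow> real \<Rightarrow> complex \<Rightarrow> complex \<Rightarrow> complex" where
  "LL t w \<theta> v = integral {0..1::real} (\<lambda>s. of_real s * inverse (t (\<theta> + of_real w + of_real s * v)) * R1 t \<theta> (of_real s * v))"

lemma LL_integrand_lipschitz:
  assumes t: "adm t" and x: "x \<in> strip" "x + v \<in> strip" and r: "r \<in> {0..1}" "r' \<in> {0..1::real}"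
  shows "norm (of_real r * inverse (t (x + of_real w + of_real r * v)) * R1 t x (of_real r * v)
            - of_real r' * inverse (t (x + of_real w + of_real r' * v)) * R1 t x (of_real r' * v)) \<le> (2 + 3 * norm v) * \<bar>r - r'\<bar>"
proof -
  have xw: "x + of_real w \<in> strip" "x + of_real w + v \<in> strip"
    using x by (auto simp: strip_def)
  define A where "A = (\<lambda>r. inverse (t (x + of_real w + of_real r * v)))"
  define C where "C = (\<lambda>r::real. R1 t x (of_real r * v))"
  have A: "norm (A r - A r') \<le> 101/100 * (norm v * \<bar>r - r'\<bar>)"
  proof -
    have "norm (A r - A r') \<le> 101/100 * norm ((x + of_real w + of_real r * v) - (x + of_real w + of_real r' * v))"
      unfolding A_def by (rule adm_inverse_lipschitz[OF t strip_segment[OF xw r(1)] strip_segment[OF xw r(2)]])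
    also have "(x + of_real w + of_real r * v) - (x + of_real w + of_real r' * v) = of_real (r - r') * v" by (simp add: algebra_simps)
    finally show ?thesis by (simp only: norm_mult norm_of_real) (simp add: mult_ac)
  qed
  have C: "norm (C r - C r') \<le> 101/100 * (norm v * \<bar>r - r'\<bar>)"
    unfolding C_def
  proof (rule R1_lipschitz[OF t])
    fix s :: real assume s: "s \<in> {0..1}"
    have "x + of_real s * (of_real r * v) - (x + of_real s * (of_real r' * v)) = of_real s * (of_real (r - r') * v)"
      by (simp add: algebra_simps)
    also have "norm \<dots> = \<bar>s\<bar> * (\<bar>r-r'\<bar> * norm v)" by (simp only: norm_mult norm_of_real)
    also have "\<dots> \<le> 1 * (\<bar>r-r'\<bar> * norm v)" using s by (intro mult_right_mono) auto
    finally show "norm (x + of_real s * (of_real r * v) - (x + of_real s * (of_real r' * v))) \<le> norm v * \<bar>r - r'\<bar>"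
      by (simp only: mult_1 mult.commute[of "norm v"])
  qed (use x strip_segment[OF x] r in auto)
  have Ab: "norm (A r) \<le> 1002/1000" "norm (A r') \<le> 1002/1000"
    unfolding A_def using adm_bounds(5)[OF t] strip_segment[OF xw] r by auto
  have Cb: "norm (C r) \<le> 1002/1000" "norm (C r') \<le> 1002/1000"
    unfolding C_def using R1_bounds(2)[OF t x(1)] strip_segment[OF x] r by auto
  have "of_real r * A r * C r - of_real r' * A r' * C r'
      = of_real (r - r') * (A r * C r) + of_real r' * ((A r - A r') * C r) + of_real r' * (A r' * (C r - C r'))"
    by (simp add: algebra_simps)
  also have "norm \<dots> \<le> \<bar>r - r'\<bar> * ((1002/1000) * (1002/1000)) + 1 * ((101/100 * (norm v * \<bar>r - r'\<bar>)) * (1002/1000))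
       + 1 * ((1002/1000) * (101/100 * (norm v * \<bar>r - r'\<bar>)))"
    by (intro order_trans[OF norm_triangle_ineq] add_mono norm_mult_le Ab Cb A C) (use r in \<open>auto simp flip: of_real_diff\<close>)
  also have "\<dots> = (1002/1000)^2 * \<bar>r - r'\<bar> + (2 * 101/100 * 1002/1000) * (norm v * \<bar>r - r'\<bar>)"
    by (simp add: power2_eq_square)
  also have "\<dots> \<le> 2 * \<bar>r - r'\<bar> + 3 * (norm v * \<bar>r - r'\<bar>)"
    by (intro add_mono mult_right_mono) (auto simp: power2_eq_square)
  also have "\<dots> = (2 + 3 * norm v) * \<bar>r - r'\<bar>" by (simp only: distrib_right mult.assoc)
  finally show ?thesis by (simp add: A_def C_def)
qed

text \<open>For small \<open>v\<close> the integrand is close to s / (t x * t (x + w)), and the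
  integral of s gives the factor 1/2. Taking the second factor at the endpoint x + w + v costs only
  O(v) and matches the product \<open>tau\<close> along an orbit.\<close>

lemma LL_close:
  assumes t: "adm t" and x: "x \<in> strip" "x + v \<in> strip"
  shows "norm (LL t w x v - inverse (t x * t (x + of_real w + v)) / 2) \<le> 3 * norm v"
proof -
  have xw: "x + of_real w \<in> strip" "x + of_real w + v \<in> strip"
    using x by (auto simp: strip_def)
  define c where "c = inverse (t x) * inverse (t (x + of_real w + v))"
  have "norm (LL t w x v - c/2) \<le> 3 * norm v"
    unfolding LL_def
  proof (rule integral_close_const)
    show "continuous_on {0..1} (\<lambda>s. of_real s * inverse (t (x + of_real w + of_real s * v)) * R1 t x (of_real s * v))"
    proof (rule lipschitz_on_continuous_on[of "2 + 3 * norm v"], rule lipschitz_onI)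
      show "dist (of_real r * inverse (t (x + of_real w + of_real r * v)) * R1 t x (of_real r * v))
        (of_real r' * inverse (t (x + of_real w + of_real r' * v)) * R1 t x (of_real r' * v)) \<le> (2 + 3 * norm v) * dist r r'"
        if "r \<in> {0..1}" "r' \<in> {0..1}" for r r'
        using LL_integrand_lipschitz[OF t x that, of w] by (simp add: dist_norm)
    qed auto
    show "((\<lambda>s. of_real s * c) has_integral c/2) {0..1::real}"
    proof -
      have "((\<lambda>s::real. s) has_integral 1/2) {0..1}" using ident_has_integral[of 0 1] by simp
      then have "((\<lambda>s::real. s *\<^sub>R c) has_integral (1/2) *\<^sub>R c) {0..1}"
        by (intro has_integral_scaleR_left) simp
      then show ?thesis by (simp add: scaleR_conv_of_real)
    qed
    show "continuous_on {0..1} (\<lambda>s. of_real s * c)" by (intro continuous_intros)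
    fix s :: real assume s: "s \<in> {0..1}"
    define A where "A = inverse (t (x + of_real w + of_real s * v))"
    define C where "C = R1 t x (of_real s * v)"
    have A: "norm (A - inverse (t (x + of_real w + v))) \<le> 101/100 * norm v"
    proof -
      have "norm (A - inverse (t (x + of_real w + v))) \<le> 101/100 * norm ((x + of_real w + of_real s * v) - (x + of_real w + v))"
        unfolding A_def by (rule adm_inverse_lipschitz[OF t strip_segment[OF xw s] xw(2)])
      also have "(x + of_real w + of_real s * v) - (x + of_real w + v) = of_real (s - 1) * v" by (simp add: algebra_simps)
      also have "norm \<dots> \<le> norm v" unfolding norm_mult norm_of_real using s by (intro mult_left_le_one_le) auto
      finally show ?thesis by simp
    qed
    have C: "norm (C - inverse (t x)) \<le> 101/100 * norm v"
      unfolding C_def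
    proof (rule R1_close[OF t])
      fix r :: real assume r: "r \<in> {0..1}"
      have "norm (x + of_real r * (of_real s * v) - x) = \<bar>r\<bar> * (\<bar>s\<bar> * norm v)" by (simp add: norm_mult)
      also have "\<dots> \<le> 1 * (1 * norm v)" using r s by (intro mult_mono) auto
      finally show "norm (x + of_real r * (of_real s * v) - x) \<le> norm v" by simp
    qed (use x strip_segment[OF x s] in auto)
    have Cb: "norm C \<le> 1002/1000" unfolding C_def using R1_bounds(2)[OF t x(1)] strip_segment[OF x s] by auto
    have "of_real s * A * C - of_real s * c = of_real s * ((A - inverse (t (x + of_real w + v))) * C + inverse (t (x + of_real w + v)) * (C - inverse (t x)))"
      by (simp add: c_def algebra_simps)
    also have "norm \<dots> \<le> 1 * ((101/100 * norm v) * (1002/1000) + (1002/1000) * (101/100 * norm v))"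
      by (intro order_trans[OF norm_triangle_ineq] add_mono norm_mult_le Cb A C adm_bounds(5)[OF t xw(2)]) (use s in auto)
    also have "\<dots> \<le> 3 * norm v" by simp
    finally show "norm (of_real s * inverse (t (x + of_real w + of_real s * v)) * R1 t x (of_real s * v) - of_real s * c) \<le> 3 * norm v"
      by (simp add: A_def C_def)
  qed
  then show ?thesis by (simp add: c_def)
qed

lemma LL_holomorphic:
  assumes H: "holfam D tt" and \<theta>: "\<theta> holomorphic_on D" and v: "v holomorphic_on D"
    and s: "\<And>z. z \<in> D \<Longrightarrow> \<theta> z \<in> strip" "\<And>z. z \<in> D \<Longrightarrow> \<theta> z + v z \<in> strip"
    and B: "\<And>z. z \<in> D \<Longrightarrow> norm (v z) \<le> B"
  shows "(\<lambda>z. LL (tt z) w (\<theta> z) (v z)) holomorphic_on D"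
  unfolding LL_def
proof (rule holomorphic_on_integral[OF holfam_open[OF H], where B="2 + 3 * B"])
  fix r :: real assume r: "r \<in> {0..1}"
  have s': "\<theta> z + of_real w \<in> strip" "\<theta> z + of_real w + v z \<in> strip" if "z \<in> D" for z
    using s[OF that] by (auto simp: strip_def)
  have 1: "(\<lambda>z. inverse (tt z ((\<theta> z + of_real w) + of_real r * v z))) holomorphic_on D"
    by (rule holomorphic_inverse_segment[OF H _ v _ _ r]) (use s' in \<open>auto intro!: holomorphic_intros \<theta>\<close>)
  have 2: "(\<lambda>z. R1 (tt z) (\<theta> z) (of_real r * v z)) holomorphic_on D"
  proof (rule R1_holomorphic[OF H \<theta>])
    show "norm (of_real r * v z) \<le> B" if "z \<in> D" for z
      using B[OF that] r mult_left_le_one_le[of "norm (v z)" r] by (simp add: norm_mult)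
  qed (use s strip_segment r in \<open>auto intro!: holomorphic_intros v\<close>)
  show "(\<lambda>z. of_real r * inverse (tt z (\<theta> z + of_real w + of_real r * v z)) * R1 (tt z) (\<theta> z) (of_real r * v z)) holomorphic_on D"
    by (intro holomorphic_intros 1 2)
next
  fix z and r r' :: real assume z: "z \<in> D" and r: "r \<in> {0..1}" "r' \<in> {0..1}"
  show "norm (of_real r * inverse (tt z (\<theta> z + of_real w + of_real r * v z)) * R1 (tt z) (\<theta> z) (of_real r * v z)
      - of_real r' * inverse (tt z (\<theta> z + of_real w + of_real r' * v z)) * R1 (tt z) (\<theta> z) (of_real r' * v z)) \<le> (2 + 3 * B) * \<bar>r - r'\<bar>"
    using LL_integrand_lipschitz[OF holfam_adm[OF H z] s(1)[OF z] s(2)[OF z] r, of w]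
      mult_right_mono[of "2 + 3 * norm (v z)" "2 + 3 * B" "\<bar>r - r'\<bar>"] B[OF z] by linarith
qed

section \<open>Orbit segments with rational rotation number\<close>

lemma norm_quotient_mean_bound:
  fixes E :: "nat \<Rightarrow> complex"
  assumes q: "q > 0" and E: "\<And>l. l < q \<Longrightarrow> norm (E l - 1) \<le> \<delta>" and \<delta>: "\<delta> < 1" and k: "k < q"
  shows "(\<Sum>l<q. E l) \<noteq> 0" "norm (of_nat q * E k / (\<Sum>l<q. E l) - 1) \<le> 2 * \<delta> / (1 - \<delta>)"
proof -
  have S: "norm ((\<Sum>l<q. E l) - of_nat q) \<le> of_nat q * \<delta>"
  proof -
    have "(\<Sum>l<q. E l) - of_nat q = (\<Sum>l<q. E l - 1)" by (simp add: sum_subtractf)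
    also have "norm \<dots> \<le> (\<Sum>l<q. \<delta>)" by (rule sum_norm_le) (use E in auto)
    finally show ?thesis by simp
  qed
  have Sl: "norm (\<Sum>l<q. E l) \<ge> of_nat q * (1 - \<delta>)"
    using S norm_triangle_sub[of "of_nat q :: complex" "\<Sum>l<q. E l"] by (simp add: norm_minus_commute algebra_simps)
  have pos: "of_nat q * (1 - \<delta>) > 0" using q \<delta> by simp
  show ne: "(\<Sum>l<q. E l) \<noteq> 0" using Sl pos by auto
  have "of_nat q * E k / (\<Sum>l<q. E l) - 1 = (of_nat q * (E k - 1) - ((\<Sum>l<q. E l) - of_nat q)) / (\<Sum>l<q. E l)"
    using ne by (simp add: field_simps)
  also have "norm \<dots> \<le> (of_nat q * \<delta> + of_nat q * \<delta>) / (of_nat q * (1 - \<delta>))"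
    unfolding norm_divide
  proof (rule frac_le[OF _ _ pos Sl])
    have "norm (of_nat q * (E k - 1)) \<le> of_nat q * \<delta>"
      unfolding norm_mult using E[OF k] by (simp add: mult_left_mono)
    then show "norm (of_nat q * (E k - 1) - ((\<Sum>l<q. E l) - of_nat q)) \<le> of_nat q * \<delta> + of_nat q * \<delta>"
      using S norm_triangle_ineq4[of "of_nat q * (E k - 1)" "(\<Sum>l<q. E l) - of_nat q"] by linarith
    show "0 \<le> of_nat q * \<delta> + of_nat q * \<delta>" using order_trans[OF norm_ge_zero S] by linarith
  qed
  also have "\<dots> = 2 * \<delta> / (1 - \<delta>)" using q \<delta> by (simp add: field_simps)
  finally show "norm (of_nat q * E k / (\<Sum>l<q. E l) - 1) \<le> 2 * \<delta> / (1 - \<delta>)" .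
qed

text \<open>The square of \<open>q\<close> in the smallness condition pays for the crude bound 3 * q
  on \<open>y\<close> that is known a priori for a periodic orbit of small action; the orbits
  obtained by the iteration have \<open>y\<close> near 1.\<close>

locale near_rational =
  fixes \<omega> \<epsilon> :: real and q :: nat and p :: int
  assumes q: "q > 0" and om: "\<omega> = of_int p / of_nat q + \<epsilon>" and small: "\<bar>\<epsilon>\<bar> * (real q)\<^sup>2 \<le> 1/10^6"
begin

text \<open>Orbits are parametrised by \<open>y k = (\<theta> k + \<omega> - \<theta> (Suc k)) / \<epsilon>\<close>, which is close to 1 as \<open>\<epsilon> \<longrightarrow> 0\<close>.\<close>

definition th :: "complex \<Rightarrow> (nat \<Rightarrow> complex) \<Rightarrow> nat \<Rightarrow> complex" where
  "th \<phi> y k = \<phi> + of_real (real k * \<omega>) - of_real \<epsilon> * (\<Sum>i<k. y i)"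

text \<open>For real data, - \<epsilon> * y k times \<open>ra\<close> is h (\<theta> (Suc k) -
  \<omega>) - h (\<theta> k), and with \<open>rb\<close> it is h (\<theta> (Suc k)) - h (\<theta> k
  + \<omega>). The Euler-Lagrange equation equates the former at k with the latter at Suc k, and the
  small factor \<epsilon> cancels.\<close>

definition ra :: "(complex \<Rightarrow> complex) \<Rightarrow> complex \<Rightarrow> (nat \<Rightarrow> complex) \<Rightarrow> nat \<Rightarrow> complex" where
  "ra t \<phi> y k = R1 t (th \<phi> y k) (- of_real \<epsilon> * y k)"

definition rb :: "(complex \<Rightarrow> complex) \<Rightarrow> complex \<Rightarrow> (nat \<Rightarrow> complex) \<Rightarrow> nat \<Rightarrow> complex" where
  "rb t \<phi> y k = R1 t (th \<phi> y k + of_real \<omega>) (- of_real \<epsilon> * y k)"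

text \<open>The solution with initial value 1 of the recursion to which the Euler-Lagrange equations
  reduce. It is implicit, as \<open>ra\<close> and \<open>rb\<close> depend on \<open>y\<close>;
  this is why a fixed point is needed.\<close>

definition EE :: "(complex \<Rightarrow> complex) \<Rightarrow> complex \<Rightarrow> (nat \<Rightarrow> complex) \<Rightarrow> nat \<Rightarrow> complex" where
  "EE t \<phi> y k = (\<Prod>i<k. ra t \<phi> y i / rb t \<phi> y (Suc i))"

text \<open>The Euler--Lagrange equations \<open>y (Suc k) * rb (Suc k) = y k * ra k\<close> together with \<open>sum y = q\<close> say that \<open>y\<close> is a fixed point of \<open>PS\<close>.\<close>

definition PS :: "(complex \<Rightarrow> complex) \<Rightarrow> complex \<Rightarrow> (nat \<Rightarrow> complex) \<Rightarrow> nat \<Rightarrow> complex" where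
  "PS t \<phi> y k = of_nat q * EE t \<phi> y k / (\<Sum>l<q. EE t \<phi> y l)"

text \<open>The bound \<open>Y\<close> is kept variable: it is 3/2 for the iteration and 3 * q for
  orbits about which only an action bound is known.\<close>

definition cfg :: "complex \<Rightarrow> (nat \<Rightarrow> complex) \<Rightarrow> real \<Rightarrow> bool" where
  "cfg \<phi> y Y \<longleftrightarrow> (\<forall>k\<le>q. th \<phi> y k \<in> strip) \<and> (\<forall>k<q. norm (y k) \<le> Y)"

text \<open>Up to small errors 1 / (2 * tau) is the second variation \<open>LL\<close> of one step,
  and the solution \<open>y\<close> is proportional to \<open>tau\<close>.\<close>

definition tau :: "(complex \<Rightarrow> complex) \<Rightarrow> complex \<Rightarrow> (nat \<Rightarrow> complex) \<Rightarrow> nat \<Rightarrow> complex" where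
  "tau t \<phi> y k = t (th \<phi> y k) * t (th \<phi> y (Suc k))"

lemma th_0 [simp]: "th \<phi> y 0 = \<phi>" by (simp add: th_def)

lemma th_Suc: "th \<phi> y (Suc k) = th \<phi> y k + of_real \<omega> + (- of_real \<epsilon> * y k)"
  by (simp add: th_def algebra_simps)

lemma eps_q: "\<bar>\<epsilon>\<bar> * real q \<le> 1/10^6"
proof -
  have "\<bar>\<epsilon>\<bar> * real q \<le> \<bar>\<epsilon>\<bar> * (real q)\<^sup>2"
    using q by (intro mult_left_mono) (auto simp: power2_eq_square)
  then show ?thesis using small by simp
qed

lemma cfg_strip:
  assumes "cfg \<phi> y Y" "k < q"
  shows "th \<phi> y k \<in> strip" "th \<phi> y k + (- of_real \<epsilon> * y k) \<in> strip" "th \<phi> y k + of_real \<omega> \<in> strip"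
    "th \<phi> y k + of_real \<omega> + (- of_real \<epsilon> * y k) \<in> strip" "th \<phi> y (Suc k) \<in> strip"
    "norm (- of_real \<epsilon> * y k) \<le> \<bar>\<epsilon>\<bar> * Y"
proof -
  show 1: "th \<phi> y k \<in> strip" "th \<phi> y (Suc k) \<in> strip" using assms by (auto simp: cfg_def)
  show 2: "th \<phi> y k + of_real \<omega> + (- of_real \<epsilon> * y k) \<in> strip" using 1 by (simp add: th_Suc)
  then show "th \<phi> y k + (- of_real \<epsilon> * y k) \<in> strip" by (simp add: strip_def)
  show "th \<phi> y k + of_real \<omega> \<in> strip" using 1 by simp
  show "norm (- of_real \<epsilon> * y k) \<le> \<bar>\<epsilon>\<bar> * Y" using assms by (auto simp: norm_mult cfg_def intro!: mult_left_mono)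
qed

lemma ra_rb_close:
  assumes t: "adm t" and c: "cfg \<phi> y Y" and k: "k < q"
  shows "norm (ra t \<phi> y k * t (th \<phi> y k) - 1) \<le> 102/100 * (\<bar>\<epsilon>\<bar> * Y)"
    "norm (rb t \<phi> y k * t (th \<phi> y (Suc k)) - 1) \<le> 102/100 * (\<bar>\<epsilon>\<bar> * Y)"
    "ra t \<phi> y k \<noteq> 0" "rb t \<phi> y k \<noteq> 0"
proof -
  note s = cfg_strip[OF c k]
  have *: "norm (R * t w - 1) \<le> 102/100 * (\<bar>\<epsilon>\<bar> * Y)"
    if "norm (R - inverse (t w)) \<le> 101/100 * (\<bar>\<epsilon>\<bar> * Y)" "w \<in> strip" for R w
  proof -
    have "R * t w - 1 = (R - inverse (t w)) * t w" using adm_bounds(4)[OF t that(2)] by (simp add: algebra_simps)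
    also have "norm \<dots> \<le> (101/100 * (\<bar>\<epsilon>\<bar> * Y)) * (1001/1000)"
      by (intro norm_mult_le that adm_bounds(2)[OF t])
    also have "\<dots> \<le> 102/100 * (\<bar>\<epsilon>\<bar> * Y)" using order_trans[OF norm_ge_zero s(6)] by linarith
    finally show ?thesis .
  qed
  have 1: "norm (of_real r * (- of_real \<epsilon> * y k)) \<le> \<bar>\<epsilon>\<bar> * Y" if "r \<in> {-1..1}" for r
  proof -
    have "norm (of_real r * (- of_real \<epsilon> * y k)) = \<bar>r\<bar> * norm (- of_real \<epsilon> * y k)" by (simp only: norm_mult norm_of_real)
    also have "\<dots> \<le> 1 * (\<bar>\<epsilon>\<bar> * Y)" using that s(6) by (intro mult_mono) auto
    finally show ?thesis by simp
  qed
  show "norm (ra t \<phi> y k * t (th \<phi> y k) - 1) \<le> 102/100 * (\<bar>\<epsilon>\<bar> * Y)"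
    unfolding ra_def
  proof (intro *[OF R1_close[OF t s(1) s(2) s(1)] s(1)])
    fix r :: real assume "r \<in> {0..1}"
    then show "norm (th \<phi> y k + of_real r * (- of_real \<epsilon> * y k) - th \<phi> y k) \<le> \<bar>\<epsilon>\<bar> * Y" using 1[of r] by simp
  qed
  show "norm (rb t \<phi> y k * t (th \<phi> y (Suc k)) - 1) \<le> 102/100 * (\<bar>\<epsilon>\<bar> * Y)"
    unfolding rb_def
  proof (intro *[OF R1_close[OF t s(3) s(4) s(5)] s(5)])
    fix r :: real assume r: "r \<in> {0..1}"
    have "th \<phi> y k + of_real \<omega> + of_real r * (- of_real \<epsilon> * y k) - th \<phi> y (Suc k) = of_real (r - 1) * (- of_real \<epsilon> * y k)"
      by (simp add: th_Suc algebra_simps)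
    then show "norm (th \<phi> y k + of_real \<omega> + of_real r * (- of_real \<epsilon> * y k) - th \<phi> y (Suc k)) \<le> \<bar>\<epsilon>\<bar> * Y"
      using 1[of "r - 1"] r by simp
  qed
  show "ra t \<phi> y k \<noteq> 0" "rb t \<phi> y k \<noteq> 0" unfolding ra_def rb_def by (intro R1_bounds(3)[OF t] s)+
qed

text \<open>Each factor \<open>ra\<close> / \<open>rb\<close> equals T (i + 2) / T i up to a
  relative error of at most 3 * |\<epsilon>| * Y, where T i is the value of \<open>t\<close> at site
  i. The main parts telescope, and at most q errors accumulate.\<close>

lemma EE_close:
  assumes t: "adm t" and c: "cfg \<phi> y Y" and k: "k < q" and Y: "\<bar>\<epsilon>\<bar> * Y * real q \<le> 1/1000" "Y \<ge> 0"
  shows "\<exists>\<eta>. EE t \<phi> y k = tau t \<phi> y k / tau t \<phi> y 0 * (1 + \<eta>) \<and> norm \<eta> \<le> 6 * (\<bar>\<epsilon>\<bar> * Y * real q)"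
proof -
  define d where "d = \<bar>\<epsilon>\<bar> * Y"
  have d0: "d \<ge> 0" using Y by (simp add: d_def)
  have "d * 1 \<le> d * real q" using q d0 by (intro mult_left_mono) auto
  then have d1: "d \<le> 1/1000" using Y by (simp add: d_def)
  define x where "x = 3 * d * real q"
  have x: "0 \<le> x" "x \<le> 1" using d0 Y by (auto simp: x_def d_def)
  define T where "T = (\<lambda>i. t (th \<phi> y i))"
  have Tne: "T i \<noteq> 0" if "i \<le> q" for i using adm_bounds(4)[OF t] c that by (auto simp: T_def cfg_def)
  define e where "e = (\<lambda>i. ra t \<phi> y i * T i / (rb t \<phi> y (Suc i) * T (Suc (Suc i))) - 1)"
  have e: "norm (e i) \<le> 3 * d" if "i < k" for i
  proof -
    define \<alpha> where "\<alpha> = ra t \<phi> y i * T i - 1"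
    define \<beta> where "\<beta> = rb t \<phi> y (Suc i) * T (Suc (Suc i)) - 1"
    have ab: "norm \<alpha> \<le> 102/100 * d" "norm \<beta> \<le> 102/100 * d"
      using ra_rb_close[OF t c, of i] ra_rb_close[OF t c, of "Suc i"] that k by (auto simp: \<alpha>_def \<beta>_def T_def d_def)
    have b: "norm (1 + \<beta>) \<ge> 99/100"
    proof -
      have "norm (1::complex) \<le> norm (1 + \<beta>) + norm \<beta>" using norm_triangle_ineq4[of "1 + \<beta>" \<beta>] by simp
      then show ?thesis using ab d1 by simp
    qed
    then have "1 + \<beta> \<noteq> 0" by auto
    then have "e i = (\<alpha> - \<beta>) / (1 + \<beta>)" by (simp add: e_def \<alpha>_def \<beta>_def field_simps)
    also have "norm \<dots> \<le> (102/100 * d + 102/100 * d) / (99/100)"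
      unfolding norm_divide using ab b d0 norm_triangle_ineq4[of \<alpha> \<beta>] by (intro frac_le) auto
    also have "\<dots> \<le> 3 * d" using d0 by simp
    finally show ?thesis .
  qed
  \<comment> \<open>The indices jump by two, so two factors survive at either end; this is how the
    two-point product \<open>tau\<close> arises.\<close>
  have tel: "(\<Prod>i<m. T (Suc (Suc i)) / T i) = T m * T (Suc m) / (T 0 * T 1)" if "m < q" for m
    using that
  proof (induction m)
    case 0 then show ?case using Tne[of 0] Tne[of 1] by simp
  next
    case (Suc m) then show ?case using Tne[of m] by simp
  qed
  have "EE t \<phi> y k = (\<Prod>i<k. (T (Suc (Suc i)) / T i) * (1 + e i))"
    unfolding EE_def
  proof (rule prod.cong)
    fix i assume "i \<in> {..<k}"
    then have i: "i < k" by simp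
    have "T i \<noteq> 0" "T (Suc (Suc i)) \<noteq> 0" "rb t \<phi> y (Suc i) \<noteq> 0"
      using i k Tne ra_rb_close(4)[OF t c, of "Suc i"] by auto
    then show "ra t \<phi> y i / rb t \<phi> y (Suc i) = (T (Suc (Suc i)) / T i) * (1 + e i)"
      by (simp add: e_def field_simps)
  qed simp
  also have "\<dots> = tau t \<phi> y k / tau t \<phi> y 0 * (\<Prod>i<k. 1 + e i)"
    unfolding prod.distrib tel[OF k] by (simp add: tau_def T_def)
  finally have EE: "EE t \<phi> y k = tau t \<phi> y k / tau t \<phi> y 0 * (1 + ((\<Prod>i<k. 1 + e i) - 1))" by simp
  have "norm ((\<Prod>i<k. 1 + e i) - 1) \<le> (\<Prod>i<k. 1 + norm (e i)) - 1" by (rule norm_prod_minus1_le_prod_minus1)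
  also have "(\<Prod>i<k. 1 + norm (e i)) \<le> (\<Prod>i<k. 1 + 3 * d)" by (rule prod_mono) (use e in auto)
  also have "\<dots> \<le> (\<Prod>i<k. exp (3 * d))" by (rule prod_mono) (use d0 in auto)
  also have "\<dots> = exp (3 * d * real k)" by (simp add: exp_of_nat_mult mult.commute)
  also have "\<dots> \<le> exp x" using k d0 by (simp add: x_def mult_left_mono)
  also have "\<dots> \<le> 1 + x + x\<^sup>2" using x by (intro exp_bound) auto
  also have "x\<^sup>2 \<le> x * 1" unfolding power2_eq_square using x by (intro mult_left_mono) auto
  finally have "norm ((\<Prod>i<k. 1 + e i) - 1) \<le> 2 * x" by simp
  then have "norm ((\<Prod>i<k. 1 + e i) - 1) \<le> 6 * (\<bar>\<epsilon>\<bar> * Y * real q)" by (simp add: x_def d_def)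
  then show ?thesis using EE by blast
qed

lemma tau_bounds:
  assumes t: "adm t" and c: "cfg \<phi> y Y" and k: "k < q"
  shows "norm (tau t \<phi> y k - 1) \<le> 21/10000" "tau t \<phi> y k \<noteq> 0" "norm (tau t \<phi> y k) \<le> 10021/10000"
proof -
  have s: "th \<phi> y k \<in> strip" "th \<phi> y (Suc k) \<in> strip" using c k by (auto simp: cfg_def)
  show "tau t \<phi> y k \<noteq> 0" using adm_bounds(4)[OF t] s by (simp add: tau_def)
  have "tau t \<phi> y k - 1 = (t (th \<phi> y k) - 1) * t (th \<phi> y (Suc k)) + (t (th \<phi> y (Suc k)) - 1)"
    by (simp add: tau_def algebra_simps)
  also have "norm \<dots> \<le> (1/1000) * (1001/1000) + 1/1000"
    by (intro order_trans[OF norm_triangle_ineq] add_mono norm_mult_le adm_bounds[OF t] s)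
  finally show 1: "norm (tau t \<phi> y k - 1) \<le> 21/10000" by simp
  then show "norm (tau t \<phi> y k) \<le> 10021/10000" using norm_triangle_sub[of "tau t \<phi> y k" 1] by simp
qed

lemma EE_near_1:
  assumes t: "adm t" and c: "cfg \<phi> y Y" and k: "k < q" and Y: "\<bar>\<epsilon>\<bar> * Y * real q \<le> 1/1000" "Y \<ge> 0"
  shows "norm (EE t \<phi> y k - 1) \<le> 12/1000"
proof -
  obtain \<eta> where e: "EE t \<phi> y k = tau t \<phi> y k / tau t \<phi> y 0 * (1 + \<eta>)" and \<eta>: "norm \<eta> \<le> 6/1000"
    using EE_close[OF assms] Y by force
  note b = tau_bounds[OF t c k] and b0 = tau_bounds[OF t c q]
  have lower: "norm (tau t \<phi> y 0) \<ge> 99/100" using b0(1) norm_triangle_sub[of 1 "tau t \<phi> y 0"] by (simp add: norm_minus_commute)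
  have "EE t \<phi> y k - 1 = ((tau t \<phi> y k - 1) + tau t \<phi> y k * \<eta> - (tau t \<phi> y 0 - 1)) / tau t \<phi> y 0"
    using b0(2) by (simp add: e field_simps)
  also have "norm \<dots> \<le> (21/10000 + (10021/10000) * (6/1000) + 21/10000) / (99/100)"
    unfolding norm_divide
  proof (rule frac_le[OF _ _ _ lower])
    have "norm ((tau t \<phi> y k - 1) + tau t \<phi> y k * \<eta>) \<le> 21/10000 + (10021/10000) * (6/1000)"
      by (intro order_trans[OF norm_triangle_ineq] add_mono norm_mult_le b \<eta>)
    then show "norm (tau t \<phi> y k - 1 + tau t \<phi> y k * \<eta> - (tau t \<phi> y 0 - 1)) \<le> 21/10000 + (10021/10000) * (6/1000) + 21/10000"
      using b0(1) norm_triangle_ineq4[of "(tau t \<phi> y k - 1) + tau t \<phi> y k * \<eta>" "tau t \<phi> y 0 - 1"] by linarith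
  qed auto
  finally show ?thesis by simp
qed

lemma PS_near_1:
  assumes t: "adm t" and c: "cfg \<phi> y Y" and k: "k < q" and Y: "\<bar>\<epsilon>\<bar> * Y * real q \<le> 1/1000" "Y \<ge> 0"
  shows "norm (PS t \<phi> y k - 1) \<le> 1/32" "(\<Sum>l<q. EE t \<phi> y l) \<noteq> 0"
proof -
  have E: "norm (EE t \<phi> y l - 1) \<le> 12/1000" if "l < q" for l by (rule EE_near_1[OF t c that Y])
  show "norm (PS t \<phi> y k - 1) \<le> 1/32"
    unfolding PS_def using norm_quotient_mean_bound(2)[where E="EE t \<phi> y" and \<delta>="12/1000", OF q E _ k] by simp
  show "(\<Sum>l<q. EE t \<phi> y l) \<noteq> 0" using norm_quotient_mean_bound(1)[where E="EE t \<phi> y" and \<delta>="12/1000", OF q E _ k] by simp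
qed

text \<open>The imaginary part drifts by at most |\<epsilon>| * q along the orbit, which fits into
  the margin between 1/17 and the half-width 1/16.\<close>

lemma cfgI:
  assumes \<phi>: "\<bar>Im \<phi>\<bar> \<le> 1/17" and y: "\<And>k. k < q \<Longrightarrow> norm (y k - 1) \<le> 1/2"
  shows "cfg \<phi> y (3/2)"
  unfolding cfg_def
proof (intro conjI allI impI)
  fix k assume k: "k \<le> q"
  have "\<bar>\<Sum>i<k. Im (y i)\<bar> \<le> (\<Sum>i<k. 1/2)"
  proof (rule order_trans[OF sum_abs sum_mono])
    fix i assume "i \<in> {..<k}"
    then have "norm (y i - 1) \<le> 1/2" using y k by auto
    then show "\<bar>Im (y i)\<bar> \<le> 1/2" using abs_Im_le_cmod[of "y i - 1"] by simp
  qed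
  then have "\<bar>\<epsilon>\<bar> * \<bar>\<Sum>i<k. Im (y i)\<bar> \<le> \<bar>\<epsilon>\<bar> * real q"
    using k by (intro mult_left_mono) auto
  then have "\<bar>\<epsilon> * (\<Sum>i<k. Im (y i))\<bar> \<le> 1/1000" using eps_q by (simp add: abs_mult)
  moreover have "Im (th \<phi> y k) = Im \<phi> - \<epsilon> * (\<Sum>i<k. Im (y i))" by (simp add: th_def)
  ultimately show "th \<phi> y k \<in> strip" unfolding strip_def mem_Collect_eq using \<phi> by linarith
next
  fix k assume "k < q"
  then show "norm (y k) \<le> 3/2" using y[of k] norm_triangle_sub[of "y k" 1] by simp
qed

lemma PS_cong:
  assumes "\<And>i. i < q \<Longrightarrow> y i = y' i" "k < q"
  shows "PS t \<phi> y k = PS t \<phi> y' k"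
proof -
  have th: "th \<phi> y l = th \<phi> y' l" if "l \<le> q" for l
    unfolding th_def using assms(1) that by (intro arg_cong2[where f=minus] arg_cong2[where f=times] sum.cong) auto
  have E: "EE t \<phi> y l = EE t \<phi> y' l" if "l < q" for l
    unfolding EE_def ra_def rb_def using that assms(1) th by (intro prod.cong) auto
  have "(\<Sum>l<q. EE t \<phi> y l) = (\<Sum>l<q. EE t \<phi> y' l)" using E by simp
  then show ?thesis unfolding PS_def using E[OF assms(2)] by simp
qed

definition yy :: "(nat \<Rightarrow> complex) \<Rightarrow> nat \<Rightarrow> complex" where "yy v k = 1 + v k / 2"

text \<open>\<open>PS\<close> transported from the polydisc |y k - 1| \<le> 1/2 to the unit
  polydisc. The bound 1/32 for \<open>PS\<close> becomes the required 1/16. Components from q on are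
  set to 0 because fixed points are formed over all of nat.\<close>

definition PV :: "(complex \<Rightarrow> complex) \<Rightarrow> complex \<Rightarrow> (nat \<Rightarrow> complex) \<Rightarrow> nat \<Rightarrow> complex" where
  "PV t \<phi> v k = (if k < q then 2 * (PS t \<phi> (yy v) k - 1) else 0)"

definition ysol :: "(complex \<Rightarrow> complex) \<Rightarrow> complex \<Rightarrow> nat \<Rightarrow> complex" where
  "ysol t \<phi> = yy (fixpoint (PV t \<phi>))"

lemma Y32: "\<bar>\<epsilon>\<bar> * (3/2) * real q \<le> 1/1000" using eps_q by simp

lemma th_holomorphic:
  assumes "\<phi> holomorphic_on D" "\<And>i. (\<lambda>z. y z i) holomorphic_on D"
  shows "(\<lambda>z. th (\<phi> z) (y z) k) holomorphic_on D"
  unfolding th_def by (intro holomorphic_intros assms)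

lemma PS_holomorphic:
  assumes H: "holfam D tt" and \<phi>: "\<phi> holomorphic_on D" "\<And>z. z \<in> D \<Longrightarrow> \<bar>Im (\<phi> z)\<bar> \<le> 1/17"
    and y: "\<And>i. (\<lambda>z. y z i) holomorphic_on D" "\<And>z i. z \<in> D \<Longrightarrow> norm (y z i - 1) \<le> 1/2" and k: "k < q"
  shows "(\<lambda>z. PS (tt z) (\<phi> z) (y z) k) holomorphic_on D"
proof -
  have c: "cfg (\<phi> z) (y z) (3/2)" if "z \<in> D" for z by (rule cfgI) (use \<phi> y that in auto)
  note s = cfg_strip[OF c]
  have E: "(\<lambda>z. EE (tt z) (\<phi> z) (y z) l) holomorphic_on D" if l: "l < q" for l
    unfolding EE_def
  proof (intro holomorphic_on_prod holomorphic_on_divide)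
    fix i assume i: "i \<in> {..<l}"
    show "(\<lambda>z. ra (tt z) (\<phi> z) (y z) i) holomorphic_on D"
      unfolding ra_def
      by (rule R1_holomorphic[OF H th_holomorphic[OF \<phi>(1) y(1)], where B="\<bar>\<epsilon>\<bar> * (3/2)"])
         (use s i l in \<open>auto intro!: holomorphic_intros y(1)\<close>)
    show "(\<lambda>z. rb (tt z) (\<phi> z) (y z) (Suc i)) holomorphic_on D"
      unfolding rb_def
      by (rule R1_holomorphic[OF H, where B="\<bar>\<epsilon>\<bar> * (3/2)"])
         (use s[of _ "Suc i"] i l in \<open>auto intro!: holomorphic_intros y(1) th_holomorphic \<phi>(1)\<close>)
    show "rb (tt z) (\<phi> z) (y z) (Suc i) \<noteq> 0" if "z \<in> D" for z
      using ra_rb_close(4)[OF holfam_adm[OF H that] c[OF that]] i l by auto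
  qed
  show ?thesis
    unfolding PS_def
  proof (intro holomorphic_on_divide holomorphic_on_mult holomorphic_on_const holomorphic_on_sum E k)
    show "(\<Sum>l<q. EE (tt z) (\<phi> z) (y z) l) \<noteq> 0" if "z \<in> D" for z
      by (rule PS_near_1(2)[OF holfam_adm[OF H that] c[OF that] k Y32]) simp
  qed auto
qed

lemma PV_holomorphic:
  assumes H: "holfam D tt" and \<phi>: "\<phi> holomorphic_on D" "\<And>z. z \<in> D \<Longrightarrow> \<bar>Im (\<phi> z)\<bar> \<le> 1/17"
    and v: "\<And>i. (\<lambda>z. v z i) holomorphic_on D" "\<And>z i. z \<in> D \<Longrightarrow> norm (v z i) \<le> 1"
  shows "(\<lambda>z. PV (tt z) (\<phi> z) (v z) k) holomorphic_on D"
proof (cases "k < q")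
  case True
  have "(\<lambda>z. PS (tt z) (\<phi> z) (yy (v z)) k) holomorphic_on D"
    by (rule PS_holomorphic[OF H \<phi> _ _ True])
       (use v in \<open>auto simp: yy_def norm_divide intro!: holomorphic_intros\<close>)
  then show ?thesis using True by (simp add: PV_def) (intro holomorphic_intros)
qed (simp add: PV_def)

lemma PV_contraction:
  assumes t: "adm t" and \<phi>: "\<bar>Im \<phi>\<bar> \<le> 1/17"
  shows "ball_contraction (PV t \<phi>)"
  unfolding ball_contraction_def
proof (intro conjI allI impI)
  fix u :: "nat \<Rightarrow> complex" and i assume u: "\<forall>i. norm (u i) \<le> 1"
  show "norm (PV t \<phi> u i) \<le> 1/16"
  proof (cases "i < q")
    case True
    have "cfg \<phi> (yy u) (3/2)" by (rule cfgI[OF \<phi>]) (use u in \<open>auto simp: yy_def norm_divide\<close>)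
    then have "norm (PS t \<phi> (yy u) i - 1) \<le> 1/32" using PS_near_1(1)[OF t _ True Y32] by simp
    moreover have "norm (2 * (PS t \<phi> (yy u) i - 1)) = 2 * norm (PS t \<phi> (yy u) i - 1)" by (simp only: norm_mult) simp
    ultimately show ?thesis unfolding PV_def using True by (simp only: if_True)
  qed (simp add: PV_def)
next
  fix D and u :: "complex \<Rightarrow> nat \<Rightarrow> complex" and i
  assume "open D" "\<forall>i. (\<lambda>z. u z i) holomorphic_on D" "\<forall>z\<in>D. \<forall>i. norm (u z i) \<le> 1"
  then show "(\<lambda>z. PV t \<phi> (u z) i) holomorphic_on D"
    by (intro PV_holomorphic holfam_const[OF t]) (use \<phi> in auto)
qed

lemma ysol_bound:
  assumes t: "adm t" and \<phi>: "\<bar>Im \<phi>\<bar> \<le> 1/17"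
  shows "norm (ysol t \<phi> k - 1) \<le> 1/32" "cfg \<phi> (ysol t \<phi>) (3/2)"
proof -
  show 1: "norm (ysol t \<phi> k - 1) \<le> 1/32" for k
    using fixpoint_bound[OF PV_contraction[OF assms], of k] by (simp add: ysol_def yy_def norm_divide)
  have "norm (ysol t \<phi> k - 1) \<le> 1/2" for k using 1[of k] by simp
  then show "cfg \<phi> (ysol t \<phi>) (3/2)" by (intro cfgI[OF \<phi>])
qed

lemma ysol_PS:
  assumes t: "adm t" and \<phi>: "\<bar>Im \<phi>\<bar> \<le> 1/17" and k: "k < q"
  shows "PS t \<phi> (ysol t \<phi>) k = ysol t \<phi> k"
proof -
  have "PV t \<phi> (fixpoint (PV t \<phi>)) k = fixpoint (PV t \<phi>) k" by (simp add: fixpoint_eq[OF PV_contraction[OF t \<phi>]])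
  then have "2 * (PS t \<phi> (ysol t \<phi>) k - 1) = fixpoint (PV t \<phi>) k" using k by (simp only: PV_def ysol_def if_True)
  then have "fixpoint (PV t \<phi>) k / 2 = PS t \<phi> (ysol t \<phi>) k - 1" by (metis nonzero_mult_div_cancel_left zero_neq_numeral)
  then have "1 + fixpoint (PV t \<phi>) k / 2 = PS t \<phi> (ysol t \<phi>) k" by (metis add.commute diff_add_cancel)
  then show ?thesis by (simp only: ysol_def yy_def)
qed

text \<open>Reality, time-reversal symmetry and the identification of genuine orbits all rest on
  this: each of them only has to exhibit another fixed point near 1.\<close>

lemma ysol_unique:
  assumes t: "adm t" and \<phi>: "\<bar>Im \<phi>\<bar> \<le> 1/17"
    and y: "\<And>k. k < q \<Longrightarrow> norm (y k - 1) \<le> 1/2" "\<And>k. k < q \<Longrightarrow> PS t \<phi> y k = y k" and k: "k < q"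
  shows "y k = ysol t \<phi> k"
proof -
  define v where "v = (\<lambda>k. if k < q then 2 * (y k - 1) else 0)"
  have eq: "yy v i = y i" if "i < q" for i using that by (simp add: yy_def v_def field_simps)
  have "v = fixpoint (PV t \<phi>)"
  proof (rule fixpoint_unique[OF PV_contraction[OF t \<phi>]])
    show "norm (v i) \<le> 1" for i
    proof (cases "i < q")
      case True
      have "norm (2 * (y i - 1)) = 2 * norm (y i - 1)" by (simp only: norm_mult) simp
      then show ?thesis using y(1)[OF True] True by (simp only: v_def if_True)
    qed (simp add: v_def)
    show "PV t \<phi> v = v"
    proof
      fix i show "PV t \<phi> v i = v i"
      proof (cases "i < q")
        case True
        have "PS t \<phi> (yy v) i = PS t \<phi> y i" by (rule PS_cong) (use eq True in auto)
        then show ?thesis using True y(2)[OF True] by (simp add: PV_def v_def)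
      qed (simp add: PV_def v_def)
    qed
  qed
  then show ?thesis using eq[OF k] by (simp add: ysol_def)
qed

lemma ysol_holomorphic:
  assumes H: "holfam D tt" and \<phi>: "\<phi> holomorphic_on D" "\<And>z. z \<in> D \<Longrightarrow> \<bar>Im (\<phi> z)\<bar> \<le> 1/17"
  shows "(\<lambda>z. ysol (tt z) (\<phi> z) k) holomorphic_on D"
proof -
  have "(\<lambda>z. fixpoint (PV (tt z) (\<phi> z)) k) holomorphic_on D"
    by (rule fixpoint_holomorphic[OF holfam_open[OF H]])
       (use PV_contraction holfam_adm[OF H] PV_holomorphic[OF H \<phi>] \<phi> in auto)
  then show ?thesis unfolding ysol_def yy_def by (intro holomorphic_intros) auto
qed

text \<open>The recursion forces y k = y 0 * \<open>EE\<close> k, and the sum condition determines y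
  0. No closeness of \<open>y\<close> to 1 is assumed, so the equivalence also applies to orbits
  with only a crude bound.\<close>

lemma PS_fixed_iff:
  assumes t: "adm t" and c: "cfg \<phi> y Y" and Y: "\<bar>\<epsilon>\<bar> * Y * real q \<le> 1/1000" "Y \<ge> 0"
  shows "(\<forall>k<q. PS t \<phi> y k = y k) \<longleftrightarrow>
     (\<Sum>k<q. y k) = of_nat q \<and> (\<forall>k. Suc k < q \<longrightarrow> y (Suc k) * rb t \<phi> y (Suc k) = y k * ra t \<phi> y k)"
proof -
  note ne = PS_near_1(2)[OF t c q Y]
  show ?thesis
  proof
    assume f: "\<forall>k<q. PS t \<phi> y k = y k"
    have "(\<Sum>k<q. y k) = (\<Sum>k<q. PS t \<phi> y k)" using f by simp
    also have "\<dots> = of_nat q"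
      unfolding PS_def using ne by (simp flip: sum_divide_distrib sum_distrib_left)
    finally have 1: "(\<Sum>k<q. y k) = of_nat q" .
    have "y (Suc k) * rb t \<phi> y (Suc k) = y k * ra t \<phi> y k" if k: "Suc k < q" for k
    proof -
      have "y (Suc k) = PS t \<phi> y (Suc k)" "y k = PS t \<phi> y k" using f k by auto
      then have a: "y (Suc k) = of_nat q * EE t \<phi> y (Suc k) / (\<Sum>l<q. EE t \<phi> y l)"
        and b: "y k = of_nat q * EE t \<phi> y k / (\<Sum>l<q. EE t \<phi> y l)" by (auto simp only: PS_def)
      have "EE t \<phi> y (Suc k) * rb t \<phi> y (Suc k) = EE t \<phi> y k * ra t \<phi> y k"
        using ra_rb_close(4)[OF t c k] by (simp add: EE_def)
      then show ?thesis by (subst a, subst b) (simp add: field_simps)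
    qed
    with 1 show "(\<Sum>k<q. y k) = of_nat q \<and> (\<forall>k. Suc k < q \<longrightarrow> y (Suc k) * rb t \<phi> y (Suc k) = y k * ra t \<phi> y k)" by blast
  next
    assume f: "(\<Sum>k<q. y k) = of_nat q \<and> (\<forall>k. Suc k < q \<longrightarrow> y (Suc k) * rb t \<phi> y (Suc k) = y k * ra t \<phi> y k)"
    have yE: "y k = y 0 * EE t \<phi> y k" if "k < q" for k
      using that
    proof (induction k)
      case 0 then show ?case by (simp add: EE_def)
    next
      case (Suc k)
      have "y (Suc k) * rb t \<phi> y (Suc k) = y 0 * EE t \<phi> y k * ra t \<phi> y k" using f Suc by auto
      then show ?case using ra_rb_close(4)[OF t c Suc.prems] by (simp add: EE_def field_simps)
    qed
    have "(\<Sum>k<q. y k) = (\<Sum>k<q. y 0 * EE t \<phi> y k)" by (rule sum.cong[OF refl], rule yE) simp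
    then have S: "y 0 * (\<Sum>k<q. EE t \<phi> y k) = of_nat q"
      using conjunct1[OF f] by (simp only: sum_distrib_left)
    then have "PS t \<phi> y k = y 0 * EE t \<phi> y k" for k
      using ne unfolding PS_def S[symmetric] by simp
    then show "\<forall>k<q. PS t \<phi> y k = y k" by (simp add: yE[symmetric])
  qed
qed

end

section \<open>The reciprocal of the action excess and its leading term\<close>

lemma norm_ratio_square_bound:
  fixes z w P :: complex
  assumes P: "norm (P - 1) \<le> 21/10000" and z: "norm (z - P) \<le> 101/100 * H" and w: "norm (w - P) \<le> 32/10 * H"
    and H: "0 \<le> H" "H \<le> 1/10000"
  shows "w \<noteq> 0" "norm (z^2 / w - P) \<le> 6 * H"
proof -
  have Pb: "norm P \<le> 10021/10000" "norm P \<ge> 9979/10000"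
    using P norm_triangle_sub[of P 1] norm_triangle_sub[of 1 P] by (auto simp: norm_minus_commute)
  have wb: "norm w \<ge> 99/100"
    using Pb w H norm_triangle_sub[of P w] by (simp add: norm_minus_commute)
  then show ne: "w \<noteq> 0" by auto
  have "z + P = (z - P) + 2 * P" by simp
  then have "norm (z + P) \<le> norm (z - P) + norm (2 * P)" by (metis norm_triangle_ineq)
  also have "\<dots> = norm (z - P) + 2 * norm P" by (simp only: norm_mult) simp
  finally have zP: "norm (z + P) \<le> 201/100" using z H Pb by linarith
  have wP: "norm (P - w) \<le> 32/10 * H" using w by (simp add: norm_minus_commute)
  have "z^2 / w - P = ((z - P) * (z + P) + P * (P - w)) / w"
    using ne by (simp add: field_simps power2_eq_square)
  also have "norm \<dots> \<le> ((101/100 * H) * (201/100) + (10021/10000) * (32/10 * H)) / (99/100)"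
    unfolding norm_divide
  proof (rule frac_le[OF _ _ _ wb])
    show "norm ((z - P) * (z + P) + P * (P - w)) \<le> (101/100 * H) * (201/100) + (10021/10000) * (32/10 * H)"
      by (intro order_trans[OF norm_triangle_ineq] add_mono norm_mult_le z zP Pb wP)
  qed (use H in auto)
  also have "\<dots> \<le> 6 * H" using H by simp
  finally show "norm (z^2 / w - P) \<le> 6 * H" .
qed

context near_rational
begin

definition Msum :: "(complex \<Rightarrow> complex) \<Rightarrow> complex \<Rightarrow> (nat \<Rightarrow> complex) \<Rightarrow> complex" where
  "Msum t \<phi> y = (\<Sum>k<q. (y k)\<^sup>2 * LL t \<omega> (th \<phi> y k) (- of_real \<epsilon> * y k))"

text \<open>The action excess of the orbit through \<open>\<phi>\<close> is \<open>q * \<epsilon>\<^sup>2 / (2 * Mw t \<phi>)\<close>: the reciprocal is nearly a trigonometric polynomial in the coefficients of \<open>t\<close>.\<close>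

definition Mw :: "(complex \<Rightarrow> complex) \<Rightarrow> complex \<Rightarrow> complex" where
  "Mw t \<phi> = of_nat q / (2 * Msum t \<phi> (ysol t \<phi>))"

text \<open>The mean of \<open>tau\<close> along the rigid rotation by p / q instead of the true
  orbit; on this grid averages of harmonics are sums of roots of unity.\<close>

definition XX :: "(complex \<Rightarrow> complex) \<Rightarrow> complex \<Rightarrow> complex" where
  "XX t \<phi> = (\<Sum>k<q. t (\<phi> + of_real (real k * of_int p / real q)) * t (\<phi> + of_real (real k * of_int p / real q) + of_real \<omega>)) / of_nat q"

text \<open>With y k close to q * tau k / (sum of tau) and \<open>LL\<close> close to 1 / (2 * tau
  k), twice \<open>Msum\<close> is close to q^2 / (sum of tau), so \<open>Mw\<close> is close to the
  mean of \<open>tau\<close>. In exact form this is a quotient z^2 / w with z and w both near that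
  mean.\<close>

lemma Mw_close:
  assumes t: "adm t" and \<phi>: "\<bar>Im \<phi>\<bar> \<le> 1/17"
  shows "norm (Mw t \<phi> - XX t \<phi>) \<le> 100 * (\<bar>\<epsilon>\<bar> * real q)" "Msum t \<phi> (ysol t \<phi>) \<noteq> 0"
proof -
  define y where "y = ysol t \<phi>"
  have c: "cfg \<phi> y (3/2)" unfolding y_def by (rule ysol_bound(2)[OF t \<phi>])
  define T where "T = tau t \<phi> y"
  \<comment> \<open>The factor 10 exceeds both 6 * 3/2 = 9 from \<open>EE_close\<close> and the
    constant just above 9 that \<open>LL_close\<close> produces for the error
    \<open>\<mu>\<close>.\<close>
  define H where "H = 10 * (\<bar>\<epsilon>\<bar> * real q)"
  have eq: "\<bar>\<epsilon>\<bar> \<le> \<bar>\<epsilon>\<bar> * real q" using q by (simp add: mult_le_cancel_left1)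
  have H0: "0 \<le> H" by (simp add: H_def)
  have H1: "H \<le> 1/10000" using eps_q by (simp add: H_def)
  have T1: "norm (T k - 1) \<le> 21/10000" "T k \<noteq> 0" "norm (T k) \<le> 10021/10000" if "k < q" for k
    unfolding T_def using tau_bounds[OF t c that] by auto
  have "\<forall>k\<in>{..<q}. \<exists>\<eta>. EE t \<phi> y k = T k / T 0 * (1 + \<eta>) \<and> norm \<eta> \<le> 6 * (\<bar>\<epsilon>\<bar> * (3/2) * real q)"
    unfolding T_def using EE_close[OF t c _ Y32] by auto
  from bchoice[OF this] obtain \<eta> where
    \<eta>: "\<And>k. k < q \<Longrightarrow> EE t \<phi> y k = T k / T 0 * (1 + \<eta> k)" "\<And>k. k < q \<Longrightarrow> norm (\<eta> k) \<le> 6 * (\<bar>\<epsilon>\<bar> * (3/2) * real q)"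
    by auto
  have \<eta>H: "norm (\<eta> k) \<le> H" if "k < q" for k
  proof -
    have "norm (\<eta> k) \<le> 9 * (\<bar>\<epsilon>\<bar> * real q)" using \<eta>(2)[OF that] by simp
    moreover have "0 \<le> \<bar>\<epsilon>\<bar> * real q" by simp
    ultimately show ?thesis unfolding H_def by linarith
  qed
  define L where "L = (\<lambda>k. LL t \<omega> (th \<phi> y k) (- of_real \<epsilon> * y k))"
  define \<mu> where "\<mu> = (\<lambda>k. 2 * (T k * L k) - 1)"
  have \<mu>: "norm (\<mu> k) \<le> H" if k: "k < q" for k
  proof -
    note s = cfg_strip[OF c k]
    have TL: "T k = t (th \<phi> y k) * t (th \<phi> y k + of_real \<omega> + (- of_real \<epsilon> * y k))" by (simp add: T_def tau_def th_Suc)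
    have "norm (L k - inverse (T k) / 2) \<le> 3 * norm (- of_real \<epsilon> * y k)"
      unfolding L_def TL by (rule LL_close[OF t s(1) s(2)])
    then have 1: "norm (L k - inverse (T k) / 2) \<le> 3 * (\<bar>\<epsilon>\<bar> * (3/2))" using s(6) by linarith
    have "\<mu> k = (2 * T k) * (L k - inverse (T k) / 2)" using T1(2)[OF k] by (simp add: \<mu>_def algebra_simps)
    also have "norm \<dots> \<le> (2 * (10021/10000)) * (3 * (\<bar>\<epsilon>\<bar> * (3/2)))"
      using T1(3)[OF k] by (intro norm_mult_le 1) (auto simp: norm_mult)
    also have "\<dots> \<le> H" unfolding H_def using eq by simp
    finally show ?thesis .
  qed
  define Z where "Z = (\<Sum>k<q. T k * (1 + \<eta> k))"
  define W where "W = (\<Sum>k<q. T k * ((1 + \<eta> k)^2 * (1 + \<mu> k)))"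
  define P where "P = (\<Sum>k<q. T k) / of_nat q"
  have qc: "(of_nat q :: complex) \<noteq> 0" using q by simp
  have mean: "norm ((\<Sum>k<q. f k) / of_nat q) \<le> B" if "\<And>k. k < q \<Longrightarrow> norm (f k) \<le> B" for f :: "nat \<Rightarrow> complex" and B
  proof -
    have "norm (\<Sum>k<q. f k) \<le> (\<Sum>k<q. B)" by (rule sum_norm_le) (use that in auto)
    then show ?thesis using q by (simp add: norm_divide divide_le_eq mult.commute)
  qed
  have P1: "norm (P - 1) \<le> 21/10000"
  proof -
    have "P - 1 = (\<Sum>k<q. T k - 1) / of_nat q" using qc by (simp add: P_def sum_subtractf field_simps)
    then show ?thesis using mean[OF T1(1)] by simp
  qed
  have z: "norm (Z / of_nat q - P) \<le> 101/100 * H"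
  proof -
    have "Z / of_nat q - P = (\<Sum>k<q. T k * \<eta> k) / of_nat q"
      by (simp add: Z_def P_def diff_divide_distrib[symmetric] sum_subtractf[symmetric] algebra_simps)
    also have "norm \<dots> \<le> (10021/10000) * H"
      by (rule mean) (intro norm_mult_le T1(3) \<eta>H)
    finally show ?thesis using H0 by simp
  qed
  have w: "norm (W / of_nat q - P) \<le> 32/10 * H"
  proof -
    have "W / of_nat q - P = (\<Sum>k<q. T k * (\<eta> k * ((2 + \<eta> k) * (1 + \<mu> k)) + \<mu> k)) / of_nat q"
      by (simp add: W_def P_def diff_divide_distrib[symmetric] sum_subtractf[symmetric] algebra_simps power2_eq_square)
    also have "norm \<dots> \<le> (10021/10000) * (H * ((2 + 1/10000) * (1 + 1/10000)) + H)"
    proof (rule mean)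
      fix k assume k: "k < q"
      have a: "norm (2 + \<eta> k) \<le> 2 + 1/10000" using norm_triangle_ineq[of 2 "\<eta> k"] \<eta>H[OF k] H1 by simp
      have b: "norm (1 + \<mu> k) \<le> 1 + 1/10000" using norm_triangle_ineq[of 1 "\<mu> k"] \<mu>[OF k] H1 by simp
      show "norm (T k * (\<eta> k * ((2 + \<eta> k) * (1 + \<mu> k)) + \<mu> k)) \<le> (10021/10000) * (H * ((2 + 1/10000) * (1 + 1/10000)) + H)"
        by (intro norm_mult_le order_trans[OF norm_triangle_ineq] add_mono a b T1(3)[OF k] \<eta>H[OF k] \<mu>[OF k])
    qed
    also have "\<dots> \<le> 32/10 * H" using H0 by simp
    finally show ?thesis .
  qed
  note ratio = norm_ratio_square_bound[OF P1 z w H0 H1]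
  have SE: "(\<Sum>l<q. EE t \<phi> y l) = Z / T 0"
    by (simp add: Z_def sum_divide_distrib \<eta>(1))
  have SE0: "(\<Sum>l<q. EE t \<phi> y l) \<noteq> 0" by (rule PS_near_1(2)[OF t c q Y32]) simp
  then have Z0: "Z \<noteq> 0" using SE by auto
  have T0: "T 0 \<noteq> 0" using T1(2) q by simp
  have yk: "y k = of_nat q * (T k * (1 + \<eta> k)) / Z" if k: "k < q" for k
  proof -
    have "y k = PS t \<phi> y k" unfolding y_def by (simp add: ysol_PS[OF t \<phi> k])
    then show ?thesis using T0 Z0 by (simp add: PS_def SE \<eta>(1)[OF k])
  qed
  have M: "2 * Msum t \<phi> y = (of_nat q)^2 * W / Z^2"
  proof -
    have "2 * Msum t \<phi> y = (\<Sum>k<q. (of_nat q)^2 / Z^2 * (T k * ((1 + \<eta> k)^2 * (1 + \<mu> k))))"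
      unfolding Msum_def sum_distrib_left
    proof (rule sum.cong)
      fix k assume "k \<in> {..<q}"
      then have k: "k < q" by simp
      have 1: "2 * ((y k)\<^sup>2 * LL t \<omega> (th \<phi> y k) (- of_real \<epsilon> * y k)) = (y k)^2 * (2 * L k)" by (simp add: L_def)
      have 2: "(y k)^2 = (of_nat q)^2 / Z^2 * ((T k)^2 * (1 + \<eta> k)^2)" unfolding yk[OF k] by (simp add: power_divide power_mult_distrib)
      have 3: "2 * L k = (1 + \<mu> k) / T k" using T1(2)[OF k] by (simp add: \<mu>_def)
      have 4: "(of_nat q)^2 / Z^2 * ((T k)^2 * (1 + \<eta> k)^2) * ((1 + \<mu> k) / T k) = (of_nat q)^2 / Z^2 * (T k * ((1 + \<eta> k)^2 * (1 + \<mu> k)))"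
        using T1(2)[OF k] by (simp add: power2_eq_square)
      show "2 * ((y k)\<^sup>2 * LL t \<omega> (th \<phi> y k) (- of_real \<epsilon> * y k)) = (of_nat q)^2 / Z^2 * (T k * ((1 + \<eta> k)^2 * (1 + \<mu> k)))"
        unfolding 1 unfolding 2 3 by (rule 4)
    qed simp
    then show ?thesis unfolding sum_distrib_left[symmetric] W_def by simp
  qed
  show "Msum t \<phi> (ysol t \<phi>) \<noteq> 0" using M ratio(1) Z0 qc by (auto simp flip: y_def)
  have "Mw t \<phi> = of_nat q / ((of_nat q)^2 * W / Z^2)" unfolding Mw_def y_def[symmetric] M ..
  also have "\<dots> = (Z / of_nat q)^2 / (W / of_nat q)" using qc Z0 by (simp add: power2_eq_square)
  finally have 1: "norm (Mw t \<phi> - P) \<le> 60 * (\<bar>\<epsilon>\<bar> * real q)" using ratio(2) by (simp add: H_def)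
  have "P - XX t \<phi> = (\<Sum>k<q. T k - t (\<phi> + of_real (real k * of_int p / real q)) * t (\<phi> + of_real (real k * of_int p / real q) + of_real \<omega>)) / of_nat q"
    by (simp add: P_def XX_def diff_divide_distrib sum_subtractf)
  also have "norm \<dots> \<le> 3 * (\<bar>\<epsilon>\<bar> * real q)"
  proof (rule mean)
    fix k assume k: "k < q"
    note s = cfg_strip[OF c k]
    define r where "r = \<phi> + of_real (real k * of_int p / real q)"
    have r: "r \<in> strip" "r + of_real \<omega> \<in> strip" using \<phi> by (auto simp: r_def strip_def)
    have "real k * \<omega> = real k * of_int p / real q + real k * \<epsilon>" by (simp add: om distrib_left)
    then have "of_real (real k * \<omega>) = (of_real (real k * of_int p / real q) + of_nat k * of_real \<epsilon> :: complex)"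
      by (metis of_real_add of_real_mult of_real_of_nat_eq)
    \<comment> \<open>The accumulated drift k * \<epsilon> of \<omega> against p / q is compensated
      by the mean value 1 of \<open>y\<close>; only the deviations 1 - y i remain, and they are at
      most 1/32.\<close>
    then have th: "th \<phi> y k - r = of_real \<epsilon> * (\<Sum>i<k. 1 - y i)"
      by (simp only: th_def r_def sum_subtractf) (simp add: algebra_simps)
    have "norm (\<Sum>i<k. 1 - y i) \<le> (\<Sum>i<k. 1/32)"
      by (rule sum_norm_le) (use ysol_bound(1)[OF t \<phi>] in \<open>auto simp: y_def norm_minus_commute\<close>)
    also have "\<dots> \<le> 1/32 * real q" using k by simp
    finally have "norm (th \<phi> y k - r) \<le> \<bar>\<epsilon>\<bar> * (1/32 * real q)"
      unfolding th norm_mult norm_of_real by (intro mult_left_mono) auto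
    then have d1: "norm (th \<phi> y k - r) \<le> 1/32 * (\<bar>\<epsilon>\<bar> * real q)" by simp
    have "norm (th \<phi> y (Suc k) - (r + of_real \<omega>)) \<le> norm (th \<phi> y k - r) + norm (- of_real \<epsilon> * y k)"
      using norm_triangle_ineq[of "th \<phi> y k - r" "- of_real \<epsilon> * y k"] by (simp add: th_Suc algebra_simps)
    then have d2: "norm (th \<phi> y (Suc k) - (r + of_real \<omega>)) \<le> 17/10 * (\<bar>\<epsilon>\<bar> * real q)"
      using d1 s(6) eq by linarith
    have "T k - t r * t (r + of_real \<omega>) = (t (th \<phi> y k) - t r) * t (th \<phi> y (Suc k)) + t r * (t (th \<phi> y (Suc k)) - t (r + of_real \<omega>))"
      by (simp add: T_def tau_def algebra_simps)
    also have "norm \<dots> \<le> (1/32 * (\<bar>\<epsilon>\<bar> * real q)) * (1001/1000) + (1001/1000) * (17/10 * (\<bar>\<epsilon>\<bar> * real q))"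
      by (intro order_trans[OF norm_triangle_ineq] add_mono norm_mult_le adm_bounds(2)[OF t] s(5) r(1)
          order_trans[OF adm_lipschitz[OF t s(1) r(1)] d1] order_trans[OF adm_lipschitz[OF t s(5) r(2)] d2])
    also have "\<dots> \<le> 3 * (\<bar>\<epsilon>\<bar> * real q)" by simp
    finally show "norm (T k - t (\<phi> + of_real (real k * of_int p / real q)) * t (\<phi> + of_real (real k * of_int p / real q) + of_real \<omega>)) \<le> 3 * (\<bar>\<epsilon>\<bar> * real q)"
      by (simp add: r_def)
  qed
  finally have 2: "norm (P - XX t \<phi>) \<le> 3 * (\<bar>\<epsilon>\<bar> * real q)" .
  have "norm (Mw t \<phi> - XX t \<phi>) \<le> norm (Mw t \<phi> - P) + norm (P - XX t \<phi>)"
    using norm_triangle_ineq[of "Mw t \<phi> - P" "P - XX t \<phi>"] by simp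
  moreover have "0 \<le> \<bar>\<epsilon>\<bar> * real q" by simp
  ultimately show "norm (Mw t \<phi> - XX t \<phi>) \<le> 100 * (\<bar>\<epsilon>\<bar> * real q)" using 1 2 by linarith
qed

lemma Mw_holomorphic:
  assumes H: "holfam D tt" and \<phi>: "\<phi> holomorphic_on D" "\<And>z. z \<in> D \<Longrightarrow> \<bar>Im (\<phi> z)\<bar> \<le> 1/17"
  shows "(\<lambda>z. Mw (tt z) (\<phi> z)) holomorphic_on D"
proof -
  have c: "cfg (\<phi> z) (ysol (tt z) (\<phi> z)) (3/2)" if "z \<in> D" for z
    by (rule ysol_bound(2)[OF holfam_adm[OF H that] \<phi>(2)[OF that]])
  note s = cfg_strip[OF c]
  note y = ysol_holomorphic[OF H \<phi>]
  show ?thesis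
    unfolding Mw_def
  proof (intro holomorphic_on_divide holomorphic_on_const holomorphic_on_mult)
    show "(\<lambda>z. Msum (tt z) (\<phi> z) (ysol (tt z) (\<phi> z))) holomorphic_on D"
      unfolding Msum_def
    proof (intro holomorphic_on_sum holomorphic_on_mult holomorphic_on_power y)
      fix k assume "k \<in> {..<q}"
      then have k: "k < q" by simp
      show "(\<lambda>z. LL (tt z) \<omega> (th (\<phi> z) (ysol (tt z) (\<phi> z)) k) (- of_real \<epsilon> * ysol (tt z) (\<phi> z) k)) holomorphic_on D"
        by (rule LL_holomorphic[OF H th_holomorphic[OF \<phi>(1) y], where B="\<bar>\<epsilon>\<bar> * (3/2)"])
           (use s k in \<open>auto intro!: holomorphic_intros y\<close>)
    qed
    show "2 * Msum (tt z) (\<phi> z) (ysol (tt z) (\<phi> z)) \<noteq> 0" if "z \<in> D" for z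
      using Mw_close(2)[OF holfam_adm[OF H that] \<phi>(2)[OF that]] by simp
  qed
qed

lemma R1_cnj:
  assumes "\<And>z. t (cnj z) = cnj (t z)"
  shows "R1 t (cnj x) (cnj v) = cnj (R1 t x v)"
proof -
  have "t (cnj x + of_real s * cnj v) = cnj (t (x + of_real s * v))" for s
    using assms[of "x + of_real s * v"] by simp
  then show ?thesis unfolding R1_def Henstock_Kurzweil_Integration.integral_cnj by simp
qed

text \<open>The conjugate sequence is again a fixed point, now for the conjugate initial angle, so
  uniqueness applies.\<close>

lemma ysol_cnj:
  assumes t: "adm t" and \<phi>: "\<bar>Im \<phi>\<bar> \<le> 1/17" and real: "\<And>z. t (cnj z) = cnj (t z)" and k: "k < q"
  shows "ysol t (cnj \<phi>) k = cnj (ysol t \<phi> k)"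
proof -
  define y where "y = ysol t \<phi>"
  define y' where "y' = (\<lambda>k. cnj (y k))"
  have \<phi>': "\<bar>Im (cnj \<phi>)\<bar> \<le> 1/17" using \<phi> by simp
  have th': "th (cnj \<phi>) y' i = cnj (th \<phi> y i)" for i by (simp add: th_def y'_def)
  have ra': "ra t (cnj \<phi>) y' i = cnj (ra t \<phi> y i)" for i
    using R1_cnj[of t "th \<phi> y i" "- of_real \<epsilon> * y i"] real by (simp add: ra_def th') (simp add: y'_def)
  have rb': "rb t (cnj \<phi>) y' i = cnj (rb t \<phi> y i)" for i
    using R1_cnj[of t "th \<phi> y i + of_real \<omega>" "- of_real \<epsilon> * y i"] real by (simp add: rb_def th') (simp add: y'_def)
  have EE': "EE t (cnj \<phi>) y' i = cnj (EE t \<phi> y i)" for i by (simp add: EE_def ra' rb')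
  have PS': "PS t (cnj \<phi>) y' i = cnj (PS t \<phi> y i)" for i by (simp add: PS_def EE')
  have "y' k = ysol t (cnj \<phi>) k"
  proof (rule ysol_unique[OF t \<phi>' _ _ k])
    fix i assume i: "i < q"
    have "norm (y' i - 1) = norm (y i - 1)" unfolding y'_def by (metis complex_cnj_diff complex_cnj_one complex_mod_cnj)
    then show "norm (y' i - 1) \<le> 1/2" using ysol_bound(1)[OF t \<phi>, of i] by (simp add: y_def)
    have "PS t \<phi> y i = y i" unfolding y_def by (rule ysol_PS[OF t \<phi> i])
    then show "PS t (cnj \<phi>) y' i = y' i" by (simp add: PS') (simp add: y'_def)
  qed
  then show ?thesis by (simp add: y'_def y_def)
qed

end

section \<open>Potentials with a prescribed invariant circle\<close>

lemma continuous_primitive: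
  fixes f :: "real \<Rightarrow> real"
  assumes f: "continuous_on UNIV f"
  shows "\<exists>F. F 0 = 0 \<and> (\<forall>x. (F has_real_derivative f x) (at x))"
proof -
  define F where "F = (\<lambda>x. if x \<ge> 0 then integral {0..x} f else - integral {x..0} f)"
  have int: "f integrable_on {a..b}" for a b
    using f by (intro integrable_continuous_real) (auto intro: continuous_on_subset)
  have F: "F x = integral {a..x} f - integral {a..0} f" if "a \<le> 0" "a \<le> x" for a x
    using Henstock_Kurzweil_Integration.integral_combine[OF that(1) _ int, of x]
      Henstock_Kurzweil_Integration.integral_combine[OF that(2) _ int, of 0] by (auto simp: F_def)
  have "(F has_real_derivative f x) (at x)" for x
  proof -
    define a b where "a = - \<bar>x\<bar> - 1" and "b = \<bar>x\<bar> + 1"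
    have ab: "a < x" "x < b" "a \<le> 0" by (auto simp: a_def b_def)
    have "((\<lambda>x. integral {a..x} f) has_real_derivative f x) (at x within {a..b})"
      using ab f by (intro integral_has_real_derivative) (auto intro: continuous_on_subset)
    then have "((\<lambda>x. integral {a..x} f) has_real_derivative f x) (at x)"
      using ab by (simp add: at_within_Icc_at)
    then have "((\<lambda>x. integral {a..x} f - integral {a..0} f) has_real_derivative f x) (at x)"
      using DERIV_diff[OF _ DERIV_const] by fastforce
    then show ?thesis
      by (rule has_field_derivative_transform_within_open[of _ _ _ "{a<..<b}"])
         (use ab F in auto)
  qed
  moreover have "F 0 = 0" by (simp add: F_def)
  ultimately show ?thesis by blast
qed

lemma derivative_zero_eq:
  fixes F G :: "real \<Rightarrow> real"
  assumes "\<And>x. (F has_real_derivative f x) (at x)" "\<And>x. (G has_real_derivative f x) (at x)" "F a = G a"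
  shows "F x = G x"
proof -
  have "((\<lambda>x. F x - G x) has_real_derivative 0) (at x)" for x using DERIV_diff[OF assms(1,2)] by simp
  then have "F x - G x = F a - G a" using DERIV_isconst_all[of "\<lambda>x. F x - G x"] by blast
  then show ?thesis using assms(3) by simp
qed

text \<open>The normalisation gives the parametrisation h degree 1. Evenness makes h odd and the
  potential even, hence supplies the reversing symmetry that singles out the orbit through
  0.\<close>

locale circle_potential =
  fixes T :: "real \<Rightarrow> real" and \<omega> :: real
  assumes contT: "continuous_on UNIV T" and Tb: "\<And>x. \<bar>T x - 1\<bar> \<le> 1/1000"
    and per: "\<And>x. T (x + 1) = T x" and even: "\<And>x. T (- x) = T x"
    and normalized: "integral {0..1} (\<lambda>s. 1 / T s) = 1"
begin

lemma T_bounds: "999/1000 \<le> T x" "T x \<le> 1001/1000" "T x > 0" "998/1000 \<le> 1 / T x" "1 / T x \<le> 1002/1000"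
proof -
  show 1: "999/1000 \<le> T x" "T x \<le> 1001/1000" using Tb[of x] by linarith+
  then show 2: "T x > 0" by linarith
  show "998/1000 \<le> 1 / T x" using 1 2 by (simp add: field_simps)
  show "1 / T x \<le> 1002/1000" using 1 2 by (simp add: field_simps)
qed

lemma cont_inverse: "continuous_on UNIV (\<lambda>x. 1 / T x)"
  using contT T_bounds(3) by (intro continuous_intros) (auto simp: less_le)

definition h :: "real \<Rightarrow> real" where
  "h = (SOME F. F 0 = 0 \<and> (\<forall>x. (F has_real_derivative 1 / T x) (at x)))"

lemma h_0 [simp]: "h 0 = 0" and h_deriv: "(h has_real_derivative 1 / T x) (at x)"
  using someI_ex[OF continuous_primitive[OF cont_inverse]] unfolding h_def by auto

lemma h_deriv' [derivative_intros]:
  "(g has_real_derivative g') (at x within A) \<Longrightarrow> ((\<lambda>x. h (g x)) has_real_derivative (1 / T (g x)) * g') (at x within A)"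
  using DERIV_chain2[OF h_deriv] .

lemma h_cont: "continuous_on A h"
  by (meson DERIV_isCont h_deriv continuous_at_imp_continuous_on)

lemma h_one: "h 1 = 1"
proof -
  have "((\<lambda>s. 1 / T s) has_integral h 1 - h 0) {0..1}"
    using h_deriv by (intro fundamental_theorem_of_calculus)
      (auto simp flip: has_real_derivative_iff_has_vector_derivative intro: has_field_derivative_at_within)
  then show ?thesis using normalized by (simp add: integral_unique)
qed

lemma h_add_int: "h (x + of_int n) = h x + of_int n"
proof -
  have 1: "h (x + 1) = h x + 1" for x
    by (rule derivative_zero_eq[where a=0 and f="\<lambda>x. 1 / T x"])
       (auto intro!: derivative_eq_intros simp: per h_one)
  show ?thesis
  proof (induction n)
    case (nonneg m) then show ?case
    proof (induction m)
      case (Suc m) then show ?case using 1[of "x + of_nat m"] by (simp add: add_ac)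
    qed simp
  next
    case (neg m) then show ?case
    proof (induction m)
      case 0 then show ?case using 1[of "x - 1"] by simp
    next
      case (Suc m) then show ?case using 1[of "x - of_nat m - 2"] by (simp add: algebra_simps)
    qed
  qed
qed

lemma h_minus: "h (- x) = - h x"
proof -
  have "- h (- x) = h x" for x
    by (rule derivative_zero_eq[where a=0 and f="\<lambda>x. 1 / T x"])
       (auto intro!: derivative_eq_intros simp: even h_one)
  then show ?thesis by (metis minus_minus)
qed

lemma h_increment: "x \<le> y \<Longrightarrow> 998/1000 * (y - x) \<le> h y - h x \<and> h y - h x \<le> 1002/1000 * (y - x)"
proof (cases "x < y")
  case True
  obtain z where "h y - h x = (y - x) * (1 / T z)"
    using MVT2[OF True, of h "\<lambda>x. 1 / T x"] h_deriv by blast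
  then show ?thesis
    using mult_left_mono[OF T_bounds(4)[of z], of "y - x"] mult_left_mono[OF T_bounds(5)[of z], of "y - x"] True
    by (simp only: mult.commute[of "_ / 1000"])
qed auto

lemma h_less: "x < y \<Longrightarrow> h x < h y" using h_increment[of x y] by auto
lemma h_inj: "h x = h y \<Longrightarrow> x = y" using h_less by (metis linorder_less_linear less_irrefl)

lemma h_surj: "\<exists>x. h x = y"
proof -
  have 0: "h (of_int n) = of_int n" for n using h_add_int[of 0 n] by simp
  have "\<exists>x\<ge>of_int \<lfloor>y\<rfloor>. x \<le> of_int (\<lfloor>y\<rfloor> + 1) \<and> h x = y"
    by (rule IVT'[OF _ _ _ h_cont]) (auto simp: 0 simp del: of_int_add intro: less_imp_le[OF floor_less_iff[THEN iffD1]])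
  then show ?thesis by blast
qed

definition hi :: "real \<Rightarrow> real" where "hi = inv h"

lemma h_hi [simp]: "h (hi x) = x" unfolding hi_def by (rule surj_f_inv_f) (use h_surj in \<open>metis surjI surj_def\<close>)
lemma hi_h [simp]: "hi (h x) = x" by (rule h_inj) simp

lemma hi_add_int: "hi (x + of_int n) = hi x + of_int n"
  by (rule h_inj) (simp add: h_add_int)

lemma hi_deriv: "(hi has_real_derivative T (hi x)) (at x)"
proof -
  have c: "isCont hi x"
    using isCont_inverse_function[of 1 "hi x" hi h] h_deriv DERIV_isCont by auto
  have "(hi has_real_derivative inverse (1 / T (hi x))) (at x)"
    by (rule DERIV_inverse_function[where f=h and a="x - 1" and b="x + 1"])
       (use h_deriv c T_bounds(3)[of "hi x"] in auto)
  then show ?thesis by simp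
qed

text \<open>The primitive of the Liouville form along the circle \<open>y = h x - h (x - \<omega>)\<close>.\<close>

definition U :: "real \<Rightarrow> real" where
  "U = (SOME F. F 0 = 0 \<and> (\<forall>x. (F has_real_derivative (h x - h (x - \<omega>)) / T x) (at x)))"

lemma U_0 [simp]: "U 0 = 0" and U_deriv: "(U has_real_derivative (h x - h (x - \<omega>)) / T x) (at x)"
proof -
  have "continuous_on UNIV (\<lambda>x. (h x - h (x - \<omega>)) / T x)"
    using T_bounds(3) contT
    by (intro continuous_intros h_cont continuous_on_compose2[OF h_cont[of UNIV], where f="\<lambda>x. x - \<omega>"]) (auto simp: less_le)
  then show "U 0 = 0" "(U has_real_derivative (h x - h (x - \<omega>)) / T x) (at x)"
    using someI_ex[OF continuous_primitive] unfolding U_def by blast+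
qed

lemma U_deriv' [derivative_intros]:
  "(g has_real_derivative g') (at x within A) \<Longrightarrow> ((\<lambda>x. U (g x)) has_real_derivative ((h (g x) - h (g x - \<omega>)) / T (g x)) * g') (at x within A)"
  using DERIV_chain2[OF U_deriv] .

lemma U_add_int: "U (x + of_int n) = U x + of_int n * U 1"
proof -
  have 1: "U (x + 1) = U x + U 1" for x
  proof (rule derivative_zero_eq[where F="\<lambda>x. U (x + 1)" and G="\<lambda>x. U x + U 1" and a=0 and f="\<lambda>x. (h x - h (x - \<omega>)) / T x"])
    fix x
    have "h (x + 1) = h x + 1" "h (x + 1 - \<omega>) = h (x - \<omega>) + 1"
      using h_add_int[of x 1] h_add_int[of "x - \<omega>" 1] by (auto simp: algebra_simps)
    then show "((\<lambda>x. U (x + 1)) has_real_derivative (h x - h (x - \<omega>)) / T x) (at x)"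
      by (auto intro!: derivative_eq_intros simp: per)
  qed (auto intro!: derivative_eq_intros)
  show ?thesis
  proof (induction n)
    case (nonneg m) then show ?case
    proof (induction m)
      case (Suc m) then show ?case using 1[of "x + of_nat m"] by (simp add: algebra_simps)
    qed simp
  next
    case (neg m) then show ?case
    proof (induction m)
      case 0 then show ?case using 1[of "x - 1"] by simp
    next
      case (Suc m) then show ?case using 1[of "x - of_nat m - 2"] by (simp add: algebra_simps)
    qed
  qed
qed

text \<open>The potential read in the parameter of the circle, chosen such that the relative action
  \<open>Lr\<close> of the step from x to x + \<omega> is zero.\<close>

definition Nf :: "real \<Rightarrow> real" where
  "Nf x = U (x + \<omega>) - U x - (h (x + \<omega>) - h x)\<^sup>2 / 2"

text \<open>The terms with 1 / T (x + \<omega>) cancel; what remains is the Euler-Lagrange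
  expression of the circle divided by T x.\<close>

lemma Nf_deriv: "(Nf has_real_derivative (h (x + \<omega>) + h (x - \<omega>) - 2 * h x) / T x) (at x)"
  unfolding Nf_def
  using T_bounds(3)[of x] T_bounds(3)[of "x + \<omega>"]
  by (auto intro!: derivative_eq_intros simp: divide_simps) (simp add: algebra_simps)

lemma Nf_add_int: "Nf (x + of_int n) = Nf x"
proof -
  have "x + of_int n + \<omega> = (x + \<omega>) + of_int n" by simp
  then show ?thesis by (simp only: Nf_def U_add_int h_add_int) simp
qed

lemma Nf_minus: "Nf (- x) = Nf x"
proof (rule derivative_zero_eq[where F="\<lambda>x. Nf (- x)" and a=0 and f="\<lambda>x. (h (x + \<omega>) + h (x - \<omega>) - 2 * h x) / T x"])
  fix x
  have "h (- x + \<omega>) = - h (x - \<omega>)" "h (- x - \<omega>) = - h (x + \<omega>)" using h_minus[of "x - \<omega>"] h_minus[of "x + \<omega>"] by auto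
  then show "((\<lambda>x. Nf (- x)) has_real_derivative (h (x + \<omega>) + h (x - \<omega>) - 2 * h x) / T x) (at x)"
    using DERIV_chain2[OF Nf_deriv[of "- x"] DERIV_minus[OF DERIV_ident]]
    by (simp add: even h_minus minus_divide_left)
qed (auto intro: Nf_deriv)

definition V :: "real \<Rightarrow> real" where "V x = Nf (hi x)"

lemma V_h: "V (h x) = Nf x" by (simp add: V_def)

lemma V_add_int: "V (x + of_int n) = V x" by (simp add: V_def hi_add_int Nf_add_int)

lemma V_deriv: "(V has_real_derivative h (hi x + \<omega>) + h (hi x - \<omega>) - 2 * x) (at x)"
proof -
  have "(V has_real_derivative ((h (hi x + \<omega>) + h (hi x - \<omega>) - 2 * h (hi x)) / T (hi x)) * T (hi x)) (at x)"
    unfolding V_def by (rule DERIV_chain2[OF Nf_deriv hi_deriv])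
  then show ?thesis using T_bounds(3)[of "hi x"] by simp
qed

lemma deriv_V: "deriv V x = h (hi x + \<omega>) + h (hi x - \<omega>) - 2 * x"
  by (rule DERIV_imp_deriv[OF V_deriv])

lemma deriv_V_h: "deriv V (h x) = h (x + \<omega>) + h (x - \<omega>) - 2 * h x"
  by (simp add: deriv_V)

lemma deriv_V_add_int: "deriv V (x + of_int n) = deriv V x"
proof -
  have "hi x + of_int n + \<omega> = (hi x + \<omega>) + of_int n" "hi x + of_int n - \<omega> = (hi x - \<omega>) + of_int n" by auto
  then show ?thesis by (simp only: deriv_V hi_add_int h_add_int) (simp add: algebra_simps)
qed

text \<open>The generating function in circle coordinates corrected by the coboundary of
  \<open>U\<close>: it vanishes on the circle, is nonnegative, and sums along a periodic orbit to
  the action minus p * \<open>U\<close> 1.\<close>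

definition Lr :: "real \<Rightarrow> real \<Rightarrow> real" where
  "Lr x x' = (h x - h x')\<^sup>2 / 2 + Nf x + U x - U x'"

lemma Lr_has_integral:
  "((\<lambda>s. v / T (x + \<omega> + s * v) * (h (x + s * v) - h x)) has_integral Lr x (x + \<omega> + v)) {0..1}"
proof -
  have "((\<lambda>s. v / T (x + \<omega> + s * v) * (h (x + s * v) - h x)) has_integral Lr x (x + \<omega> + 1 * v) - Lr x (x + \<omega> + 0 * v)) {0..1}"
  proof (rule fundamental_theorem_of_calculus)
    fix s :: real
    have "((\<lambda>s. Lr x (x + \<omega> + s * v)) has_real_derivative v / T (x + \<omega> + s * v) * (h (x + s * v) - h x)) (at s within {0..1})"
      unfolding Lr_def using T_bounds(3)[of "x + \<omega> + s * v"]
      by (auto intro!: derivative_eq_intros simp: field_simps)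
    then show "((\<lambda>s. Lr x (x + \<omega> + s * v)) has_vector_derivative v / T (x + \<omega> + s * v) * (h (x + s * v) - h x)) (at s within {0..1})"
      by (simp add: has_real_derivative_iff_has_vector_derivative)
  qed simp
  moreover have "Lr x (x + \<omega>) = 0" by (simp add: Lr_def Nf_def power2_commute)
  ultimately show ?thesis by simp
qed

text \<open>Both factors of the integrand are at least 998/1000 of their values for T = 1, so it is
  at least (2/3) * v^2 * s. This coercivity turns a small excess into an a priori bound on each step
  of an orbit.\<close>

lemma Lr_lower: "Lr x (x + \<omega> + v) \<ge> v\<^sup>2 / 3"
proof -
  have "((\<lambda>s. 2/3 * v\<^sup>2 * s) has_integral 2/3 * v\<^sup>2 * (1/2)) {0..1::real}"
    using ident_has_integral[of 0 1] by (intro has_integral_mult_right) simp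
  then have "2/3 * v\<^sup>2 * (1/2) \<le> Lr x (x + \<omega> + v)"
  proof (rule has_integral_le[OF _ Lr_has_integral])
    fix s :: real assume s: "s \<in> {0..1}"
    have 1: "998/1000 * (s * v\<^sup>2) \<le> (h (x + s * v) - h x) * v"
    proof (cases "v \<ge> 0")
      case True
      then have "998/1000 * (s * v) \<le> h (x + s * v) - h x" using h_increment[of x "x + s * v"] s by auto
      then have "998/1000 * (s * v) * v \<le> (h (x + s * v) - h x) * v" using True by (rule mult_right_mono)
      then show ?thesis by (simp add: power2_eq_square mult_ac)
    next
      case False
      have "s * v \<le> 0" using s False by (simp add: mult_nonneg_nonpos)
      then have "998/1000 * (- (s * v)) \<le> h x - h (x + s * v)" using h_increment[of "x + s * v" x] by auto
      then have "998/1000 * (- (s * v)) * (- v) \<le> (h x - h (x + s * v)) * (- v)" using False by (intro mult_right_mono) auto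
      then show ?thesis by (simp add: power2_eq_square algebra_simps)
    qed
    have "0 \<le> s * v\<^sup>2" using s by simp
    have "0 \<le> 1 / T (x + \<omega> + s * v)" using T_bounds(3)[of "x + \<omega> + s * v"] by simp
    then have B: "(998/1000) * (998/1000 * (s * v\<^sup>2)) \<le> (1 / T (x + \<omega> + s * v)) * ((h (x + s * v) - h x) * v)"
      by (rule mult_mono[OF T_bounds(4) 1]) (use \<open>0 \<le> s * v\<^sup>2\<close> in simp)
    have "2/3 * v\<^sup>2 * s \<le> (998/1000) * (998/1000 * (s * v\<^sup>2))" using \<open>0 \<le> s * v\<^sup>2\<close> by simp
    also note B
    also have "(1 / T (x + \<omega> + s * v)) * ((h (x + s * v) - h x) * v) = v / T (x + \<omega> + s * v) * (h (x + s * v) - h x)" by simp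
    finally show "2/3 * v\<^sup>2 * s \<le> v / T (x + \<omega> + s * v) * (h (x + s * v) - h x)" .
  qed
  then show ?thesis by simp
qed

lemma action_step: "generating_function V (h x) (h x') = Lr x x' + U x' - U x"
  by (simp add: generating_function_def Lr_def V_h)

lemma h_segment_integral:
  "((\<lambda>s. v / T (x + s * v)) has_integral (h (x + v) - h x)) {0..1}"
proof -
  have "((\<lambda>s. v / T (x + s * v)) has_integral h (x + 1 * v) - h (x + 0 * v)) {0..1}"
  proof (rule fundamental_theorem_of_calculus)
    fix s :: real
    have "((\<lambda>s. h (x + s * v)) has_real_derivative v / T (x + s * v)) (at s within {0..1})"
      by (auto intro!: derivative_eq_intros)
    then show "((\<lambda>s. h (x + s * v)) has_vector_derivative v / T (x + s * v)) (at s within {0..1})"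
      by (simp add: has_real_derivative_iff_has_vector_derivative)
  qed simp
  then show ?thesis by simp
qed

lemma R1_real:
  assumes t: "\<And>x. t (of_real x) = of_real (T x)"
  shows "of_real v * R1 t (of_real x) (of_real v) = of_real (h (x + v) - h x)"
proof -
  have "((\<lambda>s. of_real (v / T (x + s * v)) :: complex) has_integral of_real (h (x + v) - h x)) {0..1}"
    using has_integral_linear[OF h_segment_integral[of v x] bounded_linear_of_real[where ?'a=complex]] by (simp only: o_def)
  moreover have "t (of_real x + of_real s * of_real v) = of_real (T (x + s * v))" for s
    using t[of "x + s * v"] by simp
  ultimately have "((\<lambda>s. of_real v * inverse (t (of_real x + of_real s * of_real v)) :: complex) has_integral of_real (h (x + v) - h x)) {0..1}"
    by (simp add: divide_inverse)
  then have "integral {0..1} (\<lambda>s. of_real v * inverse (t (of_real x + of_real s * of_real v)) :: complex) = of_real (h (x + v) - h x)"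
    by (rule integral_unique)
  then show ?thesis unfolding R1_def by simp
qed

lemma LL_real:
  assumes t: "\<And>x. t (of_real x) = of_real (T x)"
  shows "of_real (v\<^sup>2) * LL t \<omega> (of_real x) (of_real v) = of_real (Lr x (x + \<omega> + v))"
proof -
  have "((\<lambda>s. of_real (v / T (x + \<omega> + s * v) * (h (x + s * v) - h x)) :: complex) has_integral of_real (Lr x (x + \<omega> + v))) {0..1}"
    using has_integral_linear[OF Lr_has_integral[of v x] bounded_linear_of_real[where ?'a=complex]] by (simp only: o_def)
  moreover have "of_real (v / T (x + \<omega> + s * v) * (h (x + s * v) - h x))
      = of_real (v\<^sup>2) * (of_real s * inverse (t (of_real x + of_real \<omega> + of_real s * of_real v)) * R1 t (of_real x) (of_real s * of_real v))" for s
  proof -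
    have "t (of_real x + of_real \<omega> + of_real s * of_real v) = of_real (T (x + \<omega> + s * v))"
      using t[of "x + \<omega> + s * v"] by simp
    moreover have "of_real (h (x + s * v) - h x) = of_real s * of_real v * R1 t (of_real x) (of_real s * of_real v)"
      using R1_real[OF t, of "s * v" x] by simp
    ultimately show ?thesis by (simp add: divide_inverse power2_eq_square)
  qed
  ultimately have "integral {0..1} (\<lambda>s. of_real (v\<^sup>2) * (of_real s * inverse (t (of_real x + of_real \<omega> + of_real s * of_real v)) * R1 t (of_real x) (of_real s * of_real v))) = of_real (Lr x (x + \<omega> + v))"
    by (metis (no_types, lifting) ext integral_unique)
  then show ?thesis unfolding LL_def integral_mult_right .
qed

end

section \<open>Minimal periodic orbits\<close>

lemma sum_shift_periodic:
  fixes f :: "nat \<Rightarrow> real"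
  assumes "\<And>k. f (k + q) = f k"
  shows "(\<Sum>k<q. f (k + l)) = (\<Sum>k<q. f k)"
proof (induction l)
  case (Suc l)
  have "(\<Sum>k<q. f (k + Suc l)) + f l = (\<Sum>k<Suc q. f (k + l))" by (subst sum.lessThan_Suc_shift) simp
  also have "\<dots> = (\<Sum>k<q. f (k + l)) + f l" using assms[of l] by (simp add: add.commute)
  finally show ?case using Suc by simp
qed simp

locale nr_circle = near_rational \<omega> \<epsilon> q p + circle_potential T \<omega>
  for \<omega> \<epsilon> q p T +
  fixes t :: "complex \<Rightarrow> complex"
  assumes eps: "\<epsilon> \<noteq> 0" and adm: "adm t" and treal: "\<And>x. t (of_real x) = of_real (T x)"
    and tcnj: "\<And>z. t (cnj z) = cnj (t z)"
begin

definition yof :: "(nat \<Rightarrow> real) \<Rightarrow> nat \<Rightarrow> real" where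
  "yof \<theta> k = (\<theta> k + \<omega> - \<theta> (Suc k)) / \<epsilon>"

text \<open>The equation x (k + 2) - 2 * x (k + 1) + x k = V' (x (k + 1)) for x = h \<theta>, with
  V' eliminated through \<open>deriv_V_h\<close>. It is the equation at site Suc k.\<close>

definition stationary :: "(nat \<Rightarrow> real) \<Rightarrow> nat \<Rightarrow> bool" where
  "stationary \<theta> k \<longleftrightarrow> h (\<theta> (Suc (Suc k))) + h (\<theta> k) = h (\<theta> (Suc k) + \<omega>) + h (\<theta> (Suc k) - \<omega>)"

text \<open>The equation at the site where the orbit closes up is omitted, so \<theta> 0 is free.
  The bound 3 * q is weak enough to hold for every periodic orbit of small excess.\<close>

definition bvp :: "(nat \<Rightarrow> real) \<Rightarrow> bool" where
  "bvp \<theta> \<longleftrightarrow> \<theta> q = \<theta> 0 + of_int p \<and> (\<forall>k. Suc k < q \<longrightarrow> stationary \<theta> k) \<and> (\<forall>k<q. \<bar>yof \<theta> k\<bar> \<le> 3 * real q)"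

lemma th_real: "th (of_real (\<theta> 0)) (\<lambda>k. of_real (yof \<theta> k)) k = of_real (\<theta> k)"
proof (induction k)
  case (Suc k)
  have "\<theta> k + \<omega> - \<epsilon> * yof \<theta> k = \<theta> (Suc k)" using eps by (simp add: yof_def)
  then have "of_real (\<theta> k) + of_real \<omega> - of_real \<epsilon> * of_real (yof \<theta> k) = (of_real (\<theta> (Suc k)) :: complex)"
    by (metis of_real_add of_real_diff of_real_mult)
  then show ?case by (simp only: th_Suc Suc) simp
qed simp

lemma ra_rb_real:
  fixes \<theta> :: "nat \<Rightarrow> real"
  defines "y \<equiv> \<lambda>k. of_real (yof \<theta> k) :: complex"
  shows "- of_real \<epsilon> * y k * ra t (of_real (\<theta> 0)) y k = of_real (h (\<theta> (Suc k) - \<omega>) - h (\<theta> k))"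
    "- of_real \<epsilon> * y k * rb t (of_real (\<theta> 0)) y k = of_real (h (\<theta> (Suc k)) - h (\<theta> k + \<omega>))"
proof -
  define v where "v = - \<epsilon> * yof \<theta> k"
  have v: "v = \<theta> (Suc k) - \<omega> - \<theta> k" using eps by (simp add: v_def yof_def)
  have vc: "- of_real \<epsilon> * y k = of_real v" by (simp add: v_def y_def)
  have th: "th (of_real (\<theta> 0)) y k = of_real (\<theta> k)" unfolding y_def by (rule th_real)
  show "- of_real \<epsilon> * y k * ra t (of_real (\<theta> 0)) y k = of_real (h (\<theta> (Suc k) - \<omega>) - h (\<theta> k))"
    unfolding ra_def vc th R1_real[OF treal] by (simp add: v)
  show "- of_real \<epsilon> * y k * rb t (of_real (\<theta> 0)) y k = of_real (h (\<theta> (Suc k)) - h (\<theta> k + \<omega>))"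
    unfolding rb_def vc th of_real_add[symmetric] R1_real[OF treal] by (simp add: v)
qed

lemma stationary_iff:
  fixes \<theta> :: "nat \<Rightarrow> real"
  defines "y \<equiv> \<lambda>k. of_real (yof \<theta> k) :: complex"
  shows "stationary \<theta> k \<longleftrightarrow> y (Suc k) * rb t (of_real (\<theta> 0)) y (Suc k) = y k * ra t (of_real (\<theta> 0)) y k"
proof -
  have "stationary \<theta> k \<longleftrightarrow> (h (\<theta> (Suc (Suc k))) - h (\<theta> (Suc k) + \<omega>)) = (h (\<theta> (Suc k) - \<omega>) - h (\<theta> k))"
    by (auto simp: stationary_def)
  also have "\<dots> \<longleftrightarrow> - of_real \<epsilon> * y (Suc k) * rb t (of_real (\<theta> 0)) y (Suc k) = - of_real \<epsilon> * y k * ra t (of_real (\<theta> 0)) y k"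
    unfolding y_def ra_rb_real of_real_eq_iff ..
  also have "\<dots> \<longleftrightarrow> y (Suc k) * rb t (of_real (\<theta> 0)) y (Suc k) = y k * ra t (of_real (\<theta> 0)) y k"
    using eps by (simp add: mult.assoc)
  finally show ?thesis .
qed

lemma Y3: "\<bar>\<epsilon>\<bar> * (3 * real q) * real q \<le> 1/1000"
  using small by (simp add: power2_eq_square)

lemma sum_yof: "(\<Sum>k<n. yof \<theta> k) = (\<theta> 0 + real n * \<omega> - \<theta> n) / \<epsilon>"
  by (induction n) (use eps in \<open>auto simp: yof_def field_simps\<close>)

lemma q_om: "real q * \<omega> = of_int p + real q * \<epsilon>"
  using q by (simp add: om distrib_left)

text \<open>A bootstrap: the bound 3 * q is enough for \<open>PS_near_1\<close>, and since
  \<open>y\<close> is its own image under \<open>PS\<close> it is within 1/32 of 1, hence in the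
  range of uniqueness.\<close>

lemma bvp_ysol:
  assumes b: "bvp \<theta>" and k: "k < q"
  shows "ysol t (of_real (\<theta> 0)) k = of_real (yof \<theta> k)"
proof -
  define y where "y = (\<lambda>k. of_real (yof \<theta> k) :: complex)"
  have c: "cfg (of_real (\<theta> 0)) y (3 * real q)"
    unfolding cfg_def using b th_real by (auto simp: y_def bvp_def)
  have "(\<Sum>k<q. yof \<theta> k) = real q" using b eps q_om by (simp add: sum_yof bvp_def)
  then have "(\<Sum>k<q. y k) = of_nat q" unfolding y_def by (metis of_real_of_nat_eq of_real_sum)
  then have PS: "\<forall>k<q. PS t (of_real (\<theta> 0)) y k = y k"
    unfolding PS_fixed_iff[OF adm c Y3, simplified] using b by (auto simp: bvp_def stationary_iff y_def)
  have "y k = ysol t (of_real (\<theta> 0)) k"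
  proof (rule ysol_unique[OF adm _ _ _ k])
    fix i assume i: "i < q"
    have "norm (PS t (of_real (\<theta> 0)) y i - 1) \<le> 1/32" by (rule PS_near_1(1)[OF adm c i Y3]) simp
    then show "norm (y i - 1) \<le> 1/2" using PS i by simp
    show "PS t (of_real (\<theta> 0)) y i = y i" using PS i by simp
  qed simp
  then show ?thesis by (simp add: y_def)
qed

text \<open>Each step is v = - \<epsilon> * y k and v^2 * \<open>LL\<close> is \<open>Lr\<close>, so
  \<epsilon>^2 * \<open>Msum\<close> is the excess.\<close>

lemma bvp_Mw:
  assumes b: "bvp \<theta>"
  shows "Mw t (of_real (\<theta> 0)) = of_real (real q * \<epsilon>\<^sup>2 / (2 * (\<Sum>k<q. Lr (\<theta> k) (\<theta> (Suc k)))))"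
proof -
  define y where "y = (\<lambda>k. of_real (yof \<theta> k) :: complex)"
  have "of_real (\<epsilon>\<^sup>2) * Msum t (of_real (\<theta> 0)) (ysol t (of_real (\<theta> 0)))
      = (\<Sum>k<q. of_real (Lr (\<theta> k) (\<theta> (Suc k))))"
    unfolding Msum_def sum_distrib_left
  proof (rule sum.cong)
    fix k assume "k \<in> {..<q}"
    then have k: "k < q" by simp
    define v where "v = - \<epsilon> * yof \<theta> k"
    have v: "\<theta> k + \<omega> + v = \<theta> (Suc k)" using eps by (simp add: v_def yof_def)
    have "(\<Sum>i<k. ysol t (of_real (\<theta> 0)) i) = (\<Sum>i<k. y i)"
      unfolding y_def by (rule sum.cong) (use k bvp_ysol[OF b] in auto)
    then have "th (of_real (\<theta> 0)) (ysol t (of_real (\<theta> 0))) k = th (of_real (\<theta> 0)) y k"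
      by (simp add: th_def)
    then have th: "th (of_real (\<theta> 0)) (ysol t (of_real (\<theta> 0))) k = of_real (\<theta> k)" by (simp add: y_def th_real)
    have yk: "ysol t (of_real (\<theta> 0)) k = of_real (yof \<theta> k)" by (rule bvp_ysol[OF b k])
    have vc: "- of_real \<epsilon> * of_real (yof \<theta> k) = (of_real v :: complex)" by (simp add: v_def)
    have "of_real (\<epsilon>\<^sup>2) * (of_real (yof \<theta> k))\<^sup>2 = (of_real (v\<^sup>2) :: complex)" by (simp add: v_def power_mult_distrib)
    then show "of_real (\<epsilon>\<^sup>2) * ((ysol t (of_real (\<theta> 0)) k)\<^sup>2 * LL t \<omega> (th (of_real (\<theta> 0)) (ysol t (of_real (\<theta> 0))) k) (- of_real \<epsilon> * ysol t (of_real (\<theta> 0)) k)) = of_real (Lr (\<theta> k) (\<theta> (Suc k)))"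
      unfolding th yk vc using LL_real[OF treal, of v "\<theta> k"] by (simp add: v mult.assoc[symmetric])
  qed simp
  then have "of_real (\<epsilon>\<^sup>2) * Msum t (of_real (\<theta> 0)) (ysol t (of_real (\<theta> 0))) = of_real (\<Sum>k<q. Lr (\<theta> k) (\<theta> (Suc k)))"
    by simp
  then have "Msum t (of_real (\<theta> 0)) (ysol t (of_real (\<theta> 0))) = of_real ((\<Sum>k<q. Lr (\<theta> k) (\<theta> (Suc k))) / \<epsilon>\<^sup>2)"
    using eps by (simp add: field_simps)
  then show ?thesis unfolding Mw_def by simp
qed

definition sol :: "real \<Rightarrow> nat \<Rightarrow> real" where
  "sol \<phi> k = \<phi> + real k * \<omega> - \<epsilon> * (\<Sum>i<k. Re (ysol t (of_real \<phi>) i))"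

lemma sol_0 [simp]: "sol \<phi> 0 = \<phi>" by (simp add: sol_def)

lemma yof_sol: "yof (sol \<phi>) k = Re (ysol t (of_real \<phi>) k)"
  using eps by (simp add: yof_def sol_def algebra_simps)

lemma ysol_real:
  assumes k: "k < q"
  shows "ysol t (of_real \<phi>) k = of_real (Re (ysol t (of_real \<phi>) k))"
proof -
  have "ysol t (cnj (of_real \<phi>)) k = cnj (ysol t (of_real \<phi>) k)" by (rule ysol_cnj[OF adm _ tcnj k]) simp
  then have "Im (ysol t (of_real \<phi>) k) = 0" by (metis complex_cnj_complex_of_real complex_cnj_cancel_iff cnj.simps(2) equal_neg_zero)
  then show ?thesis by (simp add: complex_eq_iff)
qed

lemma sol_bvp: "bvp (sol \<phi>)"
  unfolding bvp_def
proof (intro conjI allI impI)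
  have c: "cfg (of_real \<phi>) (ysol t (of_real \<phi>)) (3/2)" by (rule ysol_bound(2)[OF adm]) simp
  have fx: "(\<Sum>k<q. ysol t (of_real \<phi>) k) = of_nat q"
    "\<And>k. Suc k < q \<Longrightarrow> ysol t (of_real \<phi>) (Suc k) * rb t (of_real \<phi>) (ysol t (of_real \<phi>)) (Suc k) = ysol t (of_real \<phi>) k * ra t (of_real \<phi>) (ysol t (of_real \<phi>)) k"
    using PS_fixed_iff[OF adm c Y32] ysol_PS[OF adm, of "of_real \<phi>"] by auto
  have "(\<Sum>k<q. Re (ysol t (of_real \<phi>) k)) = real q" using arg_cong[OF fx(1), of Re] by simp
  then show "sol \<phi> q = sol \<phi> 0 + of_int p" using q_om by (simp add: sol_def)
  fix k
  {
    assume k: "k < q"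
    have "\<bar>yof (sol \<phi>) k\<bar> \<le> norm (ysol t (of_real \<phi>) k)" unfolding yof_sol by (rule abs_Re_le_cmod)
    also have "\<dots> \<le> 3/2" using c k by (simp add: cfg_def)
    also have "\<dots> \<le> 3 * real q" using q by simp
    finally show "\<bar>yof (sol \<phi>) k\<bar> \<le> 3 * real q" .
  }
  assume k: "Suc k < q"
  define y where "y = (\<lambda>k. of_real (yof (sol \<phi>) k) :: complex)"
  have eq: "ysol t (of_real \<phi>) i = y i" if "i < q" for i using ysol_real[OF that] by (simp add: y_def yof_sol)
  have th: "th (of_real \<phi>) (ysol t (of_real \<phi>)) i = th (of_real \<phi>) y i" if "i < q" for i
  proof -
    have "(\<Sum>j<i. ysol t (of_real \<phi>) j) = (\<Sum>j<i. y j)" by (rule sum.cong) (use eq that in auto)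
    then show ?thesis by (simp add: th_def)
  qed
  have yf: "of_real (yof (sol \<phi>) i) = y i" for i by (simp add: y_def)
  show "stationary (sol \<phi>) k"
    unfolding stationary_iff y_def[symmetric] yf using fx(2)[OF k] k eq[of k] eq[of "Suc k"] th[of k] th[of "Suc k"]
    by (simp add: ra_def rb_def)
qed

lemma sum_Lr:
  assumes "\<theta> q = \<theta> 0 + of_int p"
  shows "(\<Sum>k<q. Lr (\<theta> k) (\<theta> (Suc k))) = (\<Sum>k<q. generating_function V (h (\<theta> k)) (h (\<theta> (Suc k)))) - of_int p * U 1"
proof -
  have "(\<Sum>k<n. generating_function V (h (\<theta> k)) (h (\<theta> (Suc k)))) = (\<Sum>k<n. Lr (\<theta> k) (\<theta> (Suc k))) + U (\<theta> n) - U (\<theta> 0)" for n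
    by (induction n) (auto simp: action_step)
  from this[of q] show ?thesis by (simp add: assms U_add_int)
qed

definition reverse :: "(nat \<Rightarrow> real) \<Rightarrow> nat \<Rightarrow> real" where
  "reverse \<theta> k = of_int p - \<theta> (q - k)"

lemma h_int_minus: "h (of_int p - x) = of_int p - h x"
  using h_add_int[of "-x" p] by (simp add: h_minus)

text \<open>Oddness of h carries the stationarity at one site to the reflected site. In the action
  the quadratic terms are permuted, while the potential terms are shifted by one site, which
  periodicity of \<open>Nf\<close> absorbs.\<close>

lemma bvp_reverse:
  assumes b: "bvp \<theta>"
  shows "bvp (reverse \<theta>)" "(\<Sum>k<q. Lr (reverse \<theta> k) (reverse \<theta> (Suc k))) = (\<Sum>k<q. Lr (\<theta> k) (\<theta> (Suc k)))"
    "k < q \<Longrightarrow> yof (reverse \<theta>) k = yof \<theta> (q - Suc k)"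
proof -
  have y: "yof (reverse \<theta>) k = yof \<theta> (q - Suc k)" if "k < q" for k
  proof -
    have "q - k = Suc (q - Suc k)" using that by simp
    then show ?thesis by (simp add: yof_def reverse_def)
  qed
  then show "k < q \<Longrightarrow> yof (reverse \<theta>) k = yof \<theta> (q - Suc k)" .
  have per: "reverse \<theta> q = reverse \<theta> 0 + of_int p" using b by (simp add: reverse_def bvp_def)
  show "bvp (reverse \<theta>)"
    unfolding bvp_def
  proof (intro conjI allI impI)
    show "reverse \<theta> q = reverse \<theta> 0 + of_int p" by (rule per)
    show "\<bar>yof (reverse \<theta>) k\<bar> \<le> 3 * real q" if "k < q" for k using b that by (simp add: y bvp_def)
    fix k assume k: "Suc k < q"
    define m where "m = q - Suc (Suc k)"
    have m: "q - k = Suc (Suc m)" "q - Suc k = Suc m" "q - Suc (Suc k) = m" "Suc m < q" using k by (auto simp: m_def)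
    have "stationary \<theta> m" using b m by (simp add: bvp_def)
    moreover have "of_int p - \<theta> (Suc m) + \<omega> = of_int p - (\<theta> (Suc m) - \<omega>)" "of_int p - \<theta> (Suc m) - \<omega> = of_int p - (\<theta> (Suc m) + \<omega>)"
      by auto
    ultimately show "stationary (reverse \<theta>) k"
      unfolding stationary_def reverse_def m by (simp only: h_int_minus)
  qed
  have gf: "generating_function V (h (reverse \<theta> k)) (h (reverse \<theta> (Suc k))) = (h (\<theta> (q - Suc k)) - h (\<theta> (q - k)))\<^sup>2 / 2 + Nf (\<theta> (q - k))" if "k < q" for k
  proof -
    have "Nf (reverse \<theta> k) = Nf (\<theta> (q - k))" using Nf_add_int[of "- \<theta> (q - k)" p] by (simp add: reverse_def Nf_minus)
    then show ?thesis by (simp add: generating_function_def V_h) (simp add: reverse_def h_int_minus power2_commute)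
  qed
  have "(\<Sum>k<q. generating_function V (h (reverse \<theta> k)) (h (reverse \<theta> (Suc k))))
      = (\<Sum>k<q. (h (\<theta> (q - Suc k)) - h (\<theta> (q - k)))\<^sup>2 / 2 + Nf (\<theta> (q - k)))"
    by (rule sum.cong) (use gf in auto)
  also have "\<dots> = (\<Sum>k<q. (h (\<theta> k) - h (\<theta> (Suc k)))\<^sup>2 / 2 + Nf (\<theta> (Suc k)))"
    by (rule sum.reindex_bij_witness[where i="\<lambda>k. q - Suc k" and j="\<lambda>k. q - Suc k"]) (auto simp: Suc_diff_Suc)
  also have "\<dots> = (\<Sum>k<q. (h (\<theta> k) - h (\<theta> (Suc k)))\<^sup>2 / 2) + (\<Sum>k<q. Nf (\<theta> (Suc k)))"
    by (simp add: sum.distrib)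
  also have "(\<Sum>k<q. Nf (\<theta> (Suc k))) = (\<Sum>k<q. Nf (\<theta> k))"
  proof -
    have "(\<Sum>k<q. Nf (\<theta> (Suc k))) + Nf (\<theta> 0) = (\<Sum>k<Suc q. Nf (\<theta> k))" by (subst sum.lessThan_Suc_shift) simp
    also have "\<dots> = (\<Sum>k<q. Nf (\<theta> k)) + Nf (\<theta> 0)" using b by (simp add: bvp_def Nf_add_int)
    finally show ?thesis by simp
  qed
  also have "(\<Sum>k<q. (h (\<theta> k) - h (\<theta> (Suc k)))\<^sup>2 / 2) + (\<Sum>k<q. Nf (\<theta> k)) = (\<Sum>k<q. generating_function V (h (\<theta> k)) (h (\<theta> (Suc k))))"
    by (simp add: generating_function_def V_h sum.distrib)
  finally show "(\<Sum>k<q. Lr (reverse \<theta> k) (reverse \<theta> (Suc k))) = (\<Sum>k<q. Lr (\<theta> k) (\<theta> (Suc k)))"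
    using sum_Lr[OF per] sum_Lr[of \<theta>] b by (simp add: bvp_def)
qed

text \<open>The reversal of the solution through \<phi> starts at p - \<theta> q = - \<phi> and has
  the same excess.\<close>

lemma Mw_even: "Mw t (of_real (- \<phi>)) = Mw t (of_real \<phi>)"
proof -
  have b: "bvp (sol \<phi>)" by (rule sol_bvp)
  have "reverse (sol \<phi>) 0 = - \<phi>" using b by (simp add: reverse_def bvp_def)
  then show ?thesis using bvp_Mw[OF b] bvp_Mw[OF bvp_reverse(1)[OF b]] bvp_reverse(2)[OF b] by simp
qed

text \<open>The reversal also starts at 0, so by uniqueness the solution through 0 is its own
  reversal.\<close>

lemma sol_0_symmetric: "k \<le> q \<Longrightarrow> sol 0 (q - k) = of_int p - sol 0 k"
proof -
  assume k: "k \<le> q"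
  define r where "r = reverse (sol 0)"
  have b: "bvp r" unfolding r_def by (rule bvp_reverse(1)[OF sol_bvp])
  have r0: "r 0 = 0" using sol_bvp[of 0] by (simp add: r_def reverse_def bvp_def)
  have y: "yof r i = yof (sol 0) i" if "i < q" for i
    using bvp_ysol[OF b that] bvp_ysol[OF sol_bvp[of 0] that] r0 by (metis of_real_eq_iff sol_0)
  have "(\<Sum>i<k. yof r i) = (\<Sum>i<k. yof (sol 0) i)" by (rule sum.cong) (use y k in auto)
  then have "r k = sol 0 k" using eps r0 by (simp add: sum_yof)
  then show ?thesis by (simp add: r_def reverse_def)
qed

definition m0 :: real where "m0 = real q * \<epsilon>\<^sup>2 / (2 * Re (Mw t 0))"

lemma Mw_lower: "Re (Mw t (of_real \<phi>)) \<ge> 1/2"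
proof -
  have 1: "norm (Mw t (of_real \<phi>) - XX t (of_real \<phi>)) \<le> 1/1000" 
    using Mw_close(1)[OF adm, of "of_real \<phi>"] eps_q by simp
  have "norm (XX t (of_real \<phi>) - 1) \<le> 21/10000"
  proof -
    define f where "f = (\<lambda>k. t (of_real \<phi> + of_real (real k * of_int p / real q)) * t (of_real \<phi> + of_real (real k * of_int p / real q) + of_real \<omega>))"
    have "norm (f k - 1) \<le> 21/10000" for k
    proof -
      define a where "a = of_real \<phi> + (of_real (real k * of_int p / real q) :: complex)"
      have s: "a \<in> strip" "a + of_real \<omega> \<in> strip" by (auto simp: a_def strip_def)
      have "f k - 1 = (t a - 1) * t (a + of_real \<omega>) + (t (a + of_real \<omega>) - 1)" by (simp add: f_def a_def algebra_simps)
      also have "norm \<dots> \<le> (1/1000) * (1001/1000) + 1/1000"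
        by (intro order_trans[OF norm_triangle_ineq] add_mono norm_mult_le adm_bounds[OF adm] s)
      finally show ?thesis by simp
    qed
    then have "norm (\<Sum>k<q. f k - 1) \<le> (\<Sum>k<q. 21/10000)" by (intro sum_norm_le) auto
    moreover have "XX t (of_real \<phi>) - 1 = (\<Sum>k<q. f k - 1) / of_nat q"
      using q by (simp add: XX_def f_def sum_subtractf field_simps)
    ultimately show ?thesis using q by (simp add: norm_divide divide_le_eq)
  qed
  then have "norm (Mw t (of_real \<phi>) - 1) \<le> 1/1000 + 21/10000"
    using 1 norm_triangle_ineq[of "Mw t (of_real \<phi>) - XX t (of_real \<phi>)" "XX t (of_real \<phi>) - 1"] by simp
  then show ?thesis using abs_Re_le_cmod[of "Mw t (of_real \<phi>) - 1"] by simp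
qed

lemma standard_map_step:
  "standard_map V (x, y) = (x + y + deriv V x, y + deriv V x)"
  by (simp add: standard_map_def)

text \<open>The equation missing at the closing site holds by symmetry: the point there is 0, its
  two neighbours are opposite, and V' vanishes at 0. The solution through 0 is therefore a genuine
  periodic orbit.\<close>

lemma minimal_orbit: "of_int p * U 1 + m0 \<in> periodic_actions V p q"
proof -
  define \<theta> where "\<theta> = sol 0"
  have b: "bvp \<theta>" unfolding \<theta>_def by (rule sol_bvp)
  have \<theta>0: "\<theta> 0 = 0" by (simp add: \<theta>_def)
  have \<theta>q: "\<theta> q = of_int p" using b \<theta>0 by (simp add: bvp_def)
  \<comment> \<open>The orbit shifted by one site: X 1 is the closing site, and X 0 is its
    predecessor, translated back by p. The momentum at a site is the difference to the preceding
    site, so the orbit must be started at X 1.\<close>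
  define X where "X = (\<lambda>k. case k of 0 \<Rightarrow> h (\<theta> (q - 1)) - of_int p | Suc k \<Rightarrow> h (\<theta> k))"
  define z where "z = (X 1, X 1 - X 0)"
  have step: "deriv V (X (Suc k)) = X (Suc (Suc k)) - 2 * X (Suc k) + X k" if "k < q" for k
  proof (cases k)
    case 0
    have "\<theta> (q - 1) = of_int p - \<theta> 1" unfolding \<theta>_def using q by (intro sol_0_symmetric) simp
    then have "X 0 = - h (\<theta> 1)" by (simp add: X_def h_int_minus)
    moreover have "deriv V (X 1) = 0" using deriv_V_h[of 0] h_minus[of \<omega>] by (simp add: X_def \<theta>0)
    ultimately show ?thesis using 0 by (simp add: X_def \<theta>0)
  next
    case (Suc m)
    then have "stationary \<theta> m" using b that by (simp add: bvp_def)
    then show ?thesis using Suc deriv_V_h[of "\<theta> (Suc m)"] by (simp add: X_def stationary_def)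
  qed
  have orb: "(standard_map V ^^ k) z = (X (Suc k), X (Suc k) - X k)" if "k \<le> q" for k
    using that
  proof (induction k)
    case 0 then show ?case by (simp add: z_def)
  next
    case (Suc k)
    then show ?case using step[of k] by (simp add: standard_map_step)
  qed
  have "(standard_map V ^^ q) z = (fst z + of_int p, snd z)"
  proof -
    obtain m where m: "q = Suc m" using q by (metis gr0_conv_Suc)
    have "h (\<theta> q) = of_int p" using h_add_int[of 0 p] \<theta>q by simp
    then show ?thesis using orb[of q] m by (simp add: z_def X_def \<theta>0)
  qed
  then have pp: "periodic_point V p q z" by (simp add: periodic_point_def)
  have "orbit_action V q z = (\<Sum>k<q. generating_function V (h (\<theta> k)) (h (\<theta> (Suc k))))"
    unfolding orbit_action_def
  proof (rule sum.cong)
    fix k assume "k \<in> {..<q}"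
    then show "generating_function V (fst ((standard_map V ^^ k) z)) (fst ((standard_map V ^^ Suc k) z)) = generating_function V (h (\<theta> k)) (h (\<theta> (Suc k)))"
      using orb[of k] orb[of "Suc k"] by (simp add: X_def del: funpow.simps)
  qed simp
  also have "\<dots> = of_int p * U 1 + (\<Sum>k<q. Lr (\<theta> k) (\<theta> (Suc k)))" using sum_Lr[of \<theta>] b by (simp add: bvp_def)
  also have "(\<Sum>k<q. Lr (\<theta> k) (\<theta> (Suc k))) = m0"
  proof -
    define A where "A = (\<Sum>k<q. Lr (\<theta> k) (\<theta> (Suc k)))"
    have R: "Re (Mw t 0) = real q * \<epsilon>\<^sup>2 / (2 * A)" using bvp_Mw[OF b] \<theta>0 by (simp add: A_def)
    then have "A \<noteq> 0" using Mw_lower[of 0] by auto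
    then show ?thesis unfolding m0_def R A_def[symmetric] using q eps by simp
  qed
  finally have e: "orbit_action V q z = of_int p * U 1 + m0" .
  show ?thesis unfolding e[symmetric] periodic_actions_def using pp by blast
qed

lemma standard_map_translate:
  "(standard_map V ^^ k) (a + of_int n, b) = (fst ((standard_map V ^^ k) (a, b)) + of_int n, snd ((standard_map V ^^ k) (a, b)))"
proof (induction k)
  case (Suc k)
  obtain c d where cd: "(standard_map V ^^ k) (a, b) = (c, d)" by fastforce
  then show ?case using Suc by (simp add: standard_map_step deriv_V_add_int)
qed simp

lemma Lr_add_int: "Lr (x + of_int n) (x' + of_int n) = Lr x x'"
  by (simp add: Lr_def h_add_int Nf_add_int U_add_int)

lemma Re_Mw_0: "Re (Mw t 0) = real q * \<epsilon>\<^sup>2 / (2 * m0)" "m0 > 0" "m0 \<le> real q * \<epsilon>\<^sup>2"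
proof -
  have M: "Re (Mw t 0) \<ge> 1/2" using Mw_lower[of 0] by simp
  have e: "real q * \<epsilon>\<^sup>2 > 0" using q eps by simp
  have "R = E / (2 * (E / (2 * R)))" if "R \<ge> 1/2" "E > 0" for R E :: real using that by simp
  from this[OF M e] show "Re (Mw t 0) = real q * \<epsilon>\<^sup>2 / (2 * m0)" unfolding m0_def .
  show "m0 > 0" unfolding m0_def using M e by (intro divide_pos_pos) auto
  have "m0 \<le> real q * \<epsilon>\<^sup>2 / 1" unfolding m0_def using M e by (intro divide_left_mono) auto
  then show "m0 \<le> real q * \<epsilon>\<^sup>2" by simp
qed

text \<open>As p is invertible modulo q, the multiples of p / q meet every class m / q modulo
  1.\<close>

lemma residue_exists:
  assumes "coprime p (int q)"
  shows "\<exists>k n. k < q \<and> int k * p = m + n * int q"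
proof -
  obtain u v where uv: "u * p + v * int q = 1" using bezout_int[of p "int q"] assms by (auto simp: coprime_iff_gcd_eq_1)
  define k where "k = nat ((u * m) mod int q)"
  have "int k = (u * m) mod int q" using q by (simp add: k_def)
  then have kq: "int k = u * m - int q * (u * m div int q)" by (metis minus_mult_div_eq_mod)
  have "int k * p = m * (u * p) - int q * (u * m div int q) * p" by (simp add: kq algebra_simps)
  also have "u * p = 1 - v * int q" using uv by simp
  finally have "int k * p = m + (- m * v - (u * m div int q) * p) * int q" by (simp add: algebra_simps)
  moreover have "k < q" using q by (simp add: k_def nat_less_iff)
  ultimately show ?thesis by blast
qed

text \<open>An orbit of smaller action has small excess, hence all its steps are bounded and it is a
  \<open>bvp\<close> whichever site is taken as the start. Starting at a site near 0, its excess is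
  given by \<open>Mw\<close> at an angle where \<open>Mw\<close> does not exceed its value at 0; so
  the excess is at least \<open>m0\<close>.\<close>

lemma action_lower:
  assumes cop: "coprime p (int q)"
    and max: "\<And>\<phi>. \<bar>\<phi>\<bar> \<le> 6/10 / real q \<Longrightarrow> Re (Mw t (of_real \<phi>)) \<le> Re (Mw t 0)"
    and a: "a \<in> periodic_actions V p q"
  shows "of_int p * U 1 + m0 \<le> a"
proof (rule ccontr)
  assume less: "\<not> of_int p * U 1 + m0 \<le> a"
  obtain z where z: "a = orbit_action V q z" "periodic_point V p q z" using a by (auto simp: periodic_actions_def)
  define x where "x = (\<lambda>k. fst ((standard_map V ^^ k) z))"
  define y where "y = (\<lambda>k. snd ((standard_map V ^^ k) z))"
  have xy: "(standard_map V ^^ k) z = (x k, y k)" for k by (simp add: x_def y_def)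
  have step: "x (Suc k) = x k + y k + deriv V (x k)" "y (Suc k) = x (Suc k) - x k" for k
    using xy[of "Suc k"] xy[of k] by (auto simp: standard_map_step)
  have EL: "x (Suc (Suc k)) - 2 * x (Suc k) + x k = deriv V (x (Suc k))" for k
    using step(1)[of "Suc k"] step(2)[of k] by simp
  have per: "x (k + q) = x k + of_int p" for k
  proof -
    have "(standard_map V ^^ (k + q)) z = (standard_map V ^^ k) (fst z + of_int p, snd z)"
      using z(2) by (simp add: funpow_add periodic_point_def)
    then show ?thesis using standard_map_translate[of k "fst z" p "snd z"] xy[of "k + q"] xy[of k] by simp
  qed
  define \<theta> where "\<theta> = (\<lambda>k. hi (x k))"
  have h\<theta>: "h (\<theta> k) = x k" for k by (simp add: \<theta>_def)
  have stat: "stationary \<theta> k" for k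
    using EL[of k] deriv_V_h[of "\<theta> (Suc k)"] by (simp add: stationary_def h\<theta>)
  have \<theta>per: "\<theta> (k + q) = \<theta> k + of_int p" for k by (simp add: \<theta>_def per hi_add_int)
  define A where "A = (\<Sum>k<q. Lr (\<theta> k) (\<theta> (Suc k)))"
  have aA: "a = of_int p * U 1 + A"
    using sum_Lr[of \<theta>] \<theta>per[of 0] z(1) unfolding A_def orbit_action_def xy h\<theta> by simp
  with less have Am: "A < m0" by simp
  have v: "\<theta> (Suc k) = \<theta> k + \<omega> + (- \<epsilon> * yof \<theta> k)" for k using eps by (simp add: yof_def)
  have Lr3: "(\<epsilon> * yof \<theta> k)\<^sup>2 / 3 \<le> Lr (\<theta> k) (\<theta> (Suc k))" for k
    using Lr_lower[of "- \<epsilon> * yof \<theta> k" "\<theta> k"] v[of k] by simp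
  have Lr0: "0 \<le> Lr (\<theta> k) (\<theta> (Suc k))" for k using Lr3[of k] order_trans[of 0] by (meson divide_nonneg_nonneg zero_le_numeral zero_le_power2)
  \<comment> \<open>One summand, at least (\<epsilon> * y)^2 / 3, is bounded by the whole excess,
    which is less than m0 \<le> q * \<epsilon>^2; this gives y^2 \<le> 3 * q.\<close>
  have yq: "\<bar>yof \<theta> k\<bar> \<le> 3 * real q" if k: "k < q" for k
  proof -
    have "Lr (\<theta> k) (\<theta> (Suc k)) \<le> A" unfolding A_def by (rule member_le_sum) (use k Lr0 in auto)
    then have "(\<epsilon> * yof \<theta> k)\<^sup>2 / 3 \<le> real q * \<epsilon>\<^sup>2" using Lr3[of k] Am Re_Mw_0(3) by linarith
    then have "\<epsilon>\<^sup>2 * (yof \<theta> k)\<^sup>2 \<le> \<epsilon>\<^sup>2 * (3 * real q)" by (simp add: power_mult_distrib mult_ac)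
    then have "(yof \<theta> k)\<^sup>2 \<le> 3 * real q" using eps by simp
    also have "\<dots> \<le> (3 * real q)\<^sup>2" using q by (simp add: power2_eq_square)
    finally show ?thesis using abs_le_square_iff[of "yof \<theta> k" "3 * real q"] by simp
  qed
  have yper: "yof \<theta> (k + q) = yof \<theta> k" for k using \<theta>per[of k] \<theta>per[of "Suc k"] by (simp add: yof_def)
  have yb: "\<bar>yof \<theta> k\<bar> \<le> 3 * real q" for k
  proof (induction k rule: less_induct)
    case (less k)
    show ?case
    proof (cases "k < q")
      case False
      then show ?thesis using less.IH[of "k - q"] yper[of "k - q"] q by simp
    qed (rule yq)
  qed
  have shift: "bvp (\<lambda>k. \<theta> (k + l) + of_int n)" "(\<Sum>k<q. Lr (\<theta> (k + l) + of_int n) (\<theta> (Suc k + l) + of_int n)) = A" for l n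
  proof -
    show "bvp (\<lambda>k. \<theta> (k + l) + of_int n)"
      unfolding bvp_def
    proof (intro conjI allI impI)
      show "\<theta> (q + l) + of_int n = \<theta> (0 + l) + of_int n + of_int p" using \<theta>per[of l] by (simp add: add.commute)
      fix k
      have "yof (\<lambda>k. \<theta> (k + l) + of_int n) k = yof \<theta> (k + l)" by (simp add: yof_def)
      then show "\<bar>yof (\<lambda>k. \<theta> (k + l) + of_int n) k\<bar> \<le> 3 * real q" using yb by simp
      have e: "x + of_int n + \<omega> = (x + \<omega>) + of_int n" "x + of_int n - \<omega> = (x - \<omega>) + of_int n" for x by auto
      show "stationary (\<lambda>k. \<theta> (k + l) + of_int n) k"
        using stat[of "k + l"] unfolding stationary_def e h_add_int by simp
    qed
    show "(\<Sum>k<q. Lr (\<theta> (k + l) + of_int n) (\<theta> (Suc k + l) + of_int n)) = A"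
      using sum_shift_periodic[of "\<lambda>k. Lr (\<theta> k) (\<theta> (Suc k))" q l] \<theta>per \<theta>per[of "Suc _"]
      by (simp add: Lr_add_int A_def)
  qed
  \<comment> \<open>The multiple of 1 / q that brings \<theta> 0 closest to 0.\<close>
  define m where "m = round (- real q * \<theta> 0)"
  have m: "\<bar>\<theta> 0 + of_int m / real q\<bar> \<le> 5/10 / real q"
  proof -
    have "\<bar>of_int m - (- real q * \<theta> 0)\<bar> \<le> 5/10" using of_int_round_abs_le[of "- real q * \<theta> 0"] by (simp add: m_def)
    then have "\<bar>of_int m - (- real q * \<theta> 0)\<bar> / real q \<le> 5/10 / real q" by (rule divide_right_mono) simp
    moreover have "\<theta> 0 + of_int m / real q = (of_int m - (- real q * \<theta> 0)) / real q" using q by (simp add: field_simps)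
    ultimately show ?thesis by (simp only: abs_divide abs_of_nat)
  qed
  \<comment> \<open>Site l of the orbit lies near \<theta> 0 + m / q + n, hence near 0 modulo
    1.\<close>
  obtain l n where ln: "l < q" "int l * p = m + n * int q" using residue_exists[OF cop] by blast
  have b0: "bvp \<theta>" using shift(1)[of 0 0] by simp
  have y1: "\<bar>1 - yof \<theta> k\<bar> \<le> 1/32" if "k < q" for k
  proof -
    have "norm (ysol t (of_real (\<theta> 0)) k - 1) \<le> 1/32" by (rule ysol_bound(1)[OF adm]) simp
    then have "norm (of_real (yof \<theta> k - 1) :: complex) \<le> 1/32" unfolding bvp_ysol[OF b0 that] by simp
    then show ?thesis unfolding norm_of_real by linarith
  qed
  define \<phi> where "\<phi> = \<theta> (0 + l) + of_int (- n)"
  have "\<epsilon> * (\<Sum>k<l. yof \<theta> k) = \<theta> 0 + real l * \<omega> - \<theta> l" using eps by (simp add: sum_yof)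
  moreover have "real l * \<omega> = of_int m / real q + of_int n + real l * \<epsilon>"
  proof -
    have "real l * of_int p = of_int m + of_int n * real q" using ln(2) by (metis of_int_add of_int_mult of_int_of_nat_eq)
    then show ?thesis using q by (simp add: om distrib_left field_simps)
  qed
  moreover have "\<epsilon> * (\<Sum>k<l. 1 - yof \<theta> k) = real l * \<epsilon> - \<epsilon> * (\<Sum>k<l. yof \<theta> k)" by (simp add: sum_subtractf algebra_simps)
  ultimately have \<phi>: "\<phi> = (\<theta> 0 + of_int m / real q) + \<epsilon> * (\<Sum>k<l. 1 - yof \<theta> k)" by (simp add: \<phi>_def)
  have "\<bar>\<Sum>k<l. 1 - yof \<theta> k\<bar> \<le> (\<Sum>k<l. 1/32)" by (rule order_trans[OF sum_abs sum_mono]) (use y1 ln in auto)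
  also have "\<dots> \<le> real q" using ln by simp
  finally have "\<bar>\<epsilon> * (\<Sum>k<l. 1 - yof \<theta> k)\<bar> \<le> \<bar>\<epsilon>\<bar> * real q" unfolding abs_mult by (intro mult_left_mono) auto
  \<comment> \<open>The deviation of the orbit from the grid enlarges the radius 5/10 / q given by
    rounding to 6/10 / q.\<close>
  also have "\<dots> \<le> 1/10 / real q" using small q by (simp add: field_simps power2_eq_square)
  finally have "\<bar>\<phi>\<bar> \<le> 5/10 / real q + 1/10 / real q" unfolding \<phi>
    by (intro order_trans[OF abs_triangle_ineq] add_mono m)
  then have "\<bar>\<phi>\<bar> \<le> 6/10 / real q" by (simp add: add_divide_distrib[symmetric])
  note max' = max[OF this]
  have MA: "Mw t (of_real \<phi>) = of_real (real q * \<epsilon>\<^sup>2 / (2 * A))"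
    using bvp_Mw[OF shift(1)[of l "-n"]] by (simp only: shift(2) \<phi>_def)
  have le: "real q * \<epsilon>\<^sup>2 / (2 * A) \<le> real q * \<epsilon>\<^sup>2 / (2 * m0)"
    using max' unfolding Re_Mw_0(1) MA Re_complex_of_real .
  have "real q * \<epsilon>\<^sup>2 / (2 * A) > 0"
    using Mw_lower[of \<phi>] unfolding MA Re_complex_of_real by linarith
  moreover have e: "real q * \<epsilon>\<^sup>2 > 0" using q eps by simp
  ultimately have "A > 0" by (simp add: zero_less_divide_iff)
  then have "real q * \<epsilon>\<^sup>2 / (2 * m0) < real q * \<epsilon>\<^sup>2 / (2 * A)"
    using Am e by (intro divide_strict_left_mono) auto
  then show False using le by simp
qed

lemma Least_periodic_actions:
  assumes "coprime p (int q)"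
    and "\<And>\<phi>. \<bar>\<phi>\<bar> \<le> 6/10 / real q \<Longrightarrow> Re (Mw t (of_real \<phi>)) \<le> Re (Mw t 0)"
  shows "(LEAST a. a \<in> periodic_actions V p q) = of_int p * U 1 + m0"
proof (rule Least_equality[where P="\<lambda>a. a \<in> periodic_actions V p q", OF minimal_orbit])
  show "of_int p * U 1 + m0 \<le> a" if "a \<in> periodic_actions V p q" for a
    using action_lower[OF assms(1) _ that] assms(2) by blast
qed

end

section \<open>Maximality of the reciprocal excess at the symmetric orbit\<close>

lemma norm_cos_sin_le_exp_Im: "norm (cos w) \<le> exp \<bar>Im w\<bar>" "norm (sin w) \<le> exp \<bar>Im w\<bar>"
proof -
  have 1: "norm (exp (\<i> * w)) \<le> exp \<bar>Im w\<bar>" "norm (exp (- (\<i> * w))) \<le> exp \<bar>Im w\<bar>"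
    by (auto simp: norm_exp_eq_Re)
  have "norm (exp (\<i> * w) + exp (- (\<i> * w))) \<le> 2 * exp \<bar>Im w\<bar>" "norm (exp (\<i> * w) - exp (- (\<i> * w))) \<le> 2 * exp \<bar>Im w\<bar>"
    using 1 norm_triangle_ineq[of "exp (\<i> * w)" "exp (- (\<i> * w))"] norm_triangle_ineq4[of "exp (\<i> * w)" "exp (- (\<i> * w))"] by linarith+
  then show "norm (cos w) \<le> exp \<bar>Im w\<bar>" "norm (sin w) \<le> exp \<bar>Im w\<bar>"
    by (auto simp: cos_exp_eq sin_exp_eq norm_divide norm_mult)
qed

text \<open>With x = pi * |y| at most 1.89, sin x \<ge> x * (1 - x^2 / 6) \<ge> (4/10) * x, and 1 -
  cos (2 * x) = 2 * (sin x)^2. The range extends slightly beyond half a period to allow for the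
  deviation of orbits from the grid.\<close>

lemma one_minus_cos_lower:
  assumes "\<bar>y\<bar> \<le> 6/10" shows "2 * y\<^sup>2 \<le> 1 - cos (2 * pi * y)"
proof -
  define x where "x = pi * \<bar>y\<bar>"
  have pi: "3 \<le> pi" "pi \<le> 315/100" using pi_gt3 pi_approx by auto
  have x: "0 \<le> x" "x \<le> 189/100" using assms pi mult_mono[of pi "315/100" "\<bar>y\<bar>" "6/10"] by (auto simp: x_def)
  have "\<bar>sin x - (\<Sum>m<3. sin_coeff m * x ^ m)\<bar> \<le> inverse (fact 3) * \<bar>x\<bar> ^ 3" by (rule Maclaurin_sin_bound)
  moreover have "(\<Sum>m<3. sin_coeff m * x ^ m) = x" by (simp add: sin_coeff_def eval_nat_numeral)
  moreover have "inverse (fact 3) * \<bar>x\<bar> ^ 3 = x * (x\<^sup>2 / 6)" using x by (simp add: eval_nat_numeral power2_eq_square)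
  ultimately have "x - x * (x\<^sup>2 / 6) \<le> sin x" by (simp only: abs_le_iff) linarith
  then have "x * (1 - x\<^sup>2 / 6) \<le> sin x" by (simp add: right_diff_distrib)
  moreover have "x\<^sup>2 \<le> (189/100)\<^sup>2" using x by (intro power_mono) auto
  then have "4/10 \<le> 1 - x\<^sup>2 / 6" by (simp add: power2_eq_square)
  then have "x * (4/10) \<le> x * (1 - x\<^sup>2 / 6)" using x by (intro mult_left_mono) auto
  ultimately have s: "x * (4/10) \<le> sin x" by linarith
  have "3 * \<bar>y\<bar> \<le> x" unfolding x_def using pi by (intro mult_right_mono) auto
  then have "12/10 * \<bar>y\<bar> \<le> sin x" using s by linarith
  then have "(12/10 * \<bar>y\<bar>)\<^sup>2 \<le> (sin x)\<^sup>2" by (intro power_mono) auto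
  then have "2 * (144/100 * y\<^sup>2) \<le> 2 * (sin x)\<^sup>2" by (simp add: power_mult_distrib power2_eq_square)
  moreover have "cos (2 * x) = 1 - 2 * (sin x)\<^sup>2" by (rule cos_double_sin)
  moreover have "cos (2 * x) = cos (2 * pi * y)" by (cases "y \<ge> 0") (auto simp: x_def mult.assoc)
  moreover have "0 \<le> y\<^sup>2" by simp
  ultimately show ?thesis by linarith
qed

text \<open>Evenness along the real axis already forces the derivative at 0 to vanish. Cauchy's
  inequality on discs of radius 39/100, which stay in the unit disc, bounds the second derivative,
  since 2 / (39/100)^2 < 14.\<close>

lemma even_holomorphic_increment:
  assumes hol: "e holomorphic_on ball 0 1" and bd: "\<And>w. w \<in> ball 0 1 \<Longrightarrow> norm (e w) \<le> \<eta>"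
    and even: "\<And>x::real. \<bar>x\<bar> < 1 \<Longrightarrow> e (of_real (- x)) = e (of_real x)" and x: "\<bar>x\<bar> \<le> 6/10"
  shows "norm (e (of_real x) - e 0) \<le> 14 * \<eta> * x\<^sup>2"
proof -
  have \<eta>: "0 \<le> \<eta>" using order_trans[OF norm_ge_zero bd[of 0]] by simp
  have d: "(e has_field_derivative deriv e 0) (at (of_real 0))"
    using holomorphic_derivI[OF hol open_ball, of 0] by simp
  have 1: "((\<lambda>x. e (of_real x)) has_vector_derivative deriv e 0) (at 0)"
    by (rule has_vector_derivative_real_field[OF d])
  have "((\<lambda>w. e (- w)) has_field_derivative - deriv e 0) (at (of_real 0))"
    using DERIV_chain2[of e "deriv e 0" "\<lambda>w. - w" 0 "-1" UNIV] d DERIV_minus[OF DERIV_ident, of "0::complex"] by simp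
  then have "((\<lambda>x. e (- of_real x)) has_vector_derivative - deriv e 0) (at 0)"
    by (rule has_vector_derivative_real_field)
  then have "((\<lambda>x. e (of_real x)) has_vector_derivative - deriv e 0) (at 0)"
    by (rule has_vector_derivative_transform_within_open[of _ _ _ "{-1<..<1}"]) (use even in auto)
  with 1 have "deriv e 0 = - deriv e 0" by (rule vector_derivative_unique_at)
  then have d0: "deriv e 0 = 0" by simp
  have second: "norm ((deriv ^^ 2) e w) \<le> 14 * \<eta>" if w: "w \<in> cball 0 (6/10)" for w
  proof -
    have sub: "cball w (39/100) \<subseteq> ball 0 1"
    proof
      fix u assume "u \<in> cball w (39/100)"
      then have "norm (u - w) \<le> 39/100" by (simp add: dist_norm norm_minus_commute)
      then show "u \<in> ball 0 1" using w norm_triangle_sub[of u w] by simp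
    qed
    have "norm ((deriv ^^ 2) e w) \<le> fact 2 * \<eta> / (39/100) ^ 2"
    proof (rule Cauchy_inequality)
      show "e holomorphic_on ball w (39/100)" using hol sub by (meson ball_subset_cball holomorphic_on_subset order_trans)
      show "continuous_on (cball w (39/100)) e" using hol sub by (meson holomorphic_on_imp_continuous_on holomorphic_on_subset)
      show "norm (e u) \<le> \<eta>" if "norm (w - u) = 39/100" for u
      proof -
        have "u \<in> cball w (39/100)" using that by (simp add: dist_norm)
        then show ?thesis using sub by (intro bd) blast
      qed
    qed simp
    also have "\<dots> \<le> 14 * \<eta>" using \<eta> by (simp add: power2_eq_square)
    finally show ?thesis .
  qed
  have "norm ((deriv ^^ 0) e (of_real x) - (\<Sum>i\<le>1. (deriv ^^ i) e 0 * (of_real x - 0) ^ i / fact i)) \<le> (14 * \<eta>) * norm (of_real x - (0::complex)) ^ (Suc 1) / fact 1"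
  proof (rule complex_Taylor[where S="cball 0 (6/10)"])
    show "((deriv ^^ i) e has_field_derivative (deriv ^^ Suc i) e w) (at w within cball 0 (6/10))"
      if "w \<in> cball 0 (6/10)" "i \<le> 1" for i w
    proof -
      have "(deriv ^^ i) e holomorphic_on ball 0 1" using hol by (rule holomorphic_higher_deriv) simp
      then have "((deriv ^^ i) e has_field_derivative deriv ((deriv ^^ i) e) w) (at w)"
        by (rule holomorphic_derivI) (use that in auto)
      then show ?thesis by (simp add: has_field_derivative_at_within)
    qed
    show "norm ((deriv ^^ Suc 1) e w) \<le> 14 * \<eta>" if "w \<in> cball 0 (6/10)" for w
      using second[OF that] by (simp add: numeral_2_eq_2)
  qed (use x in auto)
  then show ?thesis by (simp add: d0 power2_eq_square)
qed

context nr_circle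
begin

text \<open>In the scaled variable y = q * \<phi> the cosine model drops by at least 2 * B * y^2,
  while the even error of size B / 20 rises by at most (14/20) * B * y^2. Evenness is essential: a
  general error would have a linear part that moves the maximum.\<close>

lemma Mw_max:
  assumes q100: "q \<ge> 100" and B: "B > 0"
    and close: "\<And>\<phi>. norm \<phi> < 1 / real q \<Longrightarrow> norm (Mw t \<phi> - (J + of_real B * cos (of_real (2 * pi * real q) * \<phi>))) \<le> B / 20"
    and \<phi>: "\<bar>\<phi>\<bar> \<le> 6/10 / real q"
  shows "Re (Mw t (of_real \<phi>)) \<le> Re (Mw t 0)"
proof -
  define e where "e = (\<lambda>w. Mw t (w / of_nat q) - (J + of_real B * cos (of_real (2 * pi) * w)))"
  define y where "y = real q * \<phi>"
  have qr: "real q > 0" using q by simp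
  have y: "\<bar>y\<bar> \<le> 6/10" using \<phi> qr by (simp add: y_def abs_mult field_simps)
  have wq: "norm (w / of_nat q) < 1 / real q" if "w \<in> ball 0 1" for w :: complex
    using that qr by (simp add: norm_divide divide_strict_right_mono)
  have "norm (e (of_real y) - e 0) \<le> 14 * (B/20) * y\<^sup>2"
  proof (rule even_holomorphic_increment[OF _ _ _ y])
    have "(\<lambda>w. Mw t (w / of_nat q)) holomorphic_on ball 0 1"
    proof (rule Mw_holomorphic[OF holfam_const[OF adm]])
      show "(\<lambda>w. w / of_nat q) holomorphic_on ball 0 1" by (intro holomorphic_intros) (use q in auto)
      fix w :: complex assume "w \<in> ball 0 1"
      then have "norm (w / of_nat q) < 1 / real q" by (rule wq)
      also have "\<dots> \<le> 1 / 100" using q100 by (intro divide_left_mono) auto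
      finally show "\<bar>Im (w / of_nat q)\<bar> \<le> 1/17" using abs_Im_le_cmod[of "w / of_nat q"] by linarith
    qed simp
    then show "e holomorphic_on ball 0 1" unfolding e_def by (intro holomorphic_intros)
    show "norm (e w) \<le> B / 20" if "w \<in> ball 0 1" for w
    proof -
      have "of_real (2 * pi * real q) * (w / of_nat q) = of_real (2 * pi) * w" using q by simp
      then show ?thesis using close[OF wq[OF that]] by (simp only: e_def)
    qed
    fix x :: real
    have "Mw t (of_real (- (x / real q))) = Mw t (of_real (x / real q))" by (rule Mw_even)
    then show "e (of_real (- x)) = e (of_real x)" by (simp add: e_def)
  qed
  then have "Re (e (of_real y) - e 0) \<le> 14 * (B/20) * y\<^sup>2" using complex_Re_le_cmod order_trans by blast
  moreover have "Re (e (of_real y) - e 0) = Re (Mw t (of_real \<phi>)) - Re (Mw t 0) + B * (1 - cos (2 * pi * y))"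
  proof -
    have "of_real y / of_nat q = (of_real \<phi> :: complex)" using q by (simp add: y_def)
    moreover have "cos (of_real (2 * pi) * of_real y) = (of_real (cos (2 * pi * y)) :: complex)"
      by (metis of_real_mult cos_of_real)
    ultimately show ?thesis by (simp only: e_def) (simp add: algebra_simps)
  qed
  moreover have "B * (2 * y\<^sup>2) \<le> B * (1 - cos (2 * pi * y))"
    using one_minus_cos_lower[OF y] B by (intro mult_left_mono) auto
  moreover have "0 \<le> B * y\<^sup>2" using B by simp
  moreover have "14 * (B/20) * y\<^sup>2 = 7/10 * (B * y\<^sup>2)" "B * (2 * y\<^sup>2) = 2 * (B * y\<^sup>2)" by simp_all
  ultimately show ?thesis by linarith
qed

end

section \<open>Averages of harmonics over a rational rotation\<close>

context near_rational
begin

text \<open>Coprimality makes exp (2 * pi * i * N * p / q) a q-th root of unity other than 1, so the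
  geometric sums of it and of its inverse vanish.\<close>

lemma grid_cos_sum:
  assumes cop: "coprime p (int q)" and N: "\<not> int q dvd N"
  shows "(\<Sum>k<q. cos (\<alpha> + of_real (2 * pi * of_int N * (real k * of_int p / real q)))) = (0::complex)"
proof -
  define b where "b = 2 * pi * of_int N * (of_int p / real q)"
  define z where "z = exp (\<i> * of_real b)"
  have z1: "z \<noteq> 1"
  proof
    assume "z = 1"
    then obtain n :: int where "b = of_int (2 * n) * pi" by (auto simp: z_def exp_eq_1)
    then have "of_int N * of_int p = of_int n * real q" using q by (simp add: b_def field_simps)
    then have "N * p = n * int q" by (metis of_int_eq_iff of_int_mult of_int_of_nat_eq)
    then have "int q dvd N * p" by simp
    then show False using N cop by (simp add: coprime_dvd_mult_left_iff coprime_commute)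
  qed
  have "z ^ q = exp (of_nat q * (\<i> * of_real b))" by (simp add: z_def exp_of_nat_mult)
  also have "of_nat q * (\<i> * of_real b) = 2 * of_int (N * p) * of_real pi * \<i>" using q by (simp add: b_def)
  also have "exp \<dots> = 1" unfolding exp_eq_1 by (auto intro!: exI[of _ "N * p"])
  finally have zq: "z ^ q = 1" .
  have z0: "z \<noteq> 0" by (simp add: z_def)
  have S1: "(\<Sum>k<q. z ^ k) = 0" using z1 zq by (simp add: sum_gp_strict)
  have S2: "(\<Sum>k<q. (inverse z) ^ k) = 0"
    using z1 zq by (subst sum_gp_strict) (simp add: power_inverse inverse_eq_1_iff)
  have "cos (\<alpha> + of_real (2 * pi * of_int N * (real k * of_int p / real q))) = exp (\<i> * \<alpha>) / 2 * z ^ k + exp (- (\<i> * \<alpha>)) / 2 * (inverse z) ^ k" for k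
  proof -
    have "of_real (2 * pi * of_int N * (real k * of_int p / real q)) = (of_nat k * of_real b :: complex)"
      by (simp add: b_def mult_ac)
    moreover have "z ^ k = exp (of_nat k * (\<i> * of_real b))" by (simp add: z_def exp_of_nat_mult)
    moreover have "(inverse z) ^ k = exp (- (of_nat k * (\<i> * of_real b)))"
      by (simp add: z_def exp_of_nat_mult exp_minus power_inverse)
    ultimately show ?thesis
      by (simp add: cos_exp_eq exp_add[symmetric] algebra_simps add_divide_distrib)
  qed
  then show ?thesis by (simp only: sum.distrib sum_distrib_left[symmetric] S1 S2) simp
qed

lemma grid_mean_cos:
  assumes cop: "coprime p (int q)" and n: "n < q"
  shows "(\<Sum>k<q. cos (of_real (2 * pi * real n) * (\<phi> + of_real (real k * of_int p / real q) + \<beta>))) / of_nat q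
     = (if n = 0 then 1 else (0::complex))"
proof (cases "n = 0")
  case False
  have nd: "\<not> int q dvd int n" using False n by (meson nat_dvd_not_less int_dvd_int_iff gr0I)
  have "of_real (2 * pi * real n) * (\<phi> + of_real (real k * of_int p / real q) + \<beta>)
     = of_real (2 * pi * real n) * (\<phi> + \<beta>) + of_real (2 * pi * of_int (int n) * (real k * of_int p / real q))" for k
    by (simp add: algebra_simps)
  then show ?thesis using grid_cos_sum[OF cop nd, of "of_real (2 * pi * real n) * (\<phi> + \<beta>)"] False by simp
qed (use q in simp)

text \<open>The product splits into the frequencies n - m and n + m, both of absolute value below q;
  a nonzero one of them is not divisible by q and averages out.\<close>

lemma grid_mean_cos_cos:
  assumes cop: "coprime p (int q)" and n: "2 * n < q" "2 * m < q"
  shows "(\<Sum>k<q. cos (of_real (2 * pi * real n) * (\<phi> + of_real (real k * of_int p / real q)))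
          * cos (of_real (2 * pi * real m) * (\<phi> + of_real (real k * of_int p / real q) + of_real \<omega>))) / of_nat q
     = (if n = m then if n = 0 then 1 else cos (of_real (2 * pi * real n * \<omega>)) / 2 else (0::complex))"
proof -
  define x where "x = (\<lambda>k. \<phi> + of_real (real k * of_int p / real q))"
  define A where "A = (\<lambda>k. of_real (2 * pi * real n) * x k)"
  define B where "B = (\<lambda>k. of_real (2 * pi * real m) * (x k + of_real \<omega>))"
  have *: "A k - B k = (of_real (2 * pi * of_int (int n - int m)) * \<phi> - of_real (2 * pi * real m * \<omega>))
       + of_real (2 * pi * of_int (int n - int m) * (real k * of_int p / real q))"
    "A k + B k = (of_real (2 * pi * of_int (int n + int m)) * \<phi> + of_real (2 * pi * real m * \<omega>))
       + of_real (2 * pi * of_int (int n + int m) * (real k * of_int p / real q))" for k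
    by (auto simp: A_def B_def x_def algebra_simps)
  have small: "\<not> int q dvd N" if "\<bar>N\<bar> < int q" "N \<noteq> 0" for N
    using that zdvd_not_zless[of "\<bar>N\<bar>" "int q"] by auto
  have S1: "(\<Sum>k<q. cos (A k - B k)) = (if n = m then of_nat q * cos (of_real (2 * pi * real n * \<omega>)) else 0)"
  proof (cases "n = m")
    case True then show ?thesis unfolding * by simp
  next
    case False
    have nd: "\<not> int q dvd (int n - int m)" using n False by (intro small) auto
    show ?thesis unfolding * grid_cos_sum[OF cop nd] using False by simp
  qed
  have S2: "(\<Sum>k<q. cos (A k + B k)) = (if n = 0 \<and> m = 0 then of_nat q else 0)"
  proof (cases "n = 0 \<and> m = 0")
    case True then show ?thesis unfolding * by simp
  next
    case False
    have nd: "\<not> int q dvd (int n + int m)" using n False by (intro small) auto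
    show ?thesis unfolding * grid_cos_sum[OF cop nd] by (simp only: False if_False)
  qed
  have "(\<Sum>k<q. cos (A k) * cos (B k)) = ((\<Sum>k<q. cos (A k - B k)) + (\<Sum>k<q. cos (A k + B k))) / 2"
    by (simp add: cos_times_cos sum.distrib[symmetric] sum_divide_distrib)
  also have "\<dots> = of_nat q * (if n = m then if n = 0 then 1 else cos (of_real (2 * pi * real n * \<omega>)) / 2 else 0)"
    unfolding S1 S2 by auto
  finally show ?thesis using q by (simp add: A_def B_def x_def)
qed

text \<open>Frequencies below q / 2 contribute only the constant term and diagonal squares. The
  harmonic q is constant on the grid, so it multiplies the mean c 0 of the low harmonics and itself.
  The rest \<open>r\<close> enters linearly, as all other factors are near 1.\<close>

lemma XX_close:
  fixes c :: "nat \<Rightarrow> complex" and \<nu> :: "nat \<Rightarrow> nat"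
  assumes cop: "coprime p (int q)" and j: "0 < j" and \<nu>0: "\<nu> 0 = 0"
    and \<nu>: "\<And>i. i < j \<Longrightarrow> 2 * \<nu> i < q" "\<And>i. 0 < i \<Longrightarrow> i < j \<Longrightarrow> 0 < \<nu> i" and inj: "\<And>i l. i < j \<Longrightarrow> l < j \<Longrightarrow> \<nu> i = \<nu> l \<Longrightarrow> i = l"
    and t: "\<And>z. z \<in> strip \<Longrightarrow> t z = (\<Sum>i<j. c i * cos (of_real (2 * pi * real (\<nu> i)) * z)) + C * cos (of_real (2 * pi * real q) * z) + r z"
    and adm: "adm t" and \<phi>: "\<phi> \<in> strip" and r: "\<And>z. z \<in> strip \<Longrightarrow> norm (r z) \<le> \<rho>" and \<rho>: "\<rho> \<le> 1/1000"
  shows "norm (XX t \<phi> - ((c 0)\<^sup>2 + (\<Sum>i\<in>{1..<j}. (c i)\<^sup>2 * cos (of_real (2 * pi * real (\<nu> i) * \<omega>))) / 2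
     + C * c 0 * (cos (of_real (2 * pi * real q) * \<phi>) + cos (of_real (2 * pi * real q) * (\<phi> + of_real \<omega>)))
     + C\<^sup>2 * (cos (of_real (2 * pi * real q) * \<phi>) * cos (of_real (2 * pi * real q) * (\<phi> + of_real \<omega>))))) \<le> 3 * \<rho>"
proof -
  define x where "x = (\<lambda>k. \<phi> + of_real (real k * of_int p / real q))"
  define S where "S = (\<lambda>z. \<Sum>i<j. c i * cos (of_real (2 * pi * real (\<nu> i)) * z))"
  define Q where "Q = C * cos (of_real (2 * pi * real q) * \<phi>)"
  define Q' where "Q' = C * cos (of_real (2 * pi * real q) * (\<phi> + of_real \<omega>))"
  define R where "R = (\<lambda>k. r (x k) * t (x k + of_real \<omega>) + (t (x k) - r (x k)) * r (x k + of_real \<omega>))"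
  have qc: "(of_nat q :: complex) \<noteq> 0" using q by simp
  have xs: "x k \<in> strip" "x k + of_real \<omega> \<in> strip" for k unfolding x_def using \<phi> by (simp_all only: strip_add_real)
  have per: "cos (of_real (2 * pi * real q) * (x k + \<beta>)) = cos (of_real (2 * pi * real q) * (\<phi> + \<beta>))" for k \<beta>
  proof -
    have "of_real (2 * pi * real q) * (x k + \<beta>) = of_real (2 * pi * real q) * (\<phi> + \<beta>) + of_real (2 * of_int (int k * p) * pi)"
      using q by (simp add: x_def algebra_simps)
    then show ?thesis unfolding complex_cos_eq by (metis Ints_of_int)
  qed
  have tx: "t (x k) = S (x k) + Q + r (x k)" "t (x k + of_real \<omega>) = S (x k + of_real \<omega>) + Q' + r (x k + of_real \<omega>)" for k
    using t[OF xs(1)] t[OF xs(2)] per[of k 0] per[of k "of_real \<omega>"] by (auto simp: S_def Q_def Q'_def)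
  have tt: "t (x k) * t (x k + of_real \<omega>) = S (x k) * S (x k + of_real \<omega>) + Q' * S (x k) + Q * S (x k + of_real \<omega>) + Q * Q' + R k" for k
    unfolding R_def tx by (simp add: algebra_simps)
  have mS: "(\<Sum>k<q. S (x k + \<beta>)) / of_nat q = c 0" for \<beta>
  proof -
    have "(\<Sum>k<q. S (x k + \<beta>)) / of_nat q = (\<Sum>i<j. c i * ((\<Sum>k<q. cos (of_real (2 * pi * real (\<nu> i)) * (x k + \<beta>))) / of_nat q))"
      unfolding S_def by (subst sum.swap) (simp add: sum_divide_distrib sum_distrib_left)
    also have "\<dots> = (\<Sum>i<j. c i * (if i = 0 then 1 else 0))"
    proof (rule sum.cong)
      fix i assume "i \<in> {..<j}"
      then have i: "i < j" by simp
      then have "(\<Sum>k<q. cos (of_real (2 * pi * real (\<nu> i)) * (x k + \<beta>))) / of_nat q = (if \<nu> i = 0 then 1 else 0)"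
        unfolding x_def using \<nu>(1)[OF i] by (intro grid_mean_cos[OF cop]) simp
      then show "c i * ((\<Sum>k<q. cos (of_real (2 * pi * real (\<nu> i)) * (x k + \<beta>))) / of_nat q) = c i * (if i = 0 then 1 else 0)"
        using \<nu>(2)[of i] \<nu>0 i by (cases "i = 0") auto
    qed simp
    also have "\<dots> = (\<Sum>i<j. if i = 0 then c i else 0)" by (rule sum.cong) auto
    also have "\<dots> = c 0" using j by (subst sum.delta) auto
    finally show ?thesis .
  qed
  have mSS: "(\<Sum>k<q. S (x k) * S (x k + of_real \<omega>)) / of_nat q = (c 0)\<^sup>2 + (\<Sum>i\<in>{1..<j}. (c i)\<^sup>2 * cos (of_real (2 * pi * real (\<nu> i) * \<omega>))) / 2"
  proof -
    define g where "g = (\<lambda>i l. (\<Sum>k<q. cos (of_real (2 * pi * real (\<nu> i)) * x k) * cos (of_real (2 * pi * real (\<nu> l)) * (x k + of_real \<omega>))) / of_nat q)"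
    have "(\<Sum>k<q. S (x k) * S (x k + of_real \<omega>)) = (\<Sum>k<q. \<Sum>i<j. \<Sum>l<j. c i * c l * (cos (of_real (2 * pi * real (\<nu> i)) * x k) * cos (of_real (2 * pi * real (\<nu> l)) * (x k + of_real \<omega>))))"
      by (simp add: S_def sum_product mult_ac)
    also have "\<dots> = (\<Sum>i<j. \<Sum>l<j. \<Sum>k<q. c i * c l * (cos (of_real (2 * pi * real (\<nu> i)) * x k) * cos (of_real (2 * pi * real (\<nu> l)) * (x k + of_real \<omega>))))"
      by (subst sum.swap, rule sum.cong[OF refl], subst sum.swap) simp
    finally have "(\<Sum>k<q. S (x k) * S (x k + of_real \<omega>)) / of_nat q = (\<Sum>i<j. \<Sum>l<j. c i * c l * g i l)"
      by (simp add: g_def sum_divide_distrib sum_distrib_left)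
    also have "\<dots> = (\<Sum>i<j. \<Sum>l<j. if i = l then (c i)\<^sup>2 * (if i = 0 then 1 else cos (of_real (2 * pi * real (\<nu> i) * \<omega>)) / 2) else 0)"
    proof (intro sum.cong refl)
      fix i l assume "i \<in> {..<j}" "l \<in> {..<j}"
      then have il: "i < j" "l < j" by auto
      have "g i l = (if \<nu> i = \<nu> l then if \<nu> i = 0 then 1 else cos (of_real (2 * pi * real (\<nu> i) * \<omega>)) / 2 else 0)"
        unfolding g_def x_def by (rule grid_mean_cos_cos[OF cop \<nu>(1)[OF il(1)] \<nu>(1)[OF il(2)]])
      moreover have "\<nu> i = 0 \<longleftrightarrow> i = 0" using \<nu>(2)[of i] \<nu>0 il by (cases "i = 0") auto
      moreover have "\<nu> i = \<nu> l \<longleftrightarrow> i = l" using inj il by auto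
      ultimately have "g i l = (if i = l then if i = 0 then 1 else cos (of_real (2 * pi * real (\<nu> i) * \<omega>)) / 2 else 0)"
        by (simp only: )
      then show "c i * c l * g i l = (if i = l then (c i)\<^sup>2 * (if i = 0 then 1 else cos (of_real (2 * pi * real (\<nu> i) * \<omega>)) / 2) else 0)"
        by (simp add: power2_eq_square)
    qed
    also have "\<dots> = (\<Sum>i<j. (c i)\<^sup>2 * (if i = 0 then 1 else cos (of_real (2 * pi * real (\<nu> i) * \<omega>)) / 2))"
      by (simp add: sum.delta)
    also have "{..<j} = insert 0 {1..<j}" using j by auto
    also have "(\<Sum>i\<in>insert 0 {1..<j}. (c i)\<^sup>2 * (if i = 0 then 1 else cos (of_real (2 * pi * real (\<nu> i) * \<omega>)) / 2))
       = (c 0)\<^sup>2 + (\<Sum>i\<in>{1..<j}. (c i)\<^sup>2 * cos (of_real (2 * pi * real (\<nu> i) * \<omega>)) / 2)"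
      by (subst sum.insert) auto
    finally show ?thesis by (simp add: sum_divide_distrib)
  qed
  have "XX t \<phi> = (\<Sum>k<q. t (x k) * t (x k + of_real \<omega>)) / of_nat q" by (simp add: XX_def x_def)
  also have "\<dots> = (\<Sum>k<q. S (x k) * S (x k + of_real \<omega>)) / of_nat q + Q' * ((\<Sum>k<q. S (x k + 0)) / of_nat q) + Q * ((\<Sum>k<q. S (x k + of_real \<omega>)) / of_nat q) + Q * Q' + (\<Sum>k<q. R k) / of_nat q"
    unfolding tt using qc by (simp add: sum.distrib sum_distrib_left[symmetric] add_divide_distrib)
  finally have "XX t \<phi> - ((c 0)\<^sup>2 + (\<Sum>i\<in>{1..<j}. (c i)\<^sup>2 * cos (of_real (2 * pi * real (\<nu> i) * \<omega>))) / 2 + (Q + Q') * c 0 + Q * Q') = (\<Sum>k<q. R k) / of_nat q"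
    unfolding mS mSS by (simp add: algebra_simps)
  moreover have "norm ((\<Sum>k<q. R k) / of_nat q) \<le> 3 * \<rho>"
  proof -
    have "norm (R k) \<le> 3 * \<rho>" for k
    proof -
      have \<rho>0: "0 \<le> \<rho>" using order_trans[OF norm_ge_zero r[OF \<phi>]] .
      have "norm (t (x k) - r (x k)) \<le> 1001/1000 + \<rho>"
        using norm_triangle_ineq4[of "t (x k)" "r (x k)"] adm_bounds(2)[OF adm xs(1)[of k]] r[OF xs(1)[of k]] by linarith
      then have "norm (t (x k) - r (x k)) \<le> 1002/1000" using \<rho> by linarith
      then have "norm (R k) \<le> \<rho> * (1001/1000) + (1002/1000) * \<rho>"
        unfolding R_def
        by (intro order_trans[OF norm_triangle_ineq] add_mono norm_mult_le r xs adm_bounds(2)[OF adm])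
      then show ?thesis using \<rho>0 by linarith
    qed
    then have "norm (\<Sum>k<q. R k) \<le> (\<Sum>k<q. 3 * \<rho>)" by (intro sum_norm_le) auto
    then show ?thesis using q by (simp add: norm_divide divide_le_eq mult.commute)
  qed
  moreover have "C * c 0 * (cos (of_real (2 * pi * real q) * \<phi>) + cos (of_real (2 * pi * real q) * (\<phi> + of_real \<omega>)))
     + C\<^sup>2 * (cos (of_real (2 * pi * real q) * \<phi>) * cos (of_real (2 * pi * real q) * (\<phi> + of_real \<omega>))) = (Q + Q') * c 0 + Q * Q'"
    by (simp add: Q_def Q'_def algebra_simps power2_eq_square)
  ultimately show ?thesis by (simp add: add.assoc)
qed

end

section \<open>Cosine series\<close>

locale cosine_series =
  fixes a :: real and \<nu> :: "nat \<Rightarrow> nat"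
  assumes a0: "a > 0" and a_small: "a \<le> 1/10^7" and \<nu>0: "\<nu> 0 = 0"
begin

text \<open>Majorises the harmonic on the strip by exp (\<nu> / 2) and its derivative through the
  additional factor, so one weighted bound yields both the sup and the Lipschitz requirement of
  \<open>adm\<close>.\<close>

definition wt :: "nat \<Rightarrow> real" where "wt i = exp (real (\<nu> i) / 2) * (1 + 2 * pi * real (\<nu> i))"
definition dl :: "nat \<Rightarrow> complex" where "dl i = (if i = 0 then 1 else 0)"
text \<open>The factor 2000 is set by the third harmonic, where the bound 2 * a * 100 must stay
  below 2000 * a / 8. The sum 4000 * a is within the 1/1000 demanded by \<open>adm\<close> as a
  \<le> 10^(-7).\<close>

definition cbound :: "(nat \<Rightarrow> complex) \<Rightarrow> bool" where
  "cbound c \<longleftrightarrow> (\<forall>i. norm (c i - dl i) * wt i \<le> 2000 * a * (1/2) ^ i)"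
definition csn :: "nat \<Rightarrow> complex \<Rightarrow> complex" where "csn i z = cos (of_real (2 * pi * real (\<nu> i)) * z)"
definition tser :: "(nat \<Rightarrow> complex) \<Rightarrow> complex \<Rightarrow> complex" where "tser c z = (\<Sum>\<^sub>\<infinity>i. c i * csn i z)"
definition maj :: "nat \<Rightarrow> real" where "maj i = (if i = 0 then 1 else 0) + 2000 * a * (1/2) ^ i"

lemma wt_ge_1: "wt i \<ge> 1" "exp (real (\<nu> i) / 2) \<le> wt i"
proof -
  show 1: "exp (real (\<nu> i) / 2) \<le> wt i" unfolding wt_def by (simp add: distrib_left)
  have "(1::real) \<le> exp (real (\<nu> i) / 2)" by simp
  then show "wt i \<ge> 1" using 1 by linarith
qed

lemma csn_bound:
  assumes z: "z \<in> strip"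
  shows "norm (csn i z) \<le> exp (real (\<nu> i) / 2)" "norm (sin (of_real (2 * pi * real (\<nu> i)) * z)) \<le> exp (real (\<nu> i) / 2)"
proof -
  have "\<bar>Im (of_real (2 * pi * real (\<nu> i)) * z)\<bar> = (2 * pi * \<bar>Im z\<bar>) * real (\<nu> i)" by (simp add: abs_mult)
  also have "\<dots> \<le> (1/2) * real (\<nu> i)"
  proof (rule mult_right_mono)
    have "2 * pi * \<bar>Im z\<bar> \<le> 2 * 4 * (1/16)" using z pi_less_4 by (intro mult_mono) (auto simp: strip_def)
    then show "2 * pi * \<bar>Im z\<bar> \<le> 1/2" by simp
  qed simp
  finally have le: "\<bar>Im (of_real (2 * pi * real (\<nu> i)) * z)\<bar> \<le> real (\<nu> i) / 2" by simp
  show "norm (csn i z) \<le> exp (real (\<nu> i) / 2)" "norm (sin (of_real (2 * pi * real (\<nu> i)) * z)) \<le> exp (real (\<nu> i) / 2)"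
    unfolding csn_def using norm_cos_sin_le_exp_Im[of "of_real (2 * pi * real (\<nu> i)) * z"] le by (meson exp_le_cancel_iff order_trans)+
qed

lemma convex_strip: "convex strip"
  unfolding convex_alt
proof (intro ballI allI impI)
  fix x y :: complex and u :: real assume xy: "x \<in> strip" "y \<in> strip" and u: "0 \<le> u \<and> u \<le> 1"
  have "x + of_real u * (y - x) \<in> strip" by (rule strip_segment) (use xy u in auto)
  then show "(1 - u) *\<^sub>R x + u *\<^sub>R y \<in> strip" by (simp add: scaleR_conv_of_real algebra_simps)
qed

lemma csn_lipschitz:
  assumes z: "z \<in> strip" "w \<in> strip"
  shows "norm (csn i z - csn i w) \<le> wt i * norm (z - w)"
proof (rule field_differentiable_bound[OF convex_strip])
  fix x assume x: "x \<in> strip"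
  show "(csn i has_field_derivative - sin (of_real (2 * pi * real (\<nu> i)) * x) * of_real (2 * pi * real (\<nu> i))) (at x within strip)"
    unfolding csn_def[abs_def] by (auto intro!: derivative_eq_intros)
  have "norm (- sin (of_real (2 * pi * real (\<nu> i)) * x) * of_real (2 * pi * real (\<nu> i)))
      = norm (sin (of_real (2 * pi * real (\<nu> i)) * x)) * (2 * pi * real (\<nu> i))" by (simp add: norm_mult)
  also have "\<dots> \<le> exp (real (\<nu> i) / 2) * (2 * pi * real (\<nu> i))" using csn_bound(2)[OF x] by (intro mult_right_mono) auto
  also have "\<dots> \<le> wt i" unfolding wt_def by (intro mult_left_mono) auto
  finally show "norm (- sin (of_real (2 * pi * real (\<nu> i)) * x) * of_real (2 * pi * real (\<nu> i))) \<le> wt i" .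
qed (use z in auto)

lemma cbound_term:
  assumes c: "cbound c" and z: "z \<in> strip"
  shows "norm ((c i - dl i) * csn i z) \<le> 2000 * a * (1/2) ^ i" "norm (c i * csn i z) \<le> maj i"
proof -
  have "norm ((c i - dl i) * csn i z) \<le> norm (c i - dl i) * wt i"
    unfolding norm_mult using csn_bound(1)[OF z, of i] wt_ge_1(2)[of i] by (intro mult_left_mono) auto
  also have "\<dots> \<le> 2000 * a * (1/2) ^ i" using c by (simp add: cbound_def)
  finally show 1: "norm ((c i - dl i) * csn i z) \<le> 2000 * a * (1/2) ^ i" .
  have 2: "norm (dl i * csn i z) \<le> (if i = 0 then 1 else 0)" by (simp add: dl_def csn_def \<nu>0)
  have "c i * csn i z = dl i * csn i z + (c i - dl i) * csn i z" by (simp add: algebra_simps)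
  then show "norm (c i * csn i z) \<le> maj i"
    unfolding maj_def using norm_triangle_ineq[of "dl i * csn i z" "(c i - dl i) * csn i z"] 1 2 by (simp only:)
qed

lemma half_powers_sums: "(\<lambda>i. K * (1/2::real) ^ i) sums (2 * K)"
  using sums_mult[OF geometric_sums[of "1/2::real"], of K] by (simp add: mult.commute[of 2])

lemma summable_maj: "summable maj"
proof -
  have "summable (\<lambda>i. (if i = 0 then 1 else 0) + 2000 * a * (1/2::real) ^ i)"
    by (rule summable_add[OF summable_single[of 0 "\<lambda>_. 1"] sums_summable[OF half_powers_sums]])
  then show ?thesis by (simp only: maj_def[abs_def])
qed

lemma summable_tser:
  assumes c: "cbound c" and z: "z \<in> strip"
  shows "summable (\<lambda>i. norm (c i * csn i z))" "summable (\<lambda>i. c i * csn i z)" "summable (\<lambda>i. norm ((c i - dl i) * csn i z))"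
    "tser c z = (\<Sum>i. c i * csn i z)" "tser c z = 1 + (\<Sum>i. (c i - dl i) * csn i z)"
proof -
  show 1: "summable (\<lambda>i. norm (c i * csn i z))"
    by (rule summable_comparison_test'[OF summable_maj]) (use cbound_term(2)[OF c z] in auto)
  then show 2: "summable (\<lambda>i. c i * csn i z)" by (rule summable_norm_cancel)
  show s: "tser c z = (\<Sum>i. c i * csn i z)"
    unfolding tser_def by (rule infsumI[OF norm_summable_imp_has_sum[OF 1 summable_sums[OF 2]]])
  show 3: "summable (\<lambda>i. norm ((c i - dl i) * csn i z))"
    by (rule summable_comparison_test'[OF sums_summable[OF half_powers_sums[of "2000 * a"]]]) (use cbound_term(1)[OF c z] in auto)
  have "(\<lambda>i. dl i * csn i z) sums (dl 0 * csn 0 z)"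
    by (rule sums_single[of 0 "\<lambda>i. dl i * csn i z", THEN sums_cong[THEN iffD1, rotated]]) (auto simp: dl_def)
  then have d: "(\<lambda>i. dl i * csn i z) sums 1" by (simp add: dl_def csn_def \<nu>0)
  have "(\<lambda>i. dl i * csn i z + (c i - dl i) * csn i z) sums (1 + (\<Sum>i. (c i - dl i) * csn i z))"
    by (rule sums_add[OF d summable_sums[OF summable_norm_cancel[OF 3]]])
  then show "tser c z = 1 + (\<Sum>i. (c i - dl i) * csn i z)"
    unfolding s by (intro sums_unique[symmetric]) (simp add: algebra_simps)
qed

lemma tser_holomorphic:
  assumes D: "open D" and cc: "\<And>i. (\<lambda>z. cc z i) holomorphic_on D" and cb: "\<And>z. z \<in> D \<Longrightarrow> cbound (cc z)"
    and \<theta>: "\<theta> holomorphic_on D" "\<And>z. z \<in> D \<Longrightarrow> \<theta> z \<in> strip"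
  shows "(\<lambda>z. tser (cc z) (\<theta> z)) holomorphic_on D"
proof (rule holomorphic_on_uniform_seq[OF D])
  show "(\<lambda>z. \<Sum>i<n. cc z i * csn i (\<theta> z)) holomorphic_on D" for n
    unfolding csn_def by (intro holomorphic_intros cc \<theta>(1) holomorphic_on_cos[unfolded o_def])
  show "uniform_limit D (\<lambda>n z. \<Sum>i<n. cc z i * csn i (\<theta> z)) (\<lambda>z. tser (cc z) (\<theta> z)) sequentially"
  proof (rule uniform_limit_cong'[THEN iffD1, OF _ _ Weierstrass_m_test[OF _ summable_maj]])
    show "norm (cc z n * csn n (\<theta> z)) \<le> maj n" if "z \<in> D" for n z using cbound_term(2)[OF cb \<theta>(2)] that by blast
  qed (use summable_tser(4)[OF cb \<theta>(2)] in auto)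
qed

lemma adm_tser:
  assumes c: "cbound c" shows "adm (tser c)"
  unfolding adm_def
proof (intro conjI ballI)
  show "tser c holomorphic_on strip"
    using tser_holomorphic[OF open_strip, of "\<lambda>_. c" "\<lambda>z. z"] c by simp
  have s4: "(\<Sum>i. 2000 * a * (1/2) ^ i) = 4000 * a" using sums_unique[OF half_powers_sums[of "2000 * a"]] by simp
  note sg = sums_summable[OF half_powers_sums[of "2000 * a"]]
  fix z assume z: "z \<in> strip"
  have "norm (tser c z - 1) = norm (\<Sum>i. (c i - dl i) * csn i z)" by (simp add: summable_tser(5)[OF c z])
  also have "\<dots> \<le> (\<Sum>i. 2000 * a * (1/2) ^ i)"
    by (rule order_trans[OF summable_norm[OF summable_tser(3)[OF c z]] suminf_le[OF _ summable_tser(3)[OF c z] sg]])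
       (rule cbound_term(1)[OF c z])
  also have "\<dots> \<le> 1/1000" using s4 a_small by simp
  finally show "norm (tser c z - 1) \<le> 1/1000" .
  fix w assume w: "w \<in> strip"
  have s: "summable (\<lambda>i. (c i - dl i) * (csn i z - csn i w))"
    using summable_diff[OF summable_norm_cancel[OF summable_tser(3)[OF c z]] summable_norm_cancel[OF summable_tser(3)[OF c w]]]
    by (simp add: right_diff_distrib)
  have le: "norm ((c i - dl i) * (csn i z - csn i w)) \<le> (2000 * a * norm (z - w)) * (1/2) ^ i" for i
  proof -
    have "norm ((c i - dl i) * (csn i z - csn i w)) \<le> norm (c i - dl i) * (wt i * norm (z - w))"
      unfolding norm_mult using csn_lipschitz[OF z w] by (intro mult_left_mono) auto
    also have "\<dots> = (norm (c i - dl i) * wt i) * norm (z - w)" by simp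
    also have "\<dots> \<le> (2000 * a * (1/2) ^ i) * norm (z - w)" using c by (intro mult_right_mono) (auto simp: cbound_def)
    finally show ?thesis by (simp add: mult_ac)
  qed
  have sn: "summable (\<lambda>i. norm ((c i - dl i) * (csn i z - csn i w)))"
    by (rule summable_comparison_test'[OF sums_summable[OF half_powers_sums[of "2000 * a * norm (z - w)"]]]) (use le in auto)
  have "tser c z - tser c w = (\<Sum>i. (c i - dl i) * (csn i z - csn i w))"
    using suminf_diff[OF summable_norm_cancel[OF summable_tser(3)[OF c z]] summable_norm_cancel[OF summable_tser(3)[OF c w]]]
    by (simp add: summable_tser(5)[OF c z] summable_tser(5)[OF c w] right_diff_distrib)
  also have "norm \<dots> \<le> (\<Sum>i. (2000 * a * norm (z - w)) * (1/2) ^ i)"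
    by (rule order_trans[OF summable_norm[OF sn] suminf_le[OF le sn sums_summable[OF half_powers_sums]]])
  also have "\<dots> = 4000 * a * norm (z - w)" using sums_unique[OF half_powers_sums[of "2000 * a * norm (z - w)"]] by simp
  also have "\<dots> \<le> 1 * norm (z - w)" using a_small by (intro mult_right_mono) auto
  finally show "norm (tser c z - tser c w) \<le> norm (z - w)" by simp
qed

lemma holfam_tser:
  assumes "open D" "\<And>i. (\<lambda>z. cc z i) holomorphic_on D" "\<And>z. z \<in> D \<Longrightarrow> cbound (cc z)"
  shows "holfam D (\<lambda>z. tser (cc z))"
  unfolding holfam_def using assms by (auto intro!: adm_tser tser_holomorphic)

lemma tser_minus: "tser c (- z) = tser c z"
  by (simp add: tser_def csn_def)

lemma tser_add_1: "tser c (z + 1) = tser c z"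
proof -
  have "csn i (z + 1) = csn i z" for i
  proof -
    have "of_real (2 * pi * real (\<nu> i)) * (z + 1) = of_real (2 * pi * real (\<nu> i)) * z + of_real (2 * of_int (int (\<nu> i)) * pi)"
      by (simp add: algebra_simps)
    then show ?thesis unfolding csn_def complex_cos_eq by (metis Ints_of_int)
  qed
  then show ?thesis by (simp add: tser_def)
qed

lemma tser_cnj:
  assumes "\<And>i. cnj (c i) = c i" shows "tser c (cnj z) = cnj (tser c z)"
proof -
  have "cnj (c i * csn i z) = c i * csn i (cnj z)" for i by (simp add: csn_def cnj_cos assms)
  then show ?thesis unfolding tser_def infsum_cnj[symmetric] by simp
qed

lemma tser_split:
  assumes c: "cbound c" and z: "z \<in> strip"
  shows "tser c z = (\<Sum>i<j. c i * csn i z) + (\<Sum>i. c (i + j) * csn (i + j) z)"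
  unfolding summable_tser(4)[OF c z] using suminf_split_initial_segment[OF summable_tser(2)[OF c z], of j] by simp

lemma tail_bound:
  assumes c: "cbound c" and z: "z \<in> strip" and b: "\<And>i. i \<ge> j \<Longrightarrow> norm (c i * csn i z) \<le> B * (1/2) ^ (i - j)"
  shows "norm (\<Sum>i. c (i + j) * csn (i + j) z) \<le> 2 * B"
proof -
  have s: "summable (\<lambda>i. norm (c (i + j) * csn (i + j) z))"
    using summable_tser(1)[OF c z] by (subst summable_iff_shift)
  have le: "norm (c (i + j) * csn (i + j) z) \<le> B * (1/2) ^ i" for i using b[of "i + j"] by simp
  have "norm (\<Sum>i. c (i + j) * csn (i + j) z) \<le> (\<Sum>i. B * (1/2) ^ i)"
    by (rule order_trans[OF summable_norm[OF s] suminf_le[OF le s sums_summable[OF half_powers_sums]]])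
  also have "\<dots> = 2 * B" using sums_unique[OF half_powers_sums[of B]] by simp
  finally show ?thesis .
qed

end

section \<open>Expansions to second order in the leading harmonics\<close>

lemma cos_integral_zero:
  assumes k: "k \<noteq> (0::int)"
  shows "((\<lambda>s. cos (2 * pi * of_int k * s + d)) has_integral 0) {0..1::real}"
proof -
  have "((\<lambda>s. cos (2 * pi * of_int k * s + d)) has_integral sin (2 * pi * of_int k * 1 + d) / (2 * pi * of_int k) - sin (2 * pi * of_int k * 0 + d) / (2 * pi * of_int k)) {0..1::real}"
  proof (rule fundamental_theorem_of_calculus)
    show "((\<lambda>s. sin (2 * pi * of_int k * s + d) / (2 * pi * of_int k)) has_vector_derivative cos (2 * pi * of_int k * x + d)) (at x within {0..1})" for x
      unfolding has_real_derivative_iff_has_vector_derivative[symmetric]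
      using k by (auto intro!: derivative_eq_intros)
  qed simp
  moreover have "sin (2 * pi * of_int k * 1 + d) = sin (d + 2 * pi * of_int k)" by (simp add: add.commute)
  then have "sin (2 * pi * of_int k * 1 + d) = sin d" by (simp add: sin_add sin_int_2pin cos_int_2pin)
  ultimately show ?thesis by simp
qed

lemma cos_cos_integral:
  assumes "m > 0" "n > (0::nat)"
  shows "((\<lambda>s. cos (2 * pi * real m * (s - b')) * cos (2 * pi * real n * (s - b))) has_integral (if m = n then cos (2 * pi * real n * (b - b')) / 2 else 0)) {0..1::real}"
proof -
  have eq: "cos (2 * pi * real m * (s - b')) * cos (2 * pi * real n * (s - b))
     = (1/2) * cos (2 * pi * of_int (int m - int n) * s + (2 * pi * real n * b - 2 * pi * real m * b')) + (1/2) * cos (2 * pi * of_int (int m + int n) * s + (- 2 * pi * real n * b - 2 * pi * real m * b'))" for s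
    unfolding cos_times_cos by (simp add: algebra_simps add_divide_distrib)
  have 2: "((\<lambda>s. (1/2) * cos (2 * pi * of_int (int m + int n) * s + (- 2 * pi * real n * b - 2 * pi * real m * b'))) has_integral (1/2) * 0) {0..1::real}"
    by (rule has_integral_mult_right[OF cos_integral_zero]) (use assms in auto)
  have 1: "((\<lambda>s. (1/2) * cos (2 * pi * of_int (int m - int n) * s + (2 * pi * real n * b - 2 * pi * real m * b'))) has_integral (1/2) * (if m = n then cos (2 * pi * real n * (b - b')) else 0)) {0..1::real}"
  proof (cases "m = n")
    case True
    then show ?thesis using has_integral_const_real[of "(1/2) * cos (2 * pi * real n * (b - b'))" 0 1] by (simp add: algebra_simps)
  next
    case False
    then show ?thesis using has_integral_mult_right[OF cos_integral_zero[of "int m - int n" "2 * pi * real n * b - 2 * pi * real m * b'"], of "1/2"] by simp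
  qed
  show ?thesis unfolding eq using has_integral_add[OF 1 2] by (cases "m = n") auto
qed

lemma has_integral_of_real_mult:
  assumes "(f has_integral I) {0..1::real}"
  shows "((\<lambda>s. c * of_real (f s) :: complex) has_integral c * of_real I) {0..1}"
proof -
  have "((\<lambda>s. of_real (f s) :: complex) has_integral of_real I) {0..1}"
    using has_integral_linear[OF assms bounded_linear_of_real[where ?'a=complex]] by (simp only: o_def)
  then show ?thesis by (rule has_integral_mult_right)
qed

text \<open>\<open>w * Cc t w\<close> is the action of the invariant circle with rotation number \<open>w\<close>.\<close>

definition Cc :: "(complex \<Rightarrow> complex) \<Rightarrow> real \<Rightarrow> complex" where
  "Cc t w = integral {0..1::real} (\<lambda>r. integral {0..1::real} (\<lambda>s. inverse (t (of_real s)) * inverse (t (of_real (s - r * w)))))"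

lemma adm_inverse_real_continuous:
  assumes "adm t" and that: "continuous_on A f" shows "continuous_on A (\<lambda>s::real. inverse (t (of_real (f s))))"
proof -
  have "continuous_on A (\<lambda>s. t (of_real (f s)))"
    by (rule continuous_on_compose2[OF adm_continuous[OF assms(1)]]) (auto intro!: continuous_intros that)
  then show ?thesis by (rule continuous_on_inverse) (use adm_bounds(4)[OF assms(1)] in auto)
qed

lemma Cc_inner_lipschitz:
  assumes t: "adm t"
  shows "norm (integral {0..1} (\<lambda>s. inverse (t (of_real s)) * inverse (t (of_real (s - r * w))))
      - integral {0..1} (\<lambda>s. inverse (t (of_real s)) * inverse (t (of_real (s - r' * w))))) \<le> (2 * \<bar>w\<bar>) * \<bar>r - r'\<bar>"
proof (rule integral_close_const)
  show "continuous_on {0..1} (\<lambda>s. inverse (t (of_real s)) * inverse (t (of_real (s - r * w))))" for r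
    by (intro continuous_intros adm_inverse_real_continuous[OF t])
  then show "((\<lambda>s. inverse (t (of_real s)) * inverse (t (of_real (s - r' * w)))) has_integral integral {0..1} (\<lambda>s. inverse (t (of_real s)) * inverse (t (of_real (s - r' * w))))) {0..1}"
    "continuous_on {0..1} (\<lambda>s. inverse (t (of_real s)) * inverse (t (of_real (s - r' * w))))"
    using integrable_continuous_real by blast+
  fix s :: real
  have "norm (inverse (t (of_real (s - r * w))) - inverse (t (of_real (s - r' * w)))) \<le> 101/100 * norm (of_real (s - r * w) - of_real (s - r' * w) :: complex)"
    by (rule adm_inverse_lipschitz[OF t strip_of_real strip_of_real])
  also have "norm (of_real (s - r * w) - of_real (s - r' * w) :: complex) = \<bar>w\<bar> * \<bar>r - r'\<bar>"
    unfolding of_real_diff[symmetric] norm_of_real by (simp add: abs_mult[symmetric] algebra_simps)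
  finally have 1: "norm (inverse (t (of_real (s - r * w))) - inverse (t (of_real (s - r' * w)))) \<le> 101/100 * (\<bar>w\<bar> * \<bar>r - r'\<bar>)" .
  have "norm (inverse (t (of_real s)) * (inverse (t (of_real (s - r * w))) - inverse (t (of_real (s - r' * w))))) \<le> (1002/1000) * (101/100 * (\<bar>w\<bar> * \<bar>r - r'\<bar>))"
    by (intro norm_mult_le 1 adm_bounds(5)[OF t]) simp
  also have "\<dots> \<le> (2 * \<bar>w\<bar>) * \<bar>r - r'\<bar>"
    using mult_nonneg_nonneg[of "\<bar>w\<bar>" "\<bar>r - r'\<bar>"] by (simp only: mult.assoc) linarith
  finally show "norm (inverse (t (of_real s)) * inverse (t (of_real (s - r * w))) - inverse (t (of_real s)) * inverse (t (of_real (s - r' * w)))) \<le> (2 * \<bar>w\<bar>) * \<bar>r - r'\<bar>"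
    by (simp only: right_diff_distrib)
qed

lemma Cc_holomorphic:
  assumes H: "holfam D tt"
  shows "(\<lambda>z. Cc (tt z) w) holomorphic_on D"
proof -
  have inv: "(\<lambda>z. inverse (tt z (of_real x))) holomorphic_on D" for x :: real
    by (rule holomorphic_on_inverse[OF holfam_compose[OF H holomorphic_on_const]]) (use adm_bounds(4)[OF holfam_adm[OF H]] in auto)
  show ?thesis
    unfolding Cc_def
  proof (rule holomorphic_on_integral[OF holfam_open[OF H], where B="2 * \<bar>w\<bar>"])
    fix r :: real
    show "(\<lambda>z. integral {0..1} (\<lambda>s. inverse (tt z (of_real s)) * inverse (tt z (of_real (s - r * w))))) holomorphic_on D"
    proof (rule holomorphic_on_integral[OF holfam_open[OF H], where B=3])
      show "(\<lambda>z. inverse (tt z (of_real s)) * inverse (tt z (of_real (s - r * w)))) holomorphic_on D" for s :: real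
        by (intro holomorphic_intros inv)
      fix z and s s' :: real assume z: "z \<in> D"
      note t = holfam_adm[OF H z]
      have l: "norm (inverse (tt z (of_real x)) - inverse (tt z (of_real x'))) \<le> 101/100 * \<bar>x - x'\<bar>" for x x' :: real
        using adm_inverse_lipschitz[OF t, of "of_real x" "of_real x'"] by (simp flip: of_real_diff)
      have "inverse (tt z (of_real s)) * inverse (tt z (of_real (s - r * w))) - inverse (tt z (of_real s')) * inverse (tt z (of_real (s' - r * w)))
         = (inverse (tt z (of_real s)) - inverse (tt z (of_real s'))) * inverse (tt z (of_real (s - r * w)))
           + inverse (tt z (of_real s')) * (inverse (tt z (of_real (s - r * w))) - inverse (tt z (of_real (s' - r * w))))"
        by (simp add: algebra_simps)
      also have "norm \<dots> \<le> (101/100 * \<bar>s - s'\<bar>) * (1002/1000) + (1002/1000) * (101/100 * \<bar>(s - r * w) - (s' - r * w)\<bar>)"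
        by (intro order_trans[OF norm_triangle_ineq] add_mono norm_mult_le l adm_bounds(5)[OF t strip_of_real])
      also have "\<dots> \<le> 3 * \<bar>s - s'\<bar>" by simp
      finally show "norm (inverse (tt z (of_real s)) * inverse (tt z (of_real (s - r * w))) - inverse (tt z (of_real s')) * inverse (tt z (of_real (s' - r * w)))) \<le> 3 * \<bar>s - s'\<bar>" .
    qed
  next
    fix z r r' assume "z \<in> D"
    then show "norm (integral {0..1} (\<lambda>s. inverse (tt z (of_real s)) * inverse (tt z (of_real (s - r * w))))
      - integral {0..1} (\<lambda>s. inverse (tt z (of_real s)) * inverse (tt z (of_real (s - r' * w))))) \<le> (2 * \<bar>w\<bar>) * \<bar>r - r'\<bar>"
      by (rule Cc_inner_lipschitz[OF holfam_adm[OF H]])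
  qed
qed

locale base_series = cosine_series +
  assumes \<nu>123: "\<nu> 1 = 1" "\<nu> 2 = 2" "\<nu> 3 = 3"
begin

text \<open>Orders of magnitude in \<open>a\<close>: the harmonics 1 to 3 have order 1, the
  correction of the constant term has order 2, because it only compensates their squares in the mean
  of 1 / t, and all others have order 3.\<close>

definition scoef :: "(nat \<Rightarrow> complex) \<Rightarrow> bool" where
  "scoef c \<longleftrightarrow> norm (c 0 - 1) \<le> 64 * a\<^sup>2 \<and> (\<forall>i\<in>{1,2,3}. norm (c i) \<le> 2 * a) \<and> (\<forall>i\<ge>4. norm (c i) * wt i \<le> a ^ 3 * (1/2) ^ i)"

definition pr :: "(nat \<Rightarrow> complex) \<Rightarrow> real \<Rightarrow> complex" where
  "pr c s = (\<Sum>i\<in>{1,2,3}. c i * of_real (cos (2 * pi * real i * s)))"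

lemma \<nu>_eq: "i \<in> {1,2,3} \<Longrightarrow> \<nu> i = i" using \<nu>123 by auto

lemma a_pow: "a\<^sup>2 \<le> a / 10000000" "a ^ 3 \<le> a\<^sup>2 / 10000000" "0 < a\<^sup>2" "0 < a ^ 3"
proof -
  show "a\<^sup>2 \<le> a / 10000000" using a0 a_small mult_left_mono[of a "1/10000000" a] by (simp add: power2_eq_square)
  show "a ^ 3 \<le> a\<^sup>2 / 10000000" using a0 a_small mult_left_mono[of a "1/10000000" "a\<^sup>2"] by (simp add: power3_eq_cube power2_eq_square)
qed (use a0 in auto)

lemma wt_123: "i \<in> {1,2,3} \<Longrightarrow> wt i \<le> 100"
proof -
  assume i: "i \<in> {1,2,3}"
  have "exp (3/2 :: real) ^ 2 = exp 1 ^ 3" by (simp add: exp_of_nat_mult[symmetric])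
  also have "exp (1::real) ^ 3 \<le> (272/100) ^ 3" using e_less_272 by (intro power_mono) auto
  also have "\<dots> \<le> 5 ^ 2" by (simp add: power3_eq_cube power2_eq_square)
  finally have "exp (3/2::real) \<le> 5" by (rule power2_le_imp_le) simp
  moreover have "exp (real (\<nu> i) / 2) \<le> exp (3/2)" using i \<nu>_eq[OF i] by auto
  ultimately have 1: "exp (real (\<nu> i) / 2) \<le> 5" by linarith
  have "1 + 2 * pi * real (\<nu> i) \<le> 1 + 2 * (315/100) * 3"
    using i \<nu>_eq[OF i] pi_approx by (intro add_mono mult_mono) auto
  then have 2: "1 + 2 * pi * real (\<nu> i) \<le> 20" by simp
  have "wt i \<le> 5 * 20" unfolding wt_def using 1 2 by (intro mult_mono) auto
  then show ?thesis by simp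
qed

lemma scoef_cbound:
  assumes c: "scoef c" shows "cbound c"
  unfolding cbound_def
proof
  fix i :: nat
  consider "i = 0" | "i \<in> {1,2,3}" | "i \<ge> 4" by force
  then show "norm (c i - dl i) * wt i \<le> 2000 * a * (1/2) ^ i"
  proof cases
    case 1
    then have "norm (c i - dl i) * wt i \<le> 64 * a\<^sup>2" using c by (simp add: scoef_def dl_def wt_def \<nu>0)
    also have "\<dots> \<le> 2000 * a" using a_pow(1) a0 by simp
    finally show ?thesis using 1 by simp
  next
    case 2
    then have n: "norm (c i) \<le> 2 * a" using c by (auto simp: scoef_def)
    have "norm (c i) * wt i \<le> (2 * a) * 100"
      using n wt_123[OF 2] a0 wt_ge_1(1)[of i] by (intro mult_mono) auto
    also have "\<dots> \<le> 2000 * a * (1/2) ^ 3" using a0 by (simp add: power3_eq_cube)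
    also have "\<dots> \<le> 2000 * a * (1/2) ^ i" using 2 a0 by (intro mult_left_mono power_decreasing) auto
    finally show ?thesis using 2 by (auto simp: dl_def)
  next
    case 3
    then have "norm (c i) * wt i \<le> a ^ 3 * (1/2) ^ i" using c by (simp add: scoef_def)
    also have "\<dots> \<le> 2000 * a * (1/2) ^ i" using a_pow a0 by (intro mult_right_mono) auto
    finally show ?thesis using 3 by (simp add: dl_def)
  qed
qed

lemma tser_real_close:
  assumes c: "scoef c"
  shows "norm (tser c (of_real s) - (c 0 + pr c s)) \<le> a ^ 3"
proof -
  have cb: "cbound c" by (rule scoef_cbound[OF c])
  have csr: "csn i (of_real s) = of_real (cos (2 * pi * real (\<nu> i) * s))" for i
    unfolding csn_def by (metis cos_of_real of_real_mult)
  have "norm (\<Sum>i. c (i + 4) * csn (i + 4) (of_real s)) \<le> 2 * (a ^ 3 / 16)"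
  proof (rule tail_bound[OF cb])
    fix i :: nat assume i: "i \<ge> 4"
    have "norm (csn i (of_real s)) \<le> wt i"
      unfolding csr norm_of_real using wt_ge_1(1)[of i] abs_cos_le_one[of "2 * pi * real (\<nu> i) * s"] by linarith
    then have "norm (c i * csn i (of_real s)) \<le> norm (c i) * wt i"
      unfolding norm_mult by (rule mult_left_mono) simp
    also have "\<dots> \<le> a ^ 3 * (1/2) ^ i" using c i by (simp add: scoef_def)
    also have "(1/2::real) ^ i = (1/16) * (1/2) ^ (i - 4)" using i power_add[of "1/2::real" 4 "i - 4"] by (simp add: power_divide)
    finally show "norm (c i * csn i (of_real s)) \<le> a ^ 3 / 16 * (1/2) ^ (i - 4)" by simp
  qed simp
  also have "2 * (a ^ 3 / 16) \<le> a ^ 3" using a_pow(4) by simp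
  finally have 1: "norm (\<Sum>i. c (i + 4) * csn (i + 4) (of_real s)) \<le> a ^ 3" .
  have set: "{..<4::nat} = insert 0 {1,2,3}" by auto
  have "(\<Sum>i<4. c i * csn i (of_real s)) = c 0 + (\<Sum>i\<in>{1,2,3}. c i * csn i (of_real s))"
    unfolding set by (subst sum.insert) (auto simp: csn_def \<nu>0)
  also have "(\<Sum>i\<in>{1,2,3}. c i * csn i (of_real s)) = pr c s"
    unfolding pr_def csr by (rule sum.cong) (use \<nu>_eq in auto)
  finally show ?thesis using 1 tser_split[OF cb, of "of_real s" 4] by simp
qed

lemma pr_bound:
  assumes c: "scoef c" shows "norm (pr c s) \<le> 6 * a"
proof -
  have "norm (pr c s) \<le> (\<Sum>i\<in>{1,2,3::nat}. 2 * a)"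
    unfolding pr_def
  proof (rule sum_norm_le)
    fix i :: nat assume "i \<in> {1,2,3}"
    then have n: "norm (c i) \<le> 2 * a" using c by (auto simp: scoef_def)
    have "norm (c i * of_real (cos (2 * pi * real i * s))) \<le> (2 * a) * 1"
      by (rule norm_mult_le[OF n]) (simp only: norm_of_real abs_cos_le_one)
    then show "norm (c i * of_real (cos (2 * pi * real i * s))) \<le> 2 * a" by simp
  qed
  then show ?thesis by simp
qed

text \<open>The expansion of 1 / t - 1 to second order in \<open>a\<close>. As c 0 - 1 already has
  order 2, it appears only linearly.\<close>

definition gap :: "(nat \<Rightarrow> complex) \<Rightarrow> real \<Rightarrow> complex" where
  "gap c s = - (c 0 - 1) - pr c s + (pr c s)\<^sup>2"

text \<open>With \<delta> = t - 1 the identity 1 / t = 1 - \<delta> + \<delta>^2 - \<delta>^3 / t is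
  used; replacing \<delta> by its leading part costs about (65 * 13 + 344) * a^3, plus a^3 for the
  higher harmonics.\<close>

lemma gap_bounds:
  assumes c: "scoef c"
  shows "norm (gap c s) \<le> 7 * a" "norm (gap c s + pr c s) \<le> 100 * a\<^sup>2"
    "norm (inverse (tser c (of_real s)) - (1 + gap c s)) \<le> 1200 * a ^ 3"
proof -
  have p: "norm (pr c s) \<le> 6 * a" by (rule pr_bound[OF c])
  have p2: "norm ((pr c s)\<^sup>2) \<le> 36 * a\<^sup>2"
    unfolding power2_eq_square using norm_mult_le[OF p p] by simp
  have c0: "norm (c 0 - 1) \<le> 64 * a\<^sup>2" using c by (simp add: scoef_def)
  have e: "gap c s + pr c s = - (c 0 - 1) + (pr c s)\<^sup>2" by (simp add: gap_def)
  have "norm (gap c s + pr c s) \<le> norm (- (c 0 - 1)) + norm ((pr c s)\<^sup>2)" unfolding e by (rule norm_triangle_ineq)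
  then show 1: "norm (gap c s + pr c s) \<le> 100 * a\<^sup>2" using c0 p2 unfolding norm_minus_cancel by linarith
  have "norm (gap c s) \<le> norm (gap c s + pr c s) + norm (pr c s)" using norm_triangle_ineq4[of "gap c s + pr c s" "pr c s"] by simp
  then show "norm (gap c s) \<le> 7 * a" using 1 p a_pow(1) a0 by simp
  define T where "T = tser c (of_real s)"
  define \<delta> where "\<delta> = T - 1"
  have adm: "adm (tser c)" by (rule adm_tser[OF scoef_cbound[OF c]])
  have T: "T \<noteq> 0" "norm (inverse T) \<le> 1002/1000" using adm_bounds[OF adm, of "of_real s"] by (auto simp: T_def)
  define R where "R = T - (c 0 + pr c s)"
  have R: "norm R \<le> a ^ 3" unfolding R_def T_def by (rule tser_real_close[OF c])
  have \<delta>p: "\<delta> - pr c s = (c 0 - 1) + R" by (simp add: \<delta>_def R_def)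
  have dp: "norm (\<delta> - pr c s) \<le> 65 * a\<^sup>2"
    unfolding \<delta>p using norm_triangle_ineq[of "c 0 - 1" R] c0 R a_pow(2,3) by linarith
  have d: "norm \<delta> \<le> 7 * a" using norm_triangle_ineq[of "\<delta> - pr c s" "pr c s"] dp p a_pow(1) a0 by simp
  have dpp: "norm (\<delta> + pr c s) \<le> 7 * a + 6 * a" using norm_triangle_ineq[of \<delta> "pr c s"] d p by linarith
  have "inverse T - (1 + gap c s) = - R + (\<delta> - pr c s) * (\<delta> + pr c s) + - (\<delta> * \<delta> * \<delta> * inverse T)"
  proof -
    define W where "W = \<delta> * \<delta> * \<delta> * inverse T"
    have i: "inverse T = 1 - \<delta> + \<delta>\<^sup>2 - W"
      using T(1) by (simp add: W_def \<delta>_def field_simps power2_eq_square)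
    have Rr: "R = \<delta> - pr c s - (c 0 - 1)" using \<delta>p by (simp add: algebra_simps)
    show ?thesis unfolding W_def[symmetric] unfolding i gap_def Rr by (simp add: algebra_simps power2_eq_square)
  qed
  also have "norm \<dots> \<le> a ^ 3 + (65 * a\<^sup>2) * (7 * a + 6 * a) + ((7 * a) * (7 * a) * (7 * a)) * (1002/1000)"
    by (intro order_trans[OF norm_triangle_ineq] add_mono norm_mult_le dp dpp) 
       (use R norm_mult_le[OF norm_mult_le[OF norm_mult_le[OF d d] d] T(2)] in \<open>simp_all only: norm_minus_cancel\<close>)
  also have "\<dots> \<le> 1200 * a ^ 3" using a_pow(4) by (simp add: power2_eq_square power3_eq_cube)
  finally show "norm (inverse (tser c (of_real s)) - (1 + gap c s)) \<le> 1200 * a ^ 3" by (simp add: T_def)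
qed

lemma pr_integrals:
  shows "((\<lambda>s. pr c (s - b)) has_integral 0) {0..1}"
    "((\<lambda>s. pr c s * pr c (s - b)) has_integral (\<Sum>i\<in>{1,2,3}. (c i)\<^sup>2 * of_real (cos (2 * pi * real i * b))) / 2) {0..1}"
    "((\<lambda>s. (pr c (s - b))\<^sup>2) has_integral (\<Sum>i\<in>{1,2,3}. (c i)\<^sup>2) / 2) {0..1}"
proof -
  have "((\<lambda>s. \<Sum>i\<in>{1,2,3}. c i * of_real (cos (2 * pi * real i * (s - b)))) has_integral (\<Sum>i\<in>{1,2,3}. c i * of_real 0)) {0..1}"
  proof (rule has_integral_sum)
    fix i :: nat assume i: "i \<in> {1,2,3}"
    have "2 * pi * real i * (s - b) = 2 * pi * of_int (int i) * s + (- 2 * pi * real i * b)" for s by (simp add: algebra_simps)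
    then have "((\<lambda>s. cos (2 * pi * real i * (s - b))) has_integral 0) {0..1}"
      using cos_integral_zero[of "int i" "- 2 * pi * real i * b"] i by (simp only:) auto
    then show "((\<lambda>s. c i * of_real (cos (2 * pi * real i * (s - b)))) has_integral c i * of_real 0) {0..1}"
      by (rule has_integral_of_real_mult)
  qed simp
  then show "((\<lambda>s. pr c (s - b)) has_integral 0) {0..1}" by (simp add: pr_def)
  have gen: "((\<lambda>s. pr c (s - b') * pr c (s - b)) has_integral (\<Sum>i\<in>{1,2,3}. (c i)\<^sup>2 * of_real (cos (2 * pi * real i * (b - b')))) / 2) {0..1}" for b b'
  proof -
    have "((\<lambda>s. \<Sum>i\<in>{1,2,3}. \<Sum>l\<in>{1,2,3}. (c i * c l) * of_real (cos (2 * pi * real i * (s - b')) * cos (2 * pi * real l * (s - b))))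
      has_integral (\<Sum>i\<in>{1,2,3}. \<Sum>l\<in>{1,2,3}. (c i * c l) * of_real (if i = l then cos (2 * pi * real l * (b - b')) / 2 else 0))) {0..1}"
      by (intro has_integral_sum has_integral_of_real_mult cos_cos_integral) auto
    moreover have "(\<Sum>i\<in>{1,2,3}. \<Sum>l\<in>{1,2,3}. (c i * c l) * of_real (cos (2 * pi * real i * (s - b')) * cos (2 * pi * real l * (s - b)))) = pr c (s - b') * pr c (s - b)" for s
      unfolding pr_def sum_product by (simp add: mult_ac)
    moreover have "(\<Sum>i\<in>{1,2,3}. \<Sum>l\<in>{1,2,3}. (c i * c l) * of_real (if i = l then cos (2 * pi * real l * (b - b')) / 2 else 0))
       = (\<Sum>i\<in>{1,2,3}. (c i)\<^sup>2 * of_real (cos (2 * pi * real i * (b - b')))) / 2"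
      by (simp add: power2_eq_square add_divide_distrib)
    ultimately show ?thesis by (simp only:)
  qed
  show "((\<lambda>s. pr c s * pr c (s - b)) has_integral (\<Sum>i\<in>{1,2,3}. (c i)\<^sup>2 * of_real (cos (2 * pi * real i * b))) / 2) {0..1}"
    using gen[of 0 b] by simp
  show "((\<lambda>s. (pr c (s - b))\<^sup>2) has_integral (\<Sum>i\<in>{1,2,3}. (c i)\<^sup>2) / 2) {0..1}"
    using gen[of b b] by (simp add: power2_eq_square)
qed

definition S2 :: "(nat \<Rightarrow> complex) \<Rightarrow> complex" where "S2 c = (\<Sum>i\<in>{1,2,3}. (c i)\<^sup>2)"

text \<open>\<open>R1\<close> from 0 to 1 is the mean of 1 / t, that is h 1 - h 0; orthogonality
  leaves only the mean of the squares.\<close>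

lemma mean_close:
  assumes c: "scoef c"
  shows "norm (R1 (tser c) 0 1 - (1 - (c 0 - 1) + S2 c / 2)) \<le> 1200 * a ^ 3"
proof -
  have adm: "adm (tser c)" by (rule adm_tser[OF scoef_cbound[OF c]])
  have "((\<lambda>s. 1 + gap c s) has_integral (1 + (- (c 0 - 1) - 0 + S2 c / 2))) {0..1}"
    unfolding gap_def S2_def
    using has_integral_add[OF has_integral_const_real[of 1 0 1] has_integral_add[OF has_integral_diff[OF has_integral_const_real[of "- (c 0 - 1)" 0 1] pr_integrals(1)[of c 0]] pr_integrals(3)[of c 0]]]
    by simp
  moreover have "continuous_on {0..1} (\<lambda>s. 1 + gap c s)"
    unfolding gap_def pr_def by (intro continuous_intros)
  ultimately have "norm (integral {0..1} (\<lambda>s. inverse (tser c (of_real s))) - (1 + (- (c 0 - 1) - 0 + S2 c / 2))) \<le> 1200 * a ^ 3"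
    by (intro integral_close_const[OF adm_inverse_real_continuous[OF adm continuous_on_id] gap_bounds(3)[OF c]])
  then show ?thesis by (simp add: R1_def algebra_simps)
qed

text \<open>Half the mean of cos (2 * pi * i * r * w) over r in [0, 1]; it is the weight of (c i)^2
  in the action of the circle beyond the part that the mean of 1 / t also contains.\<close>

definition sg :: "real \<Rightarrow> nat \<Rightarrow> real" where "sg w i = sin (2 * pi * real i * w) / (4 * pi * real i * w)"

lemma cos_param_integral:
  assumes "w \<noteq> 0" "i > 0"
  shows "((\<lambda>r. cos (2 * pi * real i * (r * w))) has_integral 2 * sg w i) {0..1}"
proof -
  have "((\<lambda>r. cos (2 * pi * real i * (r * w))) has_integral sin (2 * pi * real i * (1 * w)) / (2 * pi * real i * w) - sin (2 * pi * real i * (0 * w)) / (2 * pi * real i * w)) {0..1::real}"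
  proof (rule fundamental_theorem_of_calculus)
    show "((\<lambda>r. sin (2 * pi * real i * (r * w)) / (2 * pi * real i * w)) has_vector_derivative cos (2 * pi * real i * (x * w))) (at x within {0..1})" for x
      unfolding has_real_derivative_iff_has_vector_derivative[symmetric]
      using assms by (auto intro!: derivative_eq_intros)
  qed simp
  then show ?thesis by (simp add: sg_def mult_ac)
qed

text \<open>The mean in s of the product of the two principal parts is half the sum of (c i)^2 * cos
  (2 * pi * i * r * w), and averaging over r turns this into the terms with
  \<open>sg\<close>.\<close>

lemma Cc_close:
  assumes c: "scoef c" and w: "w \<noteq> 0"
  shows "norm (Cc (tser c) w - (1 - 2 * (c 0 - 1) + S2 c + (\<Sum>i\<in>{1,2,3}. (c i)\<^sup>2 * of_real (sg w i)))) \<le> 4000 * a ^ 3"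
proof -
  have adm: "adm (tser c)" by (rule adm_tser[OF scoef_cbound[OF c]])
  define K where "K = 1 - 2 * (c 0 - 1)"
  define K' where "K' = K + S2 c"
  define P where "P = (\<lambda>r. K' + (\<Sum>i\<in>{1,2,3}. (c i)\<^sup>2 * of_real (cos (2 * pi * real i * (r * w)))) / 2)"
  have inner: "norm (integral {0..1} (\<lambda>s. inverse (tser c (of_real s)) * inverse (tser c (of_real (s - r * w)))) - P r) \<le> 4000 * a ^ 3" for r :: real
  proof -
    define Q where "Q = (\<lambda>s. K - pr c (s - 0) - pr c (s - r * w) + (pr c (s - 0))\<^sup>2 + (pr c (s - r * w))\<^sup>2 + pr c s * pr c (s - r * w))"
    have "(Q has_integral (K - 0 - 0 + S2 c / 2 + S2 c / 2 + (\<Sum>i\<in>{1,2,3}. (c i)\<^sup>2 * of_real (cos (2 * pi * real i * (r * w)))) / 2)) {0..1}"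
      unfolding Q_def S2_def
      by (intro has_integral_add has_integral_diff pr_integrals)
         (use has_integral_const_real[of K 0 1] in simp)
    moreover have "K - 0 - 0 + S2 c / 2 + S2 c / 2 = K + S2 c" by simp
    ultimately have Q: "(Q has_integral P r) {0..1}" by (simp only: P_def K'_def)
    show ?thesis
    proof (rule integral_close_const[OF _ _ Q])
      show "continuous_on {0..1} (\<lambda>s. inverse (tser c (of_real s)) * inverse (tser c (of_real (s - r * w))))"
        by (intro continuous_intros adm_inverse_real_continuous[OF adm])
      show "continuous_on {0..1} Q" unfolding Q_def pr_def by (intro continuous_intros)
      fix s :: real
      define f where "f = inverse (tser c (of_real s))"
      define f' where "f' = inverse (tser c (of_real (s - r * w)))"
      define g where "g = gap c s"
      define g' where "g' = gap c (s - r * w)"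
      define p where "p = pr c s"
      define p' where "p' = pr c (s - r * w)"
      have b: "norm (f - (1 + g)) \<le> 1200 * a ^ 3" "norm (f' - (1 + g')) \<le> 1200 * a ^ 3"
        "norm (g + p) \<le> 100 * a\<^sup>2" "norm (g' + p') \<le> 100 * a\<^sup>2" "norm g' \<le> 7 * a" "norm g \<le> 7 * a" "norm p \<le> 6 * a"
        unfolding f_def f'_def g_def g'_def p_def p'_def by (rule gap_bounds[OF c] pr_bound[OF c])+
      have f': "norm f' \<le> 1002/1000" unfolding f'_def by (rule adm_bounds(5)[OF adm strip_of_real])
      have g1: "norm (1 + g) \<le> 101/100" using norm_triangle_ineq[of 1 g] b(6) a_small by simp
      \<comment> \<open>\<open>Q\<close> is (1 + g) * (1 + g') with the product g * g' replaced by
        its leading part p * p'; the last two terms are the difference g * g' - p * p'.\<close>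
      have "f * f' - Q s = (f - (1 + g)) * f' + (1 + g) * (f' - (1 + g')) + (g + p) * g' + - (p * (g' + p'))"
      proof -
        have "Q s = (1 + g) * (1 + g') - ((g + p) * g' + - (p * (g' + p')))"
          by (simp add: Q_def K_def g_def g'_def gap_def p_def p'_def algebra_simps power2_eq_square)
        then show ?thesis by (simp add: algebra_simps)
      qed
      also have "norm \<dots> \<le> (1200 * a ^ 3) * (1002/1000) + (101/100) * (1200 * a ^ 3) + (100 * a\<^sup>2) * (7 * a) + (6 * a) * (100 * a\<^sup>2)"
        by (intro order_trans[OF norm_triangle_ineq] add_mono norm_mult_le b f' g1)
           (use norm_mult_le[OF b(7) b(4)] in \<open>simp only: norm_minus_cancel\<close>)
      also have "\<dots> \<le> 4000 * a ^ 3" using a_pow(4) by (simp add: power2_eq_square power3_eq_cube)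
      finally show "norm (inverse (tser c (of_real s)) * inverse (tser c (of_real (s - r * w))) - Q s) \<le> 4000 * a ^ 3"
        by (simp add: f_def f'_def)
    qed
  qed
  have P: "(P has_integral (K' + (\<Sum>i\<in>{1,2,3}. (c i)\<^sup>2 * of_real (2 * sg w i)) / 2)) {0..1}"
    unfolding P_def
  proof (intro has_integral_add has_integral_divide has_integral_sum has_integral_of_real_mult cos_param_integral w)
    show "((\<lambda>r. K') has_integral K') {0..1::real}"
      using has_integral_const_real[of K' 0 1] by simp
  qed auto
  have "norm (Cc (tser c) w - (K' + (\<Sum>i\<in>{1,2,3}. (c i)\<^sup>2 * of_real (2 * sg w i)) / 2)) \<le> 4000 * a ^ 3"
    unfolding Cc_def
  proof (rule integral_close_const[OF _ inner P])
    show "continuous_on {0..1} P" unfolding P_def by (intro continuous_intros) auto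
    show "continuous_on {0..1} (\<lambda>r. integral {0..1} (\<lambda>s. inverse (tser c (of_real s)) * inverse (tser c (of_real (s - r * w)))))"
    proof (rule lipschitz_on_continuous_on[of "2 * \<bar>w\<bar>"], rule lipschitz_onI)
      fix r r' :: real
      show "dist (integral {0..1} (\<lambda>s. inverse (tser c (of_real s)) * inverse (tser c (of_real (s - r * w)))))
        (integral {0..1} (\<lambda>s. inverse (tser c (of_real s)) * inverse (tser c (of_real (s - r' * w))))) \<le> 2 * \<bar>w\<bar> * dist r r'"
        using Cc_inner_lipschitz[OF adm, of r w r'] by (simp add: dist_norm)
    qed simp
  qed
  moreover have "(\<Sum>i\<in>{1,2,3}. (c i)\<^sup>2 * of_real (2 * sg w i)) / 2 = (\<Sum>i\<in>{1,2,3}. (c i)\<^sup>2 * of_real (sg w i))"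
    by (simp add: add_divide_distrib)
  ultimately show ?thesis by (simp only: K'_def K_def)
qed

end

section \<open>Coefficients adapted to a Liouville number\<close>

text \<open>For |\<phi>| < 1 / q the argument 2 * pi * q * \<phi> has imaginary part below 2 * pi,
  so this bounds the resonant harmonic where the maximum is sought.\<close>

lemma exp_2pi_le: "exp (2 * pi) \<le> 1200"
proof -
  have "exp (2 * pi) \<le> exp (real 7 * 1)" using pi_approx by simp
  also have "\<dots> = exp 1 ^ 7" by (rule exp_of_nat_mult)
  also have "\<dots> \<le> (272/100) ^ 7" using e_less_272 by (intro power_mono) auto
  also have "\<dots> \<le> 1200" by (simp add: eval_nat_numeral)
  finally show ?thesis .
qed

text \<open>The indices 0 to 3 carry the frequencies 0 to 3, and the denominators of the
  approximants start at index 4. Growth by a factor 8 makes all later harmonics negligible against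
  the resonant one even on the strip. \<open>r\<close> is the radius of the parameter disc.\<close>

locale liouville_series = base_series +
  fixes \<omega> r :: real and pp :: "nat \<Rightarrow> int"
  assumes irrational: "\<omega> \<notin> \<rat>"
    and \<nu>_ge: "\<And>i. i \<ge> 4 \<Longrightarrow> \<nu> i \<ge> 100" and \<nu>_Suc: "\<And>i. i \<ge> 4 \<Longrightarrow> \<nu> (Suc i) \<ge> 8 * \<nu> i"
    and cop: "\<And>i. i \<ge> 4 \<Longrightarrow> coprime (pp i) (int (\<nu> i))"
    and near: "\<And>i. i \<ge> 4 \<Longrightarrow> 10^6 * (\<bar>\<omega> - of_int (pp i) / real (\<nu> i)\<bar> * real (\<nu> i)) \<le> a ^ 3 * (1/4) ^ i * exp (- real (\<nu> i))"
    and r0: "r > 0" "r \<le> 1/2"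
begin

text \<open>The prescribed size of coefficient i. It exceeds the approximation error
  |\<open>eps\<close> i| * \<open>\<nu>\<close> i by a factor 10^6, so the resonant harmonic decides
  where the maximum lies.\<close>

definition kap :: "nat \<Rightarrow> real" where "kap i = a ^ 3 * (1/4) ^ i * exp (- real (\<nu> i))"
definition eps :: "nat \<Rightarrow> real" where "eps i = \<omega> - of_int (pp i) / real (\<nu> i)"

text \<open>The range of the chart \<open>cf\<close>: a resonant coefficient is \<open>kap\<close> i
  times a factor 1 + u / 16, hence 17/16. Unlike \<open>scoef\<close> it bounds these coefficients
  without the weight.\<close>

definition kcoef :: "(nat \<Rightarrow> complex) \<Rightarrow> bool" where
  "kcoef c \<longleftrightarrow> norm (c 0 - 1) \<le> 64 * a\<^sup>2 \<and> (\<forall>i\<in>{1,2,3}. norm (c i) \<le> 2 * a) \<and> (\<forall>i\<ge>4. norm (c i) \<le> 17/16 * kap i)"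

lemma kap_pos: "kap i > 0" using a_pow(4) by (simp add: kap_def)

lemma kap_le: "kap i \<le> a ^ 3" 
proof -
  have "kap i \<le> a ^ 3 * 1 * 1" unfolding kap_def using a_pow(4) by (intro mult_mono) (auto simp: power_le_one)
  then show ?thesis by simp
qed

lemma kap_tiny: "kap i \<le> 1/10^20"
proof -
  have "a ^ 3 \<le> (1/10^7) ^ 3" using a0 a_small by (intro power_mono) auto
  also have "\<dots> \<le> 1/10^20" by (simp add: power3_eq_cube)
  finally show ?thesis using kap_le[of i] by linarith
qed

lemma \<nu>_mono: "i \<ge> 4 \<Longrightarrow> \<nu> (i + k) \<ge> \<nu> i" "i \<ge> 4 \<Longrightarrow> k > 0 \<Longrightarrow> \<nu> (i + k) \<ge> 8 * \<nu> i"
proof -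
  show 1: "\<nu> (i + k) \<ge> \<nu> i" if "i \<ge> 4" for i k
  proof (induction k)
    case (Suc k)
    then show ?case using \<nu>_Suc[of "i + k"] that by simp
  qed simp
  show "\<nu> (i + k) \<ge> 8 * \<nu> i" if "i \<ge> 4" "k > 0"
    using 1[of "Suc i" "k - 1"] \<nu>_Suc[OF that(1)] that by simp
qed

text \<open>Only exp (\<nu> / 2) is left to beat the linear factor of the weight; its quadratic
  Taylor term does so from \<nu> = 100 on.\<close>

lemma wt_kap:
  assumes i: "i \<ge> 4"
  shows "17/16 * wt i \<le> exp (real (\<nu> i))"
proof -
  define n where "n = real (\<nu> i)"
  have n: "n \<ge> 100" using \<nu>_ge[OF i] by (simp add: n_def)
  have "1 + n / 2 + (n / 2)\<^sup>2 / 2 \<le> exp (n / 2)" using n by (intro exp_lower_Taylor_quadratic) auto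
  moreover have "(n / 2)\<^sup>2 / 2 \<ge> 12 * n" using n mult_mono[of 100 n n n] by (simp add: power2_eq_square)
  moreover have "17/16 * (1 + 2 * pi * n) \<le> 17/16 * (1 + 2 * (315/100) * n)"
    using pi_approx n by (intro mult_left_mono add_mono mult_right_mono) auto
  moreover have "17/16 * (1 + 2 * (315/100) * n) \<le> 1 + n / 2 + 12 * n" using n by simp
  ultimately have "17/16 * (1 + 2 * pi * n) \<le> exp (n / 2)" by linarith
  then have "exp (n / 2) * (17/16 * (1 + 2 * pi * n)) \<le> exp (n / 2) * exp (n / 2)" by (intro mult_left_mono) auto
  also have "exp (n / 2) * exp (n / 2) = exp n" by (simp flip: exp_add)
  finally show ?thesis by (simp add: wt_def n_def mult_ac)
qed

lemma kcoef_scoef: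
  assumes c: "kcoef c" shows "scoef c"
  unfolding scoef_def
proof (intro conjI allI impI)
  show "norm (c 0 - 1) \<le> 64 * a\<^sup>2" "\<forall>i\<in>{1,2,3}. norm (c i) \<le> 2 * a" using c by (auto simp: kcoef_def)
  fix i :: nat assume i: "i \<ge> 4"
  have "norm (c i) * wt i \<le> (17/16 * kap i) * wt i"
    using c i wt_ge_1(1)[of i] by (intro mult_right_mono) (auto simp: kcoef_def)
  also have "\<dots> = kap i * (17/16 * wt i)" by simp
  also have "\<dots> \<le> kap i * exp (real (\<nu> i))" using wt_kap[OF i] kap_pos[of i] by (intro mult_left_mono) auto
  also have "\<dots> = a ^ 3 * (1/4) ^ i" by (simp add: kap_def exp_minus)
  also have "\<dots> \<le> a ^ 3 * (1/2) ^ i" using a_pow(4) by (intro mult_left_mono power_mono) auto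
  finally show "norm (c i) * wt i \<le> a ^ 3 * (1/2) ^ i" .
qed

lemma kcoef_adm: "kcoef c \<Longrightarrow> adm (tser c)" by (intro adm_tser scoef_cbound kcoef_scoef)

lemma eps_kap: "i \<ge> 4 \<Longrightarrow> \<bar>eps i\<bar> * real (\<nu> i) \<le> kap i / 10^6"
  using near[of i] by (simp add: eps_def kap_def)

lemma eps_ne: "i \<ge> 4 \<Longrightarrow> eps i \<noteq> 0"
proof
  assume "eps i = 0"
  then have "\<omega> = of_int (pp i) / of_nat (\<nu> i)" by (simp add: eps_def)
  then have "\<omega> \<in> \<rat>" by simp
  then show False using irrational by simp
qed

lemma near_rational_i:
  assumes i: "i \<ge> 4" shows "near_rational \<omega> (eps i) (\<nu> i) (pp i)"
proof
  show "\<nu> i > 0" using \<nu>_ge[OF i] by simp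
  show "\<omega> = of_int (pp i) / of_nat (\<nu> i) + eps i" by (simp add: eps_def)
  have "real (\<nu> i) \<le> exp (real (\<nu> i))" using exp_ge_add_one_self[of "real (\<nu> i)"] by linarith
  then have "real (\<nu> i) * exp (- real (\<nu> i)) \<le> 1" by (simp add: exp_minus field_simps)
  then have "a ^ 3 * (1/4) ^ i * (real (\<nu> i) * exp (- real (\<nu> i))) \<le> 1 * 1 * 1"
    using a_pow a0 a_small by (intro mult_mono) (auto simp: power_le_one)
  then have "kap i * real (\<nu> i) \<le> 1" by (simp add: kap_def mult_ac)
  moreover have "(\<bar>eps i\<bar> * real (\<nu> i)) * real (\<nu> i) \<le> (kap i / 10^6) * real (\<nu> i)"
    using eps_kap[OF i] by (intro mult_right_mono) auto
  ultimately show "\<bar>eps i\<bar> * (real (\<nu> i))\<^sup>2 \<le> 1 / 10 ^ 6" by (simp add: power2_eq_square mult_ac)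
qed

text \<open>The limit of the reciprocal excess as the period tends to infinity; a resonant harmonic contributes only at its own period.\<close>

definition Iw :: "(nat \<Rightarrow> complex) \<Rightarrow> complex" where
  "Iw c = (c 0)\<^sup>2 + (\<Sum>i. (c (Suc i))\<^sup>2 * of_real (cos (2 * pi * real (\<nu> (Suc i)) * \<omega>))) / 2"

lemma Iw_term_bound:
  assumes c: "kcoef c"
  shows "norm ((c (Suc i))\<^sup>2 * of_real (cos (2 * pi * real (\<nu> (Suc i)) * \<omega>))) \<le> a * (1/2) ^ i"
    "i \<ge> 3 \<Longrightarrow> norm ((c (Suc i))\<^sup>2 * of_real (cos (2 * pi * real (\<nu> (Suc i)) * \<omega>))) \<le> 2 * (kap (Suc i))\<^sup>2"
proof -
  have n: "norm ((c (Suc i))\<^sup>2 * of_real (cos (2 * pi * real (\<nu> (Suc i)) * \<omega>))) \<le> (norm (c (Suc i)))\<^sup>2" 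
    using norm_mult_le[of "(c (Suc i))\<^sup>2" "(norm (c (Suc i)))\<^sup>2" "of_real (cos (2 * pi * real (\<nu> (Suc i)) * \<omega>))" 1]
    by (simp only: norm_of_real abs_cos_le_one norm_power mult_1_right order_refl)
  show 2: "norm ((c (Suc i))\<^sup>2 * of_real (cos (2 * pi * real (\<nu> (Suc i)) * \<omega>))) \<le> 2 * (kap (Suc i))\<^sup>2" if "i \<ge> 3"
  proof -
    have "(norm (c (Suc i)))\<^sup>2 \<le> (17/16 * kap (Suc i))\<^sup>2" using c that by (intro power_mono) (auto simp: kcoef_def)
    also have "\<dots> \<le> 2 * (kap (Suc i))\<^sup>2" by (simp add: power_mult_distrib power2_eq_square)
    finally show ?thesis using n by linarith
  qed
  show "norm ((c (Suc i))\<^sup>2 * of_real (cos (2 * pi * real (\<nu> (Suc i)) * \<omega>))) \<le> a * (1/2) ^ i"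
  proof (cases "i \<ge> 3")
    case True
    have "2 * (kap (Suc i))\<^sup>2 \<le> 2 * (kap (Suc i) * (1/2))"
      using kap_pos[of "Suc i"] kap_tiny[of "Suc i"] unfolding power2_eq_square by (intro mult_left_mono) auto
    also have "\<dots> = kap (Suc i)" by simp
    also have "\<dots> \<le> a ^ 3 * (1/4) ^ Suc i * 1" unfolding kap_def using a_pow by (intro mult_left_mono) auto
    also have "\<dots> \<le> a * (1/2) ^ i * 1"
    proof (intro mult_mono)
      show "a ^ 3 \<le> a" using a_pow a0 by linarith
      have "(1/4::real) ^ Suc i \<le> (1/4) ^ i" by simp
      also have "\<dots> \<le> (1/2) ^ i" by (intro power_mono) auto
      finally show "(1/4::real) ^ Suc i \<le> (1/2) ^ i" .
    qed (use a0 in auto)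
    finally show ?thesis using 2[OF True] by linarith
  next
    case False
    then have "Suc i \<in> {1,2,3}" by auto
    then have "norm (c (Suc i)) \<le> 2 * a" using c unfolding kcoef_def by blast
    then have "(norm (c (Suc i)))\<^sup>2 \<le> (2 * a)\<^sup>2" by (intro power_mono) auto
    also have "\<dots> = 4 * a\<^sup>2" by (simp add: power_mult_distrib)
    also have "\<dots> \<le> a * (1/2) ^ 2" using a_pow(1) a0 by (simp add: power2_eq_square)
    also have "\<dots> \<le> a * (1/2) ^ i" using False a0 by (intro mult_left_mono power_decreasing) auto
    finally show ?thesis using n by linarith
  qed
qed

lemma Iw_summable:
  assumes c: "kcoef c"
  shows "summable (\<lambda>i. norm ((c (Suc i))\<^sup>2 * of_real (cos (2 * pi * real (\<nu> (Suc i)) * \<omega>))))"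
  by (rule summable_comparison_test'[OF sums_summable[OF half_powers_sums[of a]]]) (use Iw_term_bound(1)[OF c] in auto)

lemma Iw_holomorphic:
  assumes D: "open D" and cc: "\<And>i. (\<lambda>z. cc z i) holomorphic_on D" "\<And>z. z \<in> D \<Longrightarrow> kcoef (cc z)"
  shows "(\<lambda>z. Iw (cc z)) holomorphic_on D"
proof -
  have "(\<lambda>z. \<Sum>i. (cc z (Suc i))\<^sup>2 * of_real (cos (2 * pi * real (\<nu> (Suc i)) * \<omega>))) holomorphic_on D"
  proof (rule holomorphic_on_uniform_seq[OF D])
    show "(\<lambda>z. \<Sum>i<n. (cc z (Suc i))\<^sup>2 * of_real (cos (2 * pi * real (\<nu> (Suc i)) * \<omega>))) holomorphic_on D" for n
      by (intro holomorphic_intros cc)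
    show "uniform_limit D (\<lambda>n z. \<Sum>i<n. (cc z (Suc i))\<^sup>2 * of_real (cos (2 * pi * real (\<nu> (Suc i)) * \<omega>)))
      (\<lambda>z. \<Sum>i. (cc z (Suc i))\<^sup>2 * of_real (cos (2 * pi * real (\<nu> (Suc i)) * \<omega>))) sequentially"
      by (rule Weierstrass_m_test[OF _ sums_summable[OF half_powers_sums[of a]]]) (rule Iw_term_bound(1)[OF cc(2)])
  qed
  then show ?thesis unfolding Iw_def by (intro holomorphic_intros cc) auto
qed

lemma kap_decay: "i \<ge> 4 \<Longrightarrow> kap (i + k) \<le> kap i * (1/4) ^ k"
proof -
  assume i: "i \<ge> 4"
  have "exp (- real (\<nu> (i + k))) \<le> exp (- real (\<nu> i))" using \<nu>_mono(1)[OF i, of k] by simp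
  then have "a ^ 3 * (1/4) ^ (i + k) * exp (- real (\<nu> (i + k))) \<le> a ^ 3 * (1/4) ^ (i + k) * exp (- real (\<nu> i))"
    using a_pow by (intro mult_left_mono) auto
  then show ?thesis by (simp add: kap_def power_add mult_ac)
qed

text \<open>Coefficients enter \<open>Iw\<close> through their squares, so even the resonant
  coefficient j contributes only on the order of (\<open>kap\<close> j)^2, against its linear effect
  at its own period.\<close>

lemma Iw_partial:
  assumes c: "kcoef c" and j: "j \<ge> 4"
  shows "norm (Iw c - ((c 0)\<^sup>2 + (\<Sum>i\<in>{1..<j}. (c i)\<^sup>2 * of_real (cos (2 * pi * real (\<nu> i) * \<omega>))) / 2)) \<le> 2 * (kap j)\<^sup>2"
proof -
  define f where "f = (\<lambda>i. (c i)\<^sup>2 * of_real (cos (2 * pi * real (\<nu> i) * \<omega>)))"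
  have s: "summable (\<lambda>i. norm (f (Suc i)))" using Iw_summable[OF c] by (simp add: f_def)
  have s': "summable (\<lambda>i. norm (f (Suc (i + (j - 1)))))" by (rule summable_ignore_initial_segment[OF s])
  have split: "(\<Sum>i. f (Suc i)) = (\<Sum>i. f (Suc (i + (j - 1)))) + (\<Sum>i<j - 1. f (Suc i))"
    by (rule suminf_split_initial_segment[OF summable_norm_cancel[OF s]])
  have "(\<Sum>i<j - 1. f (Suc i)) = (\<Sum>i\<in>{1..<j}. f i)"
    by (rule sum.reindex_bij_witness[where i="\<lambda>i. i - 1" and j=Suc]) (use j in auto)
  then have "Iw c - ((c 0)\<^sup>2 + (\<Sum>i\<in>{1..<j}. f i) / 2) = (\<Sum>i. f (Suc (i + (j - 1)))) / 2"
    using split by (simp add: Iw_def f_def add_divide_distrib)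
  moreover have "norm (\<Sum>i. f (Suc (i + (j - 1)))) \<le> 4 * (kap j)\<^sup>2"
  proof -
    have le: "norm (f (Suc (i + (j - 1)))) \<le> (2 * (kap j)\<^sup>2) * (1/2) ^ i" for i
    proof -
      have "norm (f (Suc (i + (j - 1)))) \<le> 2 * (kap (Suc (i + (j - 1))))\<^sup>2"
        unfolding f_def using j by (intro Iw_term_bound(2)[OF c]) simp
      also have e: "Suc (i + (j - 1)) = j + i" using j by simp
      also have "(kap (j + i))\<^sup>2 \<le> (kap j * (1/4) ^ i)\<^sup>2" using kap_decay[OF j, of i] kap_pos[of "j + i"] by (intro power_mono) auto
      also have "(kap j * (1/4) ^ i)\<^sup>2 = (kap j)\<^sup>2 * ((1/4)\<^sup>2) ^ i"
        unfolding power_mult_distrib power_mult[symmetric] by (subst mult.commute[of i 2]) (rule refl)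
      also have "\<dots> \<le> (kap j)\<^sup>2 * (1/2) ^ i" by (intro mult_left_mono power_mono) (auto simp: power2_eq_square)
      finally show ?thesis by (simp only: e mult.assoc)
    qed
    have "norm (\<Sum>i. f (Suc (i + (j - 1)))) \<le> (\<Sum>i. (2 * (kap j)\<^sup>2) * (1/2) ^ i)"
      by (rule order_trans[OF summable_norm[OF s'] suminf_le[OF le s' sums_summable[OF half_powers_sums]]])
    also have "\<dots> = 4 * (kap j)\<^sup>2" using sums_unique[OF half_powers_sums[of "2 * (kap j)\<^sup>2"]] by simp
    finally show ?thesis .
  qed
  ultimately have "norm (Iw c - ((c 0)\<^sup>2 + (\<Sum>i\<in>{1..<j}. f i) / 2)) \<le> 2 * (kap j)\<^sup>2"
    by (simp only: norm_divide) simp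
  then show ?thesis by (simp only: f_def)
qed

lemma tail_after:
  assumes c: "kcoef c" and j: "j \<ge> 4" and z: "z \<in> strip"
  shows "norm (\<Sum>i. c (i + Suc j) * csn (i + Suc j) z) \<le> kap j / 10^5"
proof -
  have "norm (\<Sum>i. c (i + Suc j) * csn (i + Suc j) z) \<le> 2 * (kap j * (17/16) / 10^6)"
  proof (rule tail_bound[OF scoef_cbound[OF kcoef_scoef[OF c]] z])
    fix i assume i: "i \<ge> Suc j"
    then have "i = j + (i - j)" "i - j > 0" by auto
    then obtain k where k: "i = j + k" "k > 0" by blast
    define n where "n = real (\<nu> j)"
    define m where "m = real (\<nu> i)"
    have n: "n \<ge> 100" using \<nu>_ge[OF j] by (simp add: n_def)
    have m: "m \<ge> 8 * n" using \<nu>_mono(2)[OF j k(2)] by (simp add: n_def m_def k(1))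
    \<comment> \<open>From m \<ge> 8 * n one gets exp (- m / 2) \<le> exp (- 4 * n): one factor exp
      (- n) reproduces \<open>kap\<close> j, and exp (- 3 * n) supplies the gain 10^(-6).\<close>
    have "exp (- m) * exp (m / 2) = exp (- (m / 2))" by (simp flip: exp_add)
    also have "\<dots> \<le> exp (- n - 3 * n)" using m by simp
    also have "\<dots> = exp (- n) * exp (- (3 * n))" by (simp flip: exp_add)
    also have "exp (- (3 * n)) \<le> 1 / 10^6"
    proof -
      have "100 \<le> exp n" using exp_ge_add_one_self[of n] n by linarith
      then have "100 ^ 3 \<le> exp n ^ 3" by (intro power_mono) auto
      also have "exp n ^ 3 = exp (3 * n)" by (simp flip: exp_of_nat_mult)
      finally show ?thesis by (simp add: exp_minus divide_simps)
    qed
    finally have e: "exp (- m) * exp (m / 2) \<le> exp (- n) * (1 / 10^6)" by simp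
    have "norm (c i * csn i z) \<le> (17/16 * kap i) * exp (m / 2)"
      using c i j csn_bound(1)[OF z, of i] by (intro norm_mult_le) (auto simp: kcoef_def m_def)
    also have "\<dots> = 17/16 * (a ^ 3 * (1/4) ^ i) * (exp (- m) * exp (m / 2))" by (simp add: kap_def m_def)
    also have "\<dots> \<le> 17/16 * (a ^ 3 * (1/4) ^ i) * (exp (- n) * (1 / 10^6))"
      using e a_pow by (intro mult_left_mono) auto
    also have "\<dots> = (kap j * (17/16) / 10^6) * (1/4) ^ k" by (simp add: kap_def n_def k(1) power_add)
    also have "\<dots> \<le> (kap j * (17/16) / 10^6) * (1/2) ^ (i - Suc j)"
    proof (intro mult_left_mono)
      have "(1/4::real) ^ k \<le> (1/2) ^ k" by (intro power_mono) auto
      also have "\<dots> \<le> (1/2) ^ (i - Suc j)" using k by (intro power_decreasing) auto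
      finally show "(1/4::real) ^ k \<le> (1/2) ^ (i - Suc j)" .
    qed (use kap_pos[of j] in auto)
    finally show "norm (c i * csn i z) \<le> (kap j * (17/16) / 10^6) * (1/2) ^ (i - Suc j)" .
  qed
  also have "\<dots> \<le> kap j / 10^5" using kap_pos[of j] by simp
  finally show ?thesis .
qed

end

section \<open>The model for the reciprocal excess at a resonant period, and the system to be
  solved\<close>

lemma cos_shift_bound:
  assumes x: "\<bar>Im x\<bar> \<le> 2 * pi"
  shows "norm (cos (x + of_real d) - cos x) \<le> 2400 * \<bar>d\<bar>" "norm (cos (x + of_real d)) \<le> 1200" "norm (cos x) \<le> 1200"
proof -
  have e: "exp \<bar>Im x\<bar> \<le> 1200" using x exp_2pi_le by (meson exp_le_cancel_iff order_trans)
  show 1: "norm (cos x) \<le> 1200" using norm_cos_sin_le_exp_Im(1)[of x] e by linarith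
  show "norm (cos (x + of_real d)) \<le> 1200" using norm_cos_sin_le_exp_Im(1)[of "x + of_real d"] e by simp
  have 2: "norm (sin x) \<le> 1200" using norm_cos_sin_le_exp_Im(2)[of x] e by linarith
  have "\<bar>cos d - 1\<bar> = 2 * (\<bar>sin (d/2)\<bar> * \<bar>sin (d/2)\<bar>)" using cos_double_sin[of "d/2"] by (simp add: power2_eq_square abs_mult)
  also have "\<dots> \<le> 2 * (\<bar>d/2\<bar> * 1)" by (intro mult_left_mono mult_mono abs_sin_x_le_abs_x abs_sin_le_one) auto
  finally have c: "norm (of_real (cos d - 1) :: complex) \<le> \<bar>d\<bar>" unfolding norm_of_real by linarith
  have s: "norm (of_real (sin d) :: complex) \<le> \<bar>d\<bar>" unfolding norm_of_real by (rule abs_sin_x_le_abs_x)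
  have "cos (x + of_real d) - cos x = cos x * of_real (cos d - 1) + - (sin x * of_real (sin d))"
    by (simp add: cos_add cos_of_real sin_of_real algebra_simps)
  also have "norm \<dots> \<le> 1200 * \<bar>d\<bar> + 1200 * \<bar>d\<bar>"
    by (intro order_trans[OF norm_triangle_ineq] add_mono norm_mult_le 1 c) (use norm_mult_le[OF 2 s] in \<open>simp only: norm_minus_cancel\<close>)
  finally show "norm (cos (x + of_real d) - cos x) \<le> 2400 * \<bar>d\<bar>" by simp
qed

context liouville_series
begin

definition Mj :: "nat \<Rightarrow> (complex \<Rightarrow> complex) \<Rightarrow> complex \<Rightarrow> complex" where
  "Mj j t \<phi> = near_rational.Mw \<omega> (eps j) (\<nu> j) t \<phi>"

lemma \<nu>_less: assumes j: "j \<ge> 4" and i: "i < j" shows "2 * \<nu> i < \<nu> j"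
proof (cases "i \<ge> 4")
  case True
  then have "8 * \<nu> i \<le> \<nu> (i + (j - i))" using i by (intro \<nu>_mono(2)) auto
  then show ?thesis using i \<nu>_ge[OF True] by simp
next
  case False
  then have "i = 0 \<or> i \<in> {1,2,3}" by auto
  then have "\<nu> i \<le> 3" using \<nu>_eq[of i] \<nu>0 by auto
  then show ?thesis using \<nu>_ge[OF j] by simp
qed

lemma \<nu>_pos: "0 < i \<Longrightarrow> 0 < \<nu> i"
proof -
  assume "0 < i"
  then have "i \<ge> 4 \<or> i \<in> {1,2,3}" by auto
  then show "0 < \<nu> i" using \<nu>_ge[of i] \<nu>_eq[of i] by auto
qed

lemma \<nu>_inj: assumes "\<nu> i = \<nu> l" shows "i = l"
proof -
  have *: "\<nu> i < \<nu> l" if "i < l" for i l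
  proof (cases "l \<ge> 4")
    case True then show ?thesis using \<nu>_less[OF True that] by simp
  next
    case False
    then have "l \<in> {1,2,3}" "i = 0 \<or> i \<in> {1,2,3}" using that by auto
    then show ?thesis using \<nu>_eq[of i] \<nu>_eq[of l] \<nu>0 that by auto
  qed
  show ?thesis using *[of i l] *[of l i] assms by (metis less_irrefl linorder_neqE_nat)
qed

text \<open>At frequency q the translation by \<omega> is a phase shift by d = 2 * pi * q *
  \<open>eps\<close> j, tiny against \<open>kap\<close> j, so the two cosines in
  \<open>XX_close\<close> merge into 2 * cos. Every error is linear in \<open>kap\<close> j with a
  small factor or quadratic in it.\<close>

lemma Mj_model:
  assumes c: "kcoef c" and j: "j \<ge> 4" and \<phi>: "norm \<phi> < 1 / real (\<nu> j)"
  shows "norm (Mj j (tser c) \<phi> - (Iw c + 2 * (c j * c 0) * cos (of_real (2 * pi * real (\<nu> j)) * \<phi>))) \<le> kap j / 1000"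
proof -
  interpret nr: near_rational \<omega> "eps j" "\<nu> j" "pp j" by (rule near_rational_i[OF j])
  define q where "q = \<nu> j"
  define K where "K = kap j"
  have K: "0 < K" "K \<le> 1/10^20" using kap_pos kap_tiny by (auto simp: K_def)
  have q100: "q \<ge> 100" using \<nu>_ge[OF j] by (simp add: q_def)
  have t: "adm (tser c)" by (rule kcoef_adm[OF c])
  have cb: "cbound c" by (rule scoef_cbound[OF kcoef_scoef[OF c]])
  have qr: "real q > 0" using q100 by simp
  have \<phi>1: "norm \<phi> < 1/100"
  proof -
    have "1 / real q \<le> 1 / 100" using q100 by (intro divide_left_mono) auto
    then show ?thesis using \<phi> by (simp add: q_def)
  qed
  then have Im\<phi>: "\<bar>Im \<phi>\<bar> < 1/100" using abs_Im_le_cmod[of \<phi>] by linarith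
  have \<phi>s: "\<phi> \<in> strip" using Im\<phi> by (simp add: strip_def)
  define x where "x = of_real (2 * pi * real q) * \<phi>"
  define d where "d = 2 * pi * (real q * eps j)"
  have Imx: "\<bar>Im x\<bar> \<le> 2 * pi"
  proof -
    have "\<bar>Im x\<bar> = 2 * pi * (real q * \<bar>Im \<phi>\<bar>)" by (simp add: x_def abs_mult)
    also have "\<dots> \<le> 2 * pi * 1"
    proof (intro mult_left_mono)
      have "real q * \<bar>Im \<phi>\<bar> \<le> real q * (1 / real q)" using \<phi> abs_Im_le_cmod[of \<phi>] by (intro mult_left_mono) (auto simp: q_def)
      then show "real q * \<bar>Im \<phi>\<bar> \<le> 1" using qr by simp
    qed simp
    finally show ?thesis by simp
  qed
  have d: "\<bar>d\<bar> \<le> K / 10^5"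
  proof -
    have "\<bar>d\<bar> = (2 * pi) * (\<bar>eps j\<bar> * real q)" by (simp add: d_def abs_mult)
    also have "\<dots> \<le> 8 * (K / 10^6)" using eps_kap[OF j] pi_less_4 by (intro mult_mono) (auto simp: q_def K_def)
    also have "\<dots> \<le> K / 10^5" using K by simp
    finally show ?thesis .
  qed
  have x': "cos (of_real (2 * pi * real q) * (\<phi> + of_real \<omega>)) = cos (x + of_real d)"
  proof -
    have "real q * \<omega> = of_int (pp j) + real q * eps j" using qr by (simp add: eps_def q_def field_simps)
    then have "2 * pi * (real q * \<omega>) = 2 * pi * (of_int (pp j) + real q * eps j)" by (rule arg_cong)
    then have "2 * pi * real q * \<omega> = 2 * of_int (pp j) * pi + d" by (simp only: d_def mult.assoc distrib_left) (simp only: mult.commute mult.left_commute)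
    then have "of_real (2 * pi * real q * \<omega>) = (of_real (2 * of_int (pp j) * pi) + of_real d :: complex)" by (metis of_real_add)
    moreover have "of_real (2 * pi * real q) * (\<phi> + of_real \<omega>) = x + of_real (2 * pi * real q * \<omega>)" by (simp add: x_def algebra_simps)
    ultimately have "of_real (2 * pi * real q) * (\<phi> + of_real \<omega>) = (x + of_real d) + of_real (2 * of_int (pp j) * pi)" by simp
    then show ?thesis unfolding complex_cos_eq by (metis Ints_of_int)
  qed
  define Ij where "Ij = (c 0)\<^sup>2 + (\<Sum>i\<in>{1..<j}. (c i)\<^sup>2 * cos (of_real (2 * pi * real (\<nu> i) * \<omega>))) / 2"
  have XX: "norm (nr.XX (tser c) \<phi> - (Ij + c j * c 0 * (cos x + cos (x + of_real d)) + (c j)\<^sup>2 * (cos x * cos (x + of_real d)))) \<le> 3 * (K / 10^5)"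
    unfolding Ij_def x'[symmetric] unfolding x_def q_def
  proof (rule nr.XX_close[where \<nu>=\<nu> and j=j, OF cop[OF j] _ \<nu>0])
    show "tser c z = (\<Sum>i<j. c i * cos (of_real (2 * pi * real (\<nu> i)) * z)) + c j * cos (of_real (2 * pi * real (\<nu> j)) * z) + (\<Sum>i. c (i + Suc j) * csn (i + Suc j) z)" if "z \<in> strip" for z
      using tser_split[OF cb that, of "Suc j"] by (simp add: csn_def)
    show "norm (\<Sum>i. c (i + Suc j) * csn (i + Suc j) z) \<le> K / 10^5" if "z \<in> strip" for z
      unfolding K_def by (rule tail_after[OF c j that])
    show "K / 10^5 \<le> 1/1000" using K by simp
    show "0 < j" using j by simp
  qed (use \<nu>_less[OF j] \<nu>_pos \<nu>_inj t \<phi>s in auto)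
  have Ijw: "norm (Ij - Iw c) \<le> 2 * K\<^sup>2"
    using Iw_partial[OF c j] unfolding Ij_def K_def by (simp only: cos_of_real norm_minus_commute)
  have M: "norm (Mj j (tser c) \<phi> - nr.XX (tser c) \<phi>) \<le> 100 * (K / 10^6)"
  proof -
    have "norm (Mj j (tser c) \<phi> - nr.XX (tser c) \<phi>) \<le> 100 * (\<bar>eps j\<bar> * real (\<nu> j))"
      unfolding Mj_def by (rule nr.Mw_close(1)[OF t]) (use Im\<phi> in linarith)
    then show ?thesis using eps_kap[OF j] unfolding K_def by linarith
  qed
  have cj: "norm (c j) \<le> 17/16 * K" using c j by (simp add: kcoef_def K_def)
  have c0: "norm (c 0) \<le> 1001/1000" using adm_bounds(1)[OF t] c a_pow(1) a_small norm_triangle_sub[of "c 0" 1] by (simp add: kcoef_def)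
  note cs = cos_shift_bound(1,2)[OF Imx, of d] cos_shift_bound(3)[OF Imx]
  \<comment> \<open>The quadratic terms carry factors up to 2 * 10^6, coming from the bound 1200 on
    each cosine; K \<le> 10^(-20) absorbs them.\<close>
  have K2: "K\<^sup>2 \<le> K / 10^20" unfolding power2_eq_square using K mult_left_mono[of K "1/10^20" K] by simp
  have A: "norm (c j * c 0 * (cos (x + of_real d) - cos x)) \<le> (17/16 * K) * (1001/1000) * (2400 * (K / 10^5))"
    by (intro norm_mult_le cj c0 order_trans[OF cs(1)]) (use d in simp)
  have B: "norm (c j * c j * (cos x * cos (x + of_real d))) \<le> (17/16 * K) * (17/16 * K) * (1200 * 1200)"
    by (intro norm_mult_le cj cs)
  have A': "(17/16 * K) * (1001/1000) * (2400 * (K / 10^5)) \<le> K\<^sup>2" by (simp add: power2_eq_square)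
  have B': "(17/16 * K) * (17/16 * K) * (1200 * 1200) \<le> 2 * 10^6 * K\<^sup>2" by (simp add: power2_eq_square)
  define Z where "Z = Ij + c j * c 0 * (cos x + cos (x + of_real d)) + (c j)\<^sup>2 * (cos x * cos (x + of_real d))"
  have "Mj j (tser c) \<phi> - (Iw c + 2 * (c j * c 0) * cos x)
     = (Mj j (tser c) \<phi> - nr.XX (tser c) \<phi>) + (nr.XX (tser c) \<phi> - Z) + (Ij - Iw c) + c j * c 0 * (cos (x + of_real d) - cos x) + c j * c j * (cos x * cos (x + of_real d))"
    by (simp add: Z_def algebra_simps power2_eq_square)
  also have "norm \<dots> \<le> 100 * (K / 10^6) + 3 * (K / 10^5) + 2 * K\<^sup>2 + K\<^sup>2 + 2 * 10^6 * K\<^sup>2"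
    by (intro order_trans[OF norm_triangle_ineq] add_mono M XX[folded Z_def] Ijw order_trans[OF A A'] order_trans[OF B B'])
  also have "\<dots> \<le> K / 1000" using K K2 by simp
  finally show ?thesis by (simp add: x_def q_def K_def)
qed

text \<open>The weight of (c i)^2 in \<open>Iw\<close> + 2 * (mean of 1 / t): the mean gives 1, and
  \<open>Iw\<close> gives half a cosine.\<close>

definition gm :: "nat \<Rightarrow> real" where "gm i = 1 + cos (2 * pi * real i * \<omega>) / 2"
text \<open>The determinant of the two leading-order conditions in the unknowns (c 1)^2 and (c
  2)^2.\<close>

definition DD :: real where "DD = sg \<omega> 1 * gm 2 - sg \<omega> 2 * gm 1"

text \<open>The combinations with the mean of \<open>1 / t\<close> cancel the dependence on the constant coefficient to leading order.\<close>

definition e1 :: "(nat \<Rightarrow> complex) \<Rightarrow> complex" where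
  "e1 c = (Cc (tser c) \<omega> - 1 - 2 * (R1 (tser c) 0 1 - 1)) / of_real (a\<^sup>2) - of_real (\<Sum>i\<in>{1,2,3}. sg \<omega> i)"
definition e2 :: "(nat \<Rightarrow> complex) \<Rightarrow> complex" where
  "e2 c = (Iw c - 1 + 2 * (R1 (tser c) 0 1 - 1)) / of_real (a\<^sup>2) - of_real (\<Sum>i\<in>{1,2,3}. gm i)"

text \<open>A chart of the coefficients by the unit polydisc. Squaring the factor 1 + u / 16 gives 1
  + u / 8 up to a small square, which is the origin of the factor 8 in the Newton map. Component 3
  of \<open>u\<close> is idle; the parameter takes its place.\<close>

definition cf :: "complex \<Rightarrow> (nat \<Rightarrow> complex) \<Rightarrow> nat \<Rightarrow> complex" where
  "cf \<tau> u i = (if i = 0 then 1 + 64 * of_real (a\<^sup>2) * u 0 else if i = 3 then of_real a * (1 + \<tau>)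
     else if i < 3 then of_real a * (1 + u i / 16) else of_real (kap i) * (1 + u i / 16))"

text \<open>A quasi-Newton map: at its fixed points the mean of \<open>1 / t\<close> is 1, the action of the circle and \<open>Iw\<close> have prescribed values, and so have all \<open>Mj i\<close>. The parameter only enters through the third harmonic.\<close>

definition P2 :: "complex \<Rightarrow> (nat \<Rightarrow> complex) \<Rightarrow> nat \<Rightarrow> complex" where
  "P2 \<tau> u i = (let c = cf \<tau> u in
     if i = 0 then u 0 + (R1 (tser c) 0 1 - 1) / of_real (64 * a\<^sup>2)
     else if i = 1 then u 1 - 8 * (of_real (gm 2) * e1 c - of_real (sg \<omega> 2) * e2 c) / of_real DD
     else if i = 2 then u 2 - 8 * (of_real (sg \<omega> 1) * e2 c - of_real (gm 1) * e1 c) / of_real DD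
     else if i = 3 then 0
     else u i - (Mj i (tser c) 0 - Iw c - 2 * of_real (kap i)) * (8 / of_real (kap i)))"

lemma norm_one_plus: "norm (x::complex) \<le> d \<Longrightarrow> norm (1 + x) \<le> 1 + d"
  using norm_triangle_ineq[of 1 x] by simp

lemma kcoef_cf:
  assumes u: "\<And>i. norm (u i) \<le> 1" and \<tau>: "norm \<tau> \<le> r"
  shows "kcoef (cf \<tau> u)"
  unfolding kcoef_def
proof (intro conjI ballI allI impI)
  have "norm (cf \<tau> u 0 - 1) = 64 * a\<^sup>2 * norm (u 0)" by (simp add: cf_def norm_mult norm_power)
  also have "\<dots> \<le> 64 * a\<^sup>2 * 1" using u[of 0] by (intro mult_left_mono) auto
  finally show "norm (cf \<tau> u 0 - 1) \<le> 64 * a\<^sup>2" by simp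
  have ub: "norm (1 + u i / 16) \<le> 17/16" for i
    using norm_one_plus[of "u i / 16" "1/16"] u[of i] by (simp add: norm_divide)
  fix i :: nat
  {
    assume i: "i \<in> {1,2,3}"
    have "norm (1 + \<tau>) \<le> 2" using norm_one_plus[OF \<tau>] r0 by simp
    moreover have "norm (1 + u i / 16) \<le> 2" using ub[of i] by simp
    ultimately have "norm (if i = 3 then 1 + \<tau> else 1 + u i / 16) \<le> 2" by simp
    then have "norm (of_real a * (if i = 3 then 1 + \<tau> else 1 + u i / 16)) \<le> a * 2"
      using a0 by (intro norm_mult_le) auto
    moreover have "cf \<tau> u i = of_real a * (if i = 3 then 1 + \<tau> else 1 + u i / 16)" using i by (auto simp: cf_def)
    ultimately show "norm (cf \<tau> u i) \<le> 2 * a" by simp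
  }
  assume "i \<ge> 4"
  then have "cf \<tau> u i = of_real (kap i) * (1 + u i / 16)" by (simp add: cf_def)
  also have "norm \<dots> \<le> kap i * (17/16)" using kap_pos[of i] by (intro norm_mult_le ub) auto
  finally show "norm (cf \<tau> u i) \<le> 17/16 * kap i" by simp
qed

lemma cf_holomorphic:
  assumes "\<tau> holomorphic_on D" "\<And>i. (\<lambda>z. u z i) holomorphic_on D"
  shows "(\<lambda>z. cf (\<tau> z) (u z) i) holomorphic_on D"
proof -
  consider "i = 0" | "i = 3" | "i < 3" "i \<noteq> 0" | "i > 3" by linarith
  then show ?thesis
    by cases (simp_all add: cf_def, (intro holomorphic_intros assms; simp)+)
qed

lemma sg_bound: "\<bar>sg \<omega> i\<bar> \<le> 1/2"
proof -
  define x where "x = 2 * pi * real i * \<omega>"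
  have "\<bar>sin x\<bar> \<le> \<bar>x\<bar>" by (rule abs_sin_x_le_abs_x)
  then have "\<bar>sin x / (2 * x)\<bar> \<le> 1/2" by (cases "x = 0") (auto simp: divide_simps)
  moreover have "sg \<omega> i = sin x / (2 * x)" by (simp add: sg_def x_def)
  ultimately show ?thesis by simp
qed

lemma gm_bound: "\<bar>gm i\<bar> \<le> 3/2"
  using abs_cos_le_one[of "2 * pi * real i * \<omega>"] unfolding gm_def by linarith

text \<open>With b = c 0 - 1, both the circle action and the mean contain b linearly, and so does
  \<open>Iw\<close>; the chosen combinations cancel b and leave sums of squares. The constant 6400
  is 4000 + 2 * 1200.\<close>

lemma e_close:
  assumes c: "kcoef c"
  shows "norm (e1 c - (\<Sum>i\<in>{1,2,3}. ((c i / of_real a)\<^sup>2 - 1) * of_real (sg \<omega> i))) \<le> 6400 * a"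
    "norm (e2 c - (\<Sum>i\<in>{1,2,3}. ((c i / of_real a)\<^sup>2 - 1) * of_real (gm i))) \<le> 2500 * a"
proof -
  have s: "scoef c" by (rule kcoef_scoef[OF c])
  have om0: "\<omega> \<noteq> 0" using irrational by auto
  define N where "N = R1 (tser c) 0 1"
  define b where "b = c 0 - 1"
  have N: "norm (N - (1 - b + S2 c / 2)) \<le> 1200 * a ^ 3" using mean_close[OF s] by (simp add: N_def b_def)
  have Cc: "norm (Cc (tser c) \<omega> - (1 - 2 * b + S2 c + (\<Sum>i\<in>{1,2,3}. (c i)\<^sup>2 * of_real (sg \<omega> i)))) \<le> 4000 * a ^ 3"
    using Cc_close[OF s om0] by (simp only: b_def)
  have a2: "(of_real (a\<^sup>2) :: complex) \<noteq> 0" using a0 by simp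
  have scale: "norm (X / of_real (a\<^sup>2)) \<le> B * a" if "norm X \<le> B * a ^ 3" for X :: complex and B
  proof -
    have "norm (X / of_real (a\<^sup>2)) = norm X / a\<^sup>2" by (simp only: norm_divide norm_of_real abs_power2)
    also have "\<dots> \<le> B * a ^ 3 / a\<^sup>2" using that a0 by (intro divide_right_mono) auto
    also have "\<dots> = B * a" using a0 by (simp add: power2_eq_square power3_eq_cube)
    finally show ?thesis .
  qed
  have d: "(x / q - s) - (y / q - s) = (x - y) / q" for x y q s :: complex by (simp add: diff_divide_distrib)
  have sums: "(\<Sum>i\<in>{1,2,3}. ((c i / of_real a)\<^sup>2 - 1) * of_real (f i)) = (\<Sum>i\<in>{1,2,3}. (c i)\<^sup>2 * of_real (f i)) / of_real (a\<^sup>2) - of_real (\<Sum>i\<in>{1,2,3}. f i)" for f :: "nat \<Rightarrow> real"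
    by (simp add: left_diff_distrib power_divide add_divide_distrib)
  have "Cc (tser c) \<omega> - 1 - 2 * (N - 1) - (\<Sum>i\<in>{1,2,3}. (c i)\<^sup>2 * of_real (sg \<omega> i))
     = (Cc (tser c) \<omega> - (1 - 2 * b + S2 c + (\<Sum>i\<in>{1,2,3}. (c i)\<^sup>2 * of_real (sg \<omega> i)))) + (-2) * (N - (1 - b + S2 c / 2))"
    by (simp add: algebra_simps)
  also have "norm \<dots> \<le> 4000 * a ^ 3 + 2 * (1200 * a ^ 3)"
    by (intro order_trans[OF norm_triangle_ineq] add_mono Cc norm_mult_le N) simp
  finally have "norm (Cc (tser c) \<omega> - 1 - 2 * (N - 1) - (\<Sum>i\<in>{1,2,3}. (c i)\<^sup>2 * of_real (sg \<omega> i))) \<le> 6400 * a ^ 3" by simp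
  from scale[OF this] show "norm (e1 c - (\<Sum>i\<in>{1,2,3}. ((c i / of_real a)\<^sup>2 - 1) * of_real (sg \<omega> i))) \<le> 6400 * a"
    unfolding sums e1_def N_def[symmetric] d .
  have b2: "norm (b * b) \<le> a ^ 3"
  proof -
    have b: "norm b \<le> 64 * a\<^sup>2" using c by (simp add: kcoef_def b_def)
    have "norm (b * b) \<le> (64 * a\<^sup>2) * (64 * a\<^sup>2)" by (rule norm_mult_le[OF b b])
    also have "\<dots> = (4096 * a) * a ^ 3" by (simp add: power2_eq_square power3_eq_cube)
    also have "\<dots> \<le> 1 * a ^ 3" using a_small a_pow by (intro mult_right_mono) auto
    finally show ?thesis by simp
  qed
  have I: "norm (Iw c - ((c 0)\<^sup>2 + (\<Sum>i\<in>{1,2,3}. (c i)\<^sup>2 * of_real (cos (2 * pi * real i * \<omega>))) / 2)) \<le> a ^ 3"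
  proof -
    have "{1..<4} = {1,2,3::nat}" by auto
    moreover have "(\<Sum>i\<in>{1,2,3}. (c i)\<^sup>2 * of_real (cos (2 * pi * real (\<nu> i) * \<omega>))) = (\<Sum>i\<in>{1,2,3}. (c i)\<^sup>2 * of_real (cos (2 * pi * real i * \<omega>)))"
      by (rule sum.cong) (use \<nu>_eq in auto)
    ultimately have "norm (Iw c - ((c 0)\<^sup>2 + (\<Sum>i\<in>{1,2,3}. (c i)\<^sup>2 * of_real (cos (2 * pi * real i * \<omega>))) / 2)) \<le> 2 * (kap 4)\<^sup>2"
      using Iw_partial[OF c, of 4] by simp
    also have "\<dots> \<le> kap 4" using kap_pos[of 4] kap_tiny[of 4] mult_left_mono[of "kap 4" "1/2" "2 * kap 4"] by (simp add: power2_eq_square)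
    finally show ?thesis using kap_le[of 4] by linarith
  qed
  have g: "(\<Sum>i\<in>{1,2,3}. (c i)\<^sup>2 * of_real (gm i)) = S2 c + (\<Sum>i\<in>{1,2,3}. (c i)\<^sup>2 * of_real (cos (2 * pi * real i * \<omega>))) / 2"
    by (simp add: S2_def gm_def distrib_left add_divide_distrib)
  have "Iw c - 1 + 2 * (N - 1) - (\<Sum>i\<in>{1,2,3}. (c i)\<^sup>2 * of_real (gm i))
     = (Iw c - ((c 0)\<^sup>2 + (\<Sum>i\<in>{1,2,3}. (c i)\<^sup>2 * of_real (cos (2 * pi * real i * \<omega>))) / 2)) + 2 * (N - (1 - b + S2 c / 2)) + b * b"
    unfolding g by (simp add: b_def algebra_simps power2_eq_square)
  also have "norm \<dots> \<le> a ^ 3 + 2 * (1200 * a ^ 3) + a ^ 3"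
    by (intro order_trans[OF norm_triangle_ineq] add_mono I norm_mult_le N b2) simp
  also have "\<dots> \<le> 2500 * a ^ 3" using a_pow by simp
  finally have "norm (Iw c - 1 + 2 * (N - 1) - (\<Sum>i\<in>{1,2,3}. (c i)\<^sup>2 * of_real (gm i))) \<le> 2500 * a ^ 3" .
  from scale[OF this] show "norm (e2 c - (\<Sum>i\<in>{1,2,3}. ((c i / of_real a)\<^sup>2 - 1) * of_real (gm i))) \<le> 2500 * a"
    unfolding sums e2_def N_def[symmetric] d .
qed

end

section \<open>Solving for the coefficients\<close>

text \<open>The iterates start at 0 and stay real, so their limit is real.\<close>

lemma fixpoint_cnj:
  assumes c: "ball_contraction \<Psi>"
    and inv: "\<And>u i. (\<And>i. norm (u i) \<le> 1) \<Longrightarrow> (\<And>i. cnj (u i) = u i) \<Longrightarrow> cnj (\<Psi> u i) = \<Psi> u i"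
  shows "cnj (fixpoint \<Psi> i) = fixpoint \<Psi> i"
proof -
  have *: "cnj ((\<Psi> ^^ n) (\<lambda>_. 0) i) = (\<Psi> ^^ n) (\<lambda>_. 0) i" for n
  proof (induction n arbitrary: i)
    case (Suc n)
    have "norm ((\<Psi> ^^ n) (\<lambda>_. 0) i) \<le> 1" for i using ball_contraction_iterate(1)[OF c, of n i] by simp
    from inv[OF this Suc] show ?case by simp
  qed simp
  have "(\<lambda>n. cnj ((\<Psi> ^^ n) (\<lambda>_. 0) i)) \<longlonglongrightarrow> cnj (fixpoint \<Psi> i)"
    by (rule tendsto_cnj[OF fixpoint_iterates(2)[OF c]])
  from LIMSEQ_unique[OF this[unfolded *] fixpoint_iterates(2)[OF c]] show ?thesis .
qed

lemma (in near_rational) Mw_cnj: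
  assumes t: "adm t" and \<phi>: "\<bar>Im \<phi>\<bar> \<le> 1/17" and real: "\<And>z. t (cnj z) = cnj (t z)"
  shows "Mw t (cnj \<phi>) = cnj (Mw t \<phi>)"
proof -
  have LL': "LL t w (cnj x) (cnj v) = cnj (LL t w x v)" for w x v
  proof -
    have "of_real s * inverse (t (cnj x + of_real w + of_real s * cnj v)) * R1 t (cnj x) (of_real s * cnj v)
      = cnj (of_real s * inverse (t (x + of_real w + of_real s * v)) * R1 t x (of_real s * v))" for s
      using real[of "x + of_real w + of_real s * v"] R1_cnj[of t x "of_real s * v", OF real] by simp
    then show ?thesis unfolding LL_def Henstock_Kurzweil_Integration.integral_cnj by (simp only:)
  qed
  note y = ysol_cnj[OF t \<phi> real]
  have th: "th (cnj \<phi>) (ysol t (cnj \<phi>)) k = cnj (th \<phi> (ysol t \<phi>) k)" if "k < q" for k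
    using that by (simp add: th_def y)
  have "Msum t (cnj \<phi>) (ysol t (cnj \<phi>)) = (\<Sum>k<q. cnj ((ysol t \<phi> k)\<^sup>2 * LL t \<omega> (th \<phi> (ysol t \<phi>) k) (- of_real \<epsilon> * ysol t \<phi> k)))"
    unfolding Msum_def
  proof (rule sum.cong)
    fix k assume "k \<in> {..<q}"
    then have k: "k < q" by simp
    show "(ysol t (cnj \<phi>) k)\<^sup>2 * LL t \<omega> (th (cnj \<phi>) (ysol t (cnj \<phi>)) k) (- of_real \<epsilon> * ysol t (cnj \<phi>) k)
      = cnj ((ysol t \<phi> k)\<^sup>2 * LL t \<omega> (th \<phi> (ysol t \<phi>) k) (- of_real \<epsilon> * ysol t \<phi> k))"
      using LL'[of \<omega> "th \<phi> (ysol t \<phi>) k" "- of_real \<epsilon> * ysol t \<phi> k"] by (simp add: th[OF k] y[OF k])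
  qed simp
  then show ?thesis by (simp add: Mw_def Msum_def)
qed

text \<open>The Newton step divides by \<open>DD\<close>; the effect of the parameter and the
  relative error of order \<open>a\<close> must both be small against it for the image to stay in
  the polydisc of radius 1/16.\<close>

locale level2 = liouville_series +
  assumes DD: "DD \<noteq> 0" and r_le: "r \<le> \<bar>DD\<bar> / 3000" and a_le: "a \<le> \<bar>DD\<bar> / 10^7"
begin

lemma gm_pair: "\<bar>gm i * sg \<omega> j - sg \<omega> i * gm j\<bar> \<le> 3/2"
proof -
  have "\<bar>gm i * sg \<omega> j\<bar> \<le> 3/2 * (1/2)" "\<bar>sg \<omega> i * gm j\<bar> \<le> 1/2 * (3/2)"
    unfolding abs_mult by (intro mult_mono gm_bound sg_bound; simp)+
  then show ?thesis by linarith
qed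

lemma sq_scaled:
  assumes "i < 3" "i \<noteq> 0" shows "(cf \<tau> u i / of_real a)\<^sup>2 - 1 = u i / 8 + u i * u i / 256"
  using assms a0 by (simp add: cf_def power2_eq_square field_simps)

text \<open>One row after Cramer's rule has decoupled the 2 by 2 system: the linear part of
  \<open>X\<close> cancels \<open>v\<close>, the square of \<open>v\<close> leaves 1/32, and the
  parameter and the error \<open>y\<close> are divided by the determinant.\<close>

lemma linear_step_bound:
  fixes v \<tau> y X :: complex
  assumes v: "norm v \<le> 1" and \<tau>: "norm \<tau> \<le> r" and K: "\<bar>K\<bar> \<le> 3/2" and y: "norm y \<le> 10850 * a"
    and X: "X = (v / 8 + v * v / 256) * of_real d + (2 * \<tau> + \<tau> * \<tau>) * of_real K + y" and d: "\<bar>d\<bar> = \<bar>DD\<bar>"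
  shows "norm (v - 8 * X / of_real d) \<le> 1/16"
proof -
  have d0: "\<bar>d\<bar> > 0" using d DD by simp
  have \<tau>1: "norm (2 * \<tau> + \<tau> * \<tau>) \<le> 5/2 * r"
  proof -
    have "norm (\<tau> * (2 + \<tau>)) \<le> r * (5/2)"
      using norm_triangle_ineq[of 2 \<tau>] \<tau> r0 by (intro norm_mult_le) auto
    then show ?thesis by (simp add: algebra_simps)
  qed
  define Y where "Y = (2 * \<tau> + \<tau> * \<tau>) * of_real K + y"
  have "norm Y \<le> 5/2 * r * (3/2) + 10850 * a"
    unfolding Y_def by (intro order_trans[OF norm_triangle_ineq] add_mono y norm_mult_le \<tau>1) (use K in simp)
  also have "\<dots> \<le> 5/2 * (\<bar>d\<bar> / 3000) * (3/2) + 10850 * (\<bar>d\<bar> / 10^7)" using r_le a_le d a0 r0 by (intro add_mono mult_mono) auto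
  also have "\<dots> = 2335 / 10^6 * \<bar>d\<bar>" by simp
  finally have "norm Y / \<bar>d\<bar> \<le> 2335 / 10^6" using d0 by (simp add: pos_divide_le_eq)
  moreover have "norm (8 * Y / of_real d) = 8 * (norm Y / \<bar>d\<bar>)" by (simp add: norm_divide norm_mult)
  ultimately have 1: "norm (8 * Y / of_real d) \<le> 8 * (2335 / 10^6)" by linarith
  have "norm (v * v) \<le> 1 * 1" by (intro norm_mult_le v)
  then have 2: "norm (v * v / 32) \<le> 1/32" by (simp only: norm_divide) simp
  have "v - 8 * X / of_real d = - (v * v / 32) - 8 * Y / of_real d"
    unfolding X Y_def using d0 by (simp add: field_simps)
  also have "norm \<dots> \<le> 1/32 + 8 * (2335 / 10^6)"
    by (intro order_trans[OF norm_triangle_ineq4] add_mono 1) (use 2 in simp)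
  finally show ?thesis by simp
qed

text \<open>In each component the linear part of the equation cancels u i. What remains is the mean
  of the squares for i = 0, the row estimate for i = 1 and 2, and for i \<ge> 4 the deviation of c 0
  from 1 together with the error of \<open>Mj_model\<close>.\<close>

lemma P2_bound:
  assumes u: "\<And>i. norm (u i) \<le> 1" and \<tau>: "norm \<tau> \<le> r"
  shows "norm (P2 \<tau> u i) \<le> 1/16"
proof -
  define c where "c = cf \<tau> u"
  have c: "kcoef c" unfolding c_def by (rule kcoef_cf[OF u \<tau>])
  have s: "scoef c" by (rule kcoef_scoef[OF c])
  define E1 where "E1 = e1 c - (\<Sum>i\<in>{1,2,3}. ((c i / of_real a)\<^sup>2 - 1) * of_real (sg \<omega> i))"
  define E2 where "E2 = e2 c - (\<Sum>i\<in>{1,2,3}. ((c i / of_real a)\<^sup>2 - 1) * of_real (gm i))"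
  have E: "norm E1 \<le> 6400 * a" "norm E2 \<le> 2500 * a" using e_close[OF c] by (auto simp: E1_def E2_def)
  have q3: "(c 3 / of_real a)\<^sup>2 - 1 = 2 * \<tau> + \<tau> * \<tau>"
  proof -
    have "c 3 / of_real a = 1 + \<tau>" using a0 by (simp add: c_def cf_def)
    then show ?thesis by (simp add: power2_eq_square algebra_simps)
  qed
  note q = sq_scaled[of _ \<tau> u, folded c_def]
  have e1: "e1 c = (u 1 / 8 + u 1 * u 1 / 256) * of_real (sg \<omega> 1) + (u 2 / 8 + u 2 * u 2 / 256) * of_real (sg \<omega> 2) + (2 * \<tau> + \<tau> * \<tau>) * of_real (sg \<omega> 3) + E1"
    using q[of 1] q[of 2] by (simp add: E1_def q3)
  have e2: "e2 c = (u 1 / 8 + u 1 * u 1 / 256) * of_real (gm 1) + (u 2 / 8 + u 2 * u 2 / 256) * of_real (gm 2) + (2 * \<tau> + \<tau> * \<tau>) * of_real (gm 3) + E2"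
    using q[of 1] q[of 2] by (simp add: E2_def q3)
  \<comment> \<open>The constant is 3/2 * 6400 + 1/2 * 2500, from the bounds on \<open>gm\<close>
    and \<open>sg\<close>.\<close>
  have mix: "norm (of_real g * E1 - of_real f * E2) \<le> 10850 * a" if "\<bar>g\<bar> \<le> 3/2" "\<bar>f\<bar> \<le> 1/2" for g f :: real
  proof -
    have "norm (of_real g * E1 - of_real f * E2) \<le> 3/2 * (6400 * a) + 1/2 * (2500 * a)"
      by (intro order_trans[OF norm_triangle_ineq4] add_mono norm_mult_le E) (use that in auto)
    then show ?thesis by simp
  qed
  consider "i = 0" | "i = 1" | "i = 2" | "i = 3" | "i \<ge> 4" by linarith
  then show ?thesis
  proof cases
    case 1
    define q where "q = 64 * (of_real (a\<^sup>2) :: complex)"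
    define S where "S = (c 1 / of_real a)\<^sup>2 + (c 2 / of_real a)\<^sup>2 + (c 3 / of_real a)\<^sup>2"
    have q0: "q \<noteq> 0" "norm q = 64 * a\<^sup>2" using a0 by (auto simp: q_def norm_mult norm_power)
    have S2: "S2 c = of_real (a\<^sup>2) * S" using a0 by (simp add: S2_def S_def field_simps)
    have sq: "norm ((1 + v) ^ 2) \<le> 6/5" if "norm v \<le> 1/16" for v :: complex
    proof -
      have "norm ((1 + v) * (1 + v)) \<le> (1 + 1/16) * (1 + 1/16)" by (intro norm_mult_le norm_one_plus that)
      then show ?thesis by (simp add: power2_eq_square)
    qed
    have DD2: "\<bar>DD\<bar> \<le> 3/2" using gm_pair[of 2 1] by (simp add: DD_def mult.commute)
    have S: "norm S \<le> 6/5 + 6/5 + 6/5"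
    proof -
      have *: "c 1 / of_real a = 1 + u 1 / 16" "c 2 / of_real a = 1 + u 2 / 16" "c 3 / of_real a = 1 + \<tau>"
        using a0 by (auto simp: c_def cf_def)
      have "norm (u 1 / 16) \<le> 1/16" "norm (u 2 / 16) \<le> 1/16" using u[of 1] u[of 2] by (auto simp: norm_divide)
      moreover have "norm \<tau> \<le> 1/16" using \<tau> r_le DD2 by linarith
      ultimately show ?thesis unfolding S_def * by (intro order_trans[OF norm_triangle_ineq] add_mono sq)
    qed
    have c0: "c 0 - 1 = q * u 0" by (simp add: c_def cf_def q_def)
    define E where "E = R1 (tser c) 0 1 - (1 - (c 0 - 1) + S2 c / 2)"
    have E: "norm (E / q) \<le> 1/1000"
    proof -
      have "norm E \<le> 1200 * a ^ 3" unfolding E_def by (rule mean_close[OF s])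
      also have "\<dots> \<le> 1/1000 * (64 * a\<^sup>2)" using a_pow by linarith
      finally have "norm E / (64 * a\<^sup>2) \<le> (1/1000 * (64 * a\<^sup>2)) / (64 * a\<^sup>2)" by (intro divide_right_mono) auto
      also have "\<dots> = 1/1000" using a0 by simp
      finally show ?thesis by (simp only: norm_divide q0(2))
    qed
    have "P2 \<tau> u i = u 0 + (R1 (tser c) 0 1 - 1) / q" by (simp add: P2_def 1 c_def q_def Let_def)
    also have "R1 (tser c) 0 1 - 1 = - (q * u 0) + q * (S / 128) + E" by (simp add: E_def c0 S2) (simp add: q_def)
    also have "u 0 + \<dots> / q = S / 128 + E / q" using q0 by (simp add: add_divide_distrib diff_divide_distrib)
    also have "norm \<dots> \<le> (6/5 + 6/5 + 6/5) / 128 + 1/1000"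
      by (intro order_trans[OF norm_triangle_ineq] add_mono E) (use S in \<open>simp only: norm_divide, simp\<close>)
    finally show ?thesis by simp
  next
    case 2
    have "P2 \<tau> u i = u 1 - 8 * (of_real (gm 2) * e1 c - of_real (sg \<omega> 2) * e2 c) / of_real DD" by (simp add: P2_def 2 c_def Let_def)
    also have "norm \<dots> \<le> 1/16"
    proof (rule linear_step_bound[OF u \<tau> _ _ _ refl])
      show "\<bar>gm 2 * sg \<omega> 3 - sg \<omega> 2 * gm 3\<bar> \<le> 3/2" by (rule gm_pair)
      show "norm (of_real (gm 2) * E1 - of_real (sg \<omega> 2) * E2) \<le> 10850 * a" by (intro mix gm_bound sg_bound)
    qed (simp add: e1 e2 DD_def algebra_simps)
    finally show ?thesis .
  next
    case 3
    \<comment> \<open>Eliminating the other unknown exchanges the roles of the harmonics 1 and 2, so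
      the determinant appears with the opposite sign.\<close>
    have "P2 \<tau> u i = u 2 - 8 * (of_real (gm 1) * e1 c - of_real (sg \<omega> 1) * e2 c) / of_real (- DD)" by (simp add: P2_def 3 c_def Let_def minus_divide_left)
    also have "norm \<dots> \<le> 1/16"
    proof (rule linear_step_bound[OF u \<tau>])
      show "\<bar>gm 1 * sg \<omega> 3 - sg \<omega> 1 * gm 3\<bar> \<le> 3/2" by (rule gm_pair)
      show "norm (of_real (gm 1) * E1 - of_real (sg \<omega> 1) * E2) \<le> 10850 * a" by (intro mix gm_bound sg_bound)
    qed (simp_all add: e1 e2 DD_def algebra_simps)
    finally show ?thesis .
  next
    case 4 then show ?thesis by (simp add: P2_def Let_def)
  next
    case 5
    define K where "K = (of_real (kap i) :: complex)"
    have K: "K \<noteq> 0" "norm K = kap i" using kap_pos[of i] by (auto simp: K_def)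
    define E where "E = Mj i (tser c) 0 - (Iw c + 2 * (c i * c 0))"
    have E: "norm (E * (8 / K)) \<le> (kap i / 1000) * (8 / kap i)"
    proof (rule norm_mult_le)
      show "norm E \<le> kap i / 1000" using Mj_model[OF c 5, of 0] \<nu>_ge[OF 5] by (simp add: E_def)
      show "norm (8 / K) \<le> 8 / kap i" by (simp add: norm_divide K)
    qed
    have ci: "c i = K * (1 + u i / 16)" using 5 by (simp add: c_def cf_def K_def)
    have b: "norm (c 0 - 1) \<le> 64 * a\<^sup>2" using c by (simp add: kcoef_def)
    have ub: "norm (16 + u i) \<le> 17" using norm_triangle_ineq[of 16 "u i"] u[of i] by simp
    have "P2 \<tau> u i = u i - (Mj i (tser c) 0 - Iw c - 2 * K) * (8 / K)" using 5 by (simp add: P2_def c_def K_def Let_def)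
    also have "Mj i (tser c) 0 = Iw c + 2 * (K * (1 + u i / 16) * c 0) + E" by (simp add: E_def ci)
    also have "u i - (Iw c + 2 * (K * (1 + u i / 16) * c 0) + E - Iw c - 2 * K) * (8 / K) = - ((16 + u i) * (c 0 - 1)) - E * (8 / K)"
      using K(1) by (simp add: field_simps)
    also have "norm \<dots> \<le> 17 * (64 * a\<^sup>2) + (kap i / 1000) * (8 / kap i)"
      by (intro order_trans[OF norm_triangle_ineq4] add_mono E) (use norm_mult_le[OF ub b] in simp)
    also have "\<dots> \<le> 1/16" using kap_pos[of i] a_pow(1) a_small by simp
    finally show ?thesis .
  qed
qed

lemma P2_holomorphic:
  assumes D: "open D" and \<tau>: "\<tau> holomorphic_on D" "\<And>z. z \<in> D \<Longrightarrow> norm (\<tau> z) \<le> r"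
    and u: "\<And>i. (\<lambda>z. u z i) holomorphic_on D" "\<And>z i. z \<in> D \<Longrightarrow> norm (u z i) \<le> 1"
  shows "(\<lambda>z. P2 (\<tau> z) (u z) i) holomorphic_on D"
proof -
  define c where "c = (\<lambda>z. cf (\<tau> z) (u z))"
  have ch: "(\<lambda>z. c z i) holomorphic_on D" for i unfolding c_def by (rule cf_holomorphic[OF \<tau>(1) u(1)])
  have k: "kcoef (c z)" if "z \<in> D" for z unfolding c_def by (rule kcoef_cf[OF u(2)[OF that] \<tau>(2)[OF that]])
  have H: "holfam D (\<lambda>z. tser (c z))" by (rule holfam_tser[OF D ch scoef_cbound[OF kcoef_scoef[OF k]]])
  have R: "(\<lambda>z. R1 (tser (c z)) 0 1) holomorphic_on D"
    by (rule R1_holomorphic[OF H, where B=1]) (auto simp: strip_def)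
  note C = Cc_holomorphic[OF H, of \<omega>] and I = Iw_holomorphic[OF D ch k]
  have e: "(\<lambda>z. e1 (c z)) holomorphic_on D" "(\<lambda>z. e2 (c z)) holomorphic_on D"
    unfolding e1_def e2_def using a0 by (auto intro!: holomorphic_intros R C I)
  consider "i = 0" | "i = 1" | "i = 2" | "i = 3" | "i \<ge> 4" by linarith
  then show ?thesis
  proof cases
    case 5
    have "(\<lambda>z. Mj i (tser (c z)) 0) holomorphic_on D"
      unfolding Mj_def by (rule near_rational.Mw_holomorphic[OF near_rational_i[OF 5] H]) auto
    then have "(\<lambda>z. u z i - (Mj i (tser (c z)) 0 - Iw (c z) - 2 * of_real (kap i)) * (8 / of_real (kap i))) holomorphic_on D"
      by (intro holomorphic_intros u(1) I) (use kap_pos[of i] in auto)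
    then show ?thesis using 5 by (simp add: P2_def c_def Let_def)
  next
    case 1
    have "(\<lambda>z. u z 0 + (R1 (tser (c z)) 0 1 - 1) / of_real (64 * a\<^sup>2)) holomorphic_on D"
      by (intro holomorphic_intros u(1) R) (use a0 in simp)
    then show ?thesis using 1 by (simp add: P2_def c_def Let_def)
  next
    case 2
    have "(\<lambda>z. u z 1 - 8 * (of_real (gm 2) * e1 (c z) - of_real (sg \<omega> 2) * e2 (c z)) / of_real DD) holomorphic_on D"
      by (intro holomorphic_intros u(1) e) (use DD in simp)
    then show ?thesis using 2 by (simp add: P2_def c_def Let_def)
  next
    case 3
    have "(\<lambda>z. u z 2 - 8 * (of_real (sg \<omega> 1) * e2 (c z) - of_real (gm 1) * e1 (c z)) / of_real DD) holomorphic_on D"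
      by (intro holomorphic_intros u(1) e) (use DD in simp)
    then show ?thesis using 3 by (simp add: P2_def c_def Let_def)
  next
    case 4
    then show ?thesis by (simp add: P2_def Let_def)
  qed
qed

lemma P2_contraction: "norm \<tau> \<le> r \<Longrightarrow> ball_contraction (P2 \<tau>)"
  unfolding ball_contraction_def
proof (intro conjI allI impI)
  assume \<tau>: "norm \<tau> \<le> r"
  show "norm (P2 \<tau> u i) \<le> 1/16" if "\<forall>i. norm (u i) \<le> 1" for u i using P2_bound[of u \<tau> i] that \<tau> by blast
  show "(\<lambda>z. P2 \<tau> (u z) i) holomorphic_on D" if "open D" "\<forall>i. (\<lambda>z. u z i) holomorphic_on D" "\<forall>z\<in>D. \<forall>i. norm (u z i) \<le> 1" for D u i
    by (rule P2_holomorphic[OF that(1) holomorphic_on_const]) (use that \<tau> in auto)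
qed

definition usol :: "complex \<Rightarrow> nat \<Rightarrow> complex" where "usol \<tau> = fixpoint (P2 \<tau>)"
definition csol :: "complex \<Rightarrow> nat \<Rightarrow> complex" where "csol \<tau> = cf \<tau> (usol \<tau>)"

lemma usol_bound: "norm \<tau> \<le> r \<Longrightarrow> norm (usol \<tau> i) \<le> 1/16"
  unfolding usol_def by (rule fixpoint_bound[OF P2_contraction])

lemma csol_kcoef: "norm \<tau> \<le> r \<Longrightarrow> kcoef (csol \<tau>)"
proof -
  assume \<tau>: "norm \<tau> \<le> r"
  have "norm (usol \<tau> i) \<le> 1" for i using usol_bound[OF \<tau>, of i] by simp
  then show ?thesis unfolding csol_def by (rule kcoef_cf[OF _ \<tau>])
qed

lemma csol_cbound: "norm \<tau> \<le> r \<Longrightarrow> cbound (csol \<tau>)"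
  by (intro scoef_cbound kcoef_scoef csol_kcoef)

lemma csol_holomorphic: "(\<lambda>\<tau>. csol \<tau> i) holomorphic_on ball 0 r"
  unfolding csol_def usol_def
proof (rule cf_holomorphic[OF holomorphic_on_ident])
  show "(\<lambda>z. fixpoint (P2 z) i) holomorphic_on ball 0 r" for i
    by (rule fixpoint_holomorphic) (auto intro!: P2_contraction P2_holomorphic)
qed

text \<open>At a fixed point every residual vanishes. For components 1 and 2 this gives two
  combinations of \<open>e1\<close> and \<open>e2\<close> with determinant \<open>DD\<close>, so
  both are zero; with the mean equal to 1 these are statements about \<open>Cc\<close> and
  \<open>Iw\<close> alone.\<close>

lemma csol_eqs:
  assumes \<tau>: "norm \<tau> \<le> r"
  shows "R1 (tser (csol \<tau>)) 0 1 = 1"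
    "Cc (tser (csol \<tau>)) \<omega> = 1 + of_real (a\<^sup>2 * (\<Sum>i\<in>{1,2,3}. sg \<omega> i))"
    "Iw (csol \<tau>) = 1 + of_real (a\<^sup>2 * (\<Sum>i\<in>{1,2,3}. gm i))"
    "i \<ge> 4 \<Longrightarrow> Mj i (tser (csol \<tau>)) 0 = Iw (csol \<tau>) + 2 * of_real (kap i)"
proof -
  define u where "u = usol \<tau>"
  define c where "c = csol \<tau>"
  have c: "cf \<tau> u = c" by (simp add: c_def csol_def u_def)
  have fx: "P2 \<tau> u i = u i" for i using fixpoint_eq[OF P2_contraction[OF \<tau>]] unfolding u_def usol_def by metis
  have "(R1 (tser c) 0 1 - 1) / of_real (64 * a\<^sup>2) = 0" using fx[of 0] by (simp add: P2_def c Let_def)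
  then show 1: "R1 (tser (csol \<tau>)) 0 1 = 1" unfolding c_def[symmetric] using a0 by simp
  have d: "(of_real DD :: complex) = of_real (sg \<omega> 1) * of_real (gm 2) - of_real (sg \<omega> 2) * of_real (gm 1)" "(of_real DD :: complex) \<noteq> 0"
    by (simp add: DD_def) (use DD in simp)
  have "of_real (gm 2) * e1 c - of_real (sg \<omega> 2) * e2 c = 0" "of_real (sg \<omega> 1) * e2 c - of_real (gm 1) * e1 c = 0"
    using fx[of 1] fx[of 2] DD by (auto simp: P2_def c Let_def)
  then have l: "of_real DD * e1 c = 0" "of_real DD * e2 c = 0" unfolding d(1) by algebra+
  have e: "e1 c = 0" "e2 c = 0" using l DD by auto
  have a2: "(of_real (a\<^sup>2) :: complex) \<noteq> 0" using a0 by simp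
  have solve: "X = q * s" if "X / q - s = 0" "q \<noteq> 0" for X q s :: complex using that by (simp add: field_simps)
  have N: "R1 (tser c) 0 1 = 1" using 1 by (simp only: c_def)
  have fin: "x = 1 + q * s" if "x - 1 - 2 * (n - 1) = q * s" "n = 1" for x n q s :: complex using that by (simp add: algebra_simps)
  have fin': "x = 1 + q * s" if "x - 1 + 2 * (n - 1) = q * s" "n = 1" for x n q s :: complex using that by (simp add: algebra_simps)
  from fin[OF solve[OF e(1)[unfolded e1_def] a2] N] show "Cc (tser (csol \<tau>)) \<omega> = 1 + of_real (a\<^sup>2 * (\<Sum>i\<in>{1,2,3}. sg \<omega> i))"
    unfolding c_def of_real_mult .
  from fin'[OF solve[OF e(2)[unfolded e2_def] a2] N] show "Iw (csol \<tau>) = 1 + of_real (a\<^sup>2 * (\<Sum>i\<in>{1,2,3}. gm i))"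
    unfolding c_def of_real_mult .
  show "Mj i (tser (csol \<tau>)) 0 = Iw (csol \<tau>) + 2 * of_real (kap i)" if "i \<ge> 4"
  proof -
    have "of_real (kap i) \<noteq> (0::complex)" using kap_pos[of i] by simp
    moreover have "(Mj i (tser c) 0 - Iw c - 2 * of_real (kap i)) * (8 / of_real (kap i)) = 0"
      using fx[of i] that by (simp add: P2_def c Let_def)
    ultimately have "Mj i (tser c) 0 - Iw c - 2 * of_real (kap i) = 0" by (metis divide_eq_0_iff mult_eq_0_iff zero_neq_numeral)
    then show ?thesis unfolding c_def by (simp add: algebra_simps)
  qed
qed

lemma csol_cnj:
  fixes \<tau> :: real
  assumes \<tau>: "\<bar>\<tau>\<bar> \<le> r"
  shows "cnj (csol (of_real \<tau>) i) = csol (of_real \<tau>) i"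
proof -
  have cfr: "cnj (cf (of_real \<tau>) u i) = cf (of_real \<tau>) u i" if "\<And>i. cnj (u i) = u i" for u i
    using that by (simp add: cf_def)
  have "cnj (usol (of_real \<tau>) i) = usol (of_real \<tau>) i" for i
    unfolding usol_def
  proof (rule fixpoint_cnj[OF P2_contraction])
    fix u :: "nat \<Rightarrow> complex" and i :: nat
    assume u: "\<And>i. norm (u i) \<le> 1" and ur: "\<And>i. cnj (u i) = u i"
    define c where "c = cf (of_real \<tau>) u"
    have c: "cf (of_real \<tau>) u = c" by (simp add: c_def)
    have k: "kcoef c" unfolding c_def using kcoef_cf[OF u, of "of_real \<tau>"] \<tau> by simp
    have cr: "cnj (c i) = c i" for i unfolding c_def by (rule cfr[OF ur])
    note tr = tser_cnj[of c, OF cr]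
    have R: "cnj (R1 (tser c) 0 1) = R1 (tser c) 0 1" using near_rational.R1_cnj[OF near_rational_i[OF order_refl], of "tser c" 0 1, OF tr] by simp
    have treal: "cnj (tser c (of_real x)) = tser c (of_real x)" for x using tr[of "of_real x"] by simp
    have C: "cnj (Cc (tser c) \<omega>) = Cc (tser c) \<omega>"
      unfolding Cc_def Henstock_Kurzweil_Integration.integral_cnj by (simp only: complex_cnj_mult complex_cnj_inverse treal)
    have I: "cnj (Iw c) = Iw c"
    proof -
      define f where "f = (\<lambda>i. (c (Suc i))\<^sup>2 * of_real (cos (2 * pi * real (\<nu> (Suc i)) * \<omega>)))"
      have "summable f" unfolding f_def by (rule summable_norm_cancel[OF Iw_summable[OF k]])
      then have "(\<lambda>i. cnj (f i)) sums cnj (suminf f)" using summable_sums sums_cnj by blast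
      moreover have "cnj (f i) = f i" for i by (simp add: f_def cr)
      ultimately have "cnj (suminf f) = suminf f" using sums_unique by force
      then show ?thesis unfolding Iw_def f_def[symmetric] by (simp add: cr)
    qed
    have M: "cnj (Mj i (tser c) 0) = Mj i (tser c) 0" if "i \<ge> 4"
      using near_rational.Mw_cnj[OF near_rational_i[OF that] kcoef_adm[OF k], of 0] tr unfolding Mj_def by simp
    show "cnj (P2 (of_real \<tau>) u i) = P2 (of_real \<tau>) u i"
      using M by (simp add: P2_def c Let_def e1_def e2_def R C I ur)
  qed (use \<tau> in simp)
  then show ?thesis unfolding csol_def by (rule cfr)
qed

end

section \<open>The real potentials and their values of the beta function\<close>

lemma integral_HK_of_real:
  fixes f :: "'a::euclidean_space \<Rightarrow> real"
  shows "integral S (\<lambda>x. of_real (f x)) = (of_real (integral S f) :: complex)"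
proof (cases "f integrable_on S")
  case True
  then show ?thesis by (intro integral_unique has_integral_of_real integrable_integral)
next
  case False
  have "\<not> (\<lambda>x. of_real (f x) :: complex) integrable_on S"
    using integrable_linear[OF _ bounded_linear_Re, of "\<lambda>x. of_real (f x)" S] False by (auto simp: o_def)
  with False show ?thesis by (simp add: not_integrable_integral)
qed

text \<open>h x - h (x - \<omega>) is \<omega> times the mean of 1 / T over the segment; exchanging
  the two integrations gives the order used in \<open>Cc\<close>.\<close>

lemma (in circle_potential) U_1_integral:
  assumes t: "adm t" "\<And>x. t (of_real x) = of_real (T x)"
  shows "of_real (U 1) = of_real \<omega> * Cc t \<omega>"
proof -
  define f where "f = (\<lambda>r s. 1 / T s * (1 / T (s - r * \<omega>)))"
  have cT: "continuous_on S g \<Longrightarrow> continuous_on S (\<lambda>z. 1 / T (g z))" for S :: "'x::topological_space set" and g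
    by (rule continuous_on_compose2[OF cont_inverse]) auto
  have "((\<lambda>x. (h x - h (x - \<omega>)) / T x) has_integral U 1 - U 0) {0..1}"
    using U_deriv by (intro fundamental_theorem_of_calculus)
      (auto simp flip: has_real_derivative_iff_has_vector_derivative intro: has_field_derivative_at_within)
  then have "U 1 = integral {0..1} (\<lambda>x. (h x - h (x - \<omega>)) / T x)" by (simp add: integral_unique)
  also have "(\<lambda>x. (h x - h (x - \<omega>)) / T x) = (\<lambda>x. \<omega> * integral {0..1} (\<lambda>r. f r x))"
  proof
    fix x
    have "((\<lambda>s. - \<omega> / T (x + s * - \<omega>)) has_integral h (x + - \<omega>) - h x) {0..1}" by (rule h_segment_integral)
    from has_integral_mult_right[OF this, of "- 1 / T x"]
    have "((\<lambda>s. \<omega> * f s x) has_integral (h x - h (x - \<omega>)) / T x) {0..1}"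
    proof (rule has_integral_eq_rhs[OF has_integral_eq[rotated]])
      show "- 1 / T x * (- \<omega> / T (x + s * - \<omega>)) = \<omega> * f s x" for s by (simp add: f_def)
      show "(h x - h (x - \<omega>)) / T x = - 1 / T x * (h (x + - \<omega>) - h x)" using T_bounds(3)[of x] by (simp add: field_simps)
    qed
    from integral_unique[OF this] show "(h x - h (x - \<omega>)) / T x = \<omega> * integral {0..1} (\<lambda>r. f r x)"
      by (simp only: Henstock_Kurzweil_Integration.integral_mult_right)
  qed
  also have "integral {0..1} \<dots> = \<omega> * integral {0..1} (\<lambda>x. integral {0..1} (\<lambda>r. f r x))" by simp
  also have "integral {0..1} (\<lambda>x. integral {0..1} (\<lambda>r. f r x)) = integral {0..1} (\<lambda>r. integral {0..1} (\<lambda>x. f r x))"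
  proof -
    have "continuous_on (cbox (0, 0) (1, 1)) (\<lambda>(x, r). f r x)"
      unfolding f_def case_prod_unfold by (intro continuous_intros cT)
    from integral_swap_continuous[OF this] show ?thesis by simp
  qed
  finally have U: "U 1 = \<omega> * integral {0..1} (\<lambda>r. integral {0..1} (f r))" .
  have "Cc t \<omega> = integral {0..1} (\<lambda>r. integral {0..1} (\<lambda>s. of_real (f r s)))"
    unfolding Cc_def f_def by (simp only: t(2) divide_inverse of_real_mult of_real_inverse mult_1_left)
  also have "(\<lambda>r. integral {0..1} (\<lambda>s. of_real (f r s) :: complex)) = (\<lambda>r. of_real (integral {0..1} (f r)))"
    by (simp add: integral_HK_of_real)
  also have "integral {0..1} \<dots> = of_real (integral {0..1} (\<lambda>r. integral {0..1} (f r)))"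
    by (simp add: integral_HK_of_real)
  finally show ?thesis by (simp add: U)
qed

context level2
begin

definition TT :: "real \<Rightarrow> real \<Rightarrow> real" where "TT \<tau> x = Re (tser (csol (of_real \<tau>)) (of_real x))"
definition VV :: "real \<Rightarrow> real \<Rightarrow> real" where "VV \<tau> = circle_potential.V (TT \<tau>) \<omega>"

lemma TT_circle:
  assumes \<tau>: "\<bar>\<tau>\<bar> \<le> r"
  shows "circle_potential (TT \<tau>)" "tser (csol (of_real \<tau>)) (of_real x) = of_real (TT \<tau> x)"
    "tser (csol (of_real \<tau>)) (cnj z) = cnj (tser (csol (of_real \<tau>)) z)" "adm (tser (csol (of_real \<tau>)))"
proof -
  define t where "t = tser (csol (of_real \<tau>))"
  have n: "norm (of_real \<tau> :: complex) \<le> r" using \<tau> by simp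
  show adm: "adm (tser (csol (of_real \<tau>)))" by (rule kcoef_adm[OF csol_kcoef[OF n]])
  show cnj: "tser (csol (of_real \<tau>)) (cnj z) = cnj (tser (csol (of_real \<tau>)) z)" for z
    by (rule tser_cnj[OF csol_cnj[OF \<tau>]])
  show re: "tser (csol (of_real \<tau>)) (of_real x) = of_real (TT \<tau> x)" for x
  proof -
    have "cnj (t (of_real x)) = t (of_real x)" using cnj[of "of_real x"] by (simp add: t_def)
    then show ?thesis unfolding TT_def t_def[symmetric] by (simp add: complex_eq_iff)
  qed
  have inv: "inverse (t (0 + of_real s * 1)) = of_real (1 / TT \<tau> s)" for s
    by (simp add: t_def re divide_inverse)
  show "circle_potential (TT \<tau>)"
  proof
    show "continuous_on UNIV (TT \<tau>)"
      unfolding TT_def by (intro continuous_intros continuous_on_compose2[OF adm_continuous[OF adm]]) auto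
    show "\<bar>TT \<tau> x - 1\<bar> \<le> 1/1000" for x
      using adm_bounds(1)[OF adm strip_of_real, of x] unfolding re by (metis norm_of_real of_real_1 of_real_diff)
    show "TT \<tau> (x + 1) = TT \<tau> x" for x using tser_add_1[of "csol (of_real \<tau>)" "of_real x"] by (simp add: TT_def)
    show "TT \<tau> (- x) = TT \<tau> x" for x using tser_minus[of "csol (of_real \<tau>)" "of_real x"] by (simp add: TT_def)
    have "1 = R1 t 0 1" using csol_eqs(1)[OF n] by (simp add: t_def)
    also have "\<dots> = of_real (integral {0..1} (\<lambda>s. 1 / TT \<tau> s))"
      unfolding R1_def inv by (rule integral_HK_of_real)
    finally show "integral {0..1} (\<lambda>s. 1 / TT \<tau> s) = 1" by (metis of_real_eq_1_iff)
  qed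
qed

text \<open>The least action is p * \<open>U\<close> 1 + \<open>m0\<close>. \<open>U\<close> 1 is
  fixed through \<open>Cc\<close>, and \<open>m0\<close> through \<open>Mj\<close> at 0, whose value
  is \<open>Iw\<close> plus 2 * \<open>kap\<close> i; none of these depends on the
  parameter.\<close>

theorem beta_constant:
  assumes \<tau>: "\<bar>\<tau>\<bar> \<le> r" and i: "i \<ge> 4"
  shows "mather_beta (VV \<tau>) (of_int (pp i) / real (\<nu> i)) =
    (1 / real (\<nu> i)) * (of_int (pp i) * (\<omega> * (1 + a\<^sup>2 * (\<Sum>i\<in>{1,2,3}. sg \<omega> i)))
      + real (\<nu> i) * (eps i)\<^sup>2 / (2 * (1 + a\<^sup>2 * (\<Sum>i\<in>{1,2,3}. gm i) + 2 * kap i)))"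
proof -
  define c where "c = csol (of_real \<tau>)"
  have n: "norm (of_real \<tau> :: complex) \<le> r" using \<tau> by simp
  have k: "kcoef c" unfolding c_def by (rule csol_kcoef[OF n])
  interpret near_rational \<omega> "eps i" "\<nu> i" "pp i" by (rule near_rational_i[OF i])
  interpret circle_potential "TT \<tau>" \<omega> by (rule TT_circle[OF \<tau>])
  interpret nr_circle \<omega> "eps i" "\<nu> i" "pp i" "TT \<tau>" "tser c"
    by unfold_locales (use eps_ne[OF i] TT_circle[OF \<tau>] in \<open>auto simp: c_def\<close>)
  have re: "cnj (c l) = c l" for l unfolding c_def by (rule csol_cnj[OF \<tau>])
  define B where "B = 2 * Re (c i * c 0)"
  have Bc: "of_real B = 2 * (c i * c 0)"
  proof -
    have "Im (c i * c 0) = 0" using re by (metis complex_cnj_mult complex_In_mult_cnj_zero cnj.simps(2) equal_neg_zero)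
    then show ?thesis by (simp add: B_def complex_eq_iff)
  qed
  \<comment> \<open>A positive amplitude of at least \<open>kap\<close> i puts the maximum, not a
    minimum, at 0, and makes the model error \<open>kap\<close> i / 1000 small enough for
    \<open>Mw_max\<close>.\<close>
  have B: "B \<ge> kap i"
  proof -
    define K where "K = (of_real (kap i) :: complex)"
    have c0: "norm (c 0 - 1) \<le> 1/1000"
    proof -
      have "norm (c 0 - 1) \<le> 64 * a\<^sup>2" using k by (simp add: kcoef_def)
      moreover have "64 * a\<^sup>2 \<le> 1/1000" using a_pow(1) a_small by simp
      ultimately show ?thesis by linarith
    qed
    have ci: "norm (c i) \<le> 17/16 * kap i" using k i by (simp add: kcoef_def)
    have e: "c i - K = K * (usol (of_real \<tau>) i / 16)" using i by (simp add: c_def csol_def cf_def K_def algebra_simps)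
    have cK: "norm (c i - K) \<le> kap i * (1/16)"
      unfolding e using usol_bound[OF n, of i] kap_pos[of i] by (intro norm_mult_le) (auto simp: K_def norm_divide)
    have "c i * c 0 - K = c i * (c 0 - 1) + (c i - K)" by (simp add: algebra_simps)
    also have "norm \<dots> \<le> (17/16 * kap i) * (1/1000) + kap i * (1/16)"
      by (intro order_trans[OF norm_triangle_ineq] add_mono norm_mult_le ci c0 cK)
    also have "\<dots> \<le> kap i / 2" using kap_pos[of i] by simp
    finally have "\<bar>Re (c i * c 0 - K)\<bar> \<le> kap i / 2" using abs_Re_le_cmod order_trans by blast
    moreover have "Re (c i * c 0 - K) = Re (c i * c 0) - kap i" by (simp only: minus_complex.sel K_def Re_complex_of_real)
    ultimately show ?thesis unfolding B_def by linarith
  qed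
  have L: "(LEAST x. x \<in> periodic_actions V (pp i) (\<nu> i)) = of_int (pp i) * U 1 + m0"
  proof (rule Least_periodic_actions[OF cop[OF i] Mw_max[OF \<nu>_ge[OF i]]])
    show "B > 0" using B kap_pos[of i] by linarith
    fix \<phi> :: complex assume \<phi>: "norm \<phi> < 1 / real (\<nu> i)"
    show "norm (Mw (tser c) \<phi> - (Iw c + of_real B * cos (of_real (2 * pi * real (\<nu> i)) * \<phi>))) \<le> B / 20"
      using Mj_model[OF k i \<phi>] B kap_pos[of i] unfolding Mj_def Bc by linarith
  qed
  have "of_real (U 1) = of_real \<omega> * Cc (tser c) \<omega>" by (rule U_1_integral[OF adm treal])
  also have "\<dots> = of_real (\<omega> * (1 + a\<^sup>2 * (\<Sum>i\<in>{1,2,3}. sg \<omega> i)))" unfolding c_def csol_eqs(2)[OF n] by simp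
  finally have U1: "U 1 = \<omega> * (1 + a\<^sup>2 * (\<Sum>i\<in>{1,2,3}. sg \<omega> i))" by (simp only: of_real_eq_iff)
  have "Mw (tser c) 0 = of_real (1 + a\<^sup>2 * (\<Sum>i\<in>{1,2,3}. gm i) + 2 * kap i)"
    using csol_eqs(3)[OF n] csol_eqs(4)[OF n i] unfolding Mj_def c_def by simp
  then have m: "m0 = real (\<nu> i) * (eps i)\<^sup>2 / (2 * (1 + a\<^sup>2 * (\<Sum>i\<in>{1,2,3}. gm i) + 2 * kap i))"
    unfolding m0_def by (simp only: complex.sel Re_complex_of_real)
  show ?thesis
    using mather_beta_rational[OF _ cop[OF i], of "VV \<tau>"] \<nu>_ge[OF i] by (simp add: VV_def L U1 m)
qed

end

section \<open>Nontriviality\<close>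

lemma DERIV_bound_increment:
  fixes f :: "real \<Rightarrow> real"
  assumes "\<And>y. (f has_real_derivative f' y) (at y)" "\<And>y. \<bar>f' y\<bar> \<le> B"
  shows "\<bar>f u - f v\<bar> \<le> B * \<bar>u - v\<bar>"
  using field_differentiable_bound[of UNIV f f' B u v] assms by (simp add: abs_minus_commute)

context level2
begin

definition bb :: "real \<Rightarrow> nat \<Rightarrow> real" where "bb \<tau> i = Re (csol (of_real \<tau>) i)"
text \<open>The multiplier of the second difference with step \<omega> on the harmonic i, divided by
  2 * pi * i because h is a primitive of 1 / T.\<close>

definition kk :: "nat \<Rightarrow> real" where "kk i = (2 - 2 * cos (2 * pi * real i * \<omega>)) / (2 * pi * real i)"
text \<open>The part of V' of first order in \<open>a\<close>: the second difference of the
  first-order part of h.\<close>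

definition GG :: "real \<Rightarrow> real \<Rightarrow> real" where "GG \<tau> x = (\<Sum>i\<in>{1,2,3}. bb \<tau> i * kk i * sin (2 * pi * real i * x))"

lemma bb_bound: "\<bar>\<tau>\<bar> \<le> r \<Longrightarrow> i \<in> {1,2,3} \<Longrightarrow> \<bar>bb \<tau> i\<bar> \<le> 2 * a"
  using csol_kcoef[of "of_real \<tau>"] abs_Re_le_cmod[of "csol (of_real \<tau>) i"] unfolding kcoef_def bb_def by fastforce

lemma sum_bb_cos_bound:
  assumes "\<bar>\<tau>\<bar> \<le> r" "\<And>i. \<bar>k i\<bar> \<le> 4"
  shows "\<bar>\<Sum>i\<in>{1,2,3}. bb \<tau> i * (k i * cos (y i))\<bar> \<le> 24 * a"
proof -
  have "\<bar>\<Sum>i\<in>{1,2,3}. bb \<tau> i * (k i * cos (y i))\<bar> \<le> (\<Sum>i\<in>{1,2,3::nat}. 2 * a * (4 * 1))"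
    by (rule order_trans[OF sum_abs sum_mono], unfold abs_mult, intro mult_mono)
       (use assms a0 bb_bound in auto)
  then show ?thesis by simp
qed

text \<open>Splitting h into identity, first-order part q and rest g, the second difference of g is
  of order a^2 since g has Lipschitz constant 101 * a^2. Passing from the parameter y = hi x to x
  costs 24 * a * (8 * a).\<close>

lemma deriv_VV_close:
  assumes \<tau>: "\<bar>\<tau>\<bar> \<le> r"
  shows "\<bar>deriv (VV \<tau>) x - GG \<tau> x\<bar> \<le> (202 * \<bar>\<omega>\<bar> + 192) * a\<^sup>2"
proof -
  interpret circle_potential "TT \<tau>" \<omega> by (rule TT_circle[OF \<tau>])
  define c where "c = csol (of_real \<tau>)"
  have n: "norm (of_real \<tau> :: complex) \<le> r" using \<tau> by simp
  have s: "scoef c" unfolding c_def by (rule kcoef_scoef[OF csol_kcoef[OF n]])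
  have cre: "c i = of_real (bb \<tau> i)" for i
    using csol_cnj[OF \<tau>, of i] by (simp add: c_def bb_def complex_eq_iff)
  have pr: "pr c y = of_real (\<Sum>i\<in>{1,2,3}. bb \<tau> i * cos (2 * pi * real i * y))" for y
    by (simp add: pr_def cre)
  have inv: "inverse (tser c (of_real y)) = of_real (1 / TT \<tau> y)" for y
    unfolding c_def TT_circle(2)[OF \<tau>] by (simp add: divide_inverse)
  have d1: "\<bar>1 / TT \<tau> y - 1\<bar> \<le> 8 * a" for y
  proof -
    have "norm (inverse (tser c (of_real y)) - 1) \<le> 1200 * a ^ 3 + 7 * a"
      using norm_triangle_ineq[of "inverse (tser c (of_real y)) - (1 + gap c y)" "gap c y"] gap_bounds(1,3)[OF s, of y] by simp
    also have "\<dots> \<le> 8 * a" using a_pow a0 by linarith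
    finally show ?thesis unfolding inv by (metis norm_of_real of_real_1 of_real_diff)
  qed
  have d2: "\<bar>1 / TT \<tau> y - 1 + (\<Sum>i\<in>{1,2,3}. bb \<tau> i * cos (2 * pi * real i * y))\<bar> \<le> 101 * a\<^sup>2" for y
  proof -
    have "norm (inverse (tser c (of_real y)) - 1 + pr c y) \<le> 1200 * a ^ 3 + 100 * a\<^sup>2"
    proof -
      have "inverse (tser c (of_real y)) - 1 + pr c y = (inverse (tser c (of_real y)) - (1 + gap c y)) + (gap c y + pr c y)" by simp
      then show ?thesis by (simp only:) (intro order_trans[OF norm_triangle_ineq] add_mono gap_bounds[OF s])
    qed
    also have "\<dots> \<le> 101 * a\<^sup>2" using a_pow by linarith
    also have "inverse (tser c (of_real y)) - 1 + pr c y = of_real (1 / TT \<tau> y - 1 + (\<Sum>i\<in>{1,2,3}. bb \<tau> i * cos (2 * pi * real i * y)))"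
      unfolding inv pr by (simp only: of_real_add of_real_diff of_real_1)
    finally show ?thesis by (simp only: norm_of_real)
  qed
  define q where "q = (\<lambda>y. \<Sum>i\<in>{1,2,3}. - (bb \<tau> i * sin (2 * pi * real i * y) / (2 * pi * real i)))"
  define g where "g = (\<lambda>y. h y - y - q y)"
  have g: "\<bar>g u - g v\<bar> \<le> 101 * a\<^sup>2 * \<bar>u - v\<bar>" for u v
  proof -
    have "(g has_real_derivative (1 / TT \<tau> y - 1 + (\<Sum>i\<in>{1,2,3}. bb \<tau> i * cos (2 * pi * real i * y)))) (at y)" for y
      unfolding g_def q_def by (auto intro!: derivative_eq_intros)
    then show ?thesis by (rule DERIV_bound_increment) (rule d2)
  qed
  have hid: "\<bar>h y - y\<bar> \<le> 8 * a" for y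
  proof -
    \<comment> \<open>h y - y has period 1, so the estimate from 0 is needed only on the unit
      interval.\<close>
    define z where "z = y - of_int \<lfloor>y\<rfloor>"
    have z: "0 \<le> z" "z \<le> 1" unfolding z_def by linarith+
    have "((\<lambda>y. h y - y) has_real_derivative (1 / TT \<tau> y - 1)) (at y)" for y by (auto intro!: derivative_eq_intros)
    then have "\<bar>(h z - z) - (h 0 - 0)\<bar> \<le> 8 * a * \<bar>z - 0\<bar>"
      by (rule DERIV_bound_increment) (rule d1)
    also have "\<dots> \<le> 8 * a * 1" using z a0 by (intro mult_left_mono) auto
    finally show ?thesis using h_add_int[of z "\<lfloor>y\<rfloor>"] by (simp add: z_def)
  qed
  have G: "\<bar>GG \<tau> u - GG \<tau> v\<bar> \<le> 24 * a * \<bar>u - v\<bar>" for u v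
  proof -
    have 1: "(GG \<tau> has_real_derivative (\<Sum>i\<in>{1,2,3}. bb \<tau> i * ((2 - 2 * cos (2 * pi * real i * \<omega>)) * cos (2 * pi * real i * y)))) (at y)" for y
      unfolding GG_def[abs_def] kk_def by (auto intro!: derivative_eq_intros)
    have 2: "\<bar>2 - 2 * cos (2 * pi * real i * \<omega>)\<bar> \<le> 4" for i
      using abs_cos_le_one[of "2 * pi * real i * \<omega>"] by linarith
    show ?thesis by (rule DERIV_bound_increment[OF 1 sum_bb_cos_bound[OF \<tau> 2]])
  qed
  define y where "y = hi x"
  have q2: "q (y + \<omega>) + q (y - \<omega>) - 2 * q y = GG \<tau> y"
  proof -
    have "- (b * sin (k * (y + \<omega>)) / k) + - (b * sin (k * (y - \<omega>)) / k) - 2 * - (b * sin (k * y) / k) = b * ((2 - 2 * cos (k * \<omega>)) / k) * sin (k * y)" for b k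
    proof -
      have 1: "sin (k * (y + \<omega>)) = sin (k * y) * cos (k * \<omega>) + cos (k * y) * sin (k * \<omega>)"
        "sin (k * (y - \<omega>)) = sin (k * y) * cos (k * \<omega>) - cos (k * y) * sin (k * \<omega>)"
        by (simp_all add: distrib_left right_diff_distrib sin_add sin_diff)
      show ?thesis unfolding 1 divide_inverse by (simp add: algebra_simps)
    qed
    then show ?thesis unfolding q_def GG_def kk_def sum_distrib_left sum.distrib[symmetric] sum_subtractf[symmetric]
      by (intro sum.cong refl)
  qed
  have "deriv (VV \<tau>) x - GG \<tau> x = (g (y + \<omega>) - g y) + (g (y - \<omega>) - g y) + (GG \<tau> y - GG \<tau> x)"
    unfolding VV_def deriv_V q2[symmetric] by (simp add: g_def y_def)
  moreover have "\<bar>g (y + \<omega>) - g y\<bar> \<le> 101 * a\<^sup>2 * \<bar>\<omega>\<bar>" "\<bar>g (y - \<omega>) - g y\<bar> \<le> 101 * a\<^sup>2 * \<bar>\<omega>\<bar>"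
    using g[of "y + \<omega>" y] g[of "y - \<omega>" y] by auto
  moreover have "\<bar>GG \<tau> y - GG \<tau> x\<bar> \<le> 192 * a\<^sup>2"
  proof -
    have "\<bar>y - x\<bar> \<le> 8 * a" using hid[of y] by (simp add: y_def abs_minus_commute)
    then have "24 * a * \<bar>y - x\<bar> \<le> 24 * a * (8 * a)" using a0 by (intro mult_left_mono) auto
    then show ?thesis using G[of y x] by (simp add: power2_eq_square)
  qed
  ultimately have "\<bar>deriv (VV \<tau>) x - GG \<tau> x\<bar> \<le> 101 * a\<^sup>2 * \<bar>\<omega>\<bar> + 101 * a\<^sup>2 * \<bar>\<omega>\<bar> + 192 * a\<^sup>2" by linarith
  then show ?thesis by (simp add: algebra_simps)
qed

text \<open>Averaging over the translations by thirds isolates the third harmonic, the only one whose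
  leading coefficient depends on the parameter.\<close>

lemma average_deriv_VV:
  assumes \<tau>: "\<bar>\<tau>\<bar> \<le> r"
  shows "\<bar>(\<Sum>k<3. deriv (VV \<tau>) (x + real k / 3)) - 3 * (a * (1 + \<tau>) * kk 3 * sin (6 * pi * x))\<bar> \<le> 3 * ((202 * \<bar>\<omega>\<bar> + 192) * a\<^sup>2)"
proof -
  have s120: "sin (y + 2 * pi / 3) + sin (y + 4 * pi / 3) + sin y = 0" for y
  proof -
    have "y + 2 * pi / 3 = (y - pi / 3) + pi" "y + 4 * pi / 3 = (y + pi / 3) + pi" by simp_all
    then show ?thesis by (simp only: sin_periodic_pi sin_diff sin_add cos_60) simp
  qed
  have b3: "bb \<tau> 3 = a * (1 + \<tau>)" by (simp add: bb_def csol_def cf_def)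
  have S3: "(\<Sum>k<3. f k) = f 0 + f 1 + f 2" for f :: "nat \<Rightarrow> real" by (simp add: eval_nat_numeral)
  have S123: "sum f {1,2,3} = f 1 + f 2 + f 3" for f :: "nat \<Rightarrow> real" by (simp add: add.assoc)
  have h1: "(\<Sum>k<3. sin (2 * pi * real 1 * (x + real k / 3))) = 0"
  proof -
    have "2 * pi * real 1 * (x + real 0 / 3) = 2 * pi * x" "2 * pi * real 1 * (x + real 1 / 3) = 2 * pi * x + 2 * pi / 3"
      "2 * pi * real 1 * (x + real 2 / 3) = 2 * pi * x + 4 * pi / 3" by (simp_all add: field_simps)
    then show ?thesis using s120[of "2 * pi * x"] unfolding S3 by (simp only:)
  qed
  have h2: "(\<Sum>k<3. sin (2 * pi * real 2 * (x + real k / 3))) = 0"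
  proof -
    have "2 * pi * real 2 * (x + real 0 / 3) = 4 * pi * x" "2 * pi * real 2 * (x + real 1 / 3) = 4 * pi * x + 4 * pi / 3"
      "2 * pi * real 2 * (x + real 2 / 3) = (4 * pi * x + 2 * pi / 3) + 2 * pi" by (simp_all add: field_simps)
    then show ?thesis using s120[of "4 * pi * x"] unfolding S3 by (simp only: sin_periodic)
  qed
  have h3: "(\<Sum>k<3. sin (2 * pi * real 3 * (x + real k / 3))) = 3 * sin (6 * pi * x)"
  proof -
    have "2 * pi * real 3 * (x + real 0 / 3) = 6 * pi * x" "2 * pi * real 3 * (x + real 1 / 3) = 6 * pi * x + 2 * pi"
      "2 * pi * real 3 * (x + real 2 / 3) = (6 * pi * x + 2 * pi) + 2 * pi" by (simp_all add: field_simps)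
    then show ?thesis unfolding S3 by (simp only: sin_periodic)
  qed
  have "(\<Sum>k<3. GG \<tau> (x + real k / 3)) = (\<Sum>i\<in>{1,2,3}. bb \<tau> i * kk i * (\<Sum>k<3. sin (2 * pi * real i * (x + real k / 3))))"
    unfolding GG_def sum_distrib_left by (rule sum.swap)
  also have "\<dots> = bb \<tau> 1 * kk 1 * 0 + bb \<tau> 2 * kk 2 * 0 + bb \<tau> 3 * kk 3 * (3 * sin (6 * pi * x))"
    unfolding S123 h1 h2 h3 ..
  finally have "(\<Sum>k<3. GG \<tau> (x + real k / 3)) = 3 * (a * (1 + \<tau>) * kk 3 * sin (6 * pi * x))" by (simp add: b3)
  then have "\<bar>(\<Sum>k<3. deriv (VV \<tau>) (x + real k / 3)) - 3 * (a * (1 + \<tau>) * kk 3 * sin (6 * pi * x))\<bar>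
    = \<bar>\<Sum>k<3. deriv (VV \<tau>) (x + real k / 3) - GG \<tau> (x + real k / 3)\<bar>" by (simp only: sum_subtractf)
  also have "\<dots> \<le> (\<Sum>k<3::nat. (202 * \<bar>\<omega>\<bar> + 192) * a\<^sup>2)"
    by (rule order_trans[OF sum_abs sum_mono]) (rule deriv_VV_close[OF \<tau>])
  finally show ?thesis by simp
qed

text \<open>Averaging over thirds commutes with translations. At x = 1/12, where sin (6 * pi * x) =
  1, the average for \<tau> nearly attains its amplitude a * (1 + \<tau>) * kk 3, and no translate
  of the average for parameter 0 can reach this value.\<close>

lemma not_equivalent:
  assumes \<tau>: "0 \<le> \<tau>" "\<tau> \<le> r" and big: "2 * (202 * \<bar>\<omega>\<bar> + 192) * a < \<tau> * kk 3"
  shows "\<not> equivalent_potentials (VV 0) (VV \<tau>)"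
proof
  assume "equivalent_potentials (VV 0) (VV \<tau>)"
  then obtain c d where e: "VV \<tau> = (\<lambda>x. VV 0 (x + c) + d)" unfolding equivalent_potentials_def by blast
  have diff: "(VV 0 has_real_derivative deriv (VV 0) x) (at x)" for x
    using circle_potential.V_deriv[OF TT_circle(1)[of 0], of \<omega> x] circle_potential.deriv_V[OF TT_circle(1)[of 0], of \<omega> x] r0
    by (simp add: VV_def)
  have D: "deriv (VV \<tau>) x = deriv (VV 0) (x + c)" for x
    unfolding e using DERIV_add[OF DERIV_shift[THEN iffD1, OF diff[of "x + c"]] DERIV_const[of d]]
    by (intro DERIV_imp_deriv) simp
  define C where "C = (202 * \<bar>\<omega>\<bar> + 192) * a\<^sup>2"
  have k3: "kk 3 \<ge> 0" using cos_le_one[of "2 * pi * real 3 * \<omega>"] by (simp add: kk_def)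
  have 1: "3 * (a * (1 + \<tau>) * kk 3) - 3 * C \<le> (\<Sum>k<3. deriv (VV \<tau>) (1/12 + real k / 3))"
    using average_deriv_VV[of \<tau> "1/12"] \<tau> unfolding C_def by simp
  have "(\<Sum>k<3. deriv (VV \<tau>) (1/12 + real k / 3)) = (\<Sum>k<3. deriv (VV 0) ((1/12 + c) + real k / 3))"
    unfolding D by (simp add: add_ac)
  also have "\<dots> \<le> 3 * (a * (1 + 0) * kk 3 * sin (6 * pi * (1/12 + c))) + 3 * C"
    using average_deriv_VV[of 0 "1/12 + c"] r0 unfolding C_def by linarith
  also have "\<dots> \<le> 3 * (a * (1 + 0) * kk 3 * 1) + 3 * C"
    using k3 a0 by (intro add_mono mult_left_mono) auto
  finally have "a * (\<tau> * kk 3) \<le> 2 * C" using 1 by (simp add: algebra_simps)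
  also have "\<dots> = a * (2 * (202 * \<bar>\<omega>\<bar> + 192) * a)" by (simp add: C_def power2_eq_square)
  finally show False using big a0 by simp
qed

end

section \<open>Analyticity\<close>

lemma taylor_coeff_bound:
  assumes f: "f holomorphic_on ball 0 R" and R: "R > 0" and M: "\<And>z. z \<in> ball 0 R \<Longrightarrow> norm (f z) \<le> M"
  shows "norm ((deriv ^^ n) f 0 / fact n) \<le> M / (R/2) ^ n"
proof -
  have sub: "ball 0 (R/2) \<subseteq> ball (0::complex) R" "cball 0 (R/2) \<subseteq> ball (0::complex) R" using R by auto
  have "norm ((deriv ^^ n) f 0) \<le> fact n * M / (R/2) ^ n"
  proof (rule Cauchy_inequality)
    show "f holomorphic_on ball 0 (R/2)" "continuous_on (cball 0 (R/2)) f"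
      using holomorphic_on_subset[OF f sub(1)] holomorphic_on_imp_continuous_on[OF holomorphic_on_subset[OF f sub(2)]] by auto
    show "norm (f x) \<le> M" if "norm (0 - x) = R / 2" for x using that R by (intro M) simp
  qed (use R in simp)
  then show ?thesis by (simp add: norm_divide field_simps)
qed

text \<open>The coefficient m is the uniform limit of (f s - (terms below m)) / s^m along s tending
  to 0; for fixed s these quotients are holomorphic in x by induction. Separate holomorphy with a
  common bound is all that is used.\<close>

lemma taylor_coeff_holomorphic:
  fixes f :: "complex \<Rightarrow> complex \<Rightarrow> complex"
  assumes R: "R > 0" and ft: "\<And>x. x \<in> ball 0 R \<Longrightarrow> (\<lambda>t. f t x) holomorphic_on ball 0 R"
    and fx: "\<And>t. t \<in> ball 0 R \<Longrightarrow> f t holomorphic_on ball 0 R"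
    and M: "\<And>t x. t \<in> ball 0 R \<Longrightarrow> x \<in> ball 0 R \<Longrightarrow> norm (f t x) \<le> M"
  shows "(\<lambda>x. (deriv ^^ m) (\<lambda>t. f t x) 0 / fact m) holomorphic_on ball 0 R"
proof (induction m rule: less_induct)
  case (less m)
  define c where "c = (\<lambda>i x. (deriv ^^ i) (\<lambda>t. f t x) 0 / fact i)"
  define \<rho> where "\<rho> = R / 2"
  \<comment> \<open>A null sequence of positive reals with s n / \<rho> at most 1/2, so the
    remainder series is dominated by a geometric one.\<close>
  define s where "s = (\<lambda>n::nat. \<rho> / (2 * (real n + 1)))"
  have \<rho>: "\<rho> > 0" using R by (simp add: \<rho>_def)
  have s: "s n > 0" "s n / \<rho> \<le> 1/2" "s n < R" for n
  proof -
    show "s n > 0" using \<rho> by (simp add: s_def)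
    have "s n / \<rho> = 1 / (2 * (real n + 1))" using \<rho> by (simp add: s_def)
    also have "\<dots> \<le> 1 / 2" by (intro divide_left_mono) auto
    finally show "s n / \<rho> \<le> 1/2" .
    then have "s n \<le> 1/2 * \<rho>" using \<rho> by (simp add: field_simps)
    then show "s n < R" using R by (simp add: \<rho>_def)
  qed
  have geo0: "(\<lambda>i. K * (1/2) ^ i) sums (K * 2)" for K :: real
    using sums_mult[OF geometric_sums[of "1/2::real"], of K] by simp
  have M0: "M \<ge> 0" using order_trans[OF norm_ge_zero M[of 0 0]] R by simp
  have ih: "(\<lambda>x. c i x) holomorphic_on ball 0 R" if "i \<in> {..<m}" for i using less[of i] that by (simp add: c_def)
  have "(c m) holomorphic_on ball 0 R"
  proof (rule holomorphic_on_uniform_seq[OF open_ball])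
    show "(\<lambda>x. (f (of_real (s n)) x - (\<Sum>i<m. c i x * of_real (s n) ^ i)) / of_real (s n) ^ m) holomorphic_on ball 0 R" for n
      using s(1,3)[of n] by (intro holomorphic_intros fx ih) auto
    have close: "norm ((f (of_real (s n)) x - (\<Sum>i<m. c i x * of_real (s n) ^ i)) / of_real (s n) ^ m - c m x) \<le> 2 * M / \<rho> ^ Suc m * s n"
      if x: "x \<in> ball 0 R" for n x
    proof -
      define g where "g = (\<lambda>i. c (i + Suc m) x * of_real (s n) ^ (i + Suc m))"
      have "(\<lambda>i. c i x * of_real (s n) ^ i) sums f (of_real (s n)) x"
        using holomorphic_power_series[OF ft[OF x], of "of_real (s n)"] s(1,3)[of n] by (simp add: c_def)
      then have g: "g sums (f (of_real (s n)) x - (\<Sum>i<Suc m. c i x * of_real (s n) ^ i))"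
        unfolding g_def by (rule sums_split_initial_segment)
      have gb: "norm (g i) \<le> (M * (s n / \<rho>) ^ Suc m) * (1/2) ^ i" for i
      proof -
        have "norm (g i) \<le> M / \<rho> ^ (i + Suc m) * s n ^ (i + Suc m)"
          unfolding g_def c_def \<rho>_def
          by (intro norm_mult_le taylor_coeff_bound[OF ft[OF x] R] M x) (simp_all only: norm_power norm_of_real abs_of_pos[OF s(1)] order_refl)
        also have "\<dots> = M * (s n / \<rho>) ^ Suc m * (s n / \<rho>) ^ i" by (simp add: power_add power_divide mult_ac)
        also have "\<dots> \<le> M * (s n / \<rho>) ^ Suc m * (1/2) ^ i"
          using s[of n] \<rho> M0 by (intro mult_left_mono power_mono) auto
        finally show ?thesis .
      qed
      have geo: "(\<lambda>i. (M * (s n / \<rho>) ^ Suc m) * (1/2) ^ i) sums ((M * (s n / \<rho>) ^ Suc m) * 2)"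
        by (rule geo0)
      have sg: "summable (\<lambda>i. norm (g i))"
        by (rule summable_comparison_test'[OF sums_summable[OF geo], of 0]) (use gb in simp)
      have "norm (suminf g) \<le> suminf (\<lambda>i. (M * (s n / \<rho>) ^ Suc m) * (1/2) ^ i)"
        by (rule order_trans[OF summable_norm[OF sg] suminf_le[OF gb sg sums_summable[OF geo]]])
      then have b: "norm (f (of_real (s n)) x - (\<Sum>i<Suc m. c i x * of_real (s n) ^ i)) \<le> M * (s n / \<rho>) ^ Suc m * 2"
        using sums_unique[OF g] sums_unique[OF geo] by simp
      have "(f (of_real (s n)) x - (\<Sum>i<m. c i x * of_real (s n) ^ i)) / of_real (s n) ^ m - c m x
        = (f (of_real (s n)) x - (\<Sum>i<Suc m. c i x * of_real (s n) ^ i)) / of_real (s n) ^ m"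
        using s(1)[of n] by (simp add: field_simps)
      also have "norm \<dots> \<le> M * (s n / \<rho>) ^ Suc m * 2 / s n ^ m"
        unfolding norm_divide norm_power norm_of_real abs_of_pos[OF s(1)]
        by (intro divide_right_mono b) (use s(1)[of n] in simp)
      also have "\<dots> = 2 * M / \<rho> ^ Suc m * s n" using s(1)[of n] by (simp add: power_divide)
      finally show ?thesis .
    qed
    show "uniform_limit (ball 0 R) (\<lambda>n x. (f (of_real (s n)) x - (\<Sum>i<m. c i x * of_real (s n) ^ i)) / of_real (s n) ^ m) (c m) sequentially"
    proof (rule uniform_limitI)
      fix e :: real assume e: "e > 0"
      have "(\<lambda>n. 2 * M / \<rho> ^ Suc m * (\<rho> / 2 * (1 / (real n + 1)))) \<longlonglongrightarrow> 2 * M / \<rho> ^ Suc m * (\<rho> / 2 * 0)"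
        using LIMSEQ_inverse_real_of_nat by (intro tendsto_intros) (simp add: inverse_eq_divide add.commute)
      then have "(\<lambda>n. 2 * M / \<rho> ^ Suc m * s n) \<longlonglongrightarrow> 0" by (simp add: s_def)
      then have "\<forall>\<^sub>F n in sequentially. 2 * M / \<rho> ^ Suc m * s n < e" by (rule order_tendstoD(2)[OF _ e])
      then show "\<forall>\<^sub>F n in sequentially. \<forall>x\<in>ball 0 R. dist ((f (of_real (s n)) x - (\<Sum>i<m. c i x * of_real (s n) ^ i)) / of_real (s n) ^ m) (c m x) < e"
        by (rule eventually_mono) (auto simp: dist_norm intro: order.strict_trans1[OF close])
    qed
  qed
  then show ?case by (simp add: c_def)
qed

text \<open>Expand in t, and each coefficient in x. Two Cauchy estimates with radius \<rho> give the
  majorant M * (1/2)^m * (1/2)^n when both variables are below \<rho> / 2, so the iterated sum is an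
  unordered double sum. Real parts are taken coefficientwise.\<close>

lemma double_power_series:
  fixes f :: "complex \<Rightarrow> complex \<Rightarrow> complex"
  assumes R: "R > 0" and ft: "\<And>x. x \<in> ball 0 R \<Longrightarrow> (\<lambda>t. f t x) holomorphic_on ball 0 R"
    and fx: "\<And>t. t \<in> ball 0 R \<Longrightarrow> f t holomorphic_on ball 0 R"
    and M: "\<And>t x. t \<in> ball 0 R \<Longrightarrow> x \<in> ball 0 R \<Longrightarrow> norm (f t x) \<le> M"
  shows "\<exists>(b :: nat \<Rightarrow> nat \<Rightarrow> real) r. r > 0 \<and> (\<forall>t x. \<bar>t\<bar> < r \<longrightarrow> \<bar>x\<bar> < r \<longrightarrow>
           ((\<lambda>(m, n). b m n * t ^ m * x ^ n) has_sum Re (f (of_real t) (of_real x))) UNIV)"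
proof -
  define c where "c = (\<lambda>i x. (deriv ^^ i) (\<lambda>t. f t x) 0 / fact i)"
  define d where "d = (\<lambda>m n. (deriv ^^ n) (c m) 0 / fact n)"
  define \<rho> where "\<rho> = R / 2"
  have \<rho>: "\<rho> > 0" "\<rho> < R" using R by (auto simp: \<rho>_def)
  have ch: "c m holomorphic_on ball 0 R" for m unfolding c_def by (rule taylor_coeff_holomorphic[OF R ft fx M])
  have cb: "norm (c m x) \<le> M / \<rho> ^ m" if "x \<in> ball 0 R" for m x
    unfolding c_def \<rho>_def by (rule taylor_coeff_bound[OF ft[OF that] R M[OF _ that]])
  have db: "norm (d m n) \<le> M / \<rho> ^ m / \<rho> ^ n" for m n
    unfolding d_def using taylor_coeff_bound[OF ch R cb] by (simp add: \<rho>_def)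
  have M0: "M \<ge> 0" using order_trans[OF norm_ge_zero M[of 0 0]] R by simp
  have geo: "((\<lambda>n. K * (1/2) ^ n) has_sum (K * 2)) UNIV" if "K \<ge> 0" for K :: real
    by (rule norm_summable_imp_has_sum) (use that sums_mult[OF geometric_sums[of "1/2::real"], of K] in \<open>auto simp: abs_mult sums_iff\<close>)
  have "((\<lambda>(m, n). Re (d m n) * t ^ m * x ^ n) has_sum Re (f (of_real t) (of_real x))) UNIV" if tx: "\<bar>t\<bar> < \<rho> / 2" "\<bar>x\<bar> < \<rho> / 2" for t x
  proof -
    define tc where "tc = (of_real t :: complex)"
    define xc where "xc = (of_real x :: complex)"
    have tB: "tc \<in> ball 0 R" "xc \<in> ball 0 R" using tx \<rho> by (auto simp: tc_def xc_def)
    have trm: "norm (d m n * tc ^ m * xc ^ n) \<le> M * (1/2) ^ m * (1/2) ^ n" for m n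
    proof -
      have "norm (d m n * tc ^ m * xc ^ n) \<le> M / \<rho> ^ m / \<rho> ^ n * (\<rho> / 2) ^ m * (\<rho> / 2) ^ n"
        by (intro norm_mult_le db) (use tx in \<open>auto simp: norm_power tc_def xc_def intro!: power_mono\<close>)
      also have "\<dots> = M * (1/2) ^ m * (1/2) ^ n" using \<rho> by (simp add: power_divide)
      finally show ?thesis .
    qed
    have abs: "(\<lambda>n. d m n * tc ^ m * xc ^ n) sums (c m xc * tc ^ m)" for m
      using sums_mult2[OF holomorphic_power_series[OF ch tB(2)], of m "tc ^ m"] by (simp add: d_def mult_ac)
    have 1: "((\<lambda>n. d m n * tc ^ m * xc ^ n) has_sum (c m xc * tc ^ m)) UNIV" for m
    proof (rule norm_summable_imp_has_sum[OF _ abs], rule summable_comparison_test')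
      show "summable (\<lambda>n. M * (1/2) ^ m * (1/2) ^ n)"
        using has_sum_imp_sums[OF geo[of "M * (1/2) ^ m"]] M0 by (simp add: sums_iff)
    qed (use trm in simp)
    have 2: "((\<lambda>m. c m xc * tc ^ m) has_sum f tc xc) UNIV"
    proof (rule norm_summable_imp_has_sum)
      show "(\<lambda>m. c m xc * tc ^ m) sums f tc xc"
        using holomorphic_power_series[OF ft[OF tB(2)] tB(1)] by (simp add: c_def)
      show "summable (\<lambda>m. norm (c m xc * tc ^ m))"
      proof (rule summable_comparison_test')
        show "summable (\<lambda>m. M * (1/2) ^ m)" using has_sum_imp_sums[OF geo[OF M0]] by (simp add: sums_iff)
        fix m
        have "norm (c m xc * tc ^ m) \<le> M / \<rho> ^ m * (\<rho> / 2) ^ m"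
          by (intro norm_mult_le cb tB) (use tx in \<open>auto simp: norm_power tc_def intro!: power_mono\<close>)
        then show "norm (norm (c m xc * tc ^ m)) \<le> M * (1/2) ^ m" using \<rho> by (simp add: power_divide)
      qed
    qed
    have "(\<lambda>(m, n). M * (1/2) ^ m * (1/2) ^ n) summable_on (UNIV \<times> UNIV)"
    proof (rule summable_on_SigmaI[where g="\<lambda>m. M * (1/2) ^ m * 2"])
      show "((\<lambda>n. case (m, n) of (m, n) \<Rightarrow> M * (1/2) ^ m * (1/2) ^ n) has_sum M * (1/2) ^ m * 2) UNIV" for m :: nat
        using geo[of "M * (1/2) ^ m"] M0 by simp
      show "(\<lambda>m::nat. M * (1/2) ^ m * 2) summable_on UNIV"
        using has_sum_imp_summable[OF geo[of "M * 2"]] M0 by (simp add: mult_ac)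
    qed (use M0 in auto)
    then have ab: "(\<lambda>p. norm (case p of (m, n) \<Rightarrow> M * (1/2) ^ m * (1/2) ^ n)) summable_on (UNIV \<times> UNIV)"
      using M0 by (simp add: case_prod_unfold abs_mult)
    have sm: "(\<lambda>(m, n). d m n * tc ^ m * xc ^ n) summable_on (UNIV \<times> UNIV)"
    proof (rule Infinite_Sum.abs_summable_summable[OF Infinite_Sum.abs_summable_on_comparison_test[OF ab]])
      fix p :: "nat \<times> nat"
      obtain m n where p: "p = (m, n)" by (cases p)
      show "norm (case p of (m, n) \<Rightarrow> d m n * tc ^ m * xc ^ n) \<le> norm (case p of (m, n) \<Rightarrow> M * (1/2) ^ m * (1/2) ^ n)"
        unfolding p prod.case real_norm_def by (rule order_trans[OF trm abs_ge_self])
    qed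
    have "((\<lambda>(m, n). d m n * tc ^ m * xc ^ n) has_sum f tc xc) (UNIV \<times> UNIV)"
    proof (rule has_sum_SigmaI[OF _ 2 sm])
      show "((\<lambda>n. case (m, n) of (m, n) \<Rightarrow> d m n * tc ^ m * xc ^ n) has_sum c m xc * tc ^ m) UNIV" for m
        unfolding prod.case by (rule 1)
    qed
    from has_sum_Re[OF this] show ?thesis
      by (simp add: case_prod_unfold tc_def xc_def flip: of_real_power)
  qed
  then show ?thesis using \<rho> by (intro exI[of _ "\<lambda>m n. Re (d m n)"] exI[of _ "\<rho> / 2"]) auto
qed

section \<open>Holomorphic extension of the potentials\<close>

context level2
begin

lemma csol_compose_holfam:
  assumes D: "open D" and \<tau>: "\<tau> holomorphic_on D" "\<tau> ` D \<subseteq> ball 0 r"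
  shows "holfam D (\<lambda>z. tser (csol (\<tau> z)))"
proof (rule holfam_tser[OF D])
  show "(\<lambda>z. csol (\<tau> z) i) holomorphic_on D" for i
    using holomorphic_on_compose_gen[OF \<tau>(1) csol_holomorphic \<tau>(2)] by (simp add: o_def)
  show "cbound (csol (\<tau> z))" if "z \<in> D" for z using \<tau>(2) that by (intro csol_cbound) auto
qed

text \<open>The extension of h to complex parameters; as h 0 = 0, it is a divided difference from
  0.\<close>

definition hc :: "complex \<Rightarrow> complex \<Rightarrow> complex" where
  "hc \<tau> \<theta> = \<theta> * R1 (tser (csol \<tau>)) 0 \<theta>"

text \<open>A quasi-Newton map for the equation \<open>h \<theta> = x\<close> near \<open>\<theta>0\<close>.\<close>

definition Ph :: "real \<Rightarrow> complex \<Rightarrow> complex \<Rightarrow> (unit \<Rightarrow> complex) \<Rightarrow> unit \<Rightarrow> complex" where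
  "Ph \<theta>0 \<tau> x u i = u i - (hc \<tau> (of_real \<theta>0) - x + u i / 100 * R1 (tser (csol \<tau>)) (of_real \<theta>0) (u i / 100)) * 100"

definition thc :: "real \<Rightarrow> complex \<Rightarrow> complex \<Rightarrow> complex" where
  "thc \<theta>0 \<tau> x = of_real \<theta>0 + fixpoint (Ph \<theta>0 \<tau> x) () / 100"

text \<open>The step of length 0 corresponds to v = - \<omega>, and \<open>Lr\<close> x x is
  \<open>Nf\<close> x. The potential is thus obtained from \<open>LL\<close>, whose holomorphy is
  known, with no need to extend the primitive \<open>U\<close>.\<close>

definition Vc :: "real \<Rightarrow> complex \<Rightarrow> complex \<Rightarrow> complex" where
  "Vc \<theta>0 \<tau> x = of_real (\<omega>\<^sup>2) * LL (tser (csol \<tau>)) \<omega> (thc \<theta>0 \<tau> x) (- of_real \<omega>)"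

lemma near_strip: "norm u \<le> 1 \<Longrightarrow> of_real \<theta> + u / 100 \<in> strip"
  using abs_Im_le_cmod[of "u / 100"] by (simp add: strip_def norm_divide)

lemma hc_holomorphic:
  assumes D: "open D" and \<tau>: "\<tau> holomorphic_on D" "\<tau> ` D \<subseteq> ball 0 r"
  shows "(\<lambda>z. hc (\<tau> z) (of_real \<theta>)) holomorphic_on D"
  unfolding hc_def
  by (intro holomorphic_intros R1_holomorphic[OF csol_compose_holfam[OF D \<tau>], where B="\<bar>\<theta>\<bar>"]) (auto simp: strip_def)

lemma Ph_holomorphic:
  assumes D: "open D" and \<tau>: "\<tau> holomorphic_on D" "\<tau> ` D \<subseteq> ball 0 r" and x: "x holomorphic_on D"
    and u: "(\<lambda>z. u z i) holomorphic_on D" "\<And>z. z \<in> D \<Longrightarrow> norm (u z i) \<le> 1"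
  shows "(\<lambda>z. Ph \<theta>0 (\<tau> z) (x z) (u z) i) holomorphic_on D"
proof -
  have "(\<lambda>z. R1 (tser (csol (\<tau> z))) (of_real \<theta>0) (u z i / 100)) holomorphic_on D"
    by (rule R1_holomorphic[OF csol_compose_holfam[OF D \<tau>], where B=1])
       (use u near_strip in \<open>auto intro!: holomorphic_intros simp: norm_divide order_trans[of _ 1]\<close>)
  then show ?thesis unfolding Ph_def by (intro holomorphic_intros x u(1) hc_holomorphic[OF D \<tau>]) auto
qed

text \<open>The slope of h is within a few thousandths of 1 and varies little over the distance
  1/100 from \<theta>0, so subtracting the residual almost solves the equation; an initial error of
  1/10000 becomes 1/100 after rescaling.\<close>

lemma Ph_contraction:
  assumes \<tau>: "\<tau> \<in> ball 0 r" and x: "norm (hc \<tau> (of_real \<theta>0) - x) \<le> 1/10000"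
  shows "ball_contraction (Ph \<theta>0 \<tau> x)"
  unfolding ball_contraction_def
proof (intro conjI allI impI)
  fix u :: "unit \<Rightarrow> complex" and i assume u: "\<forall>i. norm (u i) \<le> 1"
  define t where "t = tser (csol \<tau>)"
  have t: "adm t" unfolding t_def using \<tau> by (intro kcoef_adm csol_kcoef) simp
  have "norm (1 - R1 t (of_real \<theta>0) (u i / 100)) \<le> 1/500 + 101/100 * (1/100)"
  proof -
    have d: "norm (of_real \<theta>0 + of_real s * (u i / 100) - of_real \<theta>0) \<le> 1/100" if "s \<in> {0..1}" for s :: real
      using norm_mult_le[of "of_real s" 1 "u i / 100" "1/100"] that u by (simp add: norm_divide)
    have 1: "norm (R1 t (of_real \<theta>0) (u i / 100) - inverse (t (of_real \<theta>0))) \<le> 101/100 * (1/100)"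
      by (rule R1_close[OF t _ _ _ d]) (use near_strip u in auto)
    have "norm (1 - inverse (t (of_real \<theta>0))) = norm (inverse (t (of_real \<theta>0)) * (t (of_real \<theta>0) - 1))"
      using adm_bounds(4)[OF t strip_of_real] by (simp add: right_diff_distrib norm_minus_commute)
    also have "\<dots> \<le> 1002/1000 * (1/1000)" by (intro norm_mult_le adm_bounds[OF t strip_of_real])
    finally have 2: "norm (1 - inverse (t (of_real \<theta>0))) \<le> 1/500" by simp
    have "1 - R1 t (of_real \<theta>0) (u i / 100) = (1 - inverse (t (of_real \<theta>0))) - (R1 t (of_real \<theta>0) (u i / 100) - inverse (t (of_real \<theta>0)))" by simp
    also have "norm \<dots> \<le> 1/500 + 101/100 * (1/100)" by (intro order_trans[OF norm_triangle_ineq4] add_mono 1 2)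
    finally show ?thesis .
  qed
  from norm_mult_le[OF _ this, of "u i" 1] have 3: "norm (u i * (1 - R1 t (of_real \<theta>0) (u i / 100))) \<le> 1 * (1/500 + 101/100 * (1/100))" using u by blast
  have "Ph \<theta>0 \<tau> x u i = u i * (1 - R1 t (of_real \<theta>0) (u i / 100)) - (hc \<tau> (of_real \<theta>0) - x) * 100"
    by (simp add: Ph_def t_def algebra_simps)
  also have "norm \<dots> \<le> 1 * (1/500 + 101/100 * (1/100)) + 1/10000 * 100"
    by (intro order_trans[OF norm_triangle_ineq4] add_mono 3 norm_mult_le x) simp
  finally show "norm (Ph \<theta>0 \<tau> x u i) \<le> 1/16" by simp
next
  fix D and u :: "complex \<Rightarrow> unit \<Rightarrow> complex" and i assume "open D" "\<forall>i. (\<lambda>z. u z i) holomorphic_on D" "\<forall>z\<in>D. \<forall>i. norm (u z i) \<le> (1::real)"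
  then show "(\<lambda>z. Ph \<theta>0 \<tau> x (u z) i) holomorphic_on D"
    using \<tau> by (intro Ph_holomorphic[where \<tau>="\<lambda>_. \<tau>" and x="\<lambda>_. x"]) auto
qed

lemma Vc_holomorphic:
  assumes D: "open D" and \<tau>: "\<tau> holomorphic_on D" "\<tau> ` D \<subseteq> ball 0 r" and x: "x holomorphic_on D"
    and close: "\<And>z. z \<in> D \<Longrightarrow> norm (hc (\<tau> z) (of_real \<theta>0) - x z) \<le> 1/10000"
  shows "(\<lambda>z. Vc \<theta>0 (\<tau> z) (x z)) holomorphic_on D"
proof -
  have c: "ball_contraction (Ph \<theta>0 (\<tau> z) (x z))" if "z \<in> D" for z
    using \<tau>(2) that by (intro Ph_contraction close) auto
  have "(\<lambda>z. fixpoint (Ph \<theta>0 (\<tau> z) (x z)) ()) holomorphic_on D"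
    by (rule fixpoint_holomorphic[OF D c Ph_holomorphic[OF D \<tau> x]])
  then have th: "(\<lambda>z. thc \<theta>0 (\<tau> z) (x z)) holomorphic_on D" unfolding thc_def by (intro holomorphic_intros) auto
  have st: "thc \<theta>0 (\<tau> z) (x z) \<in> strip" if "z \<in> D" for z
    unfolding thc_def using fixpoint_bound[OF c[OF that], of "()"] by (intro near_strip) simp
  show ?thesis unfolding Vc_def
    by (intro holomorphic_intros LL_holomorphic[OF csol_compose_holfam[OF D \<tau>] th, where B="\<bar>\<omega>\<bar>"])
       (use st in \<open>auto simp: strip_def\<close>)
qed

lemma Vc_bound:
  assumes \<tau>: "\<tau> \<in> ball 0 r" and x: "norm (hc \<tau> (of_real \<theta>0) - x) \<le> 1/10000"
  shows "norm (Vc \<theta>0 \<tau> x) \<le> \<omega>\<^sup>2 * (2 + 3 * \<bar>\<omega>\<bar>)"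
proof -
  define t where "t = tser (csol \<tau>)"
  have t: "adm t" unfolding t_def using \<tau> by (intro kcoef_adm csol_kcoef) simp
  define \<theta> where "\<theta> = thc \<theta>0 \<tau> x"
  have s: "\<theta> \<in> strip" "\<theta> + - of_real \<omega> \<in> strip"
    using near_strip[of "fixpoint (Ph \<theta>0 \<tau> x) ()" \<theta>0] fixpoint_bound[OF Ph_contraction[OF \<tau> x], of "()"]
    by (auto simp: \<theta>_def thc_def strip_def)
  have "norm (inverse (t \<theta>) * inverse (t \<theta>)) \<le> 1002/1000 * (1002/1000)" by (intro norm_mult_le adm_bounds[OF t] s)
  then have 2: "norm (inverse (t \<theta> * t (\<theta> + of_real \<omega> + - of_real \<omega>)) / 2) \<le> 2" by (simp add: norm_divide norm_mult norm_inverse)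
  have 1: "norm (LL t \<omega> \<theta> (- of_real \<omega>) - inverse (t \<theta> * t (\<theta> + of_real \<omega> + - of_real \<omega>)) / 2) \<le> 3 * norm (- of_real \<omega> :: complex)"
    by (rule LL_close[OF t s])
  have "norm (LL t \<omega> \<theta> (- of_real \<omega>)) \<le> 2 + 3 * \<bar>\<omega>\<bar>"
    using norm_triangle_sub[of "LL t \<omega> \<theta> (- of_real \<omega>)" "inverse (t \<theta> * t (\<theta> + of_real \<omega> + - of_real \<omega>)) / 2"] 1 2 by simp
  then show ?thesis unfolding Vc_def t_def[symmetric] \<theta>_def[symmetric] by (intro norm_mult_le) (simp only: norm_of_real abs_power2)
qed

text \<open>For real data conjugation invariance makes the fixed point real, so it solves h
  (\<theta>0 + v) = x and \<open>thc\<close> is the true inverse \<open>hi\<close> x.\<close>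

lemma VV_complex:
  assumes \<tau>: "\<bar>\<tau>\<bar> < r" and x: "norm (hc (of_real \<tau>) (of_real \<theta>0) - of_real x) \<le> 1/10000"
  shows "Vc \<theta>0 (of_real \<tau>) (of_real x) = of_real (VV \<tau> x)"
proof -
  have \<tau>': "\<bar>\<tau>\<bar> \<le> r" "of_real \<tau> \<in> ball (0::complex) r" using \<tau> by auto
  interpret circle_potential "TT \<tau>" \<omega> by (rule TT_circle[OF \<tau>'(1)])
  define t where "t = tser (csol (of_real \<tau>))"
  note tr = TT_circle(2)[OF \<tau>'(1), folded t_def] and tc = TT_circle(3)[OF \<tau>'(1), folded t_def]
  note near = near_rational.R1_cnj[OF near_rational_i[OF order_refl], of t, OF tc]
  note c = Ph_contraction[OF \<tau>'(2) x]
  define w where "w = fixpoint (Ph \<theta>0 (of_real \<tau>) (of_real x)) ()"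
  have hc: "hc (of_real \<tau>) (of_real y) = of_real (h y)" for y
    using R1_real[of t y 0, OF tr] by (simp add: hc_def t_def)
  have "cnj w = w"
    unfolding w_def
  proof (rule fixpoint_cnj[OF c])
    fix u :: "unit \<Rightarrow> complex" and i assume u: "\<And>i. cnj (u i) = u i"
    have "cnj (R1 t (of_real \<theta>0) (u i / 100)) = R1 t (of_real \<theta>0) (u i / 100)"
      using near[of "of_real \<theta>0" "u i / 100"] by (simp add: u)
    then show "cnj (Ph \<theta>0 (of_real \<tau>) (of_real x) u i) = Ph \<theta>0 (of_real \<tau>) (of_real x) u i"
      by (simp add: Ph_def hc u t_def[symmetric])
  qed
  then obtain v where v: "w / 100 = of_real v"
    by (metis Reals_cases Reals_cnj_iff complex_cnj_divide complex_cnj_numeral)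
  have z0: "A = 0" if "z - A * 100 = z" for A z :: complex using that by simp
  have "Ph \<theta>0 (of_real \<tau>) (of_real x) (fixpoint (Ph \<theta>0 (of_real \<tau>) (of_real x))) () = w"
    unfolding fixpoint_eq[OF c] w_def ..
  then have "hc (of_real \<tau>) (of_real \<theta>0) - of_real x + of_real v * R1 t (of_real \<theta>0) (of_real v) = 0"
    unfolding Ph_def w_def[symmetric] t_def[symmetric] v by (rule z0)
  then have "of_real (h \<theta>0 - x + (h (\<theta>0 + v) - h \<theta>0)) = (0::complex)" unfolding R1_real[OF tr] hc by simp
  then have "h (\<theta>0 + v) = x" by (simp only: of_real_eq_0_iff)
  then have hi: "hi x = \<theta>0 + v" by (metis hi_h)
  have th: "thc \<theta>0 (of_real \<tau>) (of_real x) = of_real (hi x)" by (simp add: thc_def w_def[symmetric] v hi)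
  have "Vc \<theta>0 (of_real \<tau>) (of_real x) = of_real ((- \<omega>)\<^sup>2) * LL t \<omega> (of_real (hi x)) (of_real (- \<omega>))"
    by (simp add: Vc_def th t_def)
  also have "\<dots> = of_real (VV \<tau> x)" unfolding LL_real[OF tr] by (simp add: Lr_def VV_def V_def)
  finally show ?thesis .
qed

lemma VV_analytic: "real_analytic2_on VV ({-r<..<r} \<times> UNIV)"
  unfolding real_analytic2_on_def
proof (clarify)
  fix \<tau>0 x0 :: real assume "\<tau>0 \<in> {-r<..<r}"
  then have \<tau>0: "\<bar>\<tau>0\<bar> < r" by auto
  interpret circle_potential "TT \<tau>0" \<omega> by (rule TT_circle) (use \<tau>0 in simp)
  define \<theta>0 where "\<theta>0 = hi x0"
  have tr: "tser (csol (of_real \<tau>0)) (of_real y) = of_real (TT \<tau>0 y)" for y by (rule TT_circle(2)) (use \<tau>0 in simp)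
  have h0: "hc (of_real \<tau>0) (of_real \<theta>0) = of_real x0"
    using R1_real[of "tser (csol (of_real \<tau>0))" \<theta>0 0, OF tr] by (simp add: hc_def \<theta>0_def)
  have "(\<lambda>\<tau>. hc \<tau> (of_real \<theta>0)) holomorphic_on ball 0 r" by (rule hc_holomorphic) auto
  then have "isCont (\<lambda>\<tau>. hc \<tau> (of_real \<theta>0)) (of_real \<tau>0)"
    using \<tau>0 by (intro continuous_on_interior[OF holomorphic_on_imp_continuous_on]) auto
  then obtain d where d: "d > 0" "\<And>\<tau>. dist \<tau> (of_real \<tau>0) < d \<Longrightarrow> dist (hc \<tau> (of_real \<theta>0)) (of_real x0) < 1/20000"
    unfolding continuous_at_eps_delta h0 by (metis zero_less_divide_iff zero_less_numeral zero_less_one)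
  define R where "R = min (min d (r - \<bar>\<tau>0\<bar>)) (1/20000)"
  have R: "R > 0" "R \<le> d" "R \<le> r - \<bar>\<tau>0\<bar>" "R \<le> 1/20000" using d(1) \<tau>0 unfolding R_def by linarith+
  have in_r: "of_real \<tau>0 + s \<in> ball (0::complex) r" if "s \<in> ball 0 R" for s
    using norm_triangle_ineq[of "of_real \<tau>0" s] that R(3) by simp
  have close: "norm (hc (of_real \<tau>0 + s) (of_real \<theta>0) - (of_real x0 + y)) \<le> 1/10000" if "s \<in> ball 0 R" "y \<in> ball 0 R" for s y
  proof -
    have "norm (hc (of_real \<tau>0 + s) (of_real \<theta>0) - of_real x0) < 1/20000"
      using d(2)[of "of_real \<tau>0 + s"] that R(2) by (simp add: dist_norm)
    moreover have "norm y \<le> 1/20000" using that R(4) by simp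
    ultimately show ?thesis
      using norm_triangle_ineq4[of "hc (of_real \<tau>0 + s) (of_real \<theta>0) - of_real x0" y] by (simp add: algebra_simps)
  qed
  have sub: "(\<lambda>t. of_real \<tau>0 + t) ` ball 0 R \<subseteq> ball (0::complex) r" using in_r by blast
  define f where "f = (\<lambda>s y. Vc \<theta>0 (of_real \<tau>0 + s) (of_real x0 + y))"
  have "\<exists>(b :: nat \<Rightarrow> nat \<Rightarrow> real) r. r > 0 \<and> (\<forall>t x. \<bar>t\<bar> < r \<longrightarrow> \<bar>x\<bar> < r \<longrightarrow>
           ((\<lambda>(m, n). b m n * t ^ m * x ^ n) has_sum Re (f (of_real t) (of_real x))) UNIV)"
  proof (rule double_power_series[OF R(1)])
    show "(\<lambda>t. f t x) holomorphic_on ball 0 R" if "x \<in> ball 0 R" for x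
      unfolding f_def by (rule Vc_holomorphic[OF open_ball _ sub]) (use that in_r close in \<open>auto intro!: holomorphic_intros\<close>)
    show "f t holomorphic_on ball 0 R" if "t \<in> ball 0 R" for t
      unfolding f_def by (rule Vc_holomorphic) (use that in_r close in \<open>auto intro!: holomorphic_intros\<close>)
    show "norm (f t x) \<le> \<omega>\<^sup>2 * (2 + 3 * \<bar>\<omega>\<bar>)" if "t \<in> ball 0 R" "x \<in> ball 0 R" for t x
      unfolding f_def by (rule Vc_bound[OF in_r close]) (use that in auto)
  qed
  then obtain b \<rho> where b: "\<rho> > 0" "\<And>t x. \<bar>t\<bar> < \<rho> \<Longrightarrow> \<bar>x\<bar> < \<rho> \<Longrightarrow>
           ((\<lambda>(m, n). b m n * t ^ m * x ^ n) has_sum Re (f (of_real t) (of_real x))) (UNIV :: (nat \<times> nat) set)" by blast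
  have "((\<lambda>(m, n). b m n * (t - \<tau>0) ^ m * (x - x0) ^ n) has_sum VV t x) UNIV"
    if "\<bar>t - \<tau>0\<bar> < min \<rho> R" "\<bar>x - x0\<bar> < min \<rho> R" for t x
  proof -
    have B: "of_real (t - \<tau>0) \<in> ball (0::complex) R" "of_real (x - x0) \<in> ball (0::complex) R" using that by (auto simp del: of_real_diff)
    have "Vc \<theta>0 (of_real t) (of_real x) = of_real (VV t x)"
    proof (rule VV_complex)
      show "\<bar>t\<bar> < r" using that R(3) by linarith
      show "norm (hc (of_real t) (of_real \<theta>0) - of_real x) \<le> 1/10000" using close[OF B] by simp
    qed
    then have "Re (f (of_real (t - \<tau>0)) (of_real (x - x0))) = VV t x" by (simp add: f_def)
    then show ?thesis using b(2)[of "t - \<tau>0" "x - x0"] that by simp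
  qed
  then show "\<exists>a r. r > 0 \<and> (\<forall>t x. \<bar>t - \<tau>0\<bar> < r \<longrightarrow> \<bar>x - x0\<bar> < r \<longrightarrow>
      ((\<lambda>(m, n). a m n * (t - \<tau>0) ^ m * (x - x0) ^ n) has_sum VV t x) UNIV)"
    using b(1) R(1) by (intro exI[of _ b] exI[of _ "min \<rho> R"]) auto
qed

lemma VV_family: "analytic_family {-r<..<r} VV"
  unfolding analytic_family_def potential_def
proof (intro conjI ballI allI VV_analytic)
  fix \<tau> x assume "\<tau> \<in> {-r<..<r}"
  then have "circle_potential (TT \<tau>)" by (intro TT_circle) auto
  from circle_potential.V_add_int[OF this, of \<omega> x 1] show "VV \<tau> (x + 1) = VV \<tau> x" by (simp add: VV_def)
qed

end

section \<open>Choice of the parameters\<close>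

lemma cos_sin_irrational:
  fixes w :: real
  assumes "w \<notin> \<rat>" "n > 0"
  shows "cos (2 * pi * real n * w) \<noteq> 1" "sin (2 * pi * real n * w) \<noteq> 0"
proof -
  show "cos (2 * pi * real n * w) \<noteq> 1"
  proof
    assume "cos (2 * pi * real n * w) = 1"
    then obtain k where "2 * pi * real n * w = of_int k * 2 * pi" unfolding cos_one_2pi_int by blast
    then have "w = of_int k / of_nat n" using assms(2) by (simp add: field_simps)
    then have "w \<in> \<rat>" by simp
    then show False using assms(1) by simp
  qed
  show "sin (2 * pi * real n * w) \<noteq> 0"
  proof
    assume "sin (2 * pi * real n * w) = 0"
    then obtain k where "2 * pi * real n * w = of_int k * pi" unfolding sin_zero_iff_int2 by blast
    then have "w = of_int k / of_nat (2 * n)" using assms(2) by (simp add: field_simps)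
    then have "w \<in> \<rat>" by (metis Rats_divide Rats_of_int Rats_of_nat)
    then show False using assms(1) by simp
  qed
qed

text \<open>With c and s the cosine and sine of 2 * pi * w the determinant is s * (c - 1)^2 / (8 *
  pi * w); irrationality excludes s = 0 and c = 1.\<close>

lemma harmonic_determinant:
  fixes w :: real
  assumes w: "w \<notin> \<rat>"
  shows "sin (2 * pi * real 1 * w) / (4 * pi * real 1 * w) * (1 + cos (2 * pi * real 2 * w) / 2)
     - sin (2 * pi * real 2 * w) / (4 * pi * real 2 * w) * (1 + cos (2 * pi * real 1 * w) / 2) \<noteq> 0"
proof -
  define c where "c = cos (2 * pi * w)"
  define s where "s = sin (2 * pi * w)"
  have w0: "w \<noteq> 0" using w by auto
  have e: "2 * pi * real 2 * w = 2 * (2 * pi * w)" by simp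
  have s2: "sin (2 * pi * real 2 * w) = 2 * s * c" unfolding e by (simp only: sin_double s_def c_def)
  have c2: "cos (2 * pi * real 2 * w) = 2 * c\<^sup>2 - 1" unfolding e by (simp only: cos_double_cos c_def)
  have cs: "c \<noteq> 1" "s \<noteq> 0" using cos_sin_irrational[OF w, of 1] by (auto simp: c_def s_def)
  have "s / (4 * pi * w) * (1 + (2 * c\<^sup>2 - 1) / 2) - 2 * s * c / (4 * pi * 2 * w) * (1 + c / 2) = s / (8 * pi * w) * (c - 1)\<^sup>2"
    using w0 by (simp add: field_simps power2_eq_square)
  moreover have "s / (8 * pi * w) * (c - 1)\<^sup>2 \<noteq> 0" using cs w0 by simp
  ultimately show ?thesis unfolding s2 c2 by (simp add: c_def s_def)
qed

text \<open>A weak form of the approximation hypothesis that suffices for the construction.\<close>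

definition quick_approx :: "real \<Rightarrow> bool" where
  "quick_approx w \<longleftrightarrow> (\<forall>N C. C > 0 \<longrightarrow> (\<exists>p q. q \<ge> N \<and> coprime p (int q) \<and>
      \<bar>w - of_int p / real q\<bar> * real q \<le> C * (1/4) ^ q * exp (- real q)))"

text \<open>Bounded denominators would bound the numerators as well, so infinitely many approximants
  have unbounded q. As 2 * pi > 3, the exponential leaves exp (- 2 * q) \<le> (1/4)^q to spare, and
  the power of q absorbs the factor q and the constant.\<close>

lemma quick_approxI:
  assumes inf: "infinite {(p :: int, q :: nat). q > 0 \<and> coprime p (int q) \<and>
           \<bar>w - real_of_int p / real q\<bar> \<le> real q powr (- 70) * exp (- 2 * pi * real q)}" (is "infinite ?S")
  shows "quick_approx w"
  unfolding quick_approx_def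
proof (intro allI impI)
  fix N :: nat and C :: real assume C: "C > 0"
  define M where "M = max N (nat \<lceil>1 / C\<rceil> + 1)"
  have "\<exists>z\<in>?S. snd z \<ge> M"
  proof (rule ccontr)
    assume neg: "\<not> (\<exists>z\<in>?S. snd z \<ge> M)"
    define B where "B = (\<bar>w\<bar> + 1) * real M"
    have "?S \<subseteq> {-\<lceil>B\<rceil>..\<lceil>B\<rceil>} \<times> {..M}"
    proof
      fix z assume z: "z \<in> ?S"
      obtain p q where pq: "z = (p, q)" by (cases z)
      have "\<not> snd z \<ge> M" using neg z by blast
      then have q: "q > 0" "q \<le> M" using z pq by simp_all
      have "\<bar>w - of_int p / real q\<bar> \<le> real q powr (- 70) * exp (- 2 * pi * real q)" using z pq by simp
      also have "\<dots> \<le> 1 * 1" using q by (intro mult_mono) (auto simp: powr_minus inverse_le_1_iff ge_one_powr_ge_zero)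
      finally have "\<bar>of_int p / real q\<bar> \<le> \<bar>w\<bar> + 1" by linarith
      then have "\<bar>of_int p\<bar> \<le> (\<bar>w\<bar> + 1) * real q" using q by (simp add: abs_divide pos_divide_le_eq)
      also have "\<dots> \<le> B" unfolding B_def using q by (intro mult_left_mono) auto
      finally have "\<bar>of_int p\<bar> \<le> B" .
      then have "p \<in> {-\<lceil>B\<rceil>..\<lceil>B\<rceil>}" by simp linarith
      then show "z \<in> {-\<lceil>B\<rceil>..\<lceil>B\<rceil>} \<times> {..M}" using pq q by simp
    qed
    then show False using inf finite_subset by blast
  qed
  then obtain p q where pq: "q \<ge> M" "q > 0" "coprime p (int q)"
    "\<bar>w - real_of_int p / real q\<bar> \<le> real q powr (- 70) * exp (- 2 * pi * real q)" by fastforce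
  define n where "n = real q"
  have n1: "n \<ge> 1" "n \<ge> 1 / C" using pq(1,2) by (auto simp: n_def M_def) linarith
  have "\<bar>w - real_of_int p / real q\<bar> * n \<le> (n powr (- 70) * exp (- 2 * pi * n)) * n"
    using pq(4) n1 by (intro mult_right_mono) (auto simp: n_def)
  also have "\<dots> = (n powr (- 70) * n) * exp (- 2 * pi * n)" by simp
  also have "\<dots> \<le> C * (exp (- 2 * n) * exp (- n))"
  proof (intro mult_mono)
    have "n powr (- 70) * n = n powr (- 69)" using n1 powr_mult_base[of n "-70"] by (simp add: mult.commute)
    also have "\<dots> \<le> n powr (- 1)" using n1 by (intro powr_mono) auto
    also have "\<dots> = 1 / n" using n1 by (simp add: powr_minus_divide)
    also have "\<dots> \<le> C" using n1 C by (simp add: field_simps)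
    finally show "n powr (- 70) * n \<le> C" .
    have "3 * n \<le> 2 * pi * n" using pi_gt3 n1 by (intro mult_right_mono) auto
    then show "exp (- 2 * pi * n) \<le> exp (- 2 * n) * exp (- n)" by (simp flip: exp_add)
  qed (use C in auto)
  also have "exp (- 2 * n) = exp (- 2) ^ q" by (simp add: n_def mult.commute flip: exp_of_nat_mult)
  also have "C * (exp (- 2) ^ q * exp (- n)) \<le> C * ((1/4) ^ q * exp (- n))"
  proof (intro mult_left_mono mult_right_mono power_mono)
    have "(1 + 1::real) \<le> exp 1" by (rule exp_ge_add_one_self)
    then have "(1 + 1) * (1 + 1) \<le> exp 1 * exp (1::real)" by (intro mult_mono) auto
    then have "4 \<le> exp (2::real)" by (simp flip: exp_add)
    then show "exp (- 2) \<le> (1/4::real)" by (simp add: exp_minus field_simps)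
  qed (use C in auto)
  finally show "\<exists>p q. q \<ge> N \<and> coprime p (int q) \<and> \<bar>w - of_int p / real q\<bar> * real q \<le> C * (1/4) ^ q * exp (- real q)"
    using pq by (intro exI[of _ p] exI[of _ q]) (auto simp: M_def n_def mult.assoc)
qed

theorem theorem1p2:
  fixes \<omega> :: real
  assumes "\<omega> \<notin> \<rat>"
    and "infinite {(p :: int, q :: nat). q > 0 \<and> coprime p (int q) \<and>
           \<bar>\<omega> - real_of_int p / real q\<bar> \<le> real q powr (- 70) * exp (- 2 * pi * real q)}"
  shows "\<exists>(I :: real set) (V :: real \<Rightarrow> real \<Rightarrow> real).
           open I \<and> is_interval I \<and> I \<noteq> {} \<and>
           analytic_family I V \<and> nontrivial_family I V \<and>
           (\<exists>(p :: nat \<Rightarrow> int) (q :: nat \<Rightarrow> nat).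
              (\<forall>j. q j > 0 \<and> coprime (p j) (int (q j))) \<and>
              (\<lambda>j. real_of_int (p j) / real (q j)) \<longlonglongrightarrow> \<omega> \<and>
              (\<forall>j. (\<lambda>\<tau>. mather_beta (V \<tau>) (real_of_int (p j) / real (q j))) constant_on I))"
proof -
  define D where "D = sin (2 * pi * real 1 * \<omega>) / (4 * pi * real 1 * \<omega>) * (1 + cos (2 * pi * real 2 * \<omega>) / 2)
     - sin (2 * pi * real 2 * \<omega>) / (4 * pi * real 2 * \<omega>) * (1 + cos (2 * pi * real 1 * \<omega>) / 2)"
  have D: "\<bar>D\<bar> > 0" using harmonic_determinant[OF assms(1)] by (simp add: D_def)
  define K where "K = (2 - 2 * cos (2 * pi * real 3 * \<omega>)) / (2 * pi * real 3)"
  have K: "K > 0"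
  proof -
    have "cos (2 * pi * real 3 * \<omega>) < 1"
      using cos_sin_irrational(1)[OF assms(1), of 3] cos_le_one[of "2 * pi * real 3 * \<omega>"] by linarith
    then show ?thesis unfolding K_def by (intro divide_pos_pos) auto
  qed
  define r where "r = min (1/2) (\<bar>D\<bar> / 3000)"
  have r: "r > 0" "r \<le> 1/2" "r \<le> \<bar>D\<bar> / 3000" using D by (auto simp: r_def)
  define X where "X = 202 * \<bar>\<omega>\<bar> + 192"
  have X: "X > 0" by (simp add: X_def)
  \<comment> \<open>The bounds serve the convergence of the series, the Newton step and
    nontriviality: by the last one the second-order error, divided by a, stays below r / 2 * K, the
    change of the third harmonic between the parameters 0 and r / 2.\<close>
  define a where "a = min (1/10^7) (min (\<bar>D\<bar> / 10^7) (r * K / (8 * X)))"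
  have a: "a > 0" "a \<le> 1/10^7" "a \<le> \<bar>D\<bar> / 10^7" "a \<le> r * K / (8 * X)" using D r K X unfolding a_def by auto
  have a3: "a ^ 3 / 10^6 > 0" using a(1) by simp
  \<comment> \<open>The lower bound 100 + n with n = i - 4 ensures q \<ge> i, which trades (1/4)^q
    for the (1/4)^i of the locale and later gives convergence to \<omega>.\<close>
  define P where "P = (\<lambda>n (x :: int \<times> nat). snd x \<ge> 100 + n \<and> coprime (fst x) (int (snd x)) \<and>
      \<bar>\<omega> - of_int (fst x) / real (snd x)\<bar> * real (snd x) \<le> a ^ 3 / 10^6 * (1/4) ^ snd x * exp (- real (snd x)))"
  have ex: "\<exists>x. P n x \<and> snd x \<ge> N" for n N
  proof -
    obtain p q where pq: "q \<ge> max (100 + n) N" "coprime p (int q)"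
      "\<bar>\<omega> - of_int p / real q\<bar> * real q \<le> a ^ 3 / 10^6 * (1/4) ^ q * exp (- real q)"
      using quick_approxI[OF assms(2)] a3 unfolding quick_approx_def by blast
    then have "P n (p, q) \<and> snd (p, q) \<ge> N" by (auto simp: P_def)
    then show ?thesis by blast
  qed
  have "\<exists>x. P 0 x" using ex by blast
  moreover have "\<exists>y. P (Suc n) y \<and> snd y \<ge> 8 * snd x" for x :: "int \<times> nat" and n by (rule ex)
  ultimately obtain g where g: "\<And>n. P n (g n)" "\<And>n. snd (g (Suc n)) \<ge> 8 * snd (g n)"
    using dependent_nat_choice[of P "\<lambda>n x y. snd y \<ge> 8 * snd x"] by blast
  \<comment> \<open>The frequencies 0 to 3 occupy the first four places, so the n-th approximant
    sits at index n + 4.\<close>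
  define \<nu> where "\<nu> = (\<lambda>i. if i < 4 then i else snd (g (i - 4)))"
  define pp where "pp = (\<lambda>i. fst (g (i - 4)))"
  have near: "10^6 * (\<bar>\<omega> - of_int (pp i) / real (\<nu> i)\<bar> * real (\<nu> i)) \<le> a ^ 3 * (1/4) ^ i * exp (- real (\<nu> i))" if "i \<ge> 4" for i
  proof -
    have \<nu>i: "\<nu> i = snd (g (i - 4))" "\<nu> i \<ge> i" using g(1)[of "i - 4"] that by (auto simp: \<nu>_def P_def)
    have "\<bar>\<omega> - of_int (pp i) / real (\<nu> i)\<bar> * real (\<nu> i) \<le> a ^ 3 / 10^6 * (1/4) ^ \<nu> i * exp (- real (\<nu> i))"
      using g(1)[of "i - 4"] unfolding P_def \<nu>i(1) pp_def by blast
    also have "\<dots> \<le> a ^ 3 / 10^6 * (1/4) ^ i * exp (- real (\<nu> i))"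
      using \<nu>i(2) a3 by (intro mult_right_mono mult_left_mono power_decreasing) auto
    finally show ?thesis by simp
  qed
  interpret liouville_series a \<nu> \<omega> r pp
  proof
    show "\<nu> (Suc i) \<ge> 8 * \<nu> i" if "i \<ge> 4" for i
    proof -
      have "Suc i - 4 = Suc (i - 4)" using that by simp
      then show ?thesis using g(2)[of "i - 4"] that by (simp only: \<nu>_def) simp
    qed
    show "\<nu> i \<ge> 100" "coprime (pp i) (int (\<nu> i))" if "i \<ge> 4" for i
      using g(1)[of "i - 4"] that by (auto simp: \<nu>_def pp_def P_def)
  qed (use near assms(1) a(1,2) r(1,2) in \<open>auto simp: \<nu>_def\<close>)
  have DD_eq: "DD = D" unfolding DD_def gm_def sg_def D_def ..
  interpret level2 a \<nu> \<omega> r pp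
    by unfold_locales (use D r(3) a(3) in \<open>auto simp: DD_eq\<close>)
  have "kk 3 = K" unfolding kk_def K_def ..
  have "\<not> equivalent_potentials (VV 0) (VV (r / 2))"
  proof (rule not_equivalent)
    have "2 * X * a \<le> 2 * X * (r * K / (8 * X))" using a(4) X by (intro mult_left_mono) auto
    also have "\<dots> = r * K / 4" using X by simp
    also have "\<dots> < r / 2 * K" using r(1) K by simp
    finally show "2 * (202 * \<bar>\<omega>\<bar> + 192) * a < r / 2 * kk 3" by (simp only: X_def \<open>kk 3 = K\<close>)
  qed (use r in auto)
  moreover have "0 \<in> {-r<..<r}" "r / 2 \<in> {-r<..<r}" using r(1) by auto
  ultimately have nontrivial: "nontrivial_family {-r<..<r} VV" unfolding nontrivial_family_def by blast
  have const: "(\<lambda>\<tau>. mather_beta (VV \<tau>) (of_int (pp (j + 4)) / real (\<nu> (j + 4)))) constant_on {-r<..<r}" for j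
    unfolding constant_on_def using beta_constant[of _ "j + 4"] by (metis abs_less_iff greaterThanLessThan_iff le_add2 less_imp_le minus_less_iff)
  have lim: "(\<lambda>j. of_int (pp (j + 4)) / real (\<nu> (j + 4))) \<longlonglongrightarrow> \<omega>"
  proof (rule LIM_zero_cancel, rule Lim_null_comparison)
    show "(\<lambda>j. 1 / real (Suc j)) \<longlonglongrightarrow> 0" using LIMSEQ_inverse_real_of_nat by (simp add: inverse_eq_divide)
    have "norm (of_int (pp (j + 4)) / real (\<nu> (j + 4)) - \<omega>) \<le> 1 / real (Suc j)" for j
    proof -
      define i where "i = j + 4"
      have i: "i \<ge> 4" by (simp add: i_def)
      have n: "real (\<nu> i) \<ge> real (Suc j)" using g(1)[of j] by (simp add: \<nu>_def P_def i_def)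
      have "a ^ 3 * (1/4) ^ i * exp (- real (\<nu> i)) \<le> 1 * 1 * 1"
        using a(1,2) by (intro mult_mono) (auto simp: power_le_one)
      from order_trans[OF near[OF i] this] have "\<bar>eps i\<bar> * real (\<nu> i) \<le> 1" unfolding eps_def by simp
      then have "\<bar>eps i\<bar> \<le> 1 / real (\<nu> i)" using n by (simp add: pos_le_divide_eq)
      also have "\<dots> \<le> 1 / real (Suc j)" using n by (intro divide_left_mono) auto
      finally show ?thesis by (simp add: eps_def i_def abs_minus_commute)
    qed
    then show "\<forall>\<^sub>F j in sequentially. norm (of_int (pp (j + 4)) / real (\<nu> (j + 4)) - \<omega>) \<le> 1 / real (Suc j)" by simp
  qed
  show ?thesis
  proof (intro exI conjI)
    show "open {-r<..<r}" "is_interval {-r<..<r}" "{-r<..<r} \<noteq> {}" using r(1) by (auto simp: is_interval_convex_1)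
    show "analytic_family {-r<..<r} VV" by (rule VV_family)
    show "nontrivial_family {-r<..<r} VV" by (rule nontrivial)
    show "\<forall>j. \<nu> (j + 4) > 0 \<and> coprime (pp (j + 4)) (int (\<nu> (j + 4)))" using \<nu>_pos cop by simp
    show "(\<lambda>j. of_int (pp (j + 4)) / real (\<nu> (j + 4))) \<longlonglongrightarrow> \<omega>" by (rule lim)
    show "\<forall>j. (\<lambda>\<tau>. mather_beta (VV \<tau>) (of_int (pp (j + 4)) / real (\<nu> (j + 4)))) constant_on {-r<..<r}" using const by blast
  qed
qed

end
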